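(* Let $\mathcal U$ be a free ultrafilter on $\mathbb N$. Let $c>0$, let $\varphi$ be an $m$-variable $c$-strongly convex definable predicate with respect to $\mathrm T_{\mathrm{tr}}$, and let $\mu\in\mathbb S_m(\mathrm T_{\mathcal U})$ be its associated Gibbs type. Then $(\mu,\varphi)$ satisfies the Talagrand inequality with constant $c$: for all $\nu\in\mathbb S_m(\mathrm T_{\mathcal U})$, $$d_{W,\mathrm{full}}(\mu,\nu)^2\le\frac2c\Big[(\nu,\varphi)-\chi^{\mathcal U}_{\mathrm{full}}(\nu)-(\mu,\varphi)+\chi^{\mathcal U}_{\mathrm{full}}(\mu)\Big].$$
   Context: **Tracial von Neumann algebras.** A tracial von Neumann algebra $\mathcal M=(M,\tau)$ is a von Neumann algebra with a faithful normal tracial state $\tau=\operatorname{tr}^{\mathcal M}$. On $\mathcal M^m$ put $\langle\mathbf x,\mathbf y\rangle_{L^2(\mathcal M)^m}=\sum_{j=1}^m\tau(x_j^*y_j)$, with norm $\|\cdot\|_{L^2(\mathcal M)^m}$; $D_R^{\mathcal M}=\{x\in\mathcal M:\|x\|\le R\}$ (operator norm). A tracial factor is a tracial von Neumann algebra with center $\mathbb C1$; this includes $\mathbb M_n=M_n(\mathbb C)$ with $\operatorname{tr}_n=\frac1n\mathrm{Tr}$. For a free ultrafilter $\mathcal U$ on $\mathbb N$, $\mathcal Q=\prod_{n\to\mathcal U}\mathbb M_n$ is the tracial ultraproduct (operator-norm-bounded sequences modulo those with $\lim_{n\to\mathcal U}\|x_n\|_{\operatorname{tr}_n}=0$). **Formulas,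 theories, types.** Formulas are defined recursively: basic formulas $\operatorname{Re}\operatorname{tr}(p(x_1,\dots,x_k))$ with $p$ a non-commutative $*$-polynomial; $\sup_{y\in D_R}\varphi(x_1,\dots,x_k,y)$ and $\inf_{y\in D_R}\varphi(x_1,\dots,x_k,y)$ for $\varphi$ a formula and $R>0$; $f(\varphi_1,\dots,\varphi_k)$ with $f:\mathbb R^k\to\mathbb R$ continuous and $\varphi_i$ formulas. A formula $\varphi$ in $m$ free variables is interpreted in the obvious way as a function $\varphi^{\mathcal M}:\mathcal M^m\to\mathbb R$ (with $\sup,\inf$ over $D_R^{\mathcal M}$). $\mathcal F_m$ is the set of formulas in $m$ free variables. A sentence is a formula with no free variables; a theory $\mathrm T$ is a set of sentences; $\mathcal M\models\mathrm T$ means $\varphi^{\mathcal M}=0$ for all $\varphi\in\mathrm T$; $\operatorname{Th}(\mathcal M)$ is the set of sentences vanishing in $\mathcal M$. Models are always tracial von Neumann algebras. $\mathrm T_{\mathrm{tr}}$ and $\mathrm T_{\mathrm{tr,fact}}$ are theories whose models are exactly the tracial von Neumann algebras and the tracial factors respectively, and $\mathrm T_{\mathcal U}=\operatorname{Th}(\mathcal Q)$. The type of $\mathbf x\in\mathcal M^m$ is the map $\operatorname{tp}^{\mathcal M}(\mathbf x):\mathcal F_m\to\mathbb R$, $\varphi\mapsto\varphi^{\mathcal M}(\mathbf x)$. $\mathbb S_{m,R}(\mathrm T)=\{\operatorname{tp}^{\mathcal M}(\mathbf x):\mathcal M\models\mathrm T,\ \mathbf x\in(D_R^{\mathcal M})^m\}$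 with the weak-$*$ topology (pointwise convergence on $\mathcal F_m$), and $\mathbb S_m(\mathrm T)=\bigcup_{R>0}\mathbb S_{m,R}(\mathrm T)$. **Definable predicates.** An $m$-variable definable predicate relative to $\mathrm T$ is a family $\varphi=(\varphi^{\mathcal M})_{\mathcal M\models\mathrm T}$ of functions $\varphi^{\mathcal M}:\mathcal M^m\to\mathbb R$ such that for all $\varepsilon,R>0$ there is a formula $\psi$ with $|\varphi^{\mathcal M}(\mathbf x)-\psi^{\mathcal M}(\mathbf x)|<\varepsilon$ for all $\mathcal M\models\mathrm T$ and $\mathbf x\in(D_R^{\mathcal M})^m$. It is $c$-strongly convex if $\varphi^{\mathcal M}(\mathbf x)-\frac c2\|\mathbf x\|_{L^2(\mathcal M)^m}^2$ is convex for every $\mathcal M\models\mathrm T$. For a type $\mu$ and a definable predicate $\varphi$, $(\mu,\varphi):=\varphi^{\mathcal M}(\mathbf x)$ whenever $\operatorname{tp}^{\mathcal M}(\mathbf x)=\mu$. **Wasserstein distance.** $d_{W,\mathrm{full}}(\mu,\nu)$ is the infimum of $\|\mathbf x-\mathbf y\|_{L^2(\mathcal M)^m}$ over $\mathcal M\models\mathrm T_{\mathcal U}$ and $\mathbf x,\mathbf y\in\mathcal M^m$ with $\operatorname{tp}^{\mathcal M}(\mathbf x)=\mu$, $\operatorname{tp}^{\mathcal M}(\mathbf y)=\nu$. **Free entropy and Gibbs types.** $\mathbb M_n^m$ carries the inner product $\langle\mathbf X,\mathbf Y\rangle_{\operatorname{tr}_n}=\sum_j\operatorname{tr}_n(X_j^*Y_j)$,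 and $\mathrm{vol}$ is the Lebesgue measure normalized via a linear isometry for this inner product. For $\mathcal O\subseteq\mathbb S_{m,R}(\mathrm T_{\mathrm{tr,fact}})$ open, $\Gamma_R^{(n)}(\mathcal O)=\{\mathbf X\in\mathbb M_n^m:\|X_j\|\le R\ \forall j,\ \operatorname{tp}^{\mathbb M_n}(\mathbf X)\in\mathcal O\}$. For $\mu\in\mathbb S_{m,R}(\mathrm T_{\mathrm{tr,fact}})$, $$\chi^{\mathcal U}_{\mathrm{full}}(\mu)=\inf_{\mathcal O\ni\mu}\lim_{n\to\mathcal U}\Big[\tfrac1{n^2}\log\mathrm{vol}\,\Gamma_R^{(n)}(\mathcal O)+2m\log n\Big]\in[-\infty,\infty),$$ $\mathcal O$ ranging over open neighborhoods of $\mu$ in $\mathbb S_{m,R}(\mathrm T_{\mathrm{tr,fact}})$; this is independent of the choice of $R$. A Gibbs type for $\varphi$ (with respect to $\mathcal U$) is a type in $\mathbb S_m(\mathrm T_{\mathcal U})$ maximizing $\nu\mapsto\chi^{\mathcal U}_{\mathrm{full}}(\nu)-(\nu,\varphi)$ over $\mathbb S_m(\mathrm T_{\mathcal U})$; it exists and is unique for $c$-strongly convex $\varphi$. *)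

theory Defs
  imports
    "HOL-Analysis.Analysis"
    "Jordan_Normal_Form.Schur_Decomposition"
begin

section \<open>Bounded operators on \<open>\<ell>\<^sup>2(S)\<close> and von Neumann algebras\<close>

text \<open>Every complex Hilbert space is unitarily equivalent to some \<open>\<ell>\<^sup>2(S)\<close>. Its vectors are
  represented as functions on the ambient index type that vanish outside \<open>S\<close>.\<close>

definition ell2 :: "'i set \<Rightarrow> ('i \<Rightarrow> complex) set" where
  "ell2 S = {f. (\<forall>i. i \<notin> S \<longrightarrow> f i = 0) \<and> (\<lambda>i. (cmod (f i))\<^sup>2) summable_on S}"

definition ell2_inner :: "'i set \<Rightarrow> ('i \<Rightarrow> complex) \<Rightarrow> ('i \<Rightarrow> complex) \<Rightarrow> complex" where
  "ell2_inner S f g = (\<Sum>\<^sub>\<infinity>i\<in>S. cnj (f i) * g i)"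

definition ell2_norm :: "'i set \<Rightarrow> ('i \<Rightarrow> complex) \<Rightarrow> real" where
  "ell2_norm S f = sqrt (\<Sum>\<^sub>\<infinity>i\<in>S. (cmod (f i))\<^sup>2)"

type_synonym 'i oper = "('i \<Rightarrow> complex) \<Rightarrow> ('i \<Rightarrow> complex)"

text \<open>Operators are normalised to be zero off \<open>ell2 S\<close>, so that equality of operators is equality
  of functions.\<close>

definition bounded_opers :: "'i set \<Rightarrow> 'i oper set" where
  "bounded_opers S = {T.
     (\<forall>f. f \<notin> ell2 S \<longrightarrow> T f = (\<lambda>_. 0)) \<and>
     (\<forall>f\<in>ell2 S. T f \<in> ell2 S) \<and>
     (\<forall>f\<in>ell2 S. \<forall>g\<in>ell2 S. T (\<lambda>i. f i + g i) = (\<lambda>i. T f i + T g i)) \<and>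
     (\<forall>a. \<forall>f\<in>ell2 S. T (\<lambda>i. a * f i) = (\<lambda>i. a * T f i)) \<and>
     (\<exists>B. \<forall>f\<in>ell2 S. ell2_norm S (T f) \<le> B * ell2_norm S f)}"

definition id_oper :: "'i set \<Rightarrow> 'i oper" where
  "id_oper S = (\<lambda>f. if f \<in> ell2 S then f else (\<lambda>_. 0))"

definition is_adjoint :: "'i set \<Rightarrow> 'i oper \<Rightarrow> 'i oper \<Rightarrow> bool" where
  "is_adjoint S T T' \<longleftrightarrow>
     (\<forall>f\<in>ell2 S. \<forall>g\<in>ell2 S. ell2_inner S (T f) g = ell2_inner S f (T' g))"

definition oper_norm :: "'i set \<Rightarrow> 'i oper \<Rightarrow> real" where
  "oper_norm S T = (SUP f\<in>{f \<in> ell2 S. ell2_norm S f \<le> 1}. ell2_norm S (T f))"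

definition commutant :: "'i set \<Rightarrow> 'i oper set \<Rightarrow> 'i oper set" where
  "commutant S N = {T \<in> bounded_opers S. \<forall>A\<in>N. T \<circ> A = A \<circ> T}"

definition von_neumann_algebra :: "'i set \<Rightarrow> 'i oper set \<Rightarrow> bool" where
  "von_neumann_algebra S N \<longleftrightarrow>
     N \<subseteq> bounded_opers S \<and>
     (\<forall>T\<in>N. \<exists>T'\<in>N. is_adjoint S T T') \<and>
     commutant S (commutant S N) = N"


section \<open>Tracial von Neumann algebras\<close>

record 'a tracial_algebra = "'a ring" +
  scal :: "complex \<Rightarrow> 'a \<Rightarrow> 'a"
  adj :: "'a \<Rightarrow> 'a"
  trc :: "'a \<Rightarrow> complex"
  opn :: "'a \<Rightarrow> real"

definition vN_representation ::
  "'a tracial_algebra \<Rightarrow> 'i set \<Rightarrow> 'i oper set \<Rightarrow> ('a \<Rightarrow> 'i oper) \<Rightarrow> bool" where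
  "vN_representation M S N \<pi> \<longleftrightarrow>
     von_neumann_algebra S N \<and>
     bij_betw \<pi> (carrier M) N \<and>
     \<pi> \<one>\<^bsub>M\<^esub> = id_oper S \<and>
     (\<forall>x\<in>carrier M. \<forall>y\<in>carrier M. \<pi> (x \<oplus>\<^bsub>M\<^esub> y) = (\<lambda>f i. \<pi> x f i + \<pi> y f i)) \<and>
     (\<forall>x\<in>carrier M. \<forall>y\<in>carrier M. \<pi> (x \<otimes>\<^bsub>M\<^esub> y) = \<pi> x \<circ> \<pi> y) \<and>
     (\<forall>a. \<forall>x\<in>carrier M. \<pi> (scal M a x) = (\<lambda>f i. a * \<pi> x f i)) \<and>
     (\<forall>x\<in>carrier M. is_adjoint S (\<pi> x) (\<pi> (adj M x))) \<and>
     (\<forall>x\<in>carrier M. opn M x = oper_norm S (\<pi> x))"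

definition self_adjoints :: "'a tracial_algebra \<Rightarrow> 'a set" where
  "self_adjoints M = {x \<in> carrier M. adj M x = x}"

definition pos_le :: "'a tracial_algebra \<Rightarrow> 'a \<Rightarrow> 'a \<Rightarrow> bool" where
  "pos_le M x y \<longleftrightarrow> (\<exists>z\<in>carrier M. y = x \<oplus>\<^bsub>M\<^esub> (adj M z \<otimes>\<^bsub>M\<^esub> z))"

definition is_sup :: "'a tracial_algebra \<Rightarrow> 'a set \<Rightarrow> 'a \<Rightarrow> bool" where
  "is_sup M D s \<longleftrightarrow> s \<in> self_adjoints M \<and> (\<forall>d\<in>D. pos_le M d s) \<and>
     (\<forall>u\<in>self_adjoints M. (\<forall>d\<in>D. pos_le M d u) \<longrightarrow> pos_le M s u)"

text \<open>Normality of the trace: it preserves suprema of upward directed families.\<close>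

definition normal_trace :: "'a tracial_algebra \<Rightarrow> bool" where
  "normal_trace M \<longleftrightarrow>
     (\<forall>D s. D \<noteq> {} \<and> D \<subseteq> self_adjoints M \<and>
            (\<forall>d\<in>D. \<forall>e\<in>D. \<exists>g\<in>D. pos_le M d g \<and> pos_le M e g) \<and>
            is_sup M D s \<longrightarrow>
        Re (trc M s) = (SUP d\<in>D. Re (trc M d)))"

definition faithful_normal_tracial_state :: "'a tracial_algebra \<Rightarrow> bool" where
  "faithful_normal_tracial_state M \<longleftrightarrow>
     (\<forall>x\<in>carrier M. \<forall>y\<in>carrier M. trc M (x \<oplus>\<^bsub>M\<^esub> y) = trc M x + trc M y) \<and>
     (\<forall>a. \<forall>x\<in>carrier M. trc M (scal M a x) = a * trc M x) \<and>
     trc M \<one>\<^bsub>M\<^esub> = 1 \<and>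
     (\<forall>x\<in>carrier M. \<exists>r\<ge>0. trc M (adj M x \<otimes>\<^bsub>M\<^esub> x) = complex_of_real r) \<and>
     (\<forall>x\<in>carrier M. \<forall>y\<in>carrier M. trc M (x \<otimes>\<^bsub>M\<^esub> y) = trc M (y \<otimes>\<^bsub>M\<^esub> x)) \<and>
     (\<forall>x\<in>carrier M. trc M (adj M x \<otimes>\<^bsub>M\<^esub> x) = 0 \<longrightarrow> x = \<zero>\<^bsub>M\<^esub>) \<and>
     normal_trace M"

text \<open>The index type of the Hilbert space can be taken to be the element type \<open>'a\<close> itself: the
  standard representation on \<open>L\<^sup>2(M)\<close> has dimension at most the cardinality of \<open>M\<close>.\<close>

definition tracial_vNa :: "'a tracial_algebra \<Rightarrow> bool" where
  "tracial_vNa M \<longleftrightarrow>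
     ring M \<and>
     (\<forall>a. \<forall>x\<in>carrier M. scal M a x \<in> carrier M) \<and>
     (\<forall>x\<in>carrier M. adj M x \<in> carrier M) \<and>
     (\<exists>(S::'a set) N \<pi>. vN_representation M S N \<pi>) \<and>
     faithful_normal_tracial_state M"

definition tracial_factor :: "'a tracial_algebra \<Rightarrow> bool" where
  "tracial_factor M \<longleftrightarrow> tracial_vNa M \<and>
     {z \<in> carrier M. \<forall>x\<in>carrier M. z \<otimes>\<^bsub>M\<^esub> x = x \<otimes>\<^bsub>M\<^esub> z} = range (\<lambda>a. scal M a \<one>\<^bsub>M\<^esub>)"

definition op_ball :: "'a tracial_algebra \<Rightarrow> real \<Rightarrow> 'a set" where
  "op_ball M R = {x \<in> carrier M. opn M x \<le> R}"

text \<open>Tuples are lists; \<open>tuples m A\<close> is \<open>A\<^sup>m\<close>.\<close>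

definition tuples :: "nat \<Rightarrow> 'a set \<Rightarrow> 'a list set" where
  "tuples m A = {xs. length xs = m \<and> set xs \<subseteq> A}"

definition L2_inner :: "'a tracial_algebra \<Rightarrow> 'a list \<Rightarrow> 'a list \<Rightarrow> complex" where
  "L2_inner M xs ys = (\<Sum>j<length xs. trc M (adj M (xs ! j) \<otimes>\<^bsub>M\<^esub> (ys ! j)))"

definition L2_norm :: "'a tracial_algebra \<Rightarrow> 'a list \<Rightarrow> real" where
  "L2_norm M xs = sqrt (Re (L2_inner M xs xs))"

definition tuple_diff :: "'a tracial_algebra \<Rightarrow> 'a list \<Rightarrow> 'a list \<Rightarrow> 'a list" where
  "tuple_diff M xs ys = map2 (\<lambda>x y. x \<ominus>\<^bsub>M\<^esub> y) xs ys"

definition tuple_segment :: "'a tracial_algebra \<Rightarrow> real \<Rightarrow> 'a list \<Rightarrow> 'a list \<Rightarrow> 'a list" where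
  "tuple_segment M t xs ys =
     map2 (\<lambda>x y. scal M (complex_of_real (1 - t)) x \<oplus>\<^bsub>M\<^esub> scal M (complex_of_real t) y) xs ys"


section \<open>Matrix algebras and tracial ultraproducts\<close>

definition mat_opnorm :: "nat \<Rightarrow> complex mat \<Rightarrow> real" where
  "mat_opnorm n A =
     (SUP v\<in>{v \<in> carrier_vec n. Re (v \<bullet>c v) \<le> 1}. sqrt (Re ((A *\<^sub>v v) \<bullet>c (A *\<^sub>v v))))"

definition mat_algebra :: "nat \<Rightarrow> complex mat tracial_algebra" where
  "mat_algebra n = ring_mat TYPE(complex) n
     \<lparr>scal = (\<lambda>a A. a \<cdot>\<^sub>m A),
      adj = mat_adjoint,
      trc = (\<lambda>A. (\<Sum>i<n. A $$ (i, i)) / of_nat n),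
      opn = mat_opnorm n\<rparr>"

definition free_ultrafilter :: "nat filter \<Rightarrow> bool" where
  "free_ultrafilter U \<longleftrightarrow>
     U \<noteq> bot \<and>
     (\<forall>P. eventually P U \<or> eventually (\<lambda>n. \<not> P n) U) \<and>
     (\<forall>k. eventually (\<lambda>n. n \<noteq> k) U)"

definition bounded_seqs :: "(nat \<Rightarrow> 'a tracial_algebra) \<Rightarrow> (nat \<Rightarrow> 'a) set" where
  "bounded_seqs A = {x. (\<forall>n. x n \<in> carrier (A n)) \<and> (\<exists>B. \<forall>n. opn (A n) (x n) \<le> B)}"

definition ultra_rel ::
  "nat filter \<Rightarrow> (nat \<Rightarrow> 'a tracial_algebra) \<Rightarrow> ((nat \<Rightarrow> 'a) \<times> (nat \<Rightarrow> 'a)) set" where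
  "ultra_rel U A = {(x, y). x \<in> bounded_seqs A \<and> y \<in> bounded_seqs A \<and>
     ((\<lambda>n. L2_norm (A n) [x n \<ominus>\<^bsub>A n\<^esub> y n]) \<longlongrightarrow> 0) U}"

definition ultra_class ::
  "nat filter \<Rightarrow> (nat \<Rightarrow> 'a tracial_algebra) \<Rightarrow> (nat \<Rightarrow> 'a) \<Rightarrow> (nat \<Rightarrow> 'a) set" where
  "ultra_class U A x = ultra_rel U A `` {x}"

text \<open>The norm is the quotient norm of \<open>\<ell>\<^sup>\<infinity>\<close> by the ideal of \<open>\<parallel>\<cdot>\<parallel>\<^sub>2\<close>-null sequences.\<close>

definition ultraproduct ::
  "nat filter \<Rightarrow> (nat \<Rightarrow> 'a tracial_algebra) \<Rightarrow> (nat \<Rightarrow> 'a) set tracial_algebra" where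
  "ultraproduct U A =
     \<lparr>carrier = bounded_seqs A // ultra_rel U A,
      mult = (\<lambda>X Y. \<Union>x\<in>X. \<Union>y\<in>Y. ultra_class U A (\<lambda>n. x n \<otimes>\<^bsub>A n\<^esub> y n)),
      one = ultra_class U A (\<lambda>n. \<one>\<^bsub>A n\<^esub>),
      zero = ultra_class U A (\<lambda>n. \<zero>\<^bsub>A n\<^esub>),
      add = (\<lambda>X Y. \<Union>x\<in>X. \<Union>y\<in>Y. ultra_class U A (\<lambda>n. x n \<oplus>\<^bsub>A n\<^esub> y n)),
      scal = (\<lambda>a X. \<Union>x\<in>X. ultra_class U A (\<lambda>n. scal (A n) a (x n))),
      adj = (\<lambda>X. \<Union>x\<in>X. ultra_class U A (\<lambda>n. adj (A n) (x n))),
      trc = (\<lambda>X. Lim U (\<lambda>n. trc (A n) ((SOME x. x \<in> X) n))),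
      opn = (\<lambda>X. INF x\<in>X. SUP n. opn (A n) (x n))\<rparr>"

definition matrix_ultraproduct :: "nat filter \<Rightarrow> (nat \<Rightarrow> complex mat) set tracial_algebra" where
  "matrix_ultraproduct U = ultraproduct U mat_algebra"


section \<open>Formulas, theories and types\<close>

text \<open>Terms denoting non-commutative \<open>*\<close>-polynomials.\<close>

datatype star_poly =
    PVar nat
  | PConst complex
  | PAdd star_poly star_poly
  | PMult star_poly star_poly
  | PAdj star_poly

primrec poly_eval :: "'a tracial_algebra \<Rightarrow> 'a list \<Rightarrow> star_poly \<Rightarrow> 'a" where
  "poly_eval M xs (PVar i) = xs ! i"
| "poly_eval M xs (PConst a) = scal M a \<one>\<^bsub>M\<^esub>"
| "poly_eval M xs (PAdd p q) = poly_eval M xs p \<oplus>\<^bsub>M\<^esub> poly_eval M xs q"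
| "poly_eval M xs (PMult p q) = poly_eval M xs p \<otimes>\<^bsub>M\<^esub> poly_eval M xs q"
| "poly_eval M xs (PAdj p) = adj M (poly_eval M xs p)"

primrec poly_vars :: "star_poly \<Rightarrow> nat set" where
  "poly_vars (PVar i) = {i}"
| "poly_vars (PConst a) = {}"
| "poly_vars (PAdd p q) = poly_vars p \<union> poly_vars q"
| "poly_vars (PMult p q) = poly_vars p \<union> poly_vars q"
| "poly_vars (PAdj p) = poly_vars p"

text \<open>The free variables of a formula in \<open>k\<close> free variables are numbered \<open>0, \<dots>, k - 1\<close>; a
  quantifier applied to a formula in \<open>k + 1\<close> free variables binds variable number \<open>k\<close>.\<close>

datatype formula =
    ReTr star_poly
  | SupBall real formula
  | InfBall real formula
  | Connective "(nat \<Rightarrow> real) \<Rightarrow> real" "formula list"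

text \<open>\<open>Euclidean_space k\<close> is \<open>\<real>\<^sup>k\<close>, realised as the real sequences vanishing from index \<open>k\<close> on.\<close>

fun formula_in :: "nat \<Rightarrow> formula \<Rightarrow> bool" where
  "formula_in k (ReTr p) \<longleftrightarrow> poly_vars p \<subseteq> {..<k}"
| "formula_in k (SupBall R \<psi>) \<longleftrightarrow> R > 0 \<and> formula_in (Suc k) \<psi>"
| "formula_in k (InfBall R \<psi>) \<longleftrightarrow> R > 0 \<and> formula_in (Suc k) \<psi>"
| "formula_in k (Connective f \<psi>s) \<longleftrightarrow>
     continuous_map (Euclidean_space (length \<psi>s)) euclideanreal f \<and>
     (\<forall>\<psi>\<in>set \<psi>s. formula_in k \<psi>)"

definition formulas :: "nat \<Rightarrow> formula set" where
  "formulas m = {\<psi>. formula_in m \<psi>}"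

fun interp :: "'a tracial_algebra \<Rightarrow> formula \<Rightarrow> 'a list \<Rightarrow> real" where
  "interp M (ReTr p) xs = Re (trc M (poly_eval M xs p))"
| "interp M (SupBall R \<psi>) xs = (SUP y\<in>op_ball M R. interp M \<psi> (xs @ [y]))"
| "interp M (InfBall R \<psi>) xs = (INF y\<in>op_ball M R. interp M \<psi> (xs @ [y]))"
| "interp M (Connective f \<psi>s) xs =
     (let vs = map (\<lambda>\<psi>. interp M \<psi> xs) \<psi>s
      in f (\<lambda>i. if i < length vs then vs ! i else 0))"

definition theory_of :: "'a tracial_algebra \<Rightarrow> formula set" where
  "theory_of M = {\<psi> \<in> formulas 0. interp M \<psi> [] = 0}"

definition models :: "formula set \<Rightarrow> 'u tracial_algebra set" where
  "models T = {M. tracial_vNa M \<and> (\<forall>\<psi>\<in>T. interp M \<psi> [] = 0)}"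

text \<open>A theory enters the definitions below only through its class of models. The class of all
  models is not a set, so models are those whose elements are drawn from an arbitrary universe type
  \<open>'u\<close>. Once \<open>'u\<close> has at least the cardinality of the continuum, it contains isomorphic copies of
  all matrix algebras, all separable tracial von Neumann algebras and the matrix ultraproduct.\<close>

definition models_tr :: "'u tracial_algebra set" where
  "models_tr = {M. tracial_vNa M}"

definition models_fact :: "'u tracial_algebra set" where
  "models_fact = {M. tracial_factor M}"

definition models_U :: "nat filter \<Rightarrow> 'u tracial_algebra set" where
  "models_U U = models (theory_of (matrix_ultraproduct U))"

definition tp :: "nat \<Rightarrow> 'a tracial_algebra \<Rightarrow> 'a list \<Rightarrow> (formula \<Rightarrow> real)" where
  "tp m M xs = restrict (\<lambda>\<psi>. interp M \<psi> xs) (formulas m)"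

definition types_ball :: "'u tracial_algebra set \<Rightarrow> nat \<Rightarrow> real \<Rightarrow> (formula \<Rightarrow> real) set" where
  "types_ball K m R = {tp m M xs | M xs. M \<in> K \<and> xs \<in> tuples m (op_ball M R)}"

definition types :: "'u tracial_algebra set \<Rightarrow> nat \<Rightarrow> (formula \<Rightarrow> real) set" where
  "types K m = (\<Union>R\<in>{0<..}. types_ball K m R)"

definition types_topology :: "'u tracial_algebra set \<Rightarrow> nat \<Rightarrow> real \<Rightarrow> (formula \<Rightarrow> real) topology" where
  "types_topology K m R =
     subtopology (product_topology (\<lambda>_. euclideanreal) (formulas m)) (types_ball K m R)"


section \<open>Definable predicates\<close>

type_synonym 'u predicate = "'u tracial_algebra \<Rightarrow> 'u list \<Rightarrow> real"

definition definable_predicate :: "'u tracial_algebra set \<Rightarrow> nat \<Rightarrow> 'u predicate \<Rightarrow> bool" where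
  "definable_predicate K m \<phi> \<longleftrightarrow>
     (\<forall>\<epsilon>>0. \<forall>R>0. \<exists>\<psi>\<in>formulas m. \<forall>M\<in>K. \<forall>xs\<in>tuples m (op_ball M R).
        \<bar>\<phi> M xs - interp M \<psi> xs\<bar> < \<epsilon>)"

definition strongly_convex ::
  "'u tracial_algebra set \<Rightarrow> nat \<Rightarrow> real \<Rightarrow> 'u predicate \<Rightarrow> bool" where
  "strongly_convex K m c \<phi> \<longleftrightarrow>
     (\<forall>M\<in>K. let g = (\<lambda>xs. \<phi> M xs - c / 2 * (L2_norm M xs)\<^sup>2) in
        \<forall>xs\<in>tuples m (carrier M). \<forall>ys\<in>tuples m (carrier M). \<forall>t\<in>{0..1}.
          g (tuple_segment M t xs ys) \<le> (1 - t) * g xs + t * g ys)"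

text \<open>The pairing \<open>(\<mu>, \<phi>)\<close>, for \<open>\<phi>\<close> a predicate relative to the class \<open>K\<close>.\<close>

definition pairing ::
  "'u tracial_algebra set \<Rightarrow> nat \<Rightarrow> (formula \<Rightarrow> real) \<Rightarrow> 'u predicate \<Rightarrow> real" where
  "pairing K m \<mu> \<phi> =
     (THE r. \<exists>M\<in>K. \<exists>xs\<in>tuples m (carrier M). tp m M xs = \<mu> \<and> \<phi> M xs = r)"


section \<open>Wasserstein distance\<close>

definition d_W_full ::
  "'u itself \<Rightarrow> nat filter \<Rightarrow> nat \<Rightarrow> (formula \<Rightarrow> real) \<Rightarrow> (formula \<Rightarrow> real) \<Rightarrow> ereal" where
  "d_W_full _ U m \<mu> \<nu> =
     Inf {ereal (L2_norm M (tuple_diff M xs ys)) | (M :: 'u tracial_algebra) xs ys.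
        M \<in> models_U U \<and> xs \<in> tuples m (carrier M) \<and> ys \<in> tuples m (carrier M) \<and>
        tp m M xs = \<mu> \<and> tp m M ys = \<nu>}"


section \<open>Free entropy and Gibbs types\<close>

text \<open>The matrices \<open>\<surd>n E\<^sub>p\<^sub>q\<close> and \<open>i \<surd>n E\<^sub>p\<^sub>q\<close> form a real orthonormal basis of the \<open>n\<close>-by-\<open>n\<close>
  complex matrices for the real inner product given by the normalised trace. So
  \<open>matrix_tuple n m\<close> is a linear isometry, from real coordinates indexed by
  \<open>coord_index n m\<close> onto the \<open>m\<close>-tuples of matrices.\<close>

definition coord_index :: "nat \<Rightarrow> nat \<Rightarrow> (nat \<times> nat \<times> nat \<times> bool) set" where
  "coord_index n m = {..<m} \<times> {..<n} \<times> {..<n} \<times> UNIV"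

definition matrix_tuple :: "nat \<Rightarrow> nat \<Rightarrow> (nat \<times> nat \<times> nat \<times> bool \<Rightarrow> real) \<Rightarrow> complex mat list" where
  "matrix_tuple n m a =
     map (\<lambda>j. mat n n (\<lambda>(p, q).
        complex_of_real (sqrt (real n)) * Complex (a (j, p, q, False)) (a (j, p, q, True)))) [0..<m]"

definition vol :: "nat \<Rightarrow> nat \<Rightarrow> complex mat list set \<Rightarrow> ennreal" where
  "vol n m G =
     (let P = (\<Pi>\<^sub>M i\<in>coord_index n m. (lborel :: real measure))
      in emeasure P {a \<in> space P. matrix_tuple n m a \<in> G})"

definition log_ennreal :: "ennreal \<Rightarrow> ereal" where
  "log_ennreal v = (if v = 0 then -\<infinity> else if v = \<infinity> then \<infinity> else ereal (ln (enn2real v)))"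

definition microstates ::
  "nat \<Rightarrow> nat \<Rightarrow> real \<Rightarrow> (formula \<Rightarrow> real) set \<Rightarrow> complex mat list set" where
  "microstates n m R V =
     {X \<in> tuples m (op_ball (mat_algebra n) R). tp m (mat_algebra n) X \<in> V}"

definition chi_full_R ::
  "'u itself \<Rightarrow> nat filter \<Rightarrow> nat \<Rightarrow> real \<Rightarrow> (formula \<Rightarrow> real) \<Rightarrow> ereal" where
  "chi_full_R _ U m R \<mu> =
     (INF V\<in>{V. openin (types_topology (models_fact :: 'u tracial_algebra set) m R) V \<and> \<mu> \<in> V}.
        Lim U (\<lambda>n. ereal (1 / (real n)\<^sup>2) * log_ennreal (vol n m (microstates n m R V))
                    + ereal (2 * real m * ln (real n))))"

text \<open>The value does not depend on the admissible radius \<open>R\<close>.\<close>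

definition chi_full :: "'u itself \<Rightarrow> nat filter \<Rightarrow> nat \<Rightarrow> (formula \<Rightarrow> real) \<Rightarrow> ereal" where
  "chi_full ty U m \<mu> =
     chi_full_R ty U m
       (SOME R. R > 0 \<and> \<mu> \<in> types_ball (models_fact :: 'u tracial_algebra set) m R) \<mu>"

definition gibbs_type :: "nat filter \<Rightarrow> nat \<Rightarrow> 'u predicate \<Rightarrow> (formula \<Rightarrow> real) \<Rightarrow> bool" where
  "gibbs_type U m \<phi> \<mu> \<longleftrightarrow>
     \<mu> \<in> types (models_U U :: 'u tracial_algebra set) m \<and>
     (\<forall>\<nu>\<in>types (models_U U :: 'u tracial_algebra set) m.
        chi_full TYPE('u) U m \<nu> - ereal (pairing models_tr m \<nu> \<phi>)
          \<le> chi_full TYPE('u) U m \<mu> - ereal (pairing models_tr m \<mu> \<phi>))"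

end

(* If chi(mu) and chi(nu) are finite and d(mu,nu)^2 exceeds the claimed bound, then by countable saturation of the
 ultraproduct all matrix microstates X of mu and Y of nu are at distance at least d, where d^2 exceeds the bound too.
 By strong convexity phi is smaller by (c/2) t (1-t) d^2 on the segments (1-t) X + t Y than by mere convexity, while by
 the Prekopa-Leindler inequality these segments fill a volume of entropy at least (1-t) chi(mu) + t chi(nu).  A Lindelof
 argument on the type space yields a type whose chi - phi is larger than that of the Gibbs type as t tends to 0.

 chi is evaluated at some chosen radius of a type, so the segments are first moved by X -> S X S + R (1 - S^2) with a
 diagonal S close to 1 in 2-norm: it preserves the ball of radius R, loses little volume, and makes every limit type
 have operator norm R, which forces the chosen radius to be at least R. *)
theory Submission
 imports Defs "HOL-Analysis.Analysis" "Jordan_Normal_Form.Spectral_Radius"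
begin

text \<open>Most of the length comes from the models. The Wasserstein infimum and the types tested
  against the Gibbs type range over algebras with elements in \<open>'u\<close>, so the matrix
  ultraproduct has to be shown to be a tracial von Neumann algebra in the concrete sense, a
  bicommutant on some \<ell>^2 space, and then be copied into \<open>'u\<close>. The obstacle to
  saturation and covering is that arbitrary continuous connectives give uncountably many formulas. A
  countable family with rational data replaces them; its density is uniform over all star algebras,
  and it is carried to every model of the theory of the ultraproduct by expressing closeness as a
  sentence. In the final estimate both the convexity gain (c/2) t (1-t) d^2 and the loss against the
  Gibbs bound are of first order in t. What survives is t times the excess \<Delta> of (c/2) d^2
  over the entropy-energy deficit. Hence t is of order \<Delta>/(c d^2), which keeps the quadratic
  term below half of the excess, and every other error is a small multiple of t \<Delta>.\<close>

type_synonym 'a alg = "'a tracial_algebra"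
abbreviation (input) mult_of ("(_ *[_] _)" [70, 0, 71] 70) where "x *[M] y == x \<otimes>\<^bsub>M\<^esub> y"
abbreviation (input) add_of ("(_ +[_] _)" [65, 0, 66] 65) where "x +[M] y == x \<oplus>\<^bsub>M\<^esub> y"
abbreviation (input) minus_of ("(_ -[_] _)" [65, 0, 66] 65) where "x -[M] y == x \<ominus>\<^bsub>M\<^esub> y"
abbreviation (input) tends (infixr "~>" 55) where "(f ~> l) F == filterlim f (nhds l) F"
abbreviation (input) lims (infix "~~>" 60) where "f ~~> l == filterlim f (nhds l) sequentially"
abbreviation (input) iff_of :: "bool => bool => bool" (infixr "<->" 25) where "A <-> B == A = B"
abbreviation (input) "car == carrier"
abbreviation (input) "cor == complex_of_real"
abbreviation (input) "Mat == mat_algebra"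
abbreviation (input) "sqm n == carrier_mat n n"
abbreviation (input) "madj == mat_adjoint"
abbreviation (input) "mt == matrix_tuple"
abbreviation (input) "itp n == interp (Mat n)"
abbreviation (input) "tball M k R == tuples k (op_ball M R)"
abbreviation (input) "LB I == \<Pi>\<^sub>M i\<in>I. (lborel :: real measure)"

section \<open>Trace norm and operator norm in an abstract star algebra\<close>

definition norm2 :: "'a alg => 'a => real" where
 "norm2 M x = sqrt (Re (trc M (adj M x *[M] x)))"

lemma L2_norm_single: "L2_norm M [x] = norm2 M x"
 by (simp add: L2_norm_def L2_inner_def norm2_def)

text \<open>The operator norm is characterised as the norm of left multiplication for the trace norm.
 The trace of the unit may be smaller than 1, which admits the zero algebra
 \<open>Mat 0\<close>.\<close>

locale star_alg = ring M for M :: "'a alg" (structure) +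
 assumes scal_closed [simp]: "x : car M ==> scal M a x : car M"
  and adj_closed [simp]: "x : car M ==> adj M x : car M"
  and scal_add: "[|x : car M; y : car M|] ==> scal M a (x \<oplus> y) = scal M a x \<oplus> scal M a y"
  and add_scal: "x : car M ==> scal M (a + b) x = scal M a x \<oplus> scal M b x"
  and scal_scal: "x : car M ==> scal M a (scal M b x) = scal M (a * b) x"
  and scal_one [simp]: "x : car M ==> scal M 1 x = x"
  and scal_mult_left: "[|x : car M; y : car M|] ==> scal M a x \<otimes> y = scal M a (x \<otimes> y)"
  and scal_mult_right: "[|x : car M; y : car M|] ==> x \<otimes> scal M a y = scal M a (x \<otimes> y)"
  and adj_add: "[|x : car M; y : car M|] ==> adj M (x \<oplus> y) = adj M x \<oplus> adj M y"
  and adj_scal: "x : car M ==> adj M (scal M a x) = scal M (cnj a) (adj M x)"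
  and adj_mult: "[|x : car M; y : car M|] ==> adj M (x \<otimes> y) = adj M y \<otimes> adj M x"
  and adj_adj [simp]: "x : car M ==> adj M (adj M x) = x"
  and trc_add: "[|x : car M; y : car M|] ==> trc M (x \<oplus> y) = trc M x + trc M y"
  and trc_scal: "x : car M ==> trc M (scal M a x) = a * trc M x"
  and trc_comm: "[|x : car M; y : car M|] ==> trc M (x \<otimes> y) = trc M (y \<otimes> x)"
  and trc_adj: "x : car M ==> trc M (adj M x) = cnj (trc M x)"
  and trc_pos: "x : car M ==> 0 <= Re (trc M (adj M x \<otimes> x))"
  and trc_faithful: "[|x : car M; Re (trc M (adj M x \<otimes> x)) = 0|] ==> x = \<zero>"
  and trc_one_le: "Re (trc M \<one>) <= 1"
  and opn_nonneg: "x : car M ==> 0 <= opn M x"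
  and opn_bound: "[|x : car M; y : car M|] ==> norm2 M (x \<otimes> y) <= opn M x * norm2 M y"
  and opn_least: "[|x : car M; 0 <= B;
  !!y. y : car M ==> norm2 M (x \<otimes> y) <= B * norm2 M y|] ==> opn M x <= B"
begin

abbreviation ip :: "'a => 'a => complex" where
 "ip x y \<equiv> trc M (adj M x \<otimes> y)"

abbreviation n2 :: "'a => real" where
 "n2 x \<equiv> norm2 M x"

lemma scal_zero_left [simp]: "x : car M ==> scal M 0 x = \<zero>"
proof -
 assume x: "x : car M"
 have "scal M (0 + 0) x = scal M 0 x \<oplus> scal M 0 x"
  using x by (rule add_scal)
 then show ?thesis
  using x by (metis add.r_cancel_one add_0 scal_closed)
qed

lemma a_inv_eq_scal: "x : car M ==> \<ominus> x = scal M (-1) x"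
proof -
 assume x: "x : car M"
 have "x \<oplus> scal M (-1) x = scal M (1 + -1) x"
  using x add_scal[of x 1 "-1"] by simp
 also have "... = \<zero>"
  using x by simp
 finally show ?thesis
  using x by (metis a_comm minus_equality scal_closed)
qed

lemma minus_eq_scal: "[|x : car M; y : car M|] ==> x \<ominus> y = x \<oplus> scal M (-1) y"
 by (simp add: a_minus_def a_inv_eq_scal)

lemma scal_zero_right [simp]: "scal M a \<zero> = \<zero>"
 by (metis zero_closed scal_scal scal_zero_left mult_zero_right)

lemma trc_zero [simp]: "trc M \<zero> = 0"
 by (metis mult_zero_left scal_zero_left trc_scal zero_closed)

lemma adj_zero [simp]: "adj M \<zero> = \<zero>"
 by (metis adj_closed adj_scal complex_cnj_zero scal_zero_left zero_closed)

lemma adj_one [simp]: "adj M \<one> = \<one>"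
 by (metis adj_adj adj_closed adj_mult l_one one_closed r_one)

lemma adj_minus: "[|x : car M; y : car M|] ==> adj M (x \<ominus> y) = adj M x \<ominus> adj M y"
 by (simp add: minus_eq_scal adj_add adj_scal)

lemma trc_minus: "[|x : car M; y : car M|] ==> trc M (x \<ominus> y) = trc M x - trc M y"
 by (simp add: minus_eq_scal trc_add trc_scal)

lemma ip_sym: "[|x : car M; y : car M|] ==> ip y x = cnj (ip x y)"
 by (metis adj_adj adj_closed adj_mult m_closed trc_adj)

lemma ip_add_left: "[|x : car M; y : car M; z : car M|] ==> ip (x \<oplus> y) z = ip x z + ip y z"
 by (simp add: adj_add l_distr trc_add)

lemma ip_add_right: "[|x : car M; y : car M; z : car M|] ==> ip x (y \<oplus> z) = ip x y + ip x z"
 by (simp add: r_distr trc_add)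

lemma ip_scal_left: "[|x : car M; y : car M|] ==> ip (scal M a x) y = cnj a * ip x y"
 by (simp add: adj_scal scal_mult_left trc_scal)

lemma ip_scal_right: "[|x : car M; y : car M|] ==> ip x (scal M a y) = a * ip x y"
 by (simp add: scal_mult_right trc_scal)

lemma ip_minus_left: "[|x : car M; y : car M; z : car M|] ==> ip (x \<ominus> y) z = ip x z - ip y z"
 by (simp add: minus_eq_scal ip_add_left ip_scal_left)

lemma ip_minus_right: "[|x : car M; y : car M; z : car M|] ==> ip x (y \<ominus> z) = ip x y - ip x z"
 by (simp add: minus_eq_scal ip_add_right ip_scal_right)

lemmas ip_simps = ip_add_left ip_add_right ip_scal_left ip_scal_right ip_minus_left ip_minus_right

lemma n2_nonneg [simp]: "x : car M ==> 0 <= n2 x"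
 by (simp add: norm2_def trc_pos)

lemma n2_sq: "x : car M ==> (n2 x)^2 = Re (ip x x)"
 by (simp add: norm2_def trc_pos)

lemma ip_self: "x : car M ==> ip x x = cor ((n2 x)^2)"
 using ip_sym[of x x] by (simp add: n2_sq complex_eq_iff)

lemma n2_eq_0_iff: "x : car M ==> n2 x = 0 <-> x = \<zero>"
 using trc_faithful[of x] by (auto simp: norm2_def)

lemma n2_zero [simp]: "n2 \<zero> = 0"
 by (simp add: norm2_def)

lemma n2_scal: "x : car M ==> n2 (scal M a x) = cmod a * n2 x"
proof -
 assume x: "x : car M"
 have "ip (scal M a x) (scal M a x) = (cnj a * a) * ip x x"
  using x by (simp add: ip_scal_left ip_scal_right mult.assoc)
 also have "... = cor ((cmod a)^2 * (n2 x)^2)"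
  using x by (simp add: ip_self complex_norm_square mult_ac del: of_real_power)
 finally have "(n2 (scal M a x))^2 = (cmod a * n2 x)^2"
  using x by (simp add: n2_sq[of "scal M a x"] power_mult_distrib)
 then show ?thesis
  using x by (simp add: power2_eq_iff_nonneg)
qed

lemma n2_adj: "x : car M ==> n2 (adj M x) = n2 x"
 by (simp add: norm2_def trc_comm)

lemma Cauchy_Schwarz_ip:
 assumes x: "x : car M" and y: "y : car M"
 shows "cmod (ip x y) <= n2 x * n2 y"
proof (cases "y = \<zero>")
 case True
 then show ?thesis using x by simp
next
 case False
 define a where "a = (n2 y)^2"
 have a: "a > 0"
  using False y n2_eq_0_iff[of y] by (simp add: a_def)
 define b where "b = ip y x"
 have xy: "ip x y = cnj b"
  using x y by (simp add: b_def ip_sym[of y x])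
 have yy: "ip y y = cor a"
  using y by (simp add: ip_self a_def)
 \<comment> \<open>This is a multiple of the component of x orthogonal to y, scaled by
   \<open>a\<close> to avoid division; its square norm is nonnegative.\<close>
 define z where "z = scal M (cor a) x \<ominus> scal M b y"
 have z: "z : car M"
  using x y by (simp add: z_def)
 have "ip z z = cor a * (cor a * ip x x) - cor a * (b * cnj b)
  - cnj b * cor a * b + cnj b * b * cor a"
  using x y by (simp add: z_def ip_simps xy yy b_def[symmetric] algebra_simps)
 also have "... = cor (a * (a * (n2 x)^2 - (cmod b)^2))"
  using x by (simp add: ip_self of_real_diff of_real_mult complex_norm_square del: of_real_power) (simp add: algebra_simps)
 finally have "(n2 z)^2 = a * (a * (n2 x)^2 - (cmod b)^2)"
  using z by (simp add: n2_sq)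
 then have "0 <= a * (a * (n2 x)^2 - (cmod b)^2)"
  by (metis zero_le_power2)
 then have "(cmod b)^2 <= a * (n2 x)^2"
  using a by (simp add: zero_le_mult_iff)
 then have "(cmod b)^2 <= (n2 x * n2 y)^2"
  by (simp add: a_def power_mult_distrib mult.commute)
 then show ?thesis
  using x y xy by (metis abs_le_square_iff abs_norm_cancel abs_of_nonneg complex_mod_cnj mult_nonneg_nonneg n2_nonneg)
qed

lemma n2_triangle:
 assumes x: "x : car M" and y: "y : car M"
 shows "n2 (x \<oplus> y) <= n2 x + n2 y"
proof -
 have "ip (x \<oplus> y) (x \<oplus> y) = ip x x + ip y y + (ip x y + cnj (ip x y))"
  using x y by (simp add: ip_simps ip_sym[of x y])
 then have "(n2 (x \<oplus> y))^2 = (n2 x)^2 + (n2 y)^2 + 2 * Re (ip x y)"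
  using x y by (simp add: n2_sq)
 also have "... <= (n2 x)^2 + (n2 y)^2 + 2 * (n2 x * n2 y)"
  using Cauchy_Schwarz_ip[OF x y] complex_Re_le_cmod[of "ip x y"] by linarith
 also have "... = (n2 x + n2 y)^2"
  by (simp add: power2_sum)
 finally show ?thesis
  using x y by (meson add_nonneg_nonneg n2_nonneg power2_le_imp_le)
qed

lemma n2_minus_commute: "[|x : car M; y : car M|] ==> n2 (x \<ominus> y) = n2 (y \<ominus> x)"
proof -
 assume "x : car M" "y : car M"
 moreover from this have "x \<ominus> y = scal M (-1) (y \<ominus> x)"
  by (simp add: a_inv_eq_scal[symmetric] minus_eq minus_add r_neg2 a_comm)
 ultimately show ?thesis
  by (simp add: n2_scal)
qed

lemma minus_split: "[|x : car M; y : car M; z : car M|] ==> x \<ominus> z = (x \<ominus> y) \<oplus> (y \<ominus> z)"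
 by (simp add: minus_eq a_assoc[symmetric]) (simp add: a_assoc l_neg)

lemma n2_triangle_minus:
 "[|x : car M; y : car M; z : car M|] ==> n2 (x \<ominus> z) <= n2 (x \<ominus> y) + n2 (y \<ominus> z)"
 using n2_triangle[of "x \<ominus> y" "y \<ominus> z"] by (simp add: minus_split[symmetric])

lemma add_minus_cancel: "[|x : car M; y : car M|] ==> y \<oplus> (x \<ominus> y) = x"
 by (simp add: minus_eq) (metis a_inv_closed a_lcomm r_neg r_zero)

lemma n2_le_add_minus: "[|x : car M; y : car M|] ==> n2 x <= n2 y + n2 (x \<ominus> y)"
 using n2_triangle[of y "x \<ominus> y"] by (simp add: add_minus_cancel)

lemma n2_diff_abs: "[|x : car M; y : car M|] ==> \<bar>n2 x - n2 y\<bar> <= n2 (x \<ominus> y)"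
 using n2_le_add_minus[of x y] n2_le_add_minus[of y x] by (simp add: n2_minus_commute abs_le_iff)

lemma eq_of_n2_minus: "[|x : car M; y : car M; n2 (x \<ominus> y) = 0|] ==> x = y"
 using n2_eq_0_iff[of "x \<ominus> y"] add_minus_cancel[of x y] by simp

lemma n2_one_le: "n2 \<one> <= 1"
 using trc_one_le by (simp add: norm2_def)

lemma n2_le_opn: "x : car M ==> n2 x <= opn M x"
proof -
 assume x: "x : car M"
 have "n2 (x \<otimes> \<one>) <= opn M x * n2 \<one>"
  using x by (simp add: opn_bound del: r_one)
 also have "... <= opn M x * 1"
  using x n2_one_le by (intro mult_left_mono) (auto simp: opn_nonneg)
 finally show ?thesis using x by simp
qed

lemma opn_add: "[|x : car M; y : car M|] ==> opn M (x \<oplus> y) <= opn M x + opn M y"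
proof (rule opn_least)
 fix z assume x: "x : car M" and y: "y : car M" and z: "z : car M"
 have "n2 ((x \<oplus> y) \<otimes> z) <= n2 (x \<otimes> z) + n2 (y \<otimes> z)"
  using x y z by (simp add: l_distr n2_triangle)
 also have "... <= (opn M x + opn M y) * n2 z"
  using x y z opn_bound[of x z] opn_bound[of y z] by (simp add: distrib_right)
 finally show "n2 ((x \<oplus> y) \<otimes> z) <= (opn M x + opn M y) * n2 z" .
qed (auto simp: opn_nonneg)

lemma opn_mult: "[|x : car M; y : car M|] ==> opn M (x \<otimes> y) <= opn M x * opn M y"
proof (rule opn_least)
 fix z assume x: "x : car M" and y: "y : car M" and z: "z : car M"
 have "n2 ((x \<otimes> y) \<otimes> z) <= opn M x * n2 (y \<otimes> z)"
  using x y z by (simp add: m_assoc opn_bound)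
 also have "... <= opn M x * (opn M y * n2 z)"
  using x y z by (intro mult_left_mono) (auto simp: opn_nonneg opn_bound)
 finally show "n2 ((x \<otimes> y) \<otimes> z) <= opn M x * opn M y * n2 z"
  by (simp add: mult.assoc)
qed (auto simp: opn_nonneg)

lemma opn_scal_le: "x : car M ==> opn M (scal M a x) <= cmod a * opn M x"
proof (rule opn_least)
 fix z assume x: "x : car M" and z: "z : car M"
 show "n2 (scal M a x \<otimes> z) <= cmod a * opn M x * n2 z"
  using x z opn_bound[of x z] by (simp add: scal_mult_left n2_scal mult.assoc mult_left_mono)
qed (auto simp: opn_nonneg)

lemma opn_zero [simp]: "opn M \<zero> = 0"
proof (rule antisym)
 show "opn M \<zero> <= 0"
  by (rule opn_least) auto
qed (simp add: opn_nonneg)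

lemma opn_one_le: "opn M \<one> <= 1"
 by (rule opn_least) auto

text \<open>The square of the norm of x* z is the inner product of z with x (x* z), hence at most
  |z| |x| |x* z|; one factor |x* z| cancels.\<close>

lemma opn_adj_le: "x : car M ==> opn M (adj M x) <= opn M x"
proof (rule opn_least)
 fix z assume x: "x : car M" and z: "z : car M"
 let ?w = "adj M x \<otimes> z"
 have w: "?w : car M" using x z by simp
 have "(n2 ?w)^2 = Re (ip ?w ?w)" using w by (simp add: n2_sq)
 also have "ip ?w ?w = ip z (x \<otimes> ?w)"
  using x z by (simp add: adj_mult m_assoc)
 also have "Re ... <= n2 z * n2 (x \<otimes> ?w)"
  using Cauchy_Schwarz_ip[of z "x \<otimes> ?w"] x z w complex_Re_le_cmod order_trans by blast
 also have "... <= n2 z * (opn M x * n2 ?w)"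
  using x z by (intro mult_left_mono opn_bound) auto
 finally have "n2 ?w * n2 ?w <= (opn M x * n2 z) * n2 ?w"
  by (simp add: power2_eq_square mult_ac)
 then show "n2 ?w <= opn M x * n2 z"
  using w x z by (metis le_less linorder_not_less mult_le_cancel_right n2_nonneg opn_nonneg mult_nonneg_nonneg)
qed (auto simp: opn_nonneg)

lemma opn_adj: "x : car M ==> opn M (adj M x) = opn M x"
 using opn_adj_le[of x] opn_adj_le[of "adj M x"] by simp

text \<open>Traciality makes the trace norm invariant under the adjoint, so the bound for left
  multiplication transfers to right multiplication.\<close>

lemma opn_bound_right: "[|x : car M; y : car M|] ==> n2 (x \<otimes> y) <= n2 x * opn M y"
proof -
 assume x: "x : car M" and y: "y : car M"
 have "n2 (x \<otimes> y) = n2 (adj M y \<otimes> adj M x)"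
  using x y n2_adj[of "x \<otimes> y"] by (simp add: adj_mult)
 also have "... <= opn M (adj M y) * n2 (adj M x)"
  using x y by (intro opn_bound) auto
 finally show ?thesis
  using x y by (simp add: n2_adj opn_adj mult.commute)
qed

lemma cmod_trc_le: "x : car M ==> cmod (trc M x) <= n2 x"
proof -
 assume x: "x : car M"
 have "cmod (ip \<one> x) <= n2 \<one> * n2 x"
  using x by (intro Cauchy_Schwarz_ip) auto
 also have "... <= 1 * n2 x"
  using x n2_one_le by (intro mult_right_mono) auto
 finally show ?thesis using x by simp
qed

lemma scal_minus: "[|x : car M; y : car M|] ==> scal M a (x \<ominus> y) = scal M a x \<ominus> scal M a y"
 by (simp add: minus_eq_scal scal_add scal_scal mult.commute)

lemma minus_add_minus: "[|x : car M; y : car M; u : car M; v : car M|] ==>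
  (x \<oplus> y) \<ominus> (u \<oplus> v) = (x \<ominus> u) \<oplus> (y \<ominus> v)"
 by (simp add: minus_eq minus_add a_ac)

lemma minus_self [simp]: "x : car M ==> x \<ominus> x = \<zero>"
 by (simp add: minus_eq r_neg)

lemma minus_mult_left: "[|x : car M; y : car M; z : car M|] ==> (x \<ominus> y) \<otimes> z = x \<otimes> z \<ominus> y \<otimes> z"
 by (simp add: minus_eq l_distr l_minus)

lemma minus_mult_right: "[|x : car M; y : car M; z : car M|] ==> z \<otimes> (x \<ominus> y) = z \<otimes> x \<ominus> z \<otimes> y"
 by (simp add: minus_eq r_distr r_minus)

text \<open>Multiplication is controlled in trace norm once each change of a factor is weighted by
  the operator norm of the other factor. This is why all moduli below are taken on operator norm
  balls.\<close>

lemma n2_mult_diff: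
 assumes "x : car M" "y : car M" "u : car M" "v : car M"
 shows "n2 (x \<otimes> y \<ominus> u \<otimes> v) <= opn M x * n2 (y \<ominus> v) + n2 (x \<ominus> u) * opn M v"
proof -
 have "x \<otimes> y \<ominus> u \<otimes> v = (x \<otimes> y \<ominus> x \<otimes> v) \<oplus> (x \<otimes> v \<ominus> u \<otimes> v)"
  using assms by (intro minus_split) auto
 then have "x \<otimes> y \<ominus> u \<otimes> v = x \<otimes> (y \<ominus> v) \<oplus> (x \<ominus> u) \<otimes> v"
  using assms by (simp add: minus_mult_left minus_mult_right)
 then show ?thesis
  using assms n2_triangle[of "x \<otimes> (y \<ominus> v)" "(x \<ominus> u) \<otimes> v"] opn_bound[of x "y \<ominus> v"]
  opn_bound_right[of "x \<ominus> u" v] by simp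
qed

lemma cmod_trc_diff: "[|x : car M; y : car M|] ==> cmod (trc M x - trc M y) <= n2 (x \<ominus> y)"
 using cmod_trc_le[of "x \<ominus> y"] by (simp add: trc_minus)

end

section \<open>Uniform boundedness and continuity of formulas\<close>

definition ext_list :: "real list => nat => real" where
 "ext_list vs = (%i. if i < length vs then vs ! i else 0)"

definition bounded_lists :: "nat => real => real list set" where
 "bounded_lists k B = {vs. length vs = k & (ALL i<k. \<bar>vs ! i\<bar> <= B)}"

text \<open>Padding by zeros, as \<open>interp\<close> does for connectives, turns the box into a
  product of compact intervals and singletons, so Tychonoff applies.\<close>

lemma compact_ext_list: "compact (ext_list ` bounded_lists k B)"
proof -
 have "ext_list ` bounded_lists k B = PiE UNIV (%i. if i < k then {-B..B} else {0})" (is "?L = ?R")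
 proof (intro equalityI subsetI)
  fix g assume g: "g : ?R"
  have "g = ext_list (map g [0..<k])"
  using g by (auto simp: ext_list_def PiE_iff fun_eq_iff split: if_splits)
  moreover have "map g [0..<k] : bounded_lists k B"
  using g by (auto simp: bounded_lists_def PiE_iff abs_le_iff split: if_splits) (use minus_le_iff in blast)
  ultimately show "g : ?L" by blast
 qed (auto simp: ext_list_def bounded_lists_def PiE_iff abs_le_iff split: if_splits)
 moreover have "compactin (product_topology (%_. euclideanreal) UNIV) ?R"
  by (subst compactin_PiE) auto
 ultimately show ?thesis
  by (simp add: euclidean_product_topology compactin_euclidean_iff)
qed

text \<open>The metric on functions sums the coordinate distances, cut off at 1, with weights
  (1/2)^n; the factor 2 is the sum of the weights.\<close>

lemma dist_ext_list_le:
 assumes "length v = length w" "!!i. i < length w ==> \<bar>v ! i - w ! i\<bar> <= d" "0 <= d"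
 shows "dist (ext_list v) (ext_list w) <= 2 * d"
proof -
 let ?h = "%n. (1/2)^n * min (dist (ext_list v (from_nat n)) (ext_list w (from_nat n))) 1 :: real"
 have le: "?h n <= (1/2)^n * d" for n
 proof -
  have "dist (ext_list v (from_nat n)) (ext_list w (from_nat n)) <= d"
  using assms by (auto simp: ext_list_def dist_real_def)
  then show ?thesis by (intro mult_left_mono) auto
 qed
 have s: "(%n. (1/2)^n * d) sums (2 * d)"
  using sums_mult2[OF geometric_sums[of "1/2 :: real"], of d] by simp
 have "suminf ?h <= (\<Sum>n. (1/2)^n * d)"
 proof (rule suminf_le[OF le])
  show "summable ?h"
  by (rule summable_comparison_test[OF _ sums_summable[OF s]]) (use le in auto)
 qed (use s in \<open>auto simp: sums_iff\<close>)
 also have "... = 2 * d" using s by (simp add: sums_iff)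
 finally show ?thesis by (simp add: dist_fun_def)
qed

lemma continuous_on_ext_list:
 assumes "continuous_map (Euclidean_space k) euclideanreal f"
 shows "continuous_on (ext_list ` bounded_lists k B) f"
proof -
 have "continuous_on {x. ALL i>=k. x i = 0} f"
  using assms by (simp add: Euclidean_space_def euclidean_product_topology flip: continuous_map_iff_continuous)
 then show ?thesis
  by (rule continuous_on_subset) (auto simp: ext_list_def bounded_lists_def)
qed

lemma connective_bounded:
 assumes "continuous_map (Euclidean_space k) euclideanreal f"
 shows "EX C. ALL v:bounded_lists k B. \<bar>f (ext_list v)\<bar> <= C"
proof -
 have "bounded (f ` (ext_list ` bounded_lists k B))"
  using assms compact_ext_list continuous_on_ext_list
  by (blast intro: compact_imp_bounded compact_continuous_image)
 then show ?thesis by (auto simp: bounded_iff)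
qed

lemma connective_uniformly_continuous:
 assumes "continuous_map (Euclidean_space k) euclideanreal f" "e > 0"
 shows "EX d>0. ALL v:bounded_lists k B. ALL w:bounded_lists k B.
  (ALL i<k. \<bar>v ! i - w ! i\<bar> <= d) --> \<bar>f (ext_list v) - f (ext_list w)\<bar> < e"
proof -
 have "uniformly_continuous_on (ext_list ` bounded_lists k B) f"
  using assms compact_ext_list continuous_on_ext_list by (blast intro: compact_uniformly_continuous)
 then obtain d where d: "d > 0" and
  *: "!!x y. [|x : ext_list ` bounded_lists k B; y : ext_list ` bounded_lists k B; dist x y < d|] ==> dist (f x) (f y) < e"
  using assms(2) unfolding uniformly_continuous_on_def by metis
 \<comment> \<open>The factor 2 of \<open>dist_ext_list_le\<close> turns d/3 into 2d/3, which is
   still below d.\<close>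
 show ?thesis
 proof (intro exI[of _ "d/3"] conjI ballI impI)
  fix v w assume v: "v : bounded_lists k B" and w: "w : bounded_lists k B"
  and vw: "ALL i<k. \<bar>v ! i - w ! i\<bar> <= d/3"
  have "dist (ext_list v) (ext_list w) <= 2 * (d/3)"
  using v w vw d by (intro dist_ext_list_le) (auto simp: bounded_lists_def)
  then have "dist (ext_list v) (ext_list w) < d" using d by linarith
  then have "dist (f (ext_list v)) (f (ext_list w)) < e" using v w by (intro *) auto
  then show "\<bar>f (ext_list v) - f (ext_list w)\<bar> < e" by (simp add: dist_real_def)
 qed (use d in auto)
qed

lemma abs_SUP_diff_le:
 fixes f g :: "'b => real"
 assumes "A ~= {}" "bdd_above (f ` A)" "bdd_above (g ` A)" "!!y. y : A ==> \<bar>f y - g y\<bar> <= e"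
 shows "\<bar>(SUP y\<in>A. f y) - (SUP y\<in>A. g y)\<bar> <= e"
proof -
 have "(SUP y\<in>A. f y) <= (SUP y\<in>A. g y) + e"
 proof (rule cSUP_least[OF assms(1)])
  fix y assume "y : A"
  then show "f y <= (SUP y\<in>A. g y) + e"
  using assms(4)[of y] cSUP_upper[OF _ assms(3), of y] by linarith
 qed
 moreover have "(SUP y\<in>A. g y) <= (SUP y\<in>A. f y) + e"
 proof (rule cSUP_least[OF assms(1)])
  fix y assume "y : A"
  then show "g y <= (SUP y\<in>A. f y) + e"
  using assms(4)[of y] cSUP_upper[OF _ assms(2), of y] by linarith
 qed
 ultimately show ?thesis by linarith
qed

lemma abs_INF_diff_le:
 fixes f g :: "'b => real"
 assumes "A ~= {}" "bdd_below (f ` A)" "bdd_below (g ` A)" "!!y. y : A ==> \<bar>f y - g y\<bar> <= e"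
 shows "\<bar>(INF y\<in>A. f y) - (INF y\<in>A. g y)\<bar> <= e"
proof -
 have "(INF y\<in>A. g y) - e <= (INF y\<in>A. f y)"
 proof (rule cINF_greatest[OF assms(1)])
  fix y assume "y : A"
  then show "(INF y\<in>A. g y) - e <= f y"
  using assms(4)[of y] cINF_lower[OF assms(3), of y] by linarith
 qed
 moreover have "(INF y\<in>A. f y) - e <= (INF y\<in>A. g y)"
 proof (rule cINF_greatest[OF assms(1)])
  fix y assume "y : A"
  then show "(INF y\<in>A. f y) - e <= g y"
  using assms(4)[of y] cINF_lower[OF assms(2), of y] by linarith
 qed
 ultimately show ?thesis by linarith
qed

lemma tuplesD: "xs : tuples k A ==> length xs = k" "xs : tuples k A ==> i < k ==> xs ! i : A"
 by (auto simp: tuples_def)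

lemma tuples_snoc: "xs @ [y] : tuples (Suc k) A <-> xs : tuples k A & y : A"
 by (auto simp: tuples_def)

lemma tuples_mono: "A <= B ==> tuples k A <= tuples k B"
 by (auto simp: tuples_def)

lemma op_ball_mono: "R <= R' ==> op_ball M R <= op_ball M R'"
 by (auto simp: op_ball_def)

lemma op_ballD: "x : op_ball M R ==> x : car M" "x : op_ball M R ==> opn M x <= R"
 by (auto simp: op_ball_def)

context star_alg
begin

lemma zero_in_op_ball: "0 <= R ==> \<zero> : op_ball M R"
 by (simp add: op_ball_def)

lemma poly_eval_closed:
 "[|poly_vars p <= {..<k}; xs : tuples k (car M)|] ==> poly_eval M xs p : car M"
 by (induction p) (auto simp: tuplesD)

end

text \<open>The bound depends on the polynomial and the radius but not on the algebra, so one bound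
  serves a whole sequence of matrix algebras.\<close>

lemma poly_eval_opn_bounded:
 assumes "poly_vars p <= {..<k}"
 shows "EX B>=0. ALL (M :: 'a alg) xs. star_alg M --> xs : tball M k R -->
  poly_eval M xs p : car M & opn M (poly_eval M xs p) <= B"
 using assms
proof (induction p)
 case (PVar i)
 then show ?case
  by (intro exI[of _ "max R 0"]) (auto dest: tuplesD op_ballD simp: le_max_iff_disj)
next
 case (PConst a)
 have "scal M a \<one>\<^bsub>M\<^esub> : car M & opn M (scal M a \<one>\<^bsub>M\<^esub>) <= cmod a"
  if "star_alg M" for M :: "'a alg"
 proof -
  interpret star_alg M by fact
  show ?thesis
  using opn_scal_le[of "\<one>\<^bsub>M\<^esub>" a] opn_one_le mult_left_mono[OF opn_one_le, of "cmod a"] by simp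
 qed
 then show ?case by (intro exI[of _ "cmod a"]) auto
next
 case (PAdd p q)
 then obtain B C where "B >= 0" "C >= 0"
  and B: "ALL (M :: 'a alg) xs. star_alg M --> xs : tball M k R -->
  poly_eval M xs p : car M & opn M (poly_eval M xs p) <= B"
  and C: "ALL (M :: 'a alg) xs. star_alg M --> xs : tball M k R -->
  poly_eval M xs q : car M & opn M (poly_eval M xs q) <= C"
  by auto
 show ?case
 proof (intro exI[of _ "B + C"] conjI allI impI)
  fix M :: "'a alg" and xs assume M: "star_alg M" and xs: "xs : tball M k R"
  interpret star_alg M by fact
  show "poly_eval M xs (PAdd p q) : car M" using B[rule_format, OF M xs] C[rule_format, OF M xs] by auto
  show "opn M (poly_eval M xs (PAdd p q)) <= B + C"
  using B[rule_format, OF M xs] C[rule_format, OF M xs] opn_add[of "poly_eval M xs p" "poly_eval M xs q"] by auto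
 qed (use \<open>B >= 0\<close> \<open>C >= 0\<close> in auto)
next
 case (PMult p q)
 then obtain B C where "B >= 0" "C >= 0"
  and B: "ALL (M :: 'a alg) xs. star_alg M --> xs : tball M k R -->
  poly_eval M xs p : car M & opn M (poly_eval M xs p) <= B"
  and C: "ALL (M :: 'a alg) xs. star_alg M --> xs : tball M k R -->
  poly_eval M xs q : car M & opn M (poly_eval M xs q) <= C"
  by auto
 show ?case
 proof (intro exI[of _ "B * C"] conjI allI impI)
  fix M :: "'a alg" and xs assume M: "star_alg M" and xs: "xs : tball M k R"
  interpret star_alg M by fact
  show "poly_eval M xs (PMult p q) : car M" using B[rule_format, OF M xs] C[rule_format, OF M xs] by auto
  have "opn M (poly_eval M xs p) * opn M (poly_eval M xs q) <= B * C"
  using B[rule_format, OF M xs] C[rule_format, OF M xs] opn_nonneg \<open>B >= 0\<close> by (intro mult_mono) auto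
  then show "opn M (poly_eval M xs (PMult p q)) <= B * C"
  using B[rule_format, OF M xs] C[rule_format, OF M xs] opn_mult[of "poly_eval M xs p" "poly_eval M xs q"] by auto
 qed (use \<open>B >= 0\<close> \<open>C >= 0\<close> in auto)
next
 case (PAdj p)
 then show ?case
  by (auto simp: star_alg.opn_adj star_alg.adj_closed)
qed

lemma poly_eval_Lipschitz:
 assumes "poly_vars p <= {..<k}"
 shows "EX L>=0. ALL (M :: 'a alg) xs ys d. star_alg M -->
  xs : tball M k R --> ys : tball M k R --> 0 <= d -->
  (ALL i<k. norm2 M (xs ! i -[M] ys ! i) <= d) -->
  norm2 M (poly_eval M xs p -[M] poly_eval M ys p) <= L * d"
 using assms
proof (induction p)
 case (PVar i)
 then show ?case by (intro exI[of _ 1]) auto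
next
 case (PConst a)
 have "norm2 M (scal M a \<one>\<^bsub>M\<^esub> -[M] scal M a \<one>\<^bsub>M\<^esub>) = 0"
  if "star_alg M" for M :: "'a alg"
 proof -
  interpret star_alg M by fact
  show ?thesis by simp
 qed
 then show ?case by (intro exI[of _ 0]) auto
next
 case (PAdd p q)
 let ?P = "%L p. ALL (M :: 'a alg) xs ys d. star_alg M -->
  xs : tball M k R --> ys : tball M k R --> 0 <= d -->
  (ALL i<k. norm2 M (xs ! i -[M] ys ! i) <= d) -->
  norm2 M (poly_eval M xs p -[M] poly_eval M ys p) <= L * d"
 from PAdd obtain L1 L2 where L: "L1 >= 0" "L2 >= 0" and L1: "?P L1 p" and L2: "?P L2 q" by auto
 have "?P (L1 + L2) (PAdd p q)"
 proof (intro allI impI)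
  fix M :: "'a alg" and xs ys and d :: real
  assume M: "star_alg M" and xs: "xs : tball M k R" and ys: "ys : tball M k R"
  and d: "0 <= d" "ALL i<k. norm2 M (xs ! i -[M] ys ! i) <= d"
  interpret star_alg M by fact
  have c: "xs : tuples k (car M)" "ys : tuples k (car M)"
  using xs ys by (auto simp: tuples_def op_ball_def)
  have *: "poly_eval M xs p : car M" "poly_eval M xs q : car M"
  "poly_eval M ys p : car M" "poly_eval M ys q : car M"
  using PAdd.prems c by (auto intro!: poly_eval_closed)
  have "norm2 M (poly_eval M xs p -[M] poly_eval M ys p) <= L1 * d"
  "norm2 M (poly_eval M xs q -[M] poly_eval M ys q) <= L2 * d"
  using L1 L2 M xs ys d by blast+
  then show "norm2 M (poly_eval M xs (PAdd p q) -[M] poly_eval M ys (PAdd p q)) <= (L1 + L2) * d"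
  using n2_triangle[of "poly_eval M xs p -[M] poly_eval M ys p" "poly_eval M xs q -[M] poly_eval M ys q"] *
  by (simp add: minus_add_minus distrib_right)
 qed
 then show ?case using L by (intro exI[of _ "L1 + L2"]) auto
next
 case (PMult p q)
 let ?P = "%L p. ALL (M :: 'a alg) xs ys d. star_alg M -->
  xs : tball M k R --> ys : tball M k R --> 0 <= d -->
  (ALL i<k. norm2 M (xs ! i -[M] ys ! i) <= d) -->
  norm2 M (poly_eval M xs p -[M] poly_eval M ys p) <= L * d"
 from PMult obtain L1 L2 where L: "L1 >= 0" "L2 >= 0" and L1: "?P L1 p" and L2: "?P L2 q" by auto
 obtain B where "B >= 0"
  and B: "ALL (M :: 'a alg) xs. star_alg M --> xs : tball M k R -->
  poly_eval M xs p : car M & opn M (poly_eval M xs p) <= B"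
  using poly_eval_opn_bounded[of p k R] PMult.prems by auto
 obtain C where "C >= 0"
  and C: "ALL (M :: 'a alg) xs. star_alg M --> xs : tball M k R -->
  poly_eval M xs q : car M & opn M (poly_eval M xs q) <= C"
  using poly_eval_opn_bounded[of q k R] PMult.prems by auto
 have "?P (B * L2 + L1 * C) (PMult p q)"
 proof (intro allI impI)
  fix M :: "'a alg" and xs ys and d :: real
  assume M: "star_alg M" and xs: "xs : tball M k R" and ys: "ys : tball M k R"
  and d: "0 <= d" "ALL i<k. norm2 M (xs ! i -[M] ys ! i) <= d"
  interpret star_alg M by fact
  note * = B[rule_format, OF M xs] B[rule_format, OF M ys] C[rule_format, OF M xs] C[rule_format, OF M ys]
  have 1: "norm2 M (poly_eval M xs p -[M] poly_eval M ys p) <= L1 * d"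
  and 2: "norm2 M (poly_eval M xs q -[M] poly_eval M ys q) <= L2 * d"
  using L1 L2 M xs ys d by blast+
  have "opn M (poly_eval M xs p) * norm2 M (poly_eval M xs q -[M] poly_eval M ys q) <= B * (L2 * d)"
  using * 2 \<open>B >= 0\<close> by (intro mult_mono) auto
  moreover have "norm2 M (poly_eval M xs p -[M] poly_eval M ys p) * opn M (poly_eval M ys q) <= (L1 * d) * C"
  using * 1 L d by (intro mult_mono) (auto simp: opn_nonneg)
  ultimately show "norm2 M (poly_eval M xs (PMult p q) -[M] poly_eval M ys (PMult p q)) <= (B * L2 + L1 * C) * d"
  using n2_mult_diff[of "poly_eval M xs p" "poly_eval M xs q" "poly_eval M ys p" "poly_eval M ys q"] *
  by (simp add: algebra_simps)
 qed
 then show ?case using L \<open>B >= 0\<close> \<open>C >= 0\<close> by (intro exI[of _ "B * L2 + L1 * C"]) auto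
next
 case (PAdj p)
 have eq: "norm2 M (poly_eval M xs (PAdj p) -[M] poly_eval M ys (PAdj p)) =
  norm2 M (poly_eval M xs p -[M] poly_eval M ys p)"
  if "star_alg M" "xs : tball M k R" "ys : tball M k R"
  for M :: "'a alg" and xs ys
 proof -
  interpret star_alg M by fact
  have c: "xs : tuples k (car M)" "ys : tuples k (car M)"
  using that by (auto simp: tuples_def op_ball_def)
  have *: "poly_eval M xs p : car M" "poly_eval M ys p : car M"
  using PAdj.prems c by (auto intro!: poly_eval_closed)
  then show ?thesis using n2_adj[of "poly_eval M xs p -[M] poly_eval M ys p"]
  by (simp add: adj_minus)
 qed
 from PAdj obtain L where "L >= 0" and L: "ALL (M :: 'a alg) xs ys d. star_alg M -->
  xs : tball M k R --> ys : tball M k R --> 0 <= d -->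
  (ALL i<k. norm2 M (xs ! i -[M] ys ! i) <= d) -->
  norm2 M (poly_eval M xs p -[M] poly_eval M ys p) <= L * d" by auto
 then show ?case using eq by (intro exI[of _ L]) presburger
qed

text \<open>The first argument fixes the element type of the algebras. Bounds and moduli are uniform
  over all of them because they are applied along a sequence of algebras and in its
  ultraproduct.\<close>

definition bounded_formula :: "'a itself => nat => real => formula => real => bool" where
 "bounded_formula _ k R ps B <-> (ALL (M :: 'a alg). star_alg M -->
  (ALL xs:tball M k R. \<bar>interp M ps xs\<bar> <= B))"

definition formula_modulus :: "'a itself => nat => real => formula => real => real => bool" where
 "formula_modulus _ k R ps e d <-> (ALL (M :: 'a alg). star_alg M -->
  (ALL xs:tball M k R. ALL ys:tball M k R.
  (ALL i<k. norm2 M (xs ! i -[M] ys ! i) <= d) --> \<bar>interp M ps xs - interp M ps ys\<bar> <= e))"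

lemma formula_modulus_antimono: "d' <= d ==> formula_modulus T k R ps e d ==> formula_modulus T k R ps e d'"
 unfolding formula_modulus_def by (meson order_trans)

lemma bounded_formula_mono: "B <= B' ==> bounded_formula T k R ps B ==> bounded_formula T k R ps B'"
 unfolding bounded_formula_def by (meson order_trans)

lemma interp_Connective: "interp M (Connective f pss) xs = f (ext_list (map (%ps. interp M ps xs) pss))"
 by (simp add: ext_list_def Let_def)

lemma ex_common_bound:
 assumes "ALL x:set xs. EX B. P x B" "!!x B B'. [|P x B; B <= (B' :: real)|] ==> P x B'"
 shows "EX B. ALL x:set xs. P x B"
 using assms(1)
proof (induction xs)
 case (Cons a xs)
 then obtain B C where "ALL x:set xs. P x B" "P a C" by auto
 then have "ALL x:set (a # xs). P x (max B C)" using assms(2) by (metis max.cobounded1 max.cobounded2 set_ConsD)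
 then show ?case by blast
qed auto

lemma ex_common_pos:
 assumes "ALL x:set xs. EX d>0. P x d" "!!x d d'. [|P x d; 0 < d'; d' <= (d :: real)|] ==> P x d'"
 shows "EX d>0. ALL x:set xs. P x d"
 using assms(1)
proof (induction xs)
 case Nil
 then show ?case by (intro exI[of _ 1]) auto
next
 case (Cons a xs)
 then obtain B C where *: "ALL x:set xs. P x B" "P a C" "B > 0" "C > 0" by auto
 then have pos: "min B C > 0" by simp
 moreover have "ALL x:set (a # xs). P x (min B C)"
  using assms(2)[OF _ pos] * by auto
 ultimately show ?case by blast
qed

text \<open>Supremum and infimum over a fixed set are both 1-Lipschitz for the uniform distance, so
  a bound or modulus of the body, valid at every value of the bound variable, is inherited.\<close>

lemma SupInf_step:
 fixes ps :: formula
 assumes IH: "!!R. R > 0 ==> (EX B. bounded_formula TYPE('a) (Suc k) R ps B) &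
  (ALL e>0. EX d>0. formula_modulus TYPE('a) (Suc k) R ps e d)"
  and r: "r > 0" and R: "R > 0"
 shows "(EX B. bounded_formula TYPE('a) k R (SupBall r ps) B & bounded_formula TYPE('a) k R (InfBall r ps) B) &
  (ALL e>0. EX d>0. formula_modulus TYPE('a) k R (SupBall r ps) e d & formula_modulus TYPE('a) k R (InfBall r ps) e d)"
proof -
 \<comment> \<open>Parameters and bound variable have to lie in one common ball.\<close>
 define R' where "R' = max R r"
 have R': "R' > 0" "R <= R'" "r <= R'" using R by (auto simp: R'_def)
 obtain B where B: "bounded_formula TYPE('a) (Suc k) R' ps B" using IH R' by blast
 have in': "xs @ [y] : tuples (Suc k) (op_ball M R')"
  if "xs : tball M k R" "y : op_ball M r" for xs y and M :: "'a alg"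
  using that R' by (auto simp: tuples_snoc op_ball_def tuples_def)
 have bd: "\<bar>interp M ps (xs @ [y])\<bar> <= B"
  if "star_alg M" "xs : tball M k R" "y : op_ball M r" for xs y and M :: "'a alg"
  using B in'[OF that(2,3)] that(1) unfolding bounded_formula_def by blast
 have bdd: "bdd_above ((%y. interp M ps (xs @ [y])) ` op_ball M r)" "bdd_below ((%y. interp M ps (xs @ [y])) ` op_ball M r)"
  if "star_alg M" "xs : tball M k R" for xs and M :: "'a alg"
  using bd[OF that] by (auto intro!: bdd_aboveI[where M=B] bdd_belowI[where m="-B"] simp: abs_le_iff) (smt (verit) bd that)
 have ne: "op_ball M r ~= {}" if "star_alg M" for M :: "'a alg"
  using star_alg.zero_in_op_ball[OF that, of r] r by auto
 have 1: "bounded_formula TYPE('a) k R (SupBall r ps) B" "bounded_formula TYPE('a) k R (InfBall r ps) B"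
  unfolding bounded_formula_def
 proof (safe)
  fix M :: "'a alg" and xs assume M: "star_alg M" and xs: "xs : tball M k R"
  obtain y where y: "y : op_ball M r" using ne[OF M] by auto
  have "interp M (SupBall r ps) xs <= B" using ne[OF M] bd[OF M xs] by (auto intro!: cSUP_least simp: abs_le_iff)
  moreover have "-B <= interp M ps (xs @ [y])" using bd[OF M xs y] by linarith
  moreover have "interp M ps (xs @ [y]) <= interp M (SupBall r ps) xs"
  using bdd[OF M xs] y by (auto intro!: cSUP_upper)
  ultimately show "\<bar>interp M (SupBall r ps) xs\<bar> <= B" by linarith
 next
  fix M :: "'a alg" and xs assume M: "star_alg M" and xs: "xs : tball M k R"
  obtain y where y: "y : op_ball M r" using ne[OF M] by auto
  have "-B <= interp M ps (xs @ [z])" if "z : op_ball M r" for z using bd[OF M xs that] by linarith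
  then have "-B <= interp M (InfBall r ps) xs" using ne[OF M] by (auto intro!: cINF_greatest)
  moreover have "interp M ps (xs @ [y]) <= B" using bd[OF M xs y] by linarith
  moreover have "interp M (InfBall r ps) xs <= interp M ps (xs @ [y])"
  using bdd[OF M xs] y by (auto intro!: cINF_lower)
  ultimately show "\<bar>interp M (InfBall r ps) xs\<bar> <= B" by linarith
 qed
 have 2: "EX d>0. formula_modulus TYPE('a) k R (SupBall r ps) e d & formula_modulus TYPE('a) k R (InfBall r ps) e d"
  if e: "e > 0" for e
 proof -
  obtain d where d: "d > 0" and md: "formula_modulus TYPE('a) (Suc k) R' ps e d" using IH R' e by blast
  have *: "\<bar>interp M ps (xs @ [y]) - interp M ps (ys @ [y])\<bar> <= e"
  if "star_alg M" "xs : tball M k R" "ys : tball M k R" "y : op_ball M r"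
  "ALL i<k. norm2 M (xs ! i -[M] ys ! i) <= d" for xs ys y and M :: "'a alg"
  proof -
  interpret star_alg M by fact
  have "norm2 M ((xs @ [y]) ! i -[M] (ys @ [y]) ! i) <= d" if "i < Suc k" for i
  using that \<open>y : _\<close> d \<open>ALL i<k. _\<close> \<open>xs : _\<close> \<open>ys : _\<close> by (auto simp: nth_append tuples_def op_ball_def less_Suc_eq)
  then show ?thesis using md in' that unfolding formula_modulus_def by blast
  qed
  have "formula_modulus TYPE('a) k R (SupBall r ps) e d" unfolding formula_modulus_def
  proof (safe)
  fix M :: "'a alg" and xs ys
  assume h: "star_alg M" "xs : tball M k R" "ys : tball M k R"
  "ALL i<k. norm2 M (xs ! i -[M] ys ! i) <= d"
  show "\<bar>interp M (SupBall r ps) xs - interp M (SupBall r ps) ys\<bar> <= e"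
  unfolding interp.simps using h * by (intro abs_SUP_diff_le ne bdd) auto
  qed
  moreover have "formula_modulus TYPE('a) k R (InfBall r ps) e d" unfolding formula_modulus_def
  proof (safe)
  fix M :: "'a alg" and xs ys
  assume h: "star_alg M" "xs : tball M k R" "ys : tball M k R"
  "ALL i<k. norm2 M (xs ! i -[M] ys ! i) <= d"
  show "\<bar>interp M (InfBall r ps) xs - interp M (InfBall r ps) ys\<bar> <= e"
  unfolding interp.simps using h * by (intro abs_INF_diff_le ne bdd) auto
  qed
  ultimately show ?thesis using d by blast
 qed
 show ?thesis using 1 2 by blast
qed

text \<open>Structural induction: polynomials are Lipschitz on balls, quantifiers are 1-Lipschitz
  for the uniform distance, and a connective is uniformly continuous on the compact box that
  contains the values of its arguments.\<close>

lemma formula_uniformity: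
 assumes "formula_in k ps" "R > 0"
 shows "(EX B. bounded_formula TYPE('a) k R ps B) &
  (ALL e>0. EX d>0. formula_modulus TYPE('a) k R ps e d)"
 using assms
proof (induction k ps arbitrary: R rule: formula_in.induct)
 case (1 k p)
 then have p: "poly_vars p <= {..<k}" by simp
 obtain B where "B >= 0" and B: "ALL (M :: 'a alg) xs. star_alg M --> xs : tball M k R -->
  poly_eval M xs p : car M & opn M (poly_eval M xs p) <= B"
  using poly_eval_opn_bounded[OF p, of R] by auto
 obtain L where "L >= 0" and L: "ALL (M :: 'a alg) xs ys d. star_alg M -->
  xs : tball M k R --> ys : tball M k R --> 0 <= d -->
  (ALL i<k. norm2 M (xs ! i -[M] ys ! i) <= d) -->
  norm2 M (poly_eval M xs p -[M] poly_eval M ys p) <= L * d"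
  using poly_eval_Lipschitz[OF p, of R] by auto
 have "bounded_formula TYPE('a) k R (ReTr p) B" unfolding bounded_formula_def
 proof (safe)
  fix M :: "'a alg" and xs assume M: "star_alg M" and xs: "xs : tball M k R"
  interpret star_alg M by fact
  have "\<bar>Re (trc M (poly_eval M xs p))\<bar> <= cmod (trc M (poly_eval M xs p))" by (rule abs_Re_le_cmod)
  also have "... <= norm2 M (poly_eval M xs p)" using B[rule_format, OF M xs] by (intro cmod_trc_le) auto
  also have "... <= opn M (poly_eval M xs p)" using B[rule_format, OF M xs] by (intro n2_le_opn) auto
  also have "... <= B" using B[rule_format, OF M xs] by auto
  finally show "\<bar>interp M (ReTr p) xs\<bar> <= B" by simp
 qed
 moreover have "EX d>0. formula_modulus TYPE('a) k R (ReTr p) e d" if "e > 0" for e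
 proof -
  have "formula_modulus TYPE('a) k R (ReTr p) e (e / (L + 1))" unfolding formula_modulus_def
  proof (safe)
  fix M :: "'a alg" and xs ys
  assume h: "star_alg M" "xs : tball M k R" "ys : tball M k R"
  "ALL i<k. norm2 M (xs ! i -[M] ys ! i) <= e / (L + 1)"
  interpret star_alg M by fact
  have "\<bar>Re (trc M (poly_eval M xs p)) - Re (trc M (poly_eval M ys p))\<bar> <= cmod (trc M (poly_eval M xs p) - trc M (poly_eval M ys p))"
  using abs_Re_le_cmod[of "trc M (poly_eval M xs p) - trc M (poly_eval M ys p)"] by simp
  also have "... <= norm2 M (poly_eval M xs p -[M] poly_eval M ys p)"
  using B[rule_format, OF h(1,2)] B[rule_format, OF h(1,3)] by (intro cmod_trc_diff) auto
  also have "... <= L * (e / (L + 1))" using h \<open>e > 0\<close> \<open>L >= 0\<close> by (intro L[rule_format]) auto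
  also have "... <= e" using \<open>e > 0\<close> \<open>L >= 0\<close> by (simp add: field_simps)
  finally show "\<bar>interp M (ReTr p) xs - interp M (ReTr p) ys\<bar> <= e" by simp
  qed
  then show ?thesis using that \<open>L >= 0\<close> by (intro exI[of _ "e / (L + 1)"]) auto
 qed
 ultimately show ?case by blast
next
 case (2 k r ps)
 then show ?case using SupInf_step[of k ps r R] by (metis formula_in.simps(2))
next
 case (3 k r ps)
 then show ?case using SupInf_step[of k ps r R] by (metis formula_in.simps(3))
next
 case (4 k f pss)
 let ?n = "length pss"
 have f: "continuous_map (Euclidean_space ?n) euclideanreal f" using 4 by simp
 have "EX B. ALL ps:set pss. bounded_formula TYPE('a) k R ps B"
  using 4 by (intro ex_common_bound) (auto intro: bounded_formula_mono)
 then obtain B where B: "!!ps. ps : set pss ==> bounded_formula TYPE('a) k R ps B" by blast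
 have in': "map (%ps. interp M ps xs) pss : bounded_lists ?n B"
  if "star_alg M" "xs : tball M k R" for xs and M :: "'a alg"
  using B that unfolding bounded_formula_def bounded_lists_def by auto
 obtain C where "ALL v:bounded_lists ?n B. \<bar>f (ext_list v)\<bar> <= C" using connective_bounded[OF f] by blast
 then have "bounded_formula TYPE('a) k R (Connective f pss) C"
  unfolding bounded_formula_def interp_Connective using in' by blast
 moreover have "EX d>0. formula_modulus TYPE('a) k R (Connective f pss) e d" if "e > 0" for e
 proof -
  obtain d where d: "d > 0" and dd: "!!v w. [|v : bounded_lists ?n B; w : bounded_lists ?n B;
  ALL i<?n. \<bar>v ! i - w ! i\<bar> <= d|] ==> \<bar>f (ext_list v) - f (ext_list w)\<bar> < e"
  using connective_uniformly_continuous[OF f \<open>e > 0\<close>, of B] by blast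
  have "EX d'>0. ALL ps:set pss. formula_modulus TYPE('a) k R ps d d'"
  using 4 d by (intro ex_common_pos) (auto intro: formula_modulus_antimono)
  then obtain d' where d': "d' > 0" and md: "!!ps. ps : set pss ==> formula_modulus TYPE('a) k R ps d d'" by blast
  have "formula_modulus TYPE('a) k R (Connective f pss) e d'"
  unfolding formula_modulus_def interp_Connective
  proof (safe)
  fix M :: "'a alg" and xs ys
  assume h: "star_alg M" "xs : tball M k R" "ys : tball M k R"
  "ALL i<k. norm2 M (xs ! i -[M] ys ! i) <= d'"
  show "\<bar>f (ext_list (map (%ps. interp M ps xs) pss)) - f (ext_list (map (%ps. interp M ps ys) pss))\<bar> <= e"
  proof (intro less_imp_le dd in' h)
  show "ALL i<?n. \<bar>map (%ps. interp M ps xs) pss ! i - map (%ps. interp M ps ys) pss ! i\<bar> <= d"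
  using md h unfolding formula_modulus_def by (metis nth_map nth_mem)
  qed
  qed
  then show ?thesis using d' by blast
 qed
 ultimately show ?case by blast
qed

text \<open>A quantitative spectral cut-off. In a matrix algebra, p is the spectral projection of x*
  x for eigenvalues above B^2: removing x p brings the norm down to B, while x is at least B on the
  range of p. The constants do not depend on the algebra, so the cut-off can be made in every
  coordinate of an ultraproduct.\<close>

definition truncatable :: "'a alg => bool" where
 "truncatable M <-> (ALL x:car M. ALL B>0. EX p:car M. opn M p <= 1 &
  opn M (x -[M] x *[M] p) <= B & B * norm2 M p <= norm2 M (x *[M] p))"

text \<open>In a matrix algebra, z is the square root of the positive part of a and p the spectral
  projection for the negative eigenvalues. The distance from a to z* z is thus controlled by how
  negative the quadratic form of a is at p, a statement that passes to limits.\<close>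

definition has_positive_parts :: "'a alg => bool" where
 "has_positive_parts M <-> (ALL a:car M. adj M a = a --> (EX p:car M. EX z:car M.
  opn M p <= 1 & opn M z <= sqrt (opn M a) &
  (norm2 M (a -[M] adj M z *[M] z))\<^sup>2
  <= opn M a * (- Re (trc M (adj M p *[M] (a *[M] p))))))"

definition L2_Cauchy :: "'a alg => (nat => 'a) => bool" where
 "L2_Cauchy M x <-> (ALL k. x k : car M) &
  (ALL e>0. EX N. ALL i>=N. ALL j>=N. norm2 M (x i -[M] x j) < e)"

text \<open>A trace-norm Cauchy sequence is a vector of L^2(M), and the inequality says that this
  vector is left bounded. That left bounded vectors come from M replaces closedness in a weak
  topology.\<close>

definition bounded_vectors_complete :: "'a alg => bool" where
 "bounded_vectors_complete M <-> (ALL x B. L2_Cauchy M x &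
  (ALL y:car M. ALL e>0. EX N. ALL k>=N. norm2 M (x k *[M] y) <= B * norm2 M y + e) -->
  (EX a:car M. (%k. norm2 M (x k -[M] a)) ~~> 0))"

definition positive_squares :: "'a alg => bool" where
 "positive_squares M <-> (ALL a:car M. adj M a = a &
  (ALL y:car M. 0 <= Re (trc M (adj M y *[M] (a *[M] y)))) -->
  (EX z:car M. a = adj M z *[M] z))"

section \<open>Limits along a free ultrafilter and the tracial ultraproduct\<close>

lemma ultrafilter_tendsto_compact:
 assumes U: "free_ultrafilter U" and K: "compact K" and f: "!!n. f n : K"
 shows "EX l:K. (f ~> l) U"
proof -
 have "filtermap f U ~= bot" using U by (simp add: free_ultrafilter_def filtermap_bot_iff)
 moreover have "eventually (%x. x : K) (filtermap f U)" using f by (simp add: eventually_filtermap)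
 ultimately obtain l where l: "l : K" "inf (nhds l) (filtermap f U) ~= bot"
  using K unfolding compact_filter by blast
 have "eventually (%n. f n : S) U" if S: "open S" "l : S" for S
 proof (rule ccontr)
  assume "\<not> eventually (%n. f n : S) U"
  then have "eventually (%n. f n \<notin> S) U" using U by (auto simp: free_ultrafilter_def)
  then have "eventually (%x. x \<notin> S) (filtermap f U)" by (simp add: eventually_filtermap)
  moreover have "eventually (%x. x : S) (nhds l)" using S by (rule eventually_nhds_in_open)
  ultimately have "eventually (%x. False) (inf (nhds l) (filtermap f U))"
  unfolding eventually_inf by blast
  then show False using l(2) by (simp add: trivial_limit_def)
 qed
 then show ?thesis using l by (auto simp: tendsto_def)
qed

lemma ultrafilter_tendsto_bounded:
 fixes f :: "nat => 'b::heine_borel"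
 assumes "free_ultrafilter U" "bounded (range f)"
 shows "EX l. (f ~> l) U"
 using ultrafilter_tendsto_compact[OF assms(1), of "closure (range f)" f] assms(2) closure_subset[of "range f"]
 by (auto simp: compact_closure)

lemma free_ultrafilter_ge: "free_ultrafilter U ==> eventually (%n. k <= n) U"
proof -
 assume U: "free_ultrafilter U"
 have "eventually (%n. ALL j:{..<k}. n ~= j) U"
  using U by (intro eventually_ball_finite) (auto simp: free_ultrafilter_def)
 then show ?thesis by (rule eventually_mono) (auto simp: not_less[symmetric])
qed

text \<open>Countable saturation in elementary form: at index n, satisfy the longest initial segment
  of the conditions that can be satisfied there, among those of length at most n.\<close>

lemma ultrafilter_diagonal:
 fixes P :: "nat => nat => 'b => bool"
 assumes U: "free_ultrafilter U"
  and ev: "!!k. eventually (%n. EX x. ALL j<=k. P j n x) U"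
 shows "EX x. ALL k. eventually (%n. P k n (x n)) U"
proof -
 \<comment> \<open>The cap k <= n makes \<open>S n\<close> finite so that \<open>Max\<close> is
   meaningful; freeness of the ultrafilter makes the cap hold eventually for each fixed k.\<close>
 define S where "S n = {k. k <= n & (EX x. ALL j<=k. P j n x)}" for n
 define K where "K n = Max (S n)" for n
 define x where "x n = (SOME x. ALL j<=K n. P j n x)" for n
 have "eventually (%n. P k n (x n)) U" for k
 proof (rule eventually_mono[OF eventually_conj[OF ev[of k] free_ultrafilter_ge[OF U, of k]]])
  fix n assume n: "(EX x. ALL j<=k. P j n x) & k <= n"
  then have k: "k : S n" by (auto simp: S_def)
  have fin: "finite (S n)" by (auto simp: S_def intro: finite_subset[of _ "{..n}"])
  have "K n : S n" unfolding K_def using fin k by (intro Max_in) auto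
  then have "EX x. ALL j<=K n. P j n x" by (auto simp: S_def)
  then have "ALL j<=K n. P j n (x n)" unfolding x_def by (rule someI_ex)
  moreover have "k <= K n" unfolding K_def using fin k by (rule Max_ge)
  ultimately show "P k n (x n)" by auto
 qed
 then show ?thesis by blast
qed

lemma tendsto_zero_squeeze:
 fixes f g :: "'b => real"
 assumes "(g ~> 0) F" "!!n. 0 <= f n" "!!n. f n <= g n"
 shows "(f ~> 0) F"
 by (rule tendsto_sandwich[OF _ _ tendsto_const assms(1)]) (use assms in auto)

text \<open>Unit trace is demanded only along the ultrafilter because the sequence of matrix
  algebras starts with the zero algebra \<open>Mat 0\<close>.\<close>

locale tracial_ultraproduct =
 fixes U :: "nat filter" and A :: "nat => 'a alg"
 assumes ultra: "free_ultrafilter U"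
  and algebras: "!!n. star_alg (A n)"
  and truncatable: "!!n. truncatable (A n)"
  and positive_parts: "!!n. has_positive_parts (A n)"
  and trc_one: "eventually (%n. trc (A n) \<one>\<^bsub>A n\<^esub> = 1) U"
begin

sublocale A: star_alg "A n" for n
 by (rule algebras)

abbreviation Q :: "(nat => 'a) set tracial_algebra" where
 "Q \<equiv> ultraproduct U A"

abbreviation BS :: "(nat => 'a) set" where
 "BS \<equiv> bounded_seqs A"

abbreviation cls :: "(nat => 'a) => (nat => 'a) set" where
 "cls x \<equiv> ultra_class U A x"

lemma U_not_bot [simp]: "U ~= bot"
 using ultra by (simp add: free_ultrafilter_def)

lemma BS_I: "(!!n. x n : car (A n)) ==> (!!n. opn (A n) (x n) <= B) ==> x : BS"
 by (auto simp: bounded_seqs_def)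

lemma BS_bound: "x : BS ==> EX B>0. ALL n. opn (A n) (x n) <= B"
proof -
 assume "x : BS"
 then obtain B where "!!n. opn (A n) (x n) <= B" by (auto simp: bounded_seqs_def)
 then show ?thesis by (intro exI[of _ "max B 1"]) (auto simp: le_max_iff_disj)
qed

lemma BS_carrier [simp]: "x : BS ==> x n : car (A n)"
 by (simp add: bounded_seqs_def)

lemma BS_mult [simp]: "x : BS ==> y : BS ==> (%n. x n *[A n] y n) : BS"
proof -
 assume x: "x : BS" and y: "y : BS"
 obtain B C where BC: "B > 0" "C > 0" "!!n. opn (A n) (x n) <= B" "!!n. opn (A n) (y n) <= C"
  using BS_bound[OF x] BS_bound[OF y] by auto
 have "opn (A n) (x n *[A n] y n) <= B * C" for n
  using A.opn_mult[of "x n" n "y n"] mult_mono[OF BC(3)[of n] BC(4)[of n]] BC(1) x y A.opn_nonneg[of "y n" n] by simp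
 then show ?thesis using x y by (intro BS_I) auto
qed

lemma BS_add [simp]: "x : BS ==> y : BS ==> (%n. x n +[A n] y n) : BS"
proof -
 assume x: "x : BS" and y: "y : BS"
 obtain B C where BC: "B > 0" "C > 0" "!!n. opn (A n) (x n) <= B" "!!n. opn (A n) (y n) <= C"
  using BS_bound[OF x] BS_bound[OF y] by auto
 have "opn (A n) (x n +[A n] y n) <= B + C" for n
  using A.opn_add[of "x n" n "y n"] BC(3)[of n] BC(4)[of n] x y by simp
 then show ?thesis using x y by (intro BS_I) auto
qed

lemma BS_scal [simp]: "x : BS ==> (%n. scal (A n) a (x n)) : BS"
proof -
 assume x: "x : BS"
 obtain B where B: "B > 0" "!!n. opn (A n) (x n) <= B"
  using BS_bound[OF x] by auto
 have "opn (A n) (scal (A n) a (x n)) <= cmod a * B" for n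
  using A.opn_scal_le[of "x n" n a] mult_left_mono[OF B(2)[of n], of "cmod a"] x by simp
 then show ?thesis using x by (intro BS_I) auto
qed

lemma BS_adj [simp]: "x : BS ==> (%n. adj (A n) (x n)) : BS"
 using BS_bound[of x] by (auto intro!: BS_I simp: A.opn_adj)

lemma BS_minus [simp]: "x : BS ==> y : BS ==> (%n. x n -[A n] y n) : BS"
 using BS_add[of x "%n. scal (A n) (-1) (y n)"] by (simp add: A.minus_eq_scal)

lemma BS_one [simp]: "(%n. \<one>\<^bsub>A n\<^esub>) : BS"
 by (rule BS_I[of _ 1]) (auto simp: A.opn_one_le)

lemma BS_zero [simp]: "(%n. \<zero>\<^bsub>A n\<^esub>) : BS"
 by (rule BS_I[of _ 0]) auto

lemma rel_iff: "(x, y) : ultra_rel U A <-> x : BS & y : BS & ((%n. norm2 (A n) (x n -[A n] y n)) ~> 0) U"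
 by (simp add: ultra_rel_def L2_norm_single)

lemma equiv_rel: "equiv BS (ultra_rel U A)"
proof (rule equivI)
 show "ultra_rel U A <= BS \<times> BS" by (auto simp: ultra_rel_def)
 show "refl_on BS (ultra_rel U A)" by (auto simp: refl_on_def rel_iff)
 show "sym (ultra_rel U A)"
 proof (rule symI)
  fix x y assume "(x, y) : ultra_rel U A"
  then show "(y, x) : ultra_rel U A"
  by (simp add: rel_iff A.n2_minus_commute[of "y _" _ "x _"])
 qed
 show "trans (ultra_rel U A)"
 proof (rule transI)
  fix x y z assume xy: "(x, y) : ultra_rel U A" and yz: "(y, z) : ultra_rel U A"
  then have B: "x : BS" "y : BS" "z : BS" by (auto simp: rel_iff)
  have "((%n. norm2 (A n) (x n -[A n] y n) + norm2 (A n) (y n -[A n] z n)) ~> 0) U"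
  using xy yz by (intro tendsto_add_zero) (auto simp: rel_iff)
  then have "((%n. norm2 (A n) (x n -[A n] z n)) ~> 0) U"
  by (rule tendsto_zero_squeeze) (use B in \<open>auto intro!: A.n2_triangle_minus A.n2_nonneg\<close>)
  then show "(x, z) : ultra_rel U A" using B by (simp add: rel_iff)
 qed
qed

lemma cls_eq_iff: "x : BS ==> y : BS ==>
 cls x = cls y <-> ((%n. norm2 (A n) (x n -[A n] y n)) ~> 0) U"
 unfolding ultra_class_def using eq_equiv_class_iff[OF equiv_rel] by (simp add: rel_iff)

lemma in_cls_iff: "y : cls x <-> x : BS & y : BS & cls y = cls x"
 unfolding ultra_class_def using equiv_class_eq_iff[OF equiv_rel] by (auto simp: rel_iff)

lemma carrier_Q: "car Q = cls ` BS"
 by (auto simp: ultraproduct_def quotient_def ultra_class_def)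

lemma cls_carrier [simp]: "x : BS ==> cls x : car Q"
 by (simp add: carrier_Q)

text \<open>The product in \<open>ultraproduct\<close> is a union over all representatives. Since
  representatives are bounded in operator norm, \<open>n2_mult_diff\<close> shows that every choice
  gives the same class, and the union collapses.\<close>

lemma mult_cls [simp]:
 assumes "x : BS" "y : BS"
 shows "cls x *[Q] cls y = cls (%n. x n *[A n] y n)"
proof -
 have *: "cls (%n. x' n *[A n] y' n) = cls (%n. x n *[A n] y n)" if "x' : cls x" "y' : cls y" for x' y'
 proof -
  have B: "x' : BS" "y' : BS" and e: "cls x' = cls x" "cls y' = cls y"
  using that by (auto simp: in_cls_iff)
  obtain b c where bc: "b > 0" "c > 0" "!!n. opn (A n) (x' n) <= b" "!!n. opn (A n) (y n) <= c"
  using BS_bound[OF B(1)] BS_bound[OF assms(2)] by auto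
  have "((%n. b * norm2 (A n) (y' n -[A n] y n) + norm2 (A n) (x' n -[A n] x n) * c) ~> 0) U"
  using e B assms by (intro tendsto_add_zero tendsto_mult_right_zero tendsto_mult_left_zero) (auto simp: cls_eq_iff)
  then have "((%n. norm2 (A n) ((x' n *[A n] y' n) -[A n] (x n *[A n] y n))) ~> 0) U"
  proof (rule tendsto_zero_squeeze)
  fix n
  show "norm2 (A n) ((x' n *[A n] y' n) -[A n] (x n *[A n] y n))
  <= b * norm2 (A n) (y' n -[A n] y n) + norm2 (A n) (x' n -[A n] x n) * c"
  using A.n2_mult_diff[of "x' n" n "y' n" "x n" "y n"] B assms bc
  by (smt (verit) A.minus_closed A.n2_nonneg BS_carrier mult_left_mono mult_right_mono)
  qed (use B assms in auto)
  then show ?thesis using B assms by (simp add: cls_eq_iff)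
 qed
 have "x : cls x" "y : cls y" using assms by (auto simp: in_cls_iff)
 moreover have "cls x *[Q] cls y = (\<Union>x'\<in>cls x. \<Union>y'\<in>cls y. cls (%n. x' n *[A n] y' n))" unfolding ultraproduct_def by simp
 ultimately show ?thesis using * by blast
qed

lemma add_cls [simp]:
 assumes "x : BS" "y : BS"
 shows "cls x +[Q] cls y = cls (%n. x n +[A n] y n)"
proof -
 have *: "cls (%n. x' n +[A n] y' n) = cls (%n. x n +[A n] y n)" if "x' : cls x" "y' : cls y" for x' y'
 proof -
  have B: "x' : BS" "y' : BS" and e: "cls x' = cls x" "cls y' = cls y"
  using that by (auto simp: in_cls_iff)
  have "((%n. norm2 (A n) (x' n -[A n] x n) + norm2 (A n) (y' n -[A n] y n)) ~> 0) U"
  using e B assms by (intro tendsto_add_zero) (auto simp: cls_eq_iff)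
  then have "((%n. norm2 (A n) ((x' n +[A n] y' n) -[A n] (x n +[A n] y n))) ~> 0) U"
  proof (rule tendsto_zero_squeeze)
  fix n
  show "norm2 (A n) ((x' n +[A n] y' n) -[A n] (x n +[A n] y n))
  <= norm2 (A n) (x' n -[A n] x n) + norm2 (A n) (y' n -[A n] y n)"
  using A.n2_triangle[of "x' n -[A n] x n" n "y' n -[A n] y n"] B assms by (simp add: A.minus_add_minus)
  qed (use B assms in auto)
  then show ?thesis using B assms by (simp add: cls_eq_iff)
 qed
 have "x : cls x" "y : cls y" using assms by (auto simp: in_cls_iff)
 moreover have "cls x +[Q] cls y = (\<Union>x'\<in>cls x. \<Union>y'\<in>cls y. cls (%n. x' n +[A n] y' n))" unfolding ultraproduct_def by simp
 ultimately show ?thesis using * by blast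
qed

lemma scal_cls [simp]:
 assumes "x : BS"
 shows "scal Q a (cls x) = cls (%n. scal (A n) a (x n))"
proof -
 have *: "cls (%n. scal (A n) a (x' n)) = cls (%n. scal (A n) a (x n))" if "x' : cls x" for x'
 proof -
  have B: "x' : BS" and e: "cls x' = cls x" using that by (auto simp: in_cls_iff)
  have "((%n. cmod a * norm2 (A n) (x' n -[A n] x n)) ~> 0) U"
  using e B assms by (intro tendsto_mult_right_zero) (auto simp: cls_eq_iff)
  then show ?thesis using B assms by (simp add: cls_eq_iff A.scal_minus[symmetric] A.n2_scal)
 qed
 have "x : cls x" using assms by (auto simp: in_cls_iff)
 moreover have "scal Q a (cls x) = (\<Union>x'\<in>cls x. cls (%n. scal (A n) a (x' n)))" unfolding ultraproduct_def by simp
 ultimately show ?thesis using * by blast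
qed

lemma adj_cls [simp]:
 assumes "x : BS"
 shows "adj Q (cls x) = cls (%n. adj (A n) (x n))"
proof -
 have *: "cls (%n. adj (A n) (x' n)) = cls (%n. adj (A n) (x n))" if "x' : cls x" for x'
 proof -
  have B: "x' : BS" and e: "cls x' = cls x" using that by (auto simp: in_cls_iff)
  then show ?thesis using assms by (simp add: cls_eq_iff A.adj_minus[symmetric] A.n2_adj)
 qed
 have "x : cls x" using assms by (auto simp: in_cls_iff)
 moreover have "adj Q (cls x) = (\<Union>x'\<in>cls x. cls (%n. adj (A n) (x' n)))" unfolding ultraproduct_def by simp
 ultimately show ?thesis using * by blast
qed

lemma one_Q [simp]: "\<one>\<^bsub>Q\<^esub> = cls (%n. \<one>\<^bsub>A n\<^esub>)"
 by (simp add: ultraproduct_def)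

lemma zero_Q [simp]: "\<zero>\<^bsub>Q\<^esub> = cls (%n. \<zero>\<^bsub>A n\<^esub>)"
 by (simp add: ultraproduct_def)

text \<open>The trace in \<open>ultraproduct\<close> is a limit along one chosen representative.
  Boundedness provides the limit along the ultrafilter, and an equivalent sequence has the same
  limit.\<close>

lemma trc_tendsto:
 assumes x: "x : BS"
 shows "((%n. trc (A n) (x n)) ~> trc Q (cls x)) U"
proof -
 define y where "y = (SOME y. y : cls x)"
 have "x : cls x" using x by (simp add: in_cls_iff)
 then have "y : cls x" unfolding y_def by (rule someI[of "%y. y : cls x"])
 then have y: "y : BS" and e: "((%n. norm2 (A n) (x n -[A n] y n)) ~> 0) U"
  using x by (auto simp: in_cls_iff cls_eq_iff A.n2_minus_commute[of "x _" _ "y _"])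
 obtain B where B: "B > 0" "!!n. opn (A n) (y n) <= B" using BS_bound[OF y] by auto
 have "cmod (trc (A n) (y n)) <= B" for n
  using A.cmod_trc_le[of "y n" n] A.n2_le_opn[of "y n" n] B(2)[of n] y by simp
 then have "bounded (range (%n. trc (A n) (y n)))" by (auto simp: bounded_iff)
 then obtain l where l: "((%n. trc (A n) (y n)) ~> l) U"
  using ultrafilter_tendsto_bounded[OF ultra] by blast
 have "trc Q (cls x) = l"
  using l by (simp add: ultraproduct_def y_def[symmetric] tendsto_Lim)
 moreover have "((%n. trc (A n) (x n) - trc (A n) (y n)) ~> 0) U"
  by (rule Lim_null_comparison[OF _ e]) (use x y in \<open>auto intro!: always_eventually A.cmod_trc_diff\<close>)
 from tendsto_add[OF this l] have "((%n. trc (A n) (x n)) ~> l) U" by simp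
 ultimately show ?thesis by simp
qed

lemma norm2_tendsto:
 assumes x: "x : BS"
 shows "((%n. norm2 (A n) (x n)) ~> norm2 Q (cls x)) U"
 unfolding norm2_def using trc_tendsto[of "%n. adj (A n) (x n) *[A n] x n"] x
 by (auto intro!: tendsto_intros)

lemma opn_cls_le:
 assumes x: "x : BS" and y: "y : BS" and e: "cls y = cls x" and B: "!!n. opn (A n) (y n) <= B"
 shows "opn Q (cls x) <= B"
proof -
 have "opn Q (cls x) <= (SUP n. opn (A n) (y n))"
  unfolding ultraproduct_def tracial_algebra.simps
 proof (rule cINF_lower)
  show "bdd_below ((%x. SUP n. opn (A n) (x n)) ` cls x)"
  proof (rule bdd_belowI2[of _ 0])
  fix z assume "z : cls x"
  then have z: "z : BS" by (simp add: in_cls_iff)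
  have "0 <= opn (A 0) (z 0)" using z by (intro A.opn_nonneg) auto
  also have "... <= (SUP n. opn (A n) (z n))"
  using BS_bound[OF z] by (intro cSUP_upper) (auto simp: bdd_above_def)
  finally show "0 <= (SUP n. opn (A n) (z n))" .
  qed
  show "y : cls x" using x y e by (simp add: in_cls_iff)
 qed
 also have "... <= B" using B by (intro cSUP_least) auto
 finally show ?thesis .
qed

lemma opn_cls_representative:
 assumes x: "x : BS" and e: "0 < e"
 shows "EX y:BS. cls y = cls x & (ALL n. opn (A n) (y n) <= opn Q (cls x) + e)"
proof (rule ccontr)
 assume neg: "\<not> ?thesis"
 have "opn Q (cls x) + e <= (INF y\<in>cls x. SUP n. opn (A n) (y n))"
 proof (rule cINF_greatest)
  show "cls x ~= {}" using x by (auto simp: in_cls_iff)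
  fix y assume "y : cls x"
  then have y: "y : BS" "cls y = cls x" by (auto simp: in_cls_iff)
  then obtain n where "opn Q (cls x) + e < opn (A n) (y n)" using neg by (auto simp: not_le)
  also have "... <= (SUP n. opn (A n) (y n))"
  using BS_bound[OF y(1)] by (intro cSUP_upper) (auto simp: bdd_above_def)
  finally show "opn Q (cls x) + e <= (SUP n. opn (A n) (y n))" by simp
 qed
 then show False using e by (simp add: ultraproduct_def)
qed

lemma opn_Q_bound:
 assumes x: "x : BS" and y: "y : BS"
 shows "norm2 Q (cls x *[Q] cls y) <= opn Q (cls x) * norm2 Q (cls y)"
proof (rule field_le_epsilon)
 fix e :: real assume e: "0 < e"
 define d where "d = e / (norm2 Q (cls y) + 1)"
 have n0: "0 <= norm2 Q (cls y)"
  using norm2_tendsto[OF y] y by (intro tendsto_lowerbound[OF _ _ U_not_bot]) (auto intro!: always_eventually)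
 have d: "d > 0" using e n0 by (simp add: d_def)
 obtain z where z: "z : BS" "cls z = cls x" "!!n. opn (A n) (z n) <= opn Q (cls x) + d"
  using opn_cls_representative[OF x d] by blast
 have zy: "((%n. norm2 (A n) (z n *[A n] y n)) ~> norm2 Q (cls x *[Q] cls y)) U"
  using norm2_tendsto[of "%n. z n *[A n] y n"] z x y mult_cls[of z y] by simp
 have yy: "((%n. (opn Q (cls x) + d) * norm2 (A n) (y n)) ~> (opn Q (cls x) + d) * norm2 Q (cls y)) U"
  using norm2_tendsto[OF y] by (intro tendsto_intros)
 have "norm2 Q (cls x *[Q] cls y) <= (opn Q (cls x) + d) * norm2 Q (cls y)"
 proof (rule tendsto_le[OF U_not_bot yy zy], intro always_eventually allI)
  fix n
  show "norm2 (A n) (z n *[A n] y n) <= (opn Q (cls x) + d) * norm2 (A n) (y n)"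
  using A.opn_bound[of "z n" n "y n"] z y mult_right_mono[OF z(3)[of n], of "norm2 (A n) (y n)"] by simp
 qed
 also have "d * norm2 Q (cls y) <= e"
  using e n0 by (simp add: d_def field_simps)
 then have "(opn Q (cls x) + d) * norm2 Q (cls y) <= opn Q (cls x) * norm2 Q (cls y) + e"
  by (simp add: distrib_right)
 finally show "norm2 Q (cls x *[Q] cls y) <= opn Q (cls x) * norm2 Q (cls y) + e" .
qed

lemma truncation:
 assumes x: "!!n. x n : car (A n)" and B: "0 < B"
 obtains p where "p : BS" "!!n. opn (A n) (p n) <= 1" "(%n. x n -[A n] x n *[A n] p n) : BS"
  "!!n. opn (A n) (x n -[A n] x n *[A n] p n) <= B"
  "!!n. B * norm2 (A n) (p n) <= norm2 (A n) (x n *[A n] p n)"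
proof -
 have "ALL n. EX p. p : car (A n) & opn (A n) p <= 1 & opn (A n) (x n -[A n] x n *[A n] p) <= B &
  B * norm2 (A n) p <= norm2 (A n) (x n *[A n] p)"
  using truncatable x B unfolding truncatable_def by blast
 then obtain p where p: "!!n. p n : car (A n)" "!!n. opn (A n) (p n) <= 1"
  "!!n. opn (A n) (x n -[A n] x n *[A n] p n) <= B"
  "!!n. B * norm2 (A n) (p n) <= norm2 (A n) (x n *[A n] p n)" by metis
 moreover have "p : BS" using p by (intro BS_I) auto
 moreover have "(%n. x n -[A n] x n *[A n] p n) : BS" using p x by (intro BS_I[of _ B]) auto
 ultimately show ?thesis using that by blast
qed

lemma norm2_Q_nonneg: "x : BS ==> 0 <= norm2 Q (cls x)"
 using norm2_tendsto[of x] by (intro tendsto_lowerbound[OF _ _ U_not_bot]) (auto intro!: always_eventually)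

text \<open>This identifies the quotient norm with the norm of left multiplication. Cutting x off at
  level B + e removes x p with (B + e) |p| <= |x p| <= B |p| in the limit; hence p and x p are null,
  and the truncated sequence is another representative of x.\<close>

lemma opn_Q_least:
 assumes x: "x : BS" and B: "0 <= B"
  and le: "!!y. y : BS ==> norm2 Q (cls x *[Q] cls y) <= B * norm2 Q (cls y)"
 shows "opn Q (cls x) <= B"
proof (rule field_le_epsilon)
 fix e :: real assume e: "0 < e"
 obtain p where p: "p : BS" "!!n. opn (A n) (p n) <= 1" "(%n. x n -[A n] x n *[A n] p n) : BS"
  "!!n. opn (A n) (x n -[A n] x n *[A n] p n) <= B + e"
  "!!n. (B + e) * norm2 (A n) (p n) <= norm2 (A n) (x n *[A n] p n)"
  using truncation[of x "B + e"] x B e by auto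
 have 1: "((%n. (B + e) * norm2 (A n) (p n)) ~> (B + e) * norm2 Q (cls p)) U"
  using norm2_tendsto[OF p(1)] by (intro tendsto_intros)
 have 2: "((%n. norm2 (A n) (x n *[A n] p n)) ~> norm2 Q (cls x *[Q] cls p)) U"
  using norm2_tendsto[of "%n. x n *[A n] p n"] x p by simp
 have "(B + e) * norm2 Q (cls p) <= norm2 Q (cls x *[Q] cls p)"
  by (rule tendsto_le[OF U_not_bot 2 1]) (use p in auto)
 also have "... <= B * norm2 Q (cls p)" by (rule le[OF p(1)])
 finally have "e * norm2 Q (cls p) <= 0" by (simp add: distrib_right)
 then have "norm2 Q (cls p) = 0"
  using norm2_Q_nonneg[OF p(1)] e by (simp add: mult_le_0_iff)
 then have "norm2 Q (cls x *[Q] cls p) = 0"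
  using le[OF p(1)] norm2_Q_nonneg[of "%n. x n *[A n] p n"] x p by simp
 then have z: "((%n. norm2 (A n) (x n *[A n] p n)) ~> 0) U" using 2 by simp
 have "(x n -[A n] x n *[A n] p n) -[A n] x n = scal (A n) (-1) (x n *[A n] p n)" for n
  using x p by (simp add: A.minus_eq A.a_inv_eq_scal[symmetric] A.a_ac A.r_neg2)
 then have "cls (%n. x n -[A n] x n *[A n] p n) = cls x"
  using x p z by (subst cls_eq_iff) (auto simp: A.n2_scal)
 then show "opn Q (cls x) <= B + e" using opn_cls_le[OF x p(3)] p(4) by blast
qed


lemma trc_cls_eqI: "x : BS ==> ((%n. trc (A n) (x n)) ~> l) U ==> trc Q (cls x) = l"
 using trc_tendsto tendsto_unique U_not_bot by blast

lemma carrier_Q_cases: "X : car Q ==> EX x:BS. X = cls x"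
 by (auto simp: carrier_Q)

lemma ring_Q: "ring Q"
proof (rule ringI)
 show "abelian_group Q"
 proof (rule abelian_groupI)
  fix X assume "X : car Q"
  then obtain x where x: "x : BS" "X = cls x" using carrier_Q_cases by blast
  show "\<zero>\<^bsub>Q\<^esub> +[Q] X = X" using x by simp
  have "scal (A n) (-1) (x n) +[A n] x n = \<zero>\<^bsub>A n\<^esub>" for n
  using x A.l_neg[of "x n" n] A.a_inv_eq_scal[of "x n" n] by simp
  then have "cls (%n. scal (A n) (-1) (x n)) +[Q] X = \<zero>\<^bsub>Q\<^esub>"
  using x by simp
  then show "EX y:car Q. y +[Q] X = \<zero>\<^bsub>Q\<^esub>" by (rule bexI) (use x in simp)
  fix Y assume "Y : car Q"
  then obtain y where y: "y : BS" "Y = cls y" using carrier_Q_cases by blast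
  show "X +[Q] Y : car Q" using x y by simp
  show "X +[Q] Y = Y +[Q] X" using x y by (simp add: A.a_comm)
  fix Z assume "Z : car Q"
  then obtain z where z: "z : BS" "Z = cls z" using carrier_Q_cases by blast
  show "X +[Q] Y +[Q] Z = X +[Q] (Y +[Q] Z)" using x y z by (simp add: A.a_assoc)
 qed simp
 show "Group.monoid Q"
 proof (rule monoidI)
  fix X assume "X : car Q"
  then obtain x where x: "x : BS" "X = cls x" using carrier_Q_cases by blast
  show "\<one>\<^bsub>Q\<^esub> *[Q] X = X" "X *[Q] \<one>\<^bsub>Q\<^esub> = X" using x by simp_all
  fix Y assume "Y : car Q"
  then obtain y where y: "y : BS" "Y = cls y" using carrier_Q_cases by blast
  show "X *[Q] Y : car Q" using x y by simp
  fix Z assume "Z : car Q"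
  then obtain z where z: "z : BS" "Z = cls z" using carrier_Q_cases by blast
  show "X *[Q] Y *[Q] Z = X *[Q] (Y *[Q] Z)" using x y z by (simp add: A.m_assoc)
 qed simp
 fix X Y Z assume "X : car Q" "Y : car Q" "Z : car Q"
 then obtain x y z where h: "x : BS" "X = cls x" "y : BS" "Y = cls y" "z : BS" "Z = cls z"
  using carrier_Q_cases by metis
 show "(X +[Q] Y) *[Q] Z = X *[Q] Z +[Q] Y *[Q] Z" using h by (simp add: A.l_distr)
 show "Z *[Q] (X +[Q] Y) = Z *[Q] X +[Q] Z *[Q] Y" using h by (simp add: A.r_distr)
qed

lemma trc_one_Q: "trc Q \<one>\<^bsub>Q\<^esub> = 1"
 using trc_one by (auto intro!: trc_cls_eqI tendsto_eventually)

sublocale Q: star_alg Q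
proof -
 interpret Q: ring Q by (rule ring_Q)
 show "star_alg Q"
 proof (unfold_locales)
  fix X and a b :: complex assume "X : car Q"
  then obtain x where x: "x : BS" "X = cls x" using carrier_Q_cases by blast
  show "scal Q a X : car Q" "adj Q X : car Q" using x by simp_all
  show "scal Q (a + b) X = scal Q a X +[Q] scal Q b X" using x by (simp add: A.add_scal)
  show "scal Q a (scal Q b X) = scal Q (a * b) X" using x by (simp add: A.scal_scal)
  show "scal Q 1 X = X" using x by simp
  show "adj Q (scal Q a X) = scal Q (cnj a) (adj Q X)" using x by (simp add: A.adj_scal)
  show "adj Q (adj Q X) = X" using x by simp
  show "trc Q (scal Q a X) = a * trc Q X"
  using x trc_tendsto[OF x(1)] by (auto intro!: trc_cls_eqI tendsto_intros simp: A.trc_scal)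
  show "trc Q (adj Q X) = cnj (trc Q X)"
  using x trc_tendsto[OF x(1)] by (auto intro!: trc_cls_eqI tendsto_intros simp: A.trc_adj)
  have "((%n. Re (trc (A n) (adj (A n) (x n) *[A n] x n))) ~> Re (trc Q (adj Q X *[Q] X))) U"
  using x trc_tendsto[of "%n. adj (A n) (x n) *[A n] x n"] by (auto intro!: tendsto_intros)
  then show "0 <= Re (trc Q (adj Q X *[Q] X))"
  by (rule tendsto_lowerbound) (use x in \<open>auto intro!: always_eventually A.trc_pos\<close>)
  show "X = \<zero>\<^bsub>Q\<^esub>" if "Re (trc Q (adj Q X *[Q] X)) = 0"
  proof -
  have "norm2 Q (cls x) = 0" using that x by (simp add: norm2_def)
  then have "((%n. norm2 (A n) (x n)) ~> 0) U" using norm2_tendsto[OF x(1)] by simp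
  moreover have "norm2 (A n) (x n -[A n] \<zero>\<^bsub>A n\<^esub>) = norm2 (A n) (x n)" for n
  using x by (simp add: A.minus_eq)
  ultimately show ?thesis using x by (simp add: cls_eq_iff)
  qed
  show "0 <= opn Q X"
  proof (rule field_le_epsilon)
  fix e :: real assume "0 < e"
  then obtain y where y: "y : BS" "!!n. opn (A n) (y n) <= opn Q (cls x) + e"
  using opn_cls_representative[OF x(1)] by blast
  show "0 <= opn Q X + e" using y A.opn_nonneg[of "y 0" 0] x order_trans by (metis BS_carrier)
  qed
  show "opn Q X <= B" if "0 <= B" "!!Y. Y : car Q ==> norm2 Q (X *[Q] Y) <= B * norm2 Q Y" for B
  unfolding x(2) using that x by (intro opn_Q_least[OF x(1)]) (auto simp del: mult_cls)
  fix Y assume "Y : car Q"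
  then obtain y where y: "y : BS" "Y = cls y" using carrier_Q_cases by blast
  show "scal Q a (X +[Q] Y) = scal Q a X +[Q] scal Q a Y" using x y by (simp add: A.scal_add)
  show "scal Q a X *[Q] Y = scal Q a (X *[Q] Y)" using x y by (simp add: A.scal_mult_left)
  show "X *[Q] scal Q a Y = scal Q a (X *[Q] Y)" using x y by (simp add: A.scal_mult_right)
  show "adj Q (X +[Q] Y) = adj Q X +[Q] adj Q Y" using x y by (simp add: A.adj_add)
  show "adj Q (X *[Q] Y) = adj Q Y *[Q] adj Q X" using x y by (simp add: A.adj_mult)
  show "trc Q (X +[Q] Y) = trc Q X + trc Q Y"
  using x y trc_tendsto[OF x(1)] trc_tendsto[OF y(1)] by (auto intro!: trc_cls_eqI tendsto_intros simp: A.trc_add)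
  show "trc Q (X *[Q] Y) = trc Q (Y *[Q] X)"
  using x y trc_tendsto[of "%n. y n *[A n] x n"] by (auto intro!: trc_cls_eqI simp: A.trc_comm[of "x _" _ "y _"])
  show "norm2 Q (X *[Q] Y) <= opn Q X * norm2 Q Y"
  unfolding x(2) y(2) by (rule opn_Q_bound[OF x(1) y(1)])
 next
  show "Re (trc Q \<one>\<^bsub>Q\<^esub>) <= 1" using trc_one_Q by simp
 qed
qed

lemma minus_cls: "x : BS ==> y : BS ==> cls x -[Q] cls y = cls (%n. x n -[A n] y n)"
 by (simp add: Q.minus_eq_scal A.minus_eq_scal)

lemma norm2_minus_tendsto:
 "x : BS ==> y : BS ==> ((%n. norm2 (A n) (x n -[A n] y n)) ~> norm2 Q (cls x -[Q] cls y)) U"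
 using norm2_tendsto[of "%n. x n -[A n] y n"] by (simp add: minus_cls)

text \<open>Square roots of positive parts are taken in each coordinate. Their error is bounded by
  the negative part of a quadratic form whose limit is nonnegative, so it vanishes along the
  ultrafilter.\<close>

lemma positive_squares_Q: "positive_squares Q"
 unfolding positive_squares_def
proof (intro ballI impI)
 fix X assume "X : car Q" and h: "adj Q X = X & (ALL Y:car Q. 0 <= Re (trc Q (adj Q Y *[Q] (X *[Q] Y))))"
 then obtain x where x: "x : BS" "X = cls x" using carrier_Q_cases by blast
 \<comment> \<open>Averaging with the adjoint makes every coordinate self-adjoint without changing
   the class.\<close>
 define a where "a = (%n. scal (A n) (1/2) (x n +[A n] adj (A n) (x n)))"
 have a: "a : BS" using x by (simp add: a_def)
 have asa: "adj (A n) (a n) = a n" for n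
  using x by (simp add: a_def A.adj_scal A.adj_add A.a_comm)
 have "cls a = scal Q (1/2) (X +[Q] adj Q X)" using x by (simp add: a_def)
 also have "... = scal Q (1/2) X +[Q] scal Q (1/2) X" using h \<open>X : car Q\<close> by (simp add: Q.scal_add)
 also have "... = X" using \<open>X : car Q\<close> by (simp add: Q.add_scal[symmetric])
 finally have aX: "cls a = X" .
 have "ALL n. EX p z. p : car (A n) & z : car (A n) & opn (A n) p <= 1 & opn (A n) z <= sqrt (opn (A n) (a n)) &
  (norm2 (A n) (a n -[A n] adj (A n) z *[A n] z))\<^sup>2
  <= opn (A n) (a n) * (- Re (trc (A n) (adj (A n) p *[A n] (a n *[A n] p))))"
  using positive_parts a asa unfolding has_positive_parts_def by (meson BS_carrier)
 then obtain p z where p: "!!n. p n : car (A n)" "!!n. opn (A n) (p n) <= 1" and z: "!!n. z n : car (A n)"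
  "!!n. opn (A n) (z n) <= sqrt (opn (A n) (a n))" and
  le: "!!n. (norm2 (A n) (a n -[A n] adj (A n) (z n) *[A n] z n))^2
  <= opn (A n) (a n) * (- Re (trc (A n) (adj (A n) (p n) *[A n] (a n *[A n] p n))))"
  by metis
 obtain B where B: "B > 0" "!!n. opn (A n) (a n) <= B" using BS_bound[OF a] by auto
 have pB: "p : BS" using p by (rule BS_I)
 have zB: "z : BS"
 proof (rule BS_I[OF z(1)])
  fix n show "opn (A n) (z n) <= sqrt B"
  using z(2)[of n] real_sqrt_le_mono[OF B(2)[of n]] by linarith
 qed
 define t where "t n = - Re (trc (A n) (adj (A n) (p n) *[A n] (a n *[A n] p n)))" for n
 have "(t ~> - Re (trc Q (adj Q (cls p) *[Q] (cls a *[Q] cls p)))) U"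
  unfolding t_def using pB a trc_tendsto[of "%n. adj (A n) (p n) *[A n] (a n *[A n] p n)"]
  by (auto intro!: tendsto_intros)
 moreover have "- Re (trc Q (adj Q (cls p) *[Q] (cls a *[Q] cls p))) <= 0"
  using h pB aX by (metis cls_carrier neg_le_0_iff_le)
 ultimately have "((%n. max (t n) 0) ~> 0) U"
  using tendsto_max[OF _ tendsto_const[of 0 U], of t] by (metis max.absorb2)
 then have "((%n. B * max (t n) 0) ~> 0) U" by (rule tendsto_mult_right_zero)
 then have "((%n. (norm2 (A n) (a n -[A n] adj (A n) (z n) *[A n] z n))^2) ~> 0) U"
 proof (rule tendsto_zero_squeeze)
  fix n
  have "opn (A n) (a n) * t n <= opn (A n) (a n) * max (t n) 0"
  using a by (intro mult_left_mono) (auto simp: A.opn_nonneg)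
  also have "... <= B * max (t n) 0" using B by (intro mult_right_mono) auto
  finally show "(norm2 (A n) (a n -[A n] adj (A n) (z n) *[A n] z n))^2 <= B * max (t n) 0"
  using le[of n] by (simp add: t_def)
 qed simp
 from tendsto_real_sqrt[OF this]
 have "((%n. norm2 (A n) (a n -[A n] adj (A n) (z n) *[A n] z n)) ~> 0) U"
  using a z by simp
 then have "X = adj Q (cls z) *[Q] cls z"
  using a zB by (simp add: aX[symmetric] cls_eq_iff)
 then show "EX z:car Q. X = adj Q z *[Q] z" using zB by (intro bexI[of _ "cls z"]) auto
qed

text \<open>At index n the value \<open>xi k n\<close> is within e j of all earlier
  \<open>xi j n\<close>, so the diagonal principle applies. The resulting sequence is not claimed to
  be bounded in operator norm, so it need not yet represent an element of \<open>Q\<close>.\<close>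

lemma L2_Cauchy_diagonal:
 fixes xi :: "nat => nat => 'a"
 assumes xi: "!!k. xi k : BS" and le: "!!j k. j <= k ==> norm2 Q (cls (xi k) -[Q] cls (xi j)) < e j"
 shows "EX x. (ALL n. x n : car (A n)) & (ALL k. eventually (%n. norm2 (A n) (x n -[A n] xi k n) < e k) U)"
proof -
 define P where "P k n x <-> x : car (A n) & norm2 (A n) (x -[A n] xi k n) < e k" for k n x
 have "eventually (%n. EX x. ALL j<=k. P j n x) U" for k
 proof -
  have "eventually (%n. ALL j:{..k}. norm2 (A n) (xi k n -[A n] xi j n) < e j) U"
  proof (intro eventually_ball_finite ballI)
  fix j assume "j : {..k}"
  then show "eventually (%n. norm2 (A n) (xi k n -[A n] xi j n) < e j) U"
  using order_tendstoD(2)[OF norm2_minus_tendsto[OF xi[of k] xi[of j]] le[of j k]] by simp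
  qed simp
  then show ?thesis
  by (rule eventually_mono) (auto simp: P_def xi intro!: exI[of _ "xi k _"])
 qed
 from ultrafilter_diagonal[OF ultra this]
 obtain x where x: "!!k. eventually (%n. P k n (x n)) U" by blast
 define x' where "x' n = (if x n : car (A n) then x n else \<zero>\<^bsub>A n\<^esub>)" for n
 have "eventually (%n. norm2 (A n) (x' n -[A n] xi k n) < e k) U" for k
  by (rule eventually_mono[OF x[of k]]) (auto simp: P_def x'_def)
 moreover have "x' n : car (A n)" for n by (auto simp: x'_def)
 ultimately show ?thesis by blast
qed

text \<open>The diagonal sequence x is cut off at level B + 1. The part x p cut away satisfies (B +
  1) |p| <= |x p|, while left boundedness gives |x p| <= B |p| in the limit. Hence p is null, and
  the truncated sequence, now bounded, represents the limit.\<close>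

lemma bounded_vectors_complete_Q: "bounded_vectors_complete Q"
 unfolding bounded_vectors_complete_def
proof (intro allI impI, elim conjE)
 fix X B0 assume C: "L2_Cauchy Q X"
  and bd0: "ALL Y:car Q. ALL e>0. EX N. ALL k>=N. norm2 Q (X k *[Q] Y) <= B0 * norm2 Q Y + e"
 define B where "B = max B0 0"
 have bd: "EX N. ALL k>=N. norm2 Q (X k *[Q] Y) <= B * norm2 Q Y + e" if Y: "Y : car Q" and e: "e > 0" for Y e
 proof -
  obtain N where N: "ALL k>=N. norm2 Q (X k *[Q] Y) <= B0 * norm2 Q Y + e" using bd0 Y e by blast
  have "B0 * norm2 Q Y <= B * norm2 Q Y" using Y by (intro mult_right_mono) (auto simp: B_def)
  then show ?thesis using N by (intro exI[of _ N]) force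
 qed
 have XC: "X k : car Q" for k using C by (simp add: L2_Cauchy_def)
 have "ALL k. EX N. ALL i>=N. ALL j>=N. norm2 Q (X i -[Q] X j) < (1/2)^k"
  using C by (simp add: L2_Cauchy_def)
 then obtain N where N: "!!k i j. i >= N k ==> j >= N k ==> norm2 Q (X i -[Q] X j) < (1/2)^k" by metis
 \<comment> \<open>The maximum makes \<open>N'\<close> exceed all earlier thresholds, and adding k
   makes it tend to infinity.\<close>
 define N' where "N' k = Max (N ` {..k}) + k" for k
 have N'ge: "N j <= N' k" if "j <= k" for j k
  using that unfolding N'_def by (intro trans_le_add1 Max_ge) auto
 have N'k: "k <= N' k" for k by (simp add: N'_def)
 have "ALL k. EX x. x : BS & X (N' k) = cls x" using carrier_Q_cases[OF XC] by blast
 from choice[OF this] obtain xi where xi: "!!k. xi k : BS" "!!k. X (N' k) = cls (xi k)" by blast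
 have close: "norm2 Q (cls (xi k) -[Q] cls (xi j)) < (1/2)^j" if "j <= k" for j k
  using N[of j "N' k" "N' j"] N'ge that by (simp add: xi)
 obtain x where x: "!!n. x n : car (A n)" and
  xxi: "!!k. eventually (%n. norm2 (A n) (x n -[A n] xi k n) < (1/2)^k) U"
  using L2_Cauchy_diagonal[of xi "%k. (1/2)^k"] xi close by blast
 obtain p where p: "p : BS" "!!n. opn (A n) (p n) <= 1" "(%n. x n -[A n] x n *[A n] p n) : BS"
  "!!n. opn (A n) (x n -[A n] x n *[A n] p n) <= B + 1"
  "!!n. (B + 1) * norm2 (A n) (p n) <= norm2 (A n) (x n *[A n] p n)"
  proof -
  have "0 < B + 1" by (simp add: B_def)
  from truncation[OF x this] that show ?thesis by blast
 qed
 have xp: "eventually (%n. norm2 (A n) (x n *[A n] p n) <= norm2 (A n) (xi k n *[A n] p n) + (1/2)^k) U" for k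
 proof (rule eventually_mono[OF xxi[of k]])
  fix n assume n: "norm2 (A n) (x n -[A n] xi k n) < (1/2)^k"
  have "norm2 (A n) (x n *[A n] p n) <= norm2 (A n) (xi k n *[A n] p n) + norm2 (A n) ((x n -[A n] xi k n) *[A n] p n)"
  using A.n2_le_add_minus[of "x n *[A n] p n" n "xi k n *[A n] p n"] x xi p by (simp add: A.minus_mult_left)
  also have "norm2 (A n) ((x n -[A n] xi k n) *[A n] p n) <= norm2 (A n) (x n -[A n] xi k n) * 1"
  using A.opn_bound_right[of "x n -[A n] xi k n" n "p n"] mult_left_mono[OF p(2)[of n], of "norm2 (A n) (x n -[A n] xi k n)"] x xi p
  by simp
  finally show "norm2 (A n) (x n *[A n] p n) <= norm2 (A n) (xi k n *[A n] p n) + (1/2)^k" using n by simp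
 qed
 have limxip: "((%n. norm2 (A n) (xi k n *[A n] p n) + (1/2)^k) ~> norm2 Q (X (N' k) *[Q] cls p) + (1/2)^k) U" for k
  using norm2_tendsto[of "%n. xi k n *[A n] p n"] xi p by (auto intro!: tendsto_intros)
 have limp: "((%n. norm2 (A n) (p n)) ~> norm2 Q (cls p)) U" by (rule norm2_tendsto[OF p(1)])
 have half: "EX K. ALL k>=K. (1/2)^k < e" if "e > 0" for e :: real
 proof -
  have "(%k. (1/2::real)^k) ~~> 0" by (rule LIMSEQ_realpow_zero) auto
  then have "eventually (%k. (1/2)^k < e) sequentially" using that by (rule order_tendstoD)
  then show ?thesis by (simp add: eventually_sequentially)
 qed
 \<comment> \<open>Left boundedness of the vector, tested at the class of p, transfers to the
   diagonal sequence; with e = |p| / 2 it contradicts the lower bound on x p unless p is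
   null.\<close>
 have key: "eventually (%n. norm2 (A n) (x n *[A n] p n) < B * norm2 Q (cls p) + e) U" if e: "e > 0" for e
 proof -
  obtain K where K: "!!k. k >= K ==> (1/2)^k < e/2" using half[of "e/2"] e by auto
  obtain N where N: "!!k. k >= N ==> norm2 Q (X k *[Q] cls p) <= B * norm2 Q (cls p) + e/2"
  using bd[of "cls p" "e/2"] p e by auto
  define k where "k = max K N"
  have "norm2 Q (X (N' k) *[Q] cls p) + (1/2)^k < B * norm2 Q (cls p) + e"
  using N[of "N' k"] N'k[of k] K[of k] by (simp add: k_def)
  from order_tendstoD(2)[OF limxip this] xp[of k] show ?thesis by eventually_elim auto
 qed
 have p0: "norm2 Q (cls p) = 0"
 proof (rule ccontr)
  assume "norm2 Q (cls p) ~= 0"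
  then have pos: "norm2 Q (cls p) > 0" using norm2_Q_nonneg[OF p(1)] by linarith
  have "((%n. (B + 1) * norm2 (A n) (p n)) ~> (B + 1) * norm2 Q (cls p)) U"
  using limp by (intro tendsto_intros)
  moreover have "B * norm2 Q (cls p) + norm2 Q (cls p) / 2 < (B + 1) * norm2 Q (cls p)"
  using pos by (simp add: distrib_right)
  ultimately have "eventually (%n. B * norm2 Q (cls p) + norm2 Q (cls p) / 2 < (B + 1) * norm2 (A n) (p n)) U"
  by (rule order_tendstoD)
  moreover have "eventually (%n. norm2 (A n) (x n *[A n] p n) < B * norm2 Q (cls p) + norm2 Q (cls p) / 2) U"
  using key[of "norm2 Q (cls p) / 2"] pos by simp
  ultimately have "eventually (%n. False) U"
  proof eventually_elim
  case (elim n)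
  then show ?case using p(5)[of n] by linarith
  qed
  then show False by simp
 qed
 define z where "z = (%n. x n -[A n] x n *[A n] p n)"
 have z: "z : BS" using p by (simp add: z_def)
 have zx: "norm2 (A n) (x n -[A n] z n) = norm2 (A n) (x n *[A n] p n)" for n
 proof -
  have "z n -[A n] x n = scal (A n) (-1) (x n *[A n] p n)"
  using x p by (simp add: z_def A.minus_eq A.a_inv_eq_scal[symmetric] A.a_ac A.r_neg2)
  then show ?thesis using x p z by (simp add: A.n2_minus_commute[of "x n" n "z n"] A.n2_scal)
 qed
 have lim: "norm2 Q (X (N' k) -[Q] cls z) <= (1/2)^k + e" if e: "e > 0" for k e
 proof -
  have "eventually (%n. norm2 (A n) (xi k n -[A n] z n) <= (1/2)^k + e) U"
  using xxi[of k] key[OF e]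
  proof eventually_elim
  case (elim n)
  then show ?case
  using A.n2_triangle_minus[of "xi k n" n "x n" "z n"] xi x z zx[of n] A.n2_minus_commute[of "x n" n "xi k n"]
  by (simp add: p0)
  qed
  moreover have "((%n. norm2 (A n) (xi k n -[A n] z n)) ~> norm2 Q (X (N' k) -[Q] cls z)) U"
  using norm2_minus_tendsto[OF xi(1)[of k] z] by (simp add: xi)
  ultimately show ?thesis using tendsto_upperbound U_not_bot by blast
 qed
 have "(%k. norm2 Q (X k -[Q] cls z)) ~~> 0"
 proof (rule LIMSEQ_I)
  fix r :: real assume r: "0 < r"
  obtain K where K: "!!k. k >= K ==> (1/2)^k < r/3" using half[of "r/3"] r by auto
  have "norm (norm2 Q (X k -[Q] cls z) - 0) < r" if k: "k >= N' K" for k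
  proof -
  have "norm2 Q (X k -[Q] cls z) <= norm2 Q (X k -[Q] X (N' K)) + norm2 Q (X (N' K) -[Q] cls z)"
  using XC z by (intro Q.n2_triangle_minus) auto
  moreover have "norm2 Q (X k -[Q] X (N' K)) < (1/2)^K" using k N'ge[of K K] by (intro N) auto
  ultimately have "norm2 Q (X k -[Q] cls z) < r" using lim[of "r/3" K] r K[of K] by linarith
  moreover have "0 <= norm2 Q (X k -[Q] cls z)" using XC z by (intro Q.n2_nonneg) auto
  ultimately show ?thesis by simp
  qed
  then show "EX no. ALL n>=no. norm (norm2 Q (X n -[Q] cls z) - 0) < r" by blast
 qed
 then show "EX a:car Q. (%k. norm2 Q (X k -[Q] a)) ~~> 0"
  using z by (intro bexI[of _ "cls z"]) auto
qed

end

lemma (in star_alg) add_minus_cancel_right: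
 "[|x : car M; y : car M|] ==> (x \<oplus> y) \<ominus> y = x"
 by (simp add: minus_eq a_assoc r_neg)

section \<open>Matrix algebras and their functional calculus\<close>

lemma mat_algebra_simps [simp]:
 "car (Mat n) = sqm n"
 "A *[Mat n] B = A * B"
 "A +[Mat n] B = A + B"
 "\<one>\<^bsub>Mat n\<^esub> = 1\<^sub>m n"
 "\<zero>\<^bsub>Mat n\<^esub> = 0\<^sub>m n n"
 "scal (Mat n) a A = a \<cdot>\<^sub>m A"
 "adj (Mat n) A = madj A"
 "trc (Mat n) A = (\<Sum>i<n. A $$ (i, i)) / of_nat n"
 "opn (Mat n) A = mat_opnorm n A"
 by (simp_all add: mat_algebra_def ring_mat_def)

lemma mat_adjoint_entry [simp]:
 "i < dim_col A ==> j < dim_row A ==> madj A $$ (i, j) = cnj (A $$ (j, i))" for A :: "complex mat"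
 by (simp add: mat_adjoint_def mat_of_rows_def)

lemma mat_adjoint_dim [simp]:
 "dim_row (madj A) = dim_col A" "dim_col (madj A) = dim_row A" for A :: "complex mat"
 by (auto simp: mat_adjoint_def)

lemma mat_adjoint_carrier [simp]: "A : carrier_mat n m ==> madj A : carrier_mat m n" for A :: "complex mat"
 by auto

lemma mat_mult_entry:
 assumes "A : sqm n" "B : sqm n" "i < n" "j < n"
 shows "(A * B) $$ (i, j) = (\<Sum>k<n. A $$ (i, k) * B $$ (k, j))"
 using assms by (auto simp: scalar_prod_def atLeast0LessThan)

lemma square_mult_closed [simp]: "A : sqm n ==> B : sqm n ==> A * B : sqm n"
 by (rule mult_carrier_mat)

lemma square_mult_one [simp]:
 fixes A :: "complex mat"
 shows "A : sqm n ==> 1\<^sub>m n * A = A" "A : sqm n ==> A * 1\<^sub>m n = A"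
 by (erule left_mult_one_mat, erule right_mult_one_mat)

lemma adj_mult_entry:
 assumes "A : sqm n" "B : sqm n" "i < n" "j < n"
 shows "(madj A * B) $$ (i, j) = (\<Sum>k<n. cnj (A $$ (k, i)) * B $$ (k, j))"
 using assms by (subst mat_mult_entry[where n=n]) auto

lemma mat_adjoint_mult:
 fixes A :: "complex mat"
 assumes "A : sqm n" "B : sqm n"
 shows "madj (A * B) = madj B * madj A"
proof (rule eq_matI)
 fix i j assume "i < dim_row (madj B * madj A)" "j < dim_col (madj B * madj A)"
 then have ij: "i < n" "j < n" using assms by auto
 have "(madj B * madj A) $$ (i, j) = (\<Sum>k<n. madj B $$ (i, k) * madj A $$ (k, j))"
  using assms ij by (intro mat_mult_entry) auto
 also have "... = cnj ((A * B) $$ (j, i))"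
  using assms ij by (simp add: mat_mult_entry[OF assms ij(2,1)] mult.commute)
 finally show "madj (A * B) $$ (i, j) = (madj B * madj A) $$ (i, j)"
  using assms ij by simp
qed (use assms in auto)

definition vnorm :: "nat => complex vec => real" where
 "vnorm n v = sqrt (\<Sum>i<n. (cmod (v $ i))^2)"

lemma cscalar_prod_eq: "v : carrier_vec n ==> w : carrier_vec n ==> v \<bullet>c w = (\<Sum>i<n. v $ i * cnj (w $ i))"
 by (auto simp: scalar_prod_def atLeast0LessThan)

lemma vnorm_eq: "v : carrier_vec n ==> Re (v \<bullet>c v) = (vnorm n v)^2"
 by (simp add: cscalar_prod_eq vnorm_def sum_nonneg complex_norm_square[symmetric] del: of_real_power)

lemma vnorm_nonneg [simp]: "0 <= vnorm n v"
 by (simp add: vnorm_def sum_nonneg)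

lemma mat_opnorm_eq: "A : sqm n ==>
 mat_opnorm n A = (SUP v\<in>{v : carrier_vec n. vnorm n v <= 1}. vnorm n (A *\<^sub>v v))"
proof -
 assume A: "A : sqm n"
 have "{v : carrier_vec n. Re (v \<bullet>c v) <= 1} = {v : carrier_vec n. vnorm n v <= 1}"
  using vnorm_eq by (auto simp: abs_square_le_1)
 moreover have "sqrt (Re ((A *\<^sub>v v) \<bullet>c (A *\<^sub>v v))) = vnorm n (A *\<^sub>v v)" if "v : carrier_vec n" for v
  using that A vnorm_eq[of "A *\<^sub>v v" n] by simp
 ultimately show ?thesis
  unfolding mat_opnorm_def by (intro SUP_cong) auto
qed

text \<open>The constant is the Hilbert-Schmidt norm; it guarantees that the supremum in
  \<open>mat_opnorm\<close> is over a bounded set.\<close>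

lemma vnorm_mult_bounded:
 assumes A: "A : sqm n"
 shows "EX C>=0. ALL v:carrier_vec n. vnorm n (A *\<^sub>v v) <= C * vnorm n v"
proof -
 define C where "C = sqrt (\<Sum>i<n. \<Sum>j<n. (cmod (A $$ (i, j)))^2)"
 have "vnorm n (A *\<^sub>v v) <= C * vnorm n v" if v: "v : carrier_vec n" for v
 proof -
  have "(cmod ((A *\<^sub>v v) $ i))^2 <= (\<Sum>j<n. (cmod (A $$ (i, j)))^2) * (\<Sum>j<n. (cmod (v $ j))^2)" if i: "i < n" for i
  proof -
  have "cmod ((A *\<^sub>v v) $ i) = cmod (\<Sum>j<n. A $$ (i, j) * v $ j)"
  using A v i by (auto simp: scalar_prod_def atLeast0LessThan)
  also have "... <= (\<Sum>j<n. cmod (A $$ (i, j)) * cmod (v $ j))"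
  by (rule order_trans[OF norm_sum]) (simp add: norm_mult)
  finally have "(cmod ((A *\<^sub>v v) $ i))^2 <= (\<Sum>j<n. cmod (A $$ (i, j)) * cmod (v $ j))^2"
  by (intro power_mono) auto
  also have "... <= (\<Sum>j<n. (cmod (A $$ (i, j)))^2) * (\<Sum>j<n. (cmod (v $ j))^2)"
  by (rule Cauchy_Schwarz_ineq_sum)
  finally show ?thesis .
  qed
  then have "(\<Sum>i<n. (cmod ((A *\<^sub>v v) $ i))^2) <= (\<Sum>i<n. \<Sum>j<n. (cmod (A $$ (i, j)))^2) * (\<Sum>j<n. (cmod (v $ j))^2)"
  unfolding sum_distrib_right[of _ "{..<n}" "\<Sum>j<n. (cmod (v $ j))^2"] by (intro sum_mono) auto
  then show ?thesis
  by (simp add: vnorm_def C_def real_sqrt_mult[symmetric])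
 qed
 moreover have "C >= 0" by (simp add: C_def sum_nonneg)
 ultimately show ?thesis by blast
qed

lemma vnorm_smult: "v : carrier_vec n ==> vnorm n (a \<cdot>\<^sub>v v) = cmod a * vnorm n v"
proof -
 assume v: "v : carrier_vec n"
 have "vnorm n (a \<cdot>\<^sub>v v) = sqrt (\<Sum>i<n. (cmod a)^2 * (cmod (v $ i))^2)"
  using v by (auto simp: vnorm_def norm_mult power_mult_distrib intro!: sum.cong arg_cong[where f=sqrt])
 then show ?thesis by (simp add: vnorm_def sum_distrib_left[symmetric] real_sqrt_mult)
qed

lemma vnorm_zero [simp]: "vnorm n (0\<^sub>v n) = 0"
 by (simp add: vnorm_def)

lemma vnorm_eq_0: "v : carrier_vec n ==> vnorm n v = 0 ==> v = 0\<^sub>v n"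
 by (auto simp: vnorm_def sum_nonneg_eq_0_iff intro!: eq_vecI)

lemma mat_opnorm_bdd:
 assumes A: "A : sqm n"
 shows "bdd_above ((%v. vnorm n (A *\<^sub>v v)) ` {v : carrier_vec n. vnorm n v <= 1})"
proof -
 obtain C where "C >= 0" and C: "ALL v:carrier_vec n. vnorm n (A *\<^sub>v v) <= C * vnorm n v"
  using vnorm_mult_bounded[OF A] by blast
 show ?thesis
 proof (rule bdd_aboveI2)
  fix v assume "v : {v : carrier_vec n. vnorm n v <= 1}"
  then show "vnorm n (A *\<^sub>v v) <= C"
  using C \<open>C >= 0\<close> mult_left_mono[of "vnorm n v" 1 C] by fastforce
 qed
qed

lemma vnorm_mult_le_opnorm:
 assumes A: "A : sqm n" and v: "v : carrier_vec n"
 shows "vnorm n (A *\<^sub>v v) <= mat_opnorm n A * vnorm n v"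
proof (cases "vnorm n v = 0")
 case True
 then have "v = 0\<^sub>v n" using v by (rule vnorm_eq_0[rotated])
 moreover have "A *\<^sub>v 0\<^sub>v n = 0\<^sub>v n" using A by auto
 ultimately show ?thesis by simp
next
 case False
 define w where "w = cor (1 / vnorm n v) \<cdot>\<^sub>v v"
 have pos: "vnorm n v > 0" using False by (simp add: order_less_le)
 have w: "w : carrier_vec n" "vnorm n w = 1" using v pos by (auto simp: w_def vnorm_smult norm_divide)
 have "vnorm n (A *\<^sub>v w) <= mat_opnorm n A"
  unfolding mat_opnorm_eq[OF A] using w by (intro cSUP_upper mat_opnorm_bdd A) auto
 moreover have "A *\<^sub>v w = cor (1 / vnorm n v) \<cdot>\<^sub>v (A *\<^sub>v v)"
  using A v by (simp add: w_def mult_mat_vec)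
 ultimately show ?thesis
  using pos A v by (simp add: vnorm_smult norm_divide divide_simps mult.commute)
qed

lemma mat_opnorm_nonneg: "A : sqm n ==> 0 <= mat_opnorm n A"
 unfolding mat_opnorm_eq
 by (rule cSUP_upper2[OF mat_opnorm_bdd, of _ _ "0\<^sub>v n"]) auto

lemma trc_adj_mult:
 assumes "A : sqm n" "B : sqm n"
 shows "trc (Mat n) (madj A * B) = (\<Sum>j<n. \<Sum>i<n. cnj (A $$ (i, j)) * B $$ (i, j)) / of_nat n"
 using assms by (simp add: adj_mult_entry[where n=n] del: index_mult_mat(1))

lemma norm2_mat_sq:
 assumes "A : sqm n"
 shows "Re (trc (Mat n) (madj A * A)) = (\<Sum>j<n. \<Sum>i<n. (cmod (A $$ (i, j)))^2) / real n"
proof -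
 have "trc (Mat n) (madj A * A) = cor ((\<Sum>j<n. \<Sum>i<n. (cmod (A $$ (i, j)))^2) / real n)"
  unfolding trc_adj_mult[OF assms assms] by (simp add: complex_norm_square mult.commute del: of_real_power)
 then show ?thesis by (simp only: Re_complex_of_real)
qed

lemma norm2_mat:
 assumes "A : sqm n"
 shows "norm2 (Mat n) A = sqrt ((\<Sum>j<n. \<Sum>i<n. (cmod (A $$ (i, j)))^2) / real n)"
 using norm2_mat_sq[OF assms] by (simp add: norm2_def)

lemma norm2_mat_cols:
 assumes "A : sqm n"
 shows "norm2 (Mat n) A = sqrt ((\<Sum>j<n. (vnorm n (col A j))^2) / real n)"
 using assms by (auto simp: norm2_mat vnorm_def sum_nonneg intro!: sum.cong arg_cong[where f="%x. sqrt (x / real n)"])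

lemma col_mult_mat: "A : sqm n ==> B : sqm n ==> j < n ==> col (A * B) j = A *\<^sub>v col B j"
 by (auto intro!: eq_vecI)

interpretation mat: star_alg "Mat n" for n
proof -
 interpret ring "Mat n"
  unfolding mat_algebra_def by (rule ring_mat)
 show "star_alg (Mat n)"
 proof (unfold_locales)
  fix A B :: "complex mat" and a :: complex
  assume "A : car (Mat n)" "B : car (Mat n)"
  then have AB: "A : sqm n" "B : sqm n" by auto
  show "adj (Mat n) (A *[Mat n] B) = adj (Mat n) B *[Mat n] adj (Mat n) A"
  using AB by (simp add: mat_adjoint_mult)
  show "adj (Mat n) (A +[Mat n] B) = adj (Mat n) A +[Mat n] adj (Mat n) B"
  using AB by (auto intro!: eq_matI)
  show "trc (Mat n) (A *[Mat n] B) = trc (Mat n) (B *[Mat n] A)"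
  proof -
  have "(\<Sum>i<n. \<Sum>k<n. A $$ (i, k) * B $$ (k, i)) = (\<Sum>k<n. \<Sum>i<n. B $$ (k, i) * A $$ (i, k))"
  by (subst sum.swap) (simp add: mult.commute)
  then show ?thesis using AB by (simp add: mat_mult_entry[where n=n] del: index_mult_mat(1))
  qed
  show "norm2 (Mat n) (A *[Mat n] B) <= opn (Mat n) A * norm2 (Mat n) B"
  proof -
  have "(\<Sum>j<n. (vnorm n (col (A * B) j))^2) <= (\<Sum>j<n. (mat_opnorm n A)^2 * (vnorm n (col B j))^2)"
  proof (rule sum_mono)
  fix j assume j: "j : {..<n}"
  have "vnorm n (col (A * B) j) <= mat_opnorm n A * vnorm n (col B j)"
  using AB j by (subst col_mult_mat[of _ n]) (auto intro!: vnorm_mult_le_opnorm)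
  then show "(vnorm n (col (A * B) j))^2 <= (mat_opnorm n A)^2 * (vnorm n (col B j))^2"
  by (metis power_mono power_mult_distrib vnorm_nonneg)
  qed
  then have "sqrt ((\<Sum>j<n. (vnorm n (col (A * B) j))^2) / real n) <= sqrt ((mat_opnorm n A)^2 * ((\<Sum>j<n. (vnorm n (col B j))^2) / real n))"
  by (simp add: sum_distrib_left[symmetric] divide_right_mono)
  also have "... = mat_opnorm n A * sqrt ((\<Sum>j<n. (vnorm n (col B j))^2) / real n)"
  using AB by (simp add: real_sqrt_mult mat_opnorm_nonneg del: times_divide_eq_right)
  finally show ?thesis using AB by (simp add: norm2_mat_cols)
  qed
 next
  fix A :: "complex mat" assume "A : car (Mat n)"
  then have A: "A : sqm n" by simp
  show "adj (Mat n) (adj (Mat n) A) = A" using A by (auto intro!: eq_matI)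
  show "trc (Mat n) (adj (Mat n) A) = cnj (trc (Mat n) A)" using A by simp
  show "0 <= Re (trc (Mat n) (adj (Mat n) A *[Mat n] A))"
  using norm2_mat_sq[OF A] by (simp add: sum_nonneg del: mat_algebra_simps(8) index_mult_mat(1))
  show "A = \<zero>\<^bsub>Mat n\<^esub>" if h: "Re (trc (Mat n) (adj (Mat n) A *[Mat n] A)) = 0"
  proof (cases "n = 0")
  case False
  then have "(\<Sum>j<n. \<Sum>i<n. (cmod (A $$ (i, j)))^2) = 0" using norm2_mat_sq[OF A] h by simp
  then have "A $$ (i, j) = 0" if "i < n" "j < n" for i j
  using that by (auto simp: sum_nonneg_eq_0_iff sum_nonneg)
  then show ?thesis using A by (auto intro!: eq_matI)
  qed (use A in \<open>auto intro!: eq_matI\<close>)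
  show "0 <= opn (Mat n) A" using A by (simp add: mat_opnorm_nonneg)
  fix B :: real assume B: "0 <= B" and le: "!!Y. Y : car (Mat n) ==>
  norm2 (Mat n) (A *[Mat n] Y) <= B * norm2 (Mat n) Y"
  show "opn (Mat n) A <= B" unfolding mat_algebra_simps mat_opnorm_eq[OF A]
  proof (rule cSUP_least)
  show "{v : carrier_vec n. vnorm n v <= 1} ~= {}" by (auto intro: exI[of _ "0\<^sub>v n"])
  fix v assume "v : {v : carrier_vec n. vnorm n v <= 1}"
  then have v: "v : carrier_vec n" "vnorm n v <= 1" by auto
  show "vnorm n (A *\<^sub>v v) <= B"
  proof (cases "n = 0")
  case True then show ?thesis using B by (simp add: vnorm_def)
  next
  case False
  \<comment> \<open>A vector is turned into a test matrix by putting it in column 0, so that the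
    trace norm of \<open>A * Y\<close> recovers the length of A v up to the factor 1 / sqrt
    n.\<close>
  define Y where "Y = mat n n (%(i, j). if j = 0 then v $ i else 0)"
  have Y: "Y : sqm n" by (simp add: Y_def)
  have c: "col Y j = (if j = 0 then v else 0\<^sub>v n)" if "j < n" for j
  using that v by (auto simp: Y_def intro!: eq_vecI)
  have AY: "A * Y : sqm n" using A Y by simp
  have A0: "A *\<^sub>v 0\<^sub>v n = 0\<^sub>v n" using A by auto
  have n0: "{..<n} = insert 0 {1..<n}" using False by auto
  have 1: "norm2 (Mat n) Y = sqrt ((vnorm n v)^2 / real n)"
  unfolding norm2_mat_cols[OF Y] n0 using c False by (simp add: sum.neutral)
  have 2: "norm2 (Mat n) (A * Y) = sqrt ((vnorm n (A *\<^sub>v v))^2 / real n)"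
  proof -
  have "vnorm n (col (A * Y) j) = (if j = 0 then vnorm n (A *\<^sub>v v) else 0)" if "j < n" for j
  unfolding col_mult_mat[OF A Y that] c[OF that] using A0 by simp
  then show ?thesis unfolding norm2_mat_cols[OF AY] n0 using False by simp
  qed
  have "vnorm n (A *\<^sub>v v) <= B * vnorm n v"
  using le[of Y] Y 1 2 False by (simp add: real_sqrt_divide divide_right_mono field_simps)
  also have "... <= B" using v B mult_left_mono[of "vnorm n v" 1 B] by simp
  finally show ?thesis .
  qed
  qed
 qed (auto intro!: eq_matI simp: algebra_simps sum.distrib add_divide_distrib sum_distrib_left scalar_prod_def)
qed

definition rdiag :: "nat => (nat => real) => complex mat" where
 "rdiag n d = mat n n (%(i, j). if i = j then cor (d i) else 0)"

lemma rdiag_carrier [simp]: "rdiag n d : sqm n"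
 by (simp add: rdiag_def)

lemma rdiag_mult: "rdiag n d * rdiag n e = rdiag n (%i. d i * e i)"
proof (rule eq_matI)
 fix i j assume "i < dim_row (rdiag n (%i. d i * e i))" "j < dim_col (rdiag n (%i. d i * e i))"
 then have ij: "i < n" "j < n" by (auto simp: rdiag_def)
 have "(rdiag n d * rdiag n e) $$ (i, j) = (\<Sum>k<n. rdiag n d $$ (i, k) * rdiag n e $$ (k, j))"
  using ij by (intro mat_mult_entry) auto
 also have "... = (\<Sum>k<n. if k = i then (if i = j then cor (d i * e i) else 0) else 0)"
  using ij by (intro sum.cong) (auto simp: rdiag_def)
 also have "... = rdiag n (%i. d i * e i) $$ (i, j)" using ij by (simp add: rdiag_def)
 finally show "(rdiag n d * rdiag n e) $$ (i, j) = rdiag n (%i. d i * e i) $$ (i, j)" .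
qed (auto simp: rdiag_def)

lemma rdiag_adjoint: "madj (rdiag n d) = rdiag n d"
 by (auto simp: rdiag_def intro!: eq_matI)

lemma trc_diag_real: "trc (Mat n) (rdiag n d) = cor ((\<Sum>i<n. d i) / real n)"
 by (simp add: rdiag_def)

lemma conj_diag_entry:
 assumes U: "U : sqm n" and ij: "i < n" "j < n"
 shows "(U * rdiag n d * madj U) $$ (i, j) = (\<Sum>k<n. U $$ (i, k) * cor (d k) * cnj (U $$ (j, k)))"
proof -
 have 1: "(U * rdiag n d) $$ (i, k) = U $$ (i, k) * cor (d k)" if k: "k < n" for k
 proof -
  have "(U * rdiag n d) $$ (i, k) = (\<Sum>l<n. U $$ (i, l) * rdiag n d $$ (l, k))"
  using U ij k by (intro mat_mult_entry) auto
  also have "... = (\<Sum>l<n. if l = k then U $$ (i, k) * cor (d k) else 0)"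
  using k by (intro sum.cong) (auto simp: rdiag_def)
  finally show ?thesis using k by simp
 qed
 have "(U * rdiag n d * madj U) $$ (i, j) = (\<Sum>k<n. (U * rdiag n d) $$ (i, k) * madj U $$ (k, j))"
  using U ij by (intro mat_mult_entry) (auto intro: mult_carrier_mat)
 then show ?thesis using 1 U ij by simp
qed

text \<open>Completing v to a basis and applying Gram-Schmidt gives orthogonal vectors starting with
  v; they become the columns of a unitary after normalisation.\<close>

lemma unitary_completion:
 assumes v: "v : carrier_vec n" and v0: "v ~= 0\<^sub>v n" and n: "0 < n"
 shows "EX W a. W : sqm n & madj W * W = 1\<^sub>m n & col W 0 = a \<cdot>\<^sub>v (v :: complex vec)"
proof -
 interpret cof_vec_space n "TYPE(complex)" .
 define b where "b = basis_completion v"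
 from basis_completion[OF v v0, folded b_def]
 have dist_b: "distinct b" and indep: "\<not> lin_dep (set b)" and b: "set b <= carrier_vec n"
  and hdb: "hd b = v" and len_b: "length b = n" by auto
 define ws where "ws = gram_schmidt n b"
 from hdb len_b n obtain vs where bv: "b = v # vs" by (cases b) auto
 from gram_schmidt_result[OF b dist_b indep refl, folded ws_def]
 have ws: "set ws <= carrier_vec n" "corthogonal ws" "length ws = n" by (auto simp: len_b)
 from gram_schmidt_hd[OF v, of vs, folded bv] have hdws: "hd ws = v" unfolding ws_def .
 have w0: "ws ! 0 = v" using hdws ws n by (cases ws) auto
 have wc: "ws ! i : carrier_vec n" if "i < n" for i using ws that by auto
 define W where "W = mat n n (%(i, j). cor (1 / vnorm n (ws ! j)) * ws ! j $ i)"
 have W: "W : sqm n" by (simp add: W_def)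
 have "madj W * W = 1\<^sub>m n"
 proof (rule eq_matI)
  fix i j assume "i < dim_row (1\<^sub>m n :: complex mat)" "j < dim_col (1\<^sub>m n :: complex mat)"
  then have ij: "i < n" "j < n" by auto
  have "(madj W * W) $$ (i, j) = (\<Sum>k<n. cnj (W $$ (k, i)) * W $$ (k, j))"
  using W ij by (rule_tac adj_mult_entry)
  also have "... = cor (1 / vnorm n (ws ! i)) * cor (1 / vnorm n (ws ! j)) * (ws ! j \<bullet>c ws ! i)"
  using ij by (simp add: W_def cscalar_prod_eq[OF wc wc] sum_distrib_left mult_ac)
  also have "... = (if i = j then 1 else 0)"
  proof (cases "i = j")
  case True
  have ne: "ws ! i \<bullet>c ws ! i ~= 0" using corthogonalD[OF ws(2)] ws(3) ij by auto
  have "ws ! i \<bullet>c ws ! i = cor ((vnorm n (ws ! i))^2)"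
  by (simp add: cscalar_prod_eq[OF wc[OF ij(1)] wc[OF ij(1)]] vnorm_def sum_nonneg complex_norm_square del: of_real_power)
  then show ?thesis using True ne by (simp add: power2_eq_square)
  next
  case False
  then have "ws ! j \<bullet>c ws ! i = 0" using corthogonalD[OF ws(2)] ws(3) ij by auto
  then show ?thesis using False by simp
  qed
  finally show "(madj W * W) $$ (i, j) = 1\<^sub>m n $$ (i, j)" using ij by simp
 qed (use W in auto)
 moreover have "col W 0 = cor (1 / vnorm n v) \<cdot>\<^sub>v v"
  using n v w0 by (auto simp: W_def intro!: eq_vecI)
 ultimately show ?thesis using W by blast
qed

text \<open>Deflation: in a unitary basis whose first vector is an eigenvector, the first column,
  and by symmetry the first row, vanish off the diagonal, and the remaining block is Hermitian of
  size one less.\<close>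

lemma hermitian_diagonalization:
 assumes "A : sqm n" "madj A = (A :: complex mat)"
 shows "EX U d. U : sqm n & madj U * U = 1\<^sub>m n & A = U * rdiag n d * madj U"
 using assms
proof (induction n arbitrary: A)
 case 0
 then show ?case by (intro exI[of _ "1\<^sub>m 0"] exI[of _ "%_. 0"]) (auto intro!: eq_matI simp: rdiag_def)
next
 case (Suc n)
 let ?n = "Suc n"
 have A: "A : carrier_mat ?n ?n" by fact
 have "spectrum A ~= {}" by (rule spectrum_non_empty[OF A]) simp
 then obtain e v where "eigenvector A v e" by (auto simp: spectrum_def eigenvalue_def)
 then have v: "v : carrier_vec ?n" "v ~= 0\<^sub>v ?n" and Av: "A *\<^sub>v v = e \<cdot>\<^sub>v v"
  using A by (auto simp: eigenvector_def)
 obtain W a where W: "W : carrier_mat ?n ?n" and WW: "madj W * W = 1\<^sub>m ?n" and W0: "col W 0 = a \<cdot>\<^sub>v v"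
  using unitary_completion[OF v] by auto
 have WW': "W * madj W = 1\<^sub>m ?n"
  using mat_mult_left_right_inverse[OF _ W WW] W by auto
 define B where "B = madj W * A * W"
 have B: "B : carrier_mat ?n ?n" using W A by (auto simp: B_def)
 have AB: "A = W * B * madj W"
 proof -
  have "W * B * madj W = (W * madj W) * A * (W * madj W)"
  using W A by (simp add: B_def assoc_mult_mat[where n\<^sub>1="?n" and n\<^sub>2="?n" and n\<^sub>3="?n" and n\<^sub>4="?n"])
  then show ?thesis using A by (simp add: WW')
 qed
 have Badj: "madj B = B"
  using W A Suc.prems(2) mat.adj_adj[of W ?n]
  by (simp add: B_def mat_adjoint_mult[where n="?n"] assoc_mult_mat[where n\<^sub>1="?n" and n\<^sub>2="?n" and n\<^sub>3="?n" and n\<^sub>4="?n"])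
 have sym: "B $$ (i, j) = cnj (B $$ (j, i))" if "i < ?n" "j < ?n" for i j
  using that B arg_cong[OF Badj, of "%M. M $$ (i, j)"] by simp
 have AW0: "A *\<^sub>v col W 0 = e \<cdot>\<^sub>v col W 0"
  using A v Av by (simp add: W0 mult_mat_vec smult_smult_assoc mult.commute)
 have B0: "B $$ (i, 0) = (if i = 0 then e else 0)" if i: "i < ?n" for i
 proof -
  have "col B 0 = madj W *\<^sub>v (A *\<^sub>v col W 0)"
  using W A col_mult_mat[of "madj W" ?n "A * W" 0] col_mult_mat[of A ?n W 0]
  by (simp add: B_def assoc_mult_mat[where n\<^sub>1="?n" and n\<^sub>2="?n" and n\<^sub>3="?n" and n\<^sub>4="?n"] del: col_mult2)
  also have "... = e \<cdot>\<^sub>v (madj W *\<^sub>v col W 0)"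
  unfolding AW0 using W by (intro mult_mat_vec[where nr="?n"]) auto
  also have "madj W *\<^sub>v col W 0 = col (madj W * W) 0"
  using W by (simp add: col_mult_mat[where n="?n"])
  finally have "col B 0 $ i = (if i = 0 then e else 0)" using i by (simp add: WW)
  then show ?thesis using B i by simp
 qed
 \<comment> \<open>The (0, 0) entry of the Hermitian matrix B is the eigenvalue, so it is
   real.\<close>
 have e: "e = cor (Re e)" using sym[of 0 0] B0[of 0] by (simp add: complex_eq_iff)
 have B0': "B $$ (0, j) = (if j = 0 then e else 0)" if j: "j < ?n" for j
  using sym[of 0 j] B0[OF j] j B0[of 0] by (auto split: if_splits)
 define C where "C = mat n n (%(i, j). B $$ (Suc i, Suc j))"
 have C: "C : sqm n" "madj C = C"
  by (auto simp: C_def sym[symmetric] intro!: eq_matI)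
 obtain U d where U: "U : sqm n" and UU: "madj U * U = 1\<^sub>m n" and CU: "C = U * rdiag n d * madj U"
  using Suc.IH[OF C] by auto
 \<comment> \<open>The block sum of 1 and the unitary that diagonalises the lower block.\<close>
 define V where "V = mat ?n ?n (%(i, j). case i of 0 => (if j = 0 then 1 else 0) | Suc i' =>
  (case j of 0 => 0 | Suc j' => U $$ (i', j')))"
 define d' where "d' = (%i. case i of 0 => Re e | Suc i' => d i')"
 have V: "V : carrier_mat ?n ?n" by (simp add: V_def)
 have Vs: "V $$ (0, 0) = 1" "!!j. j < n ==> V $$ (0, Suc j) = 0" "!!i. i < n ==> V $$ (Suc i, 0) = 0"
  "!!i j. i < n ==> j < n ==> V $$ (Suc i, Suc j) = U $$ (i, j)" by (auto simp: V_def)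
 have VV: "madj V * V = 1\<^sub>m ?n"
 proof (rule eq_matI)
  fix i j assume "i < dim_row (1\<^sub>m ?n :: complex mat)" "j < dim_col (1\<^sub>m ?n :: complex mat)"
  then have ij: "i < ?n" "j < ?n" by auto
  have "(madj V * V) $$ (i, j) = (\<Sum>k<?n. cnj (V $$ (k, i)) * V $$ (k, j))"
  using V ij by (rule_tac adj_mult_entry)
  also have "... = cnj (V $$ (0, i)) * V $$ (0, j) + (\<Sum>k<n. cnj (V $$ (Suc k, i)) * V $$ (Suc k, j))"
  by (rule sum.lessThan_Suc_shift)
  also have "... = (if i = j then 1 else 0)"
  proof (cases i; cases j)
  fix i' j' assume i': "i = Suc i'" and j': "j = Suc j'"
  have "(madj U * U) $$ (i', j') = (\<Sum>k<n. cnj (U $$ (k, i')) * U $$ (k, j'))"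
  using U ij i' j' by (rule_tac adj_mult_entry) auto
  then show ?thesis using ij i' j' UU by (simp add: Vs)
  qed (use ij in \<open>auto simp: Vs\<close>)
  finally show "(madj V * V) $$ (i, j) = 1\<^sub>m ?n $$ (i, j)" using ij by simp
 qed (use V in auto)
 have BV: "B = V * rdiag ?n d' * madj V"
 proof (rule eq_matI)
  fix i j assume "i < dim_row (V * rdiag ?n d' * madj V)" "j < dim_col (V * rdiag ?n d' * madj V)"
  then have ij: "i < ?n" "j < ?n" using V by auto
  have "(V * rdiag ?n d' * madj V) $$ (i, j) = (\<Sum>k<?n. V $$ (i, k) * cor (d' k) * cnj (V $$ (j, k)))"
  by (rule conj_diag_entry[OF V ij])
  also have "... = V $$ (i, 0) * cor (d' 0) * cnj (V $$ (j, 0)) +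
  (\<Sum>k<n. V $$ (i, Suc k) * cor (d' (Suc k)) * cnj (V $$ (j, Suc k)))"
  by (rule sum.lessThan_Suc_shift)
  also have "... = B $$ (i, j)"
  proof (cases i; cases j)
  fix i' j' assume i': "i = Suc i'" and j': "j = Suc j'"
  have "C $$ (i', j') = (\<Sum>k<n. U $$ (i', k) * cor (d k) * cnj (U $$ (j', k)))"
  unfolding CU using ij i' j' by (intro conj_diag_entry U) auto
  then show ?thesis using ij i' j' by (simp add: Vs d'_def C_def)
  qed (use ij B0 B0' e in \<open>auto simp: Vs d'_def\<close>)
  finally show "B $$ (i, j) = (V * rdiag ?n d' * madj V) $$ (i, j)" by simp
 qed (use V B in auto)
 have "A = (W * V) * rdiag ?n d' * madj (W * V)"
  unfolding AB BV using W V
  by (simp add: mat_adjoint_mult[where n="?n"] assoc_mult_mat[where n\<^sub>1="?n" and n\<^sub>2="?n" and n\<^sub>3="?n" and n\<^sub>4="?n"])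
 moreover have "madj (W * V) * (W * V) = madj V * ((madj W * W) * V)"
  using W V by (simp add: mat_adjoint_mult[where n="?n"] assoc_mult_mat[where n\<^sub>1="?n" and n\<^sub>2="?n" and n\<^sub>3="?n" and n\<^sub>4="?n"])
 then have "madj (W * V) * (W * V) = 1\<^sub>m ?n" using V by (simp add: WW VV)
 ultimately show ?case using W V by (intro exI[of _ "W * V"] exI[of _ d']) auto
qed


context
 fixes n :: nat and U :: "complex mat"
 assumes U: "U : sqm n" and UU: "madj U * U = 1\<^sub>m n"
begin

text \<open>Functional calculus in a fixed eigenbasis. The function is applied to the index rather
  than to the eigenvalue, so products are pointwise and repeated eigenvalues raise no question of
  well-definedness.\<close>

definition spectral :: "(nat => real) => complex mat" where
 "spectral g = U * rdiag n g * madj U"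

lemma spectral_carrier [simp]: "spectral g : sqm n"
 using U by (simp add: spectral_def)

lemma spectral_mult: "spectral g * spectral h = spectral (%i. g i * h i)"
proof -
 note assoc = assoc_mult_mat[where n\<^sub>1=n and n\<^sub>2=n and n\<^sub>3=n and n\<^sub>4=n]
 have "spectral g * spectral h = U * (rdiag n g * ((madj U * U) * (rdiag n h * madj U)))"
  using U by (simp add: spectral_def assoc)
 also have "... = U * ((rdiag n g * rdiag n h) * madj U)"
  using U by (simp add: UU assoc)
 finally show ?thesis using U by (simp add: spectral_def assoc rdiag_mult)
qed

lemma spectral_adjoint: "madj (spectral g) = spectral g"
 using U mat.adj_adj[of U n]
 by (simp add: spectral_def mat_adjoint_mult[where n=n] rdiag_adjoint assoc_mult_mat[where n\<^sub>1=n and n\<^sub>2=n and n\<^sub>3=n and n\<^sub>4=n])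

lemma spectral_quadratic_le:
 assumes y: "y : sqm n" and g: "!!i. i < n ==> g i <= c"
 shows "Re (trc (Mat n) (madj y * (spectral g * y))) <= c * (mat.n2 n y)^2"
proof -
 note assoc = assoc_mult_mat[where n\<^sub>1=n and n\<^sub>2=n and n\<^sub>3=n and n\<^sub>4=n]
 define w where "w = madj U * y"
 have w: "w : sqm n" using U y by (simp add: w_def)
 have UU': "U * madj U = 1\<^sub>m n" using mat_mult_left_right_inverse[OF _ U UU] U by auto
 have wadj: "madj w = madj y * U"
  using U y mat.adj_adj[of U n] by (simp add: w_def mat_adjoint_mult[where n=n])
 have "madj w * w = madj y * ((U * madj U) * y)"
  using U y by (simp add: wadj) (simp add: w_def assoc)
 then have ww: "madj w * w = madj y * y" using y by (simp add: UU')
 have "madj y * (spectral g * y) = madj w * (rdiag n g * w)"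
  using U y by (simp add: wadj) (simp add: w_def spectral_def assoc)
 moreover have "(rdiag n g * w) $$ (i, j) = cor (g i) * w $$ (i, j)" if "i < n" "j < n" for i j
 proof -
  have "(rdiag n g * w) $$ (i, j) = (\<Sum>k<n. rdiag n g $$ (i, k) * w $$ (k, j))"
  using that w by (intro mat_mult_entry) auto
  also have "... = (\<Sum>k<n. if k = i then cor (g i) * w $$ (i, j) else 0)"
  using that by (intro sum.cong) (auto simp: rdiag_def)
  finally show ?thesis using that by simp
 qed
 ultimately have "trc (Mat n) (madj y * (spectral g * y)) =
  (\<Sum>j<n. \<Sum>i<n. cnj (w $$ (i, j)) * (cor (g i) * w $$ (i, j))) / of_nat n"
  using w trc_adj_mult[OF w, of "rdiag n g * w"] by (simp del: mat_algebra_simps)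
 also have "... = cor ((\<Sum>j<n. \<Sum>i<n. g i * (cmod (w $$ (i, j)))^2) / real n)"
  by (simp add: complex_norm_square mult_ac del: of_real_power)
 finally have "Re (trc (Mat n) (madj y * (spectral g * y))) = (\<Sum>j<n. \<Sum>i<n. g i * (cmod (w $$ (i, j)))^2) / real n"
  by (simp only: Re_complex_of_real)
 also have "... <= (\<Sum>j<n. \<Sum>i<n. c * (cmod (w $$ (i, j)))^2) / real n"
  using g by (intro divide_right_mono sum_mono mult_right_mono) auto
 also have "... = c * Re (trc (Mat n) (madj w * w))"
  by (simp add: norm2_mat_sq[OF w] sum_distrib_left del: mat_algebra_simps)
 also have "... = c * (mat.n2 n y)^2"
  using y mat.n2_sq[of y n] by (simp add: ww)
 finally show ?thesis .
qed

lemma trc_spectral: "Re (trc (Mat n) (spectral g)) = (\<Sum>i<n. g i) / real n"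
proof -
 have "trc (Mat n) (spectral g) = trc (Mat n) (madj U * (U * rdiag n g))"
  using mat.trc_comm[of "U * rdiag n g" n "madj U"] U by (simp add: spectral_def del: mat_algebra_simps(8) index_mult_mat(1))
 also have "madj U * (U * rdiag n g) = rdiag n g"
  using U by (simp add: UU assoc_mult_mat[where n\<^sub>1=n and n\<^sub>2=n and n\<^sub>3=n and n\<^sub>4=n, symmetric])
 finally show ?thesis by (simp add: trc_diag_real del: mat_algebra_simps(8))
qed

lemma norm2_spectral: "(mat.n2 n (spectral g))^2 = (\<Sum>i<n. (g i)^2) / real n"
 using mat.n2_sq[of "spectral g" n] trc_spectral[of "%i. g i * g i"]
 by (simp add: spectral_adjoint spectral_mult power2_eq_square del: mat_algebra_simps(8))

lemma opn_spectral_le: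
 assumes "!!i. i < n ==> \<bar>g i\<bar> <= B" "0 <= B"
 shows "opn (Mat n) (spectral g) <= B"
proof (rule mat.opn_least)
 fix y assume "y : car (Mat n)"
 then have y: "y : sqm n" by simp
 have "(mat.n2 n (spectral g * y))^2 = Re (trc (Mat n) (madj y * (spectral (%i. g i * g i) * y)))"
  using y mat.n2_sq[of "spectral g * y" n]
  by (simp add: mat_adjoint_mult[where n=n] spectral_adjoint spectral_mult[symmetric]
  assoc_mult_mat[where n\<^sub>1=n and n\<^sub>2=n and n\<^sub>3=n and n\<^sub>4=n] del: mat_algebra_simps(8) index_mult_mat(1))
 also have "... <= B\<^sup>2 * (mat.n2 n y)^2"
  using assms y abs_le_square_iff[of "g _" B] by (intro spectral_quadratic_le) (auto simp: power2_eq_square)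
 finally have "(mat.n2 n (spectral g * y))^2 <= (B * mat.n2 n y)^2"
  by (simp add: power_mult_distrib)
 then show "mat.n2 n (spectral g *[Mat n] y) <= B * mat.n2 n y"
  unfolding mat_algebra_simps(2) by (rule power2_le_imp_le) (use assms y mat.n2_nonneg[of y n] in simp)
qed (use assms in auto)

lemma spectral_minus: "spectral g -[Mat n] spectral h = spectral (%i. g i - h i)"
proof -
 have "spectral (%i. g i - h i) +[Mat n] spectral h = spectral g"
  using U by (auto intro!: eq_matI simp: spectral_def conj_diag_entry[where n=n] sum.distrib[symmetric] algebra_simps
  simp del: index_mult_mat(1))
 then show ?thesis
  using mat.add_minus_cancel_right[of "spectral (%i. g i - h i)" n "spectral h"] by simp
qed

text \<open>Testing the operator bound on the rank-one projection of index i isolates the single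
  value g i.\<close>

lemma abs_le_opn_spectral:
 assumes i: "i < n"
 shows "\<bar>g i\<bar> <= opn (Mat n) (spectral g)"
proof -
 let ?e = "%j. if j = i then 1 else 0 :: real"
 have n: "n > 0" using i by simp
 have "mat.n2 n (spectral g * spectral ?e) <= opn (Mat n) (spectral g) * mat.n2 n (spectral ?e)"
  using mat.opn_bound[of "spectral g" n "spectral ?e"] by simp
 moreover have "(mat.n2 n (spectral ?e))^2 = 1 / real n"
  using i by (simp add: norm2_spectral if_distrib[of "%x. x\<^sup>2"] cong: if_cong)
 then have e: "mat.n2 n (spectral ?e) = sqrt (1 / real n)"
  using mat.n2_nonneg[of "spectral ?e" n] by (simp add: real_sqrt_unique)
 moreover have "(\<Sum>j<n. (g j * ?e j)^2) = (g i)^2"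
  using i by (simp add: if_distrib[of "%x. (_ * x)^2"] cong: if_cong)
 then have "(mat.n2 n (spectral g * spectral ?e))^2 = (g i)^2 / real n"
  unfolding spectral_mult norm2_spectral by simp
 then have "mat.n2 n (spectral g * spectral ?e) = sqrt ((g i)^2 / real n)"
  using mat.n2_nonneg[of "spectral g * spectral ?e" n] by (simp add: real_sqrt_unique)
 ultimately show ?thesis using n by (simp add: real_sqrt_divide field_simps)
qed

end

text \<open>A negative eigenvalue d satisfies d^2 <= |a| (-d), where |a| is the operator norm.
  Averaging over the eigenvalues turns the square distance to the positive part into |a| times the
  trace of the negative part.\<close>

lemma mat_has_positive_parts: "has_positive_parts (Mat n)"
 unfolding has_positive_parts_def
proof (intro ballI impI)
 fix a assume "a : car (Mat n)" "adj (Mat n) a = a"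
 then have a: "a : sqm n" "madj a = a" by auto
 obtain U d where U: "U : sqm n" "madj U * U = 1\<^sub>m n" and ad: "a = U * rdiag n d * madj U"
  using hermitian_diagonalization[OF a] by blast
 let ?S = "spectral n U"
 have aS: "a = ?S d" using ad by (simp add: spectral_def[OF U])
 note S = spectral_carrier[OF U] spectral_mult[OF U] spectral_adjoint[OF U] spectral_minus[OF U]
 define p where "p = ?S (%i. if d i < 0 then 1 else 0)"
 define z where "z = ?S (%i. sqrt (max (d i) 0))"
 have dle: "\<bar>d i\<bar> <= opn (Mat n) a" if "i < n" for i
  unfolding aS by (rule abs_le_opn_spectral[OF U that])
 have op0: "0 <= opn (Mat n) a" using a by (intro mat.opn_nonneg) auto
 have p: "opn (Mat n) p <= 1" unfolding p_def by (rule opn_spectral_le[OF U]) auto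
 have "\<bar>sqrt (max (d i) 0)\<bar> <= sqrt (opn (Mat n) a)" if "i < n" for i
  using dle[OF that] op0 by auto
 then have z: "opn (Mat n) z <= sqrt (opn (Mat n) a)"
  unfolding z_def using op0 by (intro opn_spectral_le[OF U]) auto
 have "madj z * z = ?S (%i. max (d i) 0)" by (simp add: z_def S)
 then have "(mat.n2 n (a -[Mat n] madj z * z))^2 = (\<Sum>i<n. (d i - max (d i) 0)^2) / real n"
  unfolding aS by (simp add: S norm2_spectral[OF U])
 also have "... <= (\<Sum>i<n. opn (Mat n) a * (if d i < 0 then - d i else 0)) / real n"
 proof (intro divide_right_mono sum_mono)
  fix i assume "i : {..<n}"
  then have "\<bar>d i\<bar> <= opn (Mat n) a" using dle by auto
  then show "(d i - max (d i) 0)^2 <= opn (Mat n) a * (if d i < 0 then - d i else 0)"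
  using mult_right_mono[of "- d i" "opn (Mat n) a" "- d i"] by (auto simp: power2_eq_square max_def)
 qed auto
 also have "... = opn (Mat n) a * ((\<Sum>i<n. (if d i < 0 then - d i else 0)) / real n)"
  by (simp add: sum_distrib_left)
 also have "(\<Sum>i<n. (if d i < 0 then - d i else 0)) / real n = - Re (trc (Mat n) (madj p * (a * p)))"
 proof -
  have "madj p * (a * p) = ?S (%i. if d i < 0 then d i else 0)"
  unfolding p_def aS by (simp add: S) (rule arg_cong[where f="?S"], auto)
  then have "Re (trc (Mat n) (madj p * (a * p))) = (\<Sum>i<n. if d i < 0 then d i else 0) / real n"
  by (simp add: trc_spectral[OF U] del: mat_algebra_simps(8))
  also have "... = - ((\<Sum>i<n. (if d i < 0 then - d i else 0)) / real n)"
  by (simp add: sum_negf[symmetric] minus_divide_left if_distrib[of uminus] cong: if_cong)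
  finally show ?thesis by simp
 qed
 finally have "(mat.n2 n (a -[Mat n] madj z * z))^2
  <= opn (Mat n) a * - Re (trc (Mat n) (madj p * (a * p)))" .
 then show "EX p:car (Mat n). EX z:car (Mat n).
  opn (Mat n) p <= 1 & opn (Mat n) z <= sqrt (opn (Mat n) a) &
  (mat.n2 n (a -[Mat n] adj (Mat n) z *[Mat n] z))\<^sup>2
  <= opn (Mat n) a * (- Re (trc (Mat n) (adj (Mat n) p *[Mat n] (a *[Mat n] p))))"
  using p z by (intro bexI[of _ p] bexI[of _ z]) (auto simp: p_def z_def S simp del: mat_algebra_simps(8))
qed

text \<open>All conditions reduce to scalar inequalities for the eigenvalues of x* x, compared with
  B^2.\<close>

lemma mat_truncatable: "truncatable (Mat n)"
 unfolding truncatable_def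
proof (intro ballI allI impI)
 fix x and B :: real assume "x : car (Mat n)" and B: "0 < B"
 then have x: "x : sqm n" by simp
 note assoc = assoc_mult_mat[where n\<^sub>1=n and n\<^sub>2=n and n\<^sub>3=n and n\<^sub>4=n]
 define a where "a = madj x * x"
 have a: "a : sqm n" "madj a = a"
  using x mat.adj_adj[of x n] by (auto simp: a_def mat_adjoint_mult[where n=n])
 obtain U d where U: "U : sqm n" "madj U * U = 1\<^sub>m n" and ad: "a = U * rdiag n d * madj U"
  using hermitian_diagonalization[OF a] by blast
 let ?S = "spectral n U"
 have aS: "a = ?S d" using ad by (simp add: spectral_def[OF U])
 note S = spectral_carrier[OF U] spectral_mult[OF U] spectral_adjoint[OF U] spectral_minus[OF U]
 \<comment> \<open>Norms involving x enter only through x* x, which is diagonal in the chosen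
   basis.\<close>
 have sandwich: "(mat.n2 n ((x * ?S g) * y))^2 = Re (trc (Mat n) (madj y * (?S (%i. g i * (d i * g i)) * y)))"
  if y: "y : sqm n" for g y
 proof -
  have "madj ((x * ?S g) * y) * ((x * ?S g) * y) = madj y * (?S g * (a * (?S g * y)))"
  using x y by (simp add: a_def S mat_adjoint_mult[where n=n] assoc)
  also have "?S g * (a * (?S g * y)) = (?S g * (a * ?S g)) * y"
  using a y by (simp add: S assoc)
  also have "?S g * (a * ?S g) = ?S (%i. g i * (d i * g i))"
  unfolding aS by (simp add: S)
  finally show ?thesis
  using x y mat.n2_sq[of "(x * ?S g) * y" n] by (simp add: S del: mat_algebra_simps(8) index_mult_mat(1))
 qed
 define p where "p = ?S (%i. if d i > B\<^sup>2 then 1 else 0)"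
 have pc: "p : sqm n" by (simp add: p_def S)
 have p1: "opn (Mat n) p <= 1" unfolding p_def by (rule opn_spectral_le[OF U]) auto
 have one: "1\<^sub>m n = ?S (%i. 1)"
 proof -
  have "U * madj U = 1\<^sub>m n" using mat_mult_left_right_inverse[OF _ U] U by auto
  moreover have "rdiag n (%i. 1) = 1\<^sub>m n" by (auto simp: rdiag_def intro!: eq_matI)
  ultimately show ?thesis using U by (simp add: spectral_def[OF U])
 qed
 have q: "x -[Mat n] x * p = x * ?S (%i. if d i <= B\<^sup>2 then 1 else 0)"
 proof -
  have "x -[Mat n] x * p = x *[Mat n] (1\<^sub>m n -[Mat n] p)"
  using x pc mat.minus_mult_right[of "1\<^sub>m n" n p x] by simp
  also have "1\<^sub>m n -[Mat n] p = ?S (%i. if d i <= B\<^sup>2 then 1 else 0)"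
  unfolding one p_def S(4) by (rule arg_cong[where f="?S"]) auto
  finally show ?thesis by simp
 qed
 have "opn (Mat n) (x -[Mat n] x * p) <= B"
 proof (rule mat.opn_least)
  show "x -[Mat n] x * p : car (Mat n)" using x pc by (intro mat.minus_closed) auto
  fix y assume "y : car (Mat n)"
  then have y: "y : sqm n" by simp
  have "(mat.n2 n ((x -[Mat n] x * p) * y))^2 <= B\<^sup>2 * (mat.n2 n y)^2"
  unfolding q sandwich[OF y] by (rule spectral_quadratic_le[OF U y]) auto
  then have "(mat.n2 n ((x -[Mat n] x * p) * y))^2 <= (B * mat.n2 n y)^2"
  by (simp add: power_mult_distrib)
  then show "mat.n2 n ((x -[Mat n] x * p) *[Mat n] y) <= B * mat.n2 n y"
  unfolding mat_algebra_simps(2) by (rule power2_le_imp_le) (use B y mat.n2_nonneg[of y n] in simp)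
 qed (use B in auto)
 moreover have "B * mat.n2 n p <= mat.n2 n (x * p)"
 proof -
  have "(B * mat.n2 n p)^2 = (\<Sum>i<n. B\<^sup>2 * (if d i > B\<^sup>2 then 1 else 0)^2) / real n"
  by (simp add: power_mult_distrib p_def norm2_spectral[OF U] sum_distrib_left)
  also have "... <= (\<Sum>i<n. if d i > B\<^sup>2 then d i else 0) / real n"
  by (intro divide_right_mono sum_mono) auto
  also have "... = Re (trc (Mat n) (?S (%i. if d i > B\<^sup>2 then d i else 0)))"
  by (simp add: trc_spectral[OF U] del: mat_algebra_simps(8))
  also have "... = (mat.n2 n (x * p))^2"
  proof -
  have "(mat.n2 n (x * p))^2 = (mat.n2 n (x * p * 1\<^sub>m n))^2"
  using x pc right_mult_one_mat[of "x * p" n n] by simp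
  also have "... = Re (trc (Mat n) (madj (1\<^sub>m n) * (?S (%i. if d i > B\<^sup>2 then d i else 0) * 1\<^sub>m n)))"
  unfolding p_def sandwich[OF one_carrier_mat]
  by (simp add: if_distrib[of "%x. x * _"] if_distrib[of "%x. _ * x"] cong: if_cong del: mat_algebra_simps(8) index_mult_mat(1))
  also have "madj (1\<^sub>m n) = (1\<^sub>m n :: complex mat)" using mat.adj_one[of n] by simp
  finally show ?thesis using S(1) by (simp del: mat_algebra_simps(8))
  qed
  finally show ?thesis using x pc mat.n2_nonneg[of "x * p" n] by (auto intro: power2_le_imp_le)
 qed
 ultimately show "EX p:car (Mat n). opn (Mat n) p <= 1 &
  opn (Mat n) (x -[Mat n] x *[Mat n] p) <= B &
  B * mat.n2 n p <= mat.n2 n (x *[Mat n] p)"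
  using p1 pc by (intro bexI[of _ p]) (auto simp del: mat_algebra_simps(9))
qed

section \<open>Orthonormal bases of seminormed Hilbert spaces\<close>

text \<open>The form may be degenerate: vectors will be Cauchy sequences and not classes, and
  equality of vectors is replaced by a difference of square norm 0.\<close>

locale semi_hilbert =
 fixes H :: "'h set" and add :: "'h => 'h => 'h" and smul :: "complex => 'h => 'h"
  and nil :: 'h and inn :: "'h => 'h => complex"
 assumes add_closed: "[|x : H; y : H|] ==> add x y : H"
  and smul_closed: "x : H ==> smul a x : H"
  and nil_closed: "nil : H"
  and inn_add: "[|x : H; y : H; z : H|] ==> inn x (add y z) = inn x y + inn x z"
  and inn_smul: "[|x : H; y : H|] ==> inn x (smul a y) = a * inn x y"
  and inn_nil: "x : H ==> inn x nil = 0"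
  and inn_sym: "[|x : H; y : H|] ==> inn y x = cnj (inn x y)"
  and inn_nonneg: "x : H ==> 0 <= Re (inn x x)"
  and Cauchy_Schwarz: "[|x : H; y : H|] ==> (cmod (inn x y))^2 <= Re (inn x x) * Re (inn y y)"
  and complete: "[|!!k. X k : H;
  !!e. e > 0 ==> EX N. ALL i>=N. ALL j>=N. Re (inn (add (X i) (smul (-1) (X j))) (add (X i) (smul (-1) (X j)))) < e|]
  ==> EX x:H. (%k. Re (inn (add (X k) (smul (-1) x)) (add (X k) (smul (-1) x)))) ~~> 0"
begin

lemma inn_self: "x : H ==> inn x x = cor (Re (inn x x))"
 using inn_sym[of x x] by (simp add: complex_eq_iff)

definition diff :: "'h => 'h => 'h" where "diff x y = add x (smul (-1) y)"

definition sqnorm :: "'h => real" where "sqnorm x = Re (inn x x)"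

lemma diff_closed [simp]: "x : H ==> y : H ==> diff x y : H"
 by (simp add: diff_def add_closed smul_closed)

lemma inn_diff: "[|x : H; y : H; z : H|] ==> inn x (diff y z) = inn x y - inn x z"
 by (simp add: diff_def inn_add inn_smul smul_closed)

lemma inn_diff_left: "[|x : H; y : H; z : H|] ==> inn (diff y z) x = inn y x - inn z x"
 using inn_sym[of x "diff y z"] inn_sym[of x y] inn_sym[of x z] by (simp add: inn_diff)

lemma inn_add_left: "[|x : H; y : H; z : H|] ==> inn (add y z) x = inn y x + inn z x"
 using inn_sym[of x "add y z"] inn_sym[of x y] inn_sym[of x z] by (simp add: inn_add add_closed)

lemma inn_smul_left: "[|x : H; y : H|] ==> inn (smul a y) x = cnj a * inn y x"
 using inn_sym[of x "smul a y"] inn_sym[of x y] by (simp add: inn_smul smul_closed)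

lemma sqnorm_nonneg [simp]: "x : H ==> 0 <= sqnorm x"
 by (simp add: sqnorm_def inn_nonneg)

lemma sqnorm_diff: "[|x : H; y : H|] ==> sqnorm (diff x y) = sqnorm x + sqnorm y - 2 * Re (inn x y)"
 using inn_sym[of x y] by (simp add: sqnorm_def inn_diff inn_diff_left)

lemma sqnorm_diff_commute: "[|x : H; y : H|] ==> sqnorm (diff x y) = sqnorm (diff y x)"
 using inn_sym[of x y] by (simp add: sqnorm_diff)

lemma inn_eq_of_null: "[|x : H; y : H; z : H; sqnorm (diff y z) = 0|] ==> inn x y = inn x z"
 using Cauchy_Schwarz[of x "diff y z"] by (simp add: sqnorm_def inn_diff)

lemma inn_tendsto:
 assumes "x : H" "!!k. X k : H" "y : H" "(%k. sqnorm (diff (X k) y)) ~~> 0"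
 shows "(%k. inn x (X k)) ~~> inn x y"
proof -
 have "(%k. (cmod (inn x (X k) - inn x y))^2) ~~> 0"
 proof (rule tendsto_zero_squeeze)
  show "(%k. sqnorm x * sqnorm (diff (X k) y)) ~~> 0"
  using assms(4) by (rule tendsto_mult_right_zero)
  fix k
  show "(cmod (inn x (X k) - inn x y))^2 <= sqnorm x * sqnorm (diff (X k) y)"
  using Cauchy_Schwarz[of x "diff (X k) y"] assms by (simp add: inn_diff sqnorm_def)
 qed simp
 from tendsto_real_sqrt[OF this] have "(%k. inn x (X k) - inn x y) ~~> 0"
  by (simp add: tendsto_norm_zero_iff)
 then show ?thesis by (simp add: LIM_zero_iff)
qed

definition orthonormal :: "'h set => bool" where
 "orthonormal E <-> E <= H & (ALL e:E. ALL f:E. inn e f = (if e = f then 1 else 0))"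

lemma orthonormalD: "[|orthonormal E; e : E; f : E|] ==> inn e f = (if e = f then 1 else 0)"
 by (simp add: orthonormal_def)

text \<open>A finite linear combination is described by its inner products with all vectors. This
  avoids finite sums in H, whose addition satisfies no algebraic laws on the nose.\<close>

lemma linear_combination:
 assumes "finite F" "F <= H"
 shows "EX z:H. ALL x:H. inn x z = (\<Sum>e\<in>F. f e * inn x e)"
 using assms
proof (induction F)
 case empty
 then show ?case by (intro bexI[of _ nil]) (auto simp: nil_closed inn_nil)
next
 case (insert e F)
 then obtain z where z: "z : H" "ALL x:H. inn x z = (\<Sum>e\<in>F. f e * inn x e)" by auto
 then show ?case using insert
  by (intro bexI[of _ "add (smul (f e) e) z"]) (auto simp: inn_add inn_smul add_closed smul_closed)
qed

lemma inn_combination: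
 assumes E: "orthonormal E" and F: "finite F" "F <= E" and z: "z : H" "ALL x:H. inn x z = (\<Sum>e\<in>F. f e * inn x e)"
  and e: "e : E"
 shows "inn e z = (if e : F then f e else 0)"
proof -
 have "inn e z = (\<Sum>e'\<in>F. f e' * inn e e')" using z e E by (auto simp: orthonormal_def)
 also have "... = (\<Sum>e'\<in>F. if e' = e then f e else 0)"
  using E F e by (intro sum.cong) (auto simp: orthonormal_def)
 finally show ?thesis using F by simp
qed

lemma inn_combinations:
 assumes E: "orthonormal E" and F: "finite F" "F <= G" and G: "finite G" "G <= E"
  and z: "z : H" "ALL x:H. inn x z = (\<Sum>e\<in>F. f e * inn x e)"
  and w: "w : H" "ALL x:H. inn x w = (\<Sum>e\<in>G. f e * inn x e)"
 shows "inn z w = cor (\<Sum>e\<in>F. (cmod (f e))^2)"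
proof -
 have "inn z w = (\<Sum>e\<in>G. f e * cnj (inn e z))"
  using w z inn_sym[of _ z] E G by (auto simp: orthonormal_def intro!: sum.cong)
 also have "... = (\<Sum>e\<in>G. if e : F then cor ((cmod (f e))^2) else 0)"
 proof (intro sum.cong refl)
  fix e assume "e : G"
  then have "inn e z = (if e : F then f e else 0)"
  using F G by (intro inn_combination[OF E F(1) _ z]) auto
  then show "f e * cnj (inn e z) = (if e : F then cor ((cmod (f e))^2) else 0)"
  by (simp add: complex_norm_square del: of_real_power)
 qed
 also have "... = (\<Sum>e\<in>F. cor ((cmod (f e))^2))"
  using F G by (simp add: sum.If_cases Int_absorb1)
 finally show ?thesis by simp
qed

text \<open>Finite partial combinations whose square sums are within (1/2)^k of the total form a
  Cauchy sequence; its limit has the prescribed coefficients because inner products are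
  continuous.\<close>

lemma Riesz_Fischer:
 assumes E: "orthonormal E" and s: "((%e. (cmod (f e))^2) has_sum s) E"
 shows "EX x:H. (ALL e:E. inn e x = f e) & sqnorm x = s"
proof -
 let ?g = "%e. (cmod (f e))^2"
 have "ALL k. EX F. finite F & F <= E & dist (sum ?g F) s <= (1/2)^k"
  using has_sum_finite_approximation[OF s] by simp
 then obtain F where F: "!!k. finite (F k)" "!!k. F k <= E" "!!k. dist (sum ?g (F k)) s <= (1/2)^k" by metis
 \<comment> \<open>Unions make the finite sets nested, as needed for comparing two partial
   combinations.\<close>
 define G where "G k = (\<Union>j\<le>k. F j)" for k
 have G: "finite (G k)" "G k <= E" for k using F by (auto simp: G_def)
 have Gmono: "G k <= G l" if "k <= l" for k l using that by (force simp: G_def)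
 have Gle: "sum ?g (G k) <= s" for k
  by (rule finite_sum_le_has_sum[OF s G]) auto
 have Gge: "s - (1/2)^k <= sum ?g (G k)" for k
 proof -
  have "sum ?g (F k) <= sum ?g (G k)" using G by (intro sum_mono2) (auto simp: G_def)
  then show ?thesis using F(3)[of k] by (auto simp: dist_real_def abs_le_iff)
 qed
 have "ALL k. EX z. z : H & (ALL x:H. inn x z = (\<Sum>e\<in>G k. f e * inn x e))"
  using linear_combination[OF G(1)] G(2) E unfolding orthonormal_def by (metis subset_trans)
 from choice[OF this] obtain Z where Z: "!!k. Z k : H" "!!k. ALL x:H. inn x (Z k) = (\<Sum>e\<in>G k. f e * inn x e)" by blast
 have ZZ: "sqnorm (diff (Z l) (Z k)) <= (1/2)^k" if "k <= l" for k l
 proof -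
  have "sqnorm (diff (Z l) (Z k)) = sum ?g (G l) + sum ?g (G k) - 2 * sum ?g (G k)"
  using inn_combinations[OF E G(1) Gmono[OF that] G(1,2) Z Z] inn_combinations[OF E G(1) order_refl G(1,2) Z Z]
  inn_sym[OF Z(1)[of k] Z(1)[of l]]
  by (simp add: sqnorm_diff[OF Z(1) Z(1)]) (simp add: sqnorm_def)
  then show ?thesis using Gle[of l] Gge[of k] by simp
 qed
 have half: "EX K. ALL k>=K. (1/2)^k < e" if "e > 0" for e :: real
 proof -
  have "(%k. (1/2::real)^k) ~~> 0" by (rule LIMSEQ_realpow_zero) auto
  then have "eventually (%k. (1/2)^k < e) sequentially" using that by (rule order_tendstoD)
  then show ?thesis by (simp add: eventually_sequentially)
 qed
 have "EX x:H. (%k. Re (inn (add (Z k) (smul (-1) x)) (add (Z k) (smul (-1) x)))) ~~> 0"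
 proof (rule complete[OF Z(1)])
  fix e :: real assume "e > 0"
  then obtain K where K: "!!k. k >= K ==> (1/2)^k < e" using half by auto
  have "sqnorm (diff (Z i) (Z j)) < e" if "i >= K" "j >= K" for i j
  using ZZ[of i j] ZZ[of j i] K[OF that(1)] K[OF that(2)] sqnorm_diff_commute[OF Z(1)[of i] Z(1)[of j]]
  by (cases "i <= j") auto
  then show "EX N. ALL i>=N. ALL j>=N. Re (inn (add (Z i) (smul (-1) (Z j))) (add (Z i) (smul (-1) (Z j)))) < e"
  by (auto simp: sqnorm_def diff_def)
 qed
 then obtain x where x: "x : H" and lim: "(%k. sqnorm (diff (Z k) x)) ~~> 0"
  by (auto simp: sqnorm_def diff_def)
 have "inn e x = f e" if e: "e : E" for e
 proof -
  have "(%k. inn e (Z k)) ~~> inn e x"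
  using e E Z x lim by (intro inn_tendsto) (auto simp: orthonormal_def)
  moreover have "(%k. inn e (Z k)) ~~> f e"
  proof (cases "EX K. e : G K")
  case True
  then obtain K where "e : G K" by blast
  then have "inn e (Z k) = f e" if "k >= K" for k
  using inn_combination[OF E G Z e, of k] Gmono[OF that] by auto
  then show ?thesis by (intro tendsto_eventually) (auto simp: eventually_sequentially)
  next
  case False
  \<comment> \<open>An index that is never picked up contributes at most the remaining tail (1/2)^k
    for every k, so its coefficient is 0.\<close>
  have "?g e <= (1/2)^k" for k
  proof -
  have "sum ?g (insert e (G k)) <= s" using e G by (intro finite_sum_le_has_sum[OF s]) auto
  then show ?thesis using False G[of k] Gge[of k] by simp
  qed
  then have "\<not> 0 < ?g e" using half[of "?g e"] by (meson linorder_not_less order_refl)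
  then have "f e = 0" by simp
  moreover have "inn e (Z k) = 0" for k using False inn_combination[OF E G Z e, of k] by auto
  ultimately show ?thesis by simp
  qed
  ultimately show ?thesis by (rule LIMSEQ_unique)
 qed
 moreover have "sqnorm x = s"
 proof -
  have 1: "(%k. inn x (Z k)) ~~> inn x x" using Z x lim by (intro inn_tendsto) auto
  have "inn x (Z k) = cor (sum ?g (G k))" for k
  proof -
  have "inn x (Z k) = (\<Sum>e\<in>G k. f e * cnj (inn e x))"
  using Z(2) x inn_sym[of _ x] E G(2)[of k] by (auto simp: orthonormal_def intro!: sum.cong)
  also have "... = (\<Sum>e\<in>G k. cor (?g e))"
  using calculation G(2)[of k] \<open>!!e. e : E ==> inn e x = f e\<close>
  by (intro sum.cong) (auto simp: complex_norm_square subset_iff simp del: of_real_power)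
  finally show ?thesis by simp
  qed
  then have "(%k. sum ?g (G k)) ~~> sqnorm x"
  using tendsto_Re[OF 1] by (simp add: sqnorm_def)
  moreover have "(%k. sum ?g (G k)) ~~> s"
  proof (rule tendsto_sandwich[OF _ _ _ tendsto_const])
  have "(%k. s - (1/2)^k) ~~> s - 0"
  by (intro tendsto_intros LIMSEQ_realpow_zero) auto
  then show "(%k. s - (1/2)^k) ~~> s" by simp
  qed (use Gle Gge in auto)
  ultimately show ?thesis by (rule LIMSEQ_unique)
 qed
 ultimately show ?thesis using x by blast
qed

lemma Bessel:
 assumes E: "orthonormal E" and x: "x : H"
 shows "(%e. (cmod (inn e x))^2) summable_on E"
proof (rule nonneg_bdd_above_summable_on)
 show "bdd_above (sum (%e. (cmod (inn e x))^2) ` {F. F <= E & finite F})"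
 proof (rule bdd_aboveI2)
  fix F assume "F : {F. F <= E & finite F}"
  then have F: "finite F" "F <= E" by auto
  then have FH: "F <= H" using E by (auto simp: orthonormal_def)
  obtain z where z: "z : H" "ALL y:H. inn y z = (\<Sum>e\<in>F. inn e x * inn y e)"
  using linear_combination[OF F(1) FH, of "%e. inn e x"] by blast
  have "inn x z = (\<Sum>e\<in>F. inn e x * cnj (inn e x))"
  using z x FH inn_sym[of _ x] by (auto intro!: sum.cong)
  also have "... = cor (\<Sum>e\<in>F. (cmod (inn e x))^2)"
  by (simp add: complex_norm_square del: of_real_power)
  finally have "Re (inn x z) = (\<Sum>e\<in>F. (cmod (inn e x))^2)" by (simp only: Re_complex_of_real)
  moreover have "sqnorm z = (\<Sum>e\<in>F. (cmod (inn e x))^2)"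
  using inn_combinations[OF E F(1) order_refl F z z] by (simp add: sqnorm_def)
  ultimately show "(\<Sum>e\<in>F. (cmod (inn e x))^2) <= sqnorm x"
  using sqnorm_nonneg[of "diff x z"] x z by (simp add: sqnorm_diff)
 qed
qed auto

text \<open>Zorn's lemma; a vector orthogonal to a maximal family could be normalised and adjoined
  unless it has norm 0.\<close>

lemma ex_maximal_orthonormal:
 "EX E. orthonormal E & (ALL x:H. (ALL e:E. inn e x = 0) --> sqnorm x = 0)"
proof -
 have "EX E:Collect orthonormal. ALL X:Collect orthonormal. E <= X --> X = E"
 proof (rule subset_Zorn')
  fix C assume C: "subset.chain (Collect orthonormal) C"
  have "inn e f = (if e = f then 1 else 0)" if "e : X" "X : C" "f : Y" "Y : C" for e f X Y
  proof -
  have "X <= Y \<or> Y <= X" using C that by (auto simp: subset.chain_def)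
  moreover have "orthonormal X" "orthonormal Y" using C that by (auto simp: subset.chain_def)
  ultimately show ?thesis using that by (auto dest: orthonormalD)
  qed
  moreover have "X <= H" if "X : C" for X
  proof -
  have "orthonormal X" using C that by (auto simp: subset.chain_def)
  then show ?thesis by (simp add: orthonormal_def)
  qed
  ultimately have "\<Union>C <= H" "ALL e:\<Union>C. ALL f:\<Union>C. inn e f = (if e = f then 1 else 0)" by blast+
  then show "\<Union>C : Collect orthonormal" by (simp add: orthonormal_def)
 qed
 then obtain E where E: "orthonormal E" and max: "!!X. orthonormal X ==> E <= X ==> X = E" by auto
 have "sqnorm x = 0" if x: "x : H" and perp: "ALL e:E. inn e x = 0" for x
 proof (rule ccontr)
  assume "sqnorm x ~= 0"
  then have pos: "sqnorm x > 0" using x by (simp add: order_less_le)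
  define u where "u = smul (cor (1 / sqrt (sqnorm x))) x"
  have u: "u : H" using x by (simp add: u_def smul_closed)
  define a where "a = 1 / sqrt (sqnorm x)"
  have a: "a * a * sqnorm x = 1" using pos by (simp add: a_def field_simps)
  have xx: "inn x x = cor (sqnorm x)" using inn_self[OF x] by (simp add: sqnorm_def)
  have "inn u u = cor (a * a * sqnorm x)"
  using x unfolding u_def a_def[symmetric] by (simp add: inn_smul inn_smul_left smul_closed xx)
  then have uu: "inn u u = 1" using a by simp
  have eu: "inn e u = 0" "inn u e = 0" if "e : E" for e
  using that x perp E inn_sym[of e u] u by (auto simp: u_def inn_smul orthonormal_def)
  have "orthonormal (insert u E)" using E u uu eu by (auto simp: orthonormal_def)
  then have "u : E" using max[of "insert u E"] by auto
  then show False using eu uu by force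
 qed
 then show ?thesis using E by blast
qed

end

section \<open>The standard representation\<close>

text \<open>An intrinsic description, without a Hilbert space, of the algebras for which the
  standard representation on L^2(M) has its image equal to the bicommutant.\<close>

locale tracial_W_algebra = star_alg +
 assumes trc_one: "trc M \<one> = 1"
  and bounded_complete: "bounded_vectors_complete M"
  and pos_squares: "positive_squares M"
begin

text \<open>Vectors of the trace-norm completion are the Cauchy sequences themselves; sequences with
  null difference become equal only after passing to coordinates by \<open>V\<close>.\<close>

definition L2 :: "(nat => 'a) set" where
 "L2 = {xi. L2_Cauchy M xi}"

definition linn :: "(nat => 'a) => (nat => 'a) => complex" where
 "linn xi et = lim (%k. ip (xi k) (et k))"

abbreviation ladd :: "(nat => 'a) => (nat => 'a) => nat => 'a" where
 "ladd xi et \<equiv> %k. xi k \<oplus> et k"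

abbreviation lsmul :: "complex => (nat => 'a) => nat => 'a" where
 "lsmul a xi \<equiv> %k. scal M a (xi k)"

lemma L2_D: "xi : L2 ==> e > 0 ==> EX N. ALL i>=N. ALL j>=N. n2 (xi i \<ominus> xi j) < e"
 by (simp add: L2_def L2_Cauchy_def)

lemma L2_I: "(!!k. xi k : car M) ==> (!!e. e > 0 ==> EX N. ALL i>=N. ALL j>=N. n2 (xi i \<ominus> xi j) < e) ==> xi : L2"
 by (simp add: L2_def L2_Cauchy_def)

lemma L2_carrier [simp]: "xi : L2 ==> xi k : car M"
 by (simp add: L2_def L2_Cauchy_def)

lemma L2_bounded: "xi : L2 ==> EX B>0. ALL k. n2 (xi k) <= B"
proof -
 assume xi: "xi : L2"
 obtain N where N: "!!i j. i >= N ==> j >= N ==> n2 (xi i \<ominus> xi j) < 1" using L2_D[OF xi, of 1] by auto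
 define B where "B = Max ((%k. n2 (xi k)) ` {..N}) + 1"
 have le: "n2 (xi k) <= B - 1" if "k <= N" for k
  using that unfolding B_def by (auto intro!: Max_ge)
 have "n2 (xi k) <= B" for k
 proof (cases "k <= N")
  case False
  then show ?thesis using n2_le_add_minus[of "xi k" "xi N"] N[of k N] le[of N] xi by simp
 qed (use le in force)
 moreover have "B > 0" using le[of N] n2_nonneg[OF L2_carrier[OF xi, of N]] by linarith
 ultimately show ?thesis by blast
qed

lemma ip_diff_le:
 assumes "x : car M" "y : car M" "u : car M" "v : car M"
 shows "cmod (ip x y - ip u v) <= n2 x * n2 (y \<ominus> v) + n2 (x \<ominus> u) * n2 v"
proof -
 have "ip x y - ip u v = ip x (y \<ominus> v) + ip (x \<ominus> u) v" using assms by (simp add: ip_simps)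
 then show ?thesis
  using Cauchy_Schwarz_ip[of x "y \<ominus> v"] Cauchy_Schwarz_ip[of "x \<ominus> u" v] assms
  norm_triangle_ineq[of "ip x (y \<ominus> v)" "ip (x \<ominus> u) v"] by simp
qed

lemma linn_tendsto:
 assumes xi: "xi : L2" and et: "et : L2"
 shows "(%k. ip (xi k) (et k)) ~~> linn xi et"
proof -
 obtain B C where B: "B > 0" "!!k. n2 (xi k) <= B" and C: "C > 0" "!!k. n2 (et k) <= C"
  using L2_bounded[OF xi] L2_bounded[OF et] by auto
 have "Cauchy (%k. ip (xi k) (et k))"
 proof (rule CauchyI)
  fix e :: real assume e: "0 < e"
  obtain N where N: "!!i j. i >= N ==> j >= N ==> n2 (xi i \<ominus> xi j) < e / (2 * C)"
  using L2_D[OF xi, of "e / (2 * C)"] e C by auto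
  obtain K where K: "!!i j. i >= K ==> j >= K ==> n2 (et i \<ominus> et j) < e / (2 * B)"
  using L2_D[OF et, of "e / (2 * B)"] e B by auto
  have "cmod (ip (xi i) (et i) - ip (xi j) (et j)) < e" if ij: "i >= max N K" "j >= max N K" for i j
  proof -
  have "n2 (xi i) * n2 (et i \<ominus> et j) <= B * n2 (et i \<ominus> et j)"
  using B et by (intro mult_right_mono) auto
  also have "... < B * (e / (2 * B))" using B K[of i j] ij by (intro mult_strict_left_mono) auto
  finally have 1: "n2 (xi i) * n2 (et i \<ominus> et j) < e / 2" using B by simp
  have "n2 (xi i \<ominus> xi j) * n2 (et j) <= n2 (xi i \<ominus> xi j) * C"
  using C xi by (intro mult_left_mono) auto
  also have "... < (e / (2 * C)) * C" using C N[of i j] ij by (intro mult_strict_right_mono) auto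
  finally have 2: "n2 (xi i \<ominus> xi j) * n2 (et j) < e / 2" using C by simp
  show ?thesis using ip_diff_le[of "xi i" "et i" "xi j" "et j"] 1 2 xi et by simp
  qed
  then show "EX M. ALL m>=M. ALL n>=M. norm (ip (xi m) (et m) - ip (xi n) (et n)) < e" by blast
 qed
 then show ?thesis unfolding linn_def using Cauchy_convergent_iff convergent_LIMSEQ_iff by blast
qed

lemma linn_eqI: "xi : L2 ==> et : L2 ==> (%k. ip (xi k) (et k)) ~~> l ==> linn xi et = l"
 using linn_tendsto LIMSEQ_unique by blast

lemma ladd_L2: "xi : L2 ==> et : L2 ==> ladd xi et : L2"
proof (rule L2_I)
 fix e :: real assume xi: "xi : L2" and et: "et : L2" and e: "e > 0"
 obtain N where N: "!!i j. i >= N ==> j >= N ==> n2 (xi i \<ominus> xi j) < e / 2"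
  using L2_D[OF xi, of "e / 2"] e by auto
 obtain K where K: "!!i j. i >= K ==> j >= K ==> n2 (et i \<ominus> et j) < e / 2"
  using L2_D[OF et, of "e / 2"] e by auto
 have "n2 ((xi i \<oplus> et i) \<ominus> (xi j \<oplus> et j)) < e" if "i >= max N K" "j >= max N K" for i j
  using N[of i j] K[of i j] that n2_triangle[of "xi i \<ominus> xi j" "et i \<ominus> et j"] xi et by (simp add: minus_add_minus)
 then show "EX N. ALL i>=N. ALL j>=N. n2 ((xi i \<oplus> et i) \<ominus> (xi j \<oplus> et j)) < e" by blast
qed simp

lemma L2_Lipschitz_map:
 assumes xi: "xi : L2" and h: "!!k. h k : car M" "!!i j. n2 (h i \<ominus> h j) <= C * n2 (xi i \<ominus> xi j)"
 shows "h : L2"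
proof (rule L2_I[OF h(1)])
 fix e :: real assume e: "e > 0"
 define D where "D = max C 1"
 have D: "D > 0" by (simp add: D_def)
 obtain N where N: "!!i j. i >= N ==> j >= N ==> n2 (xi i \<ominus> xi j) < e / D"
  using L2_D[OF xi, of "e / D"] e D by auto
 have "n2 (h i \<ominus> h j) < e" if "i >= N" "j >= N" for i j
 proof -
  have "C * n2 (xi i \<ominus> xi j) <= D * n2 (xi i \<ominus> xi j)" using xi by (intro mult_right_mono) (auto simp: D_def)
  also have "... < D * (e / D)" using N[OF that] D by (intro mult_strict_left_mono)
  finally show ?thesis using h(2)[of i j] D by simp
 qed
 then show "EX N. ALL i>=N. ALL j>=N. n2 (h i \<ominus> h j) < e" by blast
qed

lemma lsmul_L2: "xi : L2 ==> lsmul a xi : L2"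
 by (rule L2_Lipschitz_map[where C="cmod a"]) (auto simp: scal_minus[symmetric] n2_scal)

lemma lmul_L2: "xi : L2 ==> x : car M ==> (%k. x \<otimes> xi k) : L2"
 by (rule L2_Lipschitz_map[where C="opn M x"]) (auto simp: minus_mult_right[symmetric] opn_bound)

lemma rmul_L2: "xi : L2 ==> x : car M ==> (%k. xi k \<otimes> x) : L2"
 by (rule L2_Lipschitz_map[where C="opn M x"]) (auto simp: minus_mult_left[symmetric] mult.commute[of "opn M x"] intro: opn_bound_right)

lemma const_L2 [simp]: "x : car M ==> (%_. x) : L2"
 by (rule L2_I) auto

lemma minus_as_ladd: "xi : L2 ==> et : L2 ==> ladd xi (lsmul (-1) et) = (%k. xi k \<ominus> et k)"
 by (simp add: minus_eq_scal)

lemma lminus_L2: "xi : L2 ==> et : L2 ==> (%k. xi k \<ominus> et k) : L2"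
 using ladd_L2[OF _ lsmul_L2, of xi et "-1"] by (simp add: minus_as_ladd)

lemma linn_self_tendsto: "xi : L2 ==> (%k. (n2 (xi k))^2) ~~> Re (linn xi xi)"
 using tendsto_Re[OF linn_tendsto, of xi xi] by (simp add: n2_sq)

sublocale L2: semi_hilbert L2 ladd lsmul "%_. \<zero>" linn
proof
 fix xi et \<zeta> a assume xi: "xi : L2" and et: "et : L2"
 show "ladd xi et : L2" using xi et by (rule ladd_L2)
 show "linn xi (lsmul a et) = a * linn xi et"
  using tendsto_mult[OF tendsto_const[of a] linn_tendsto[OF xi et]] xi et
  by (intro linn_eqI lsmul_L2) (auto simp: ip_simps)
 show "linn et xi = cnj (linn xi et)"
 proof (rule linn_eqI[OF et xi])
  have "(%k. cnj (ip (xi k) (et k))) ~~> cnj (linn xi et)" using linn_tendsto[OF xi et] by (rule tendsto_cnj)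
  then show "(%k. ip (et k) (xi k)) ~~> cnj (linn xi et)" using xi et by (simp add: ip_sym[of "xi _" "et _"])
 qed
 show "(cmod (linn xi et))^2 <= Re (linn xi xi) * Re (linn et et)"
 proof (rule tendsto_le[OF _ tendsto_mult[OF linn_self_tendsto linn_self_tendsto] tendsto_power[OF tendsto_norm[OF linn_tendsto]]])
  show "\<forall>\<^sub>F k in sequentially. (cmod (ip (xi k) (et k)))^2 <= (n2 (xi k))^2 * (n2 (et k))^2"
  using Cauchy_Schwarz_ip[of "xi _" "et _"] xi et by (auto simp: power_mult_distrib[symmetric] intro!: always_eventually power_mono)
 qed (use xi et in auto)
 show "linn xi (ladd et \<zeta>) = linn xi et + linn xi \<zeta>" if \<zeta>: "\<zeta> : L2"
  using tendsto_add[OF linn_tendsto[OF xi et] linn_tendsto[OF xi \<zeta>]] xi et \<zeta>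
  by (intro linn_eqI ladd_L2) (auto simp: ip_simps)
next
 fix xi a assume xi: "xi : L2"
 show "lsmul a xi : L2" using xi by (rule lsmul_L2)
 show "linn xi (%_. \<zero>) = 0" using xi by (intro linn_eqI) auto
 show "0 <= Re (linn xi xi)"
  by (rule tendsto_lowerbound[OF linn_self_tendsto[OF xi]]) auto
next
 show "(%_. \<zero>) : L2" by simp
next
 fix X :: "nat => nat => 'a" assume X: "!!k. X k : L2" and C: "!!e. e > 0 ==> EX N. ALL i>=N. ALL j>=N.
  Re (linn (ladd (X i) (lsmul (-1) (X j))) (ladd (X i) (lsmul (-1) (X j)))) < e"
 have C': "EX N. ALL i>=N. ALL j>=N. EX K. ALL k>=K. n2 (X i k \<ominus> X j k) < e" if e: "e > 0" for e
 proof -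
  obtain N where N: "!!i j. i >= N ==> j >= N ==> Re (linn (%k. X i k \<ominus> X j k) (%k. X i k \<ominus> X j k)) < e\<^sup>2"
  using C[of "e\<^sup>2"] e X by (auto simp: minus_as_ladd)
  have "EX K. ALL k>=K. n2 (X i k \<ominus> X j k) < e" if ij: "i >= N" "j >= N" for i j
  proof -
  have "eventually (%k. (n2 (X i k \<ominus> X j k))^2 < e\<^sup>2) sequentially"
  using order_tendstoD(2)[OF linn_self_tendsto[OF lminus_L2[OF X X]] N[OF ij]] .
  then show ?thesis using e unfolding eventually_sequentially by (meson less_imp_le power_less_imp_less_base)
  qed
  then show ?thesis by blast
 qed
 have "ALL k. EX m. ALL i>=m. ALL j>=m. n2 (X k i \<ominus> X k j) < (1/2)^k" using L2_D[OF X] by simp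
 then obtain m where m: "!!k i j. i >= m k ==> j >= m k ==> n2 (X k i \<ominus> X k j) < (1/2)^k" by metis
 \<comment> \<open>The diagonal takes the k-th vector at a position where it is Cauchy within
   (1/2)^k.\<close>
 define x where "x k = X k (m k)" for k
 have xc: "x k : car M" for k using X by (simp add: x_def)
 have half: "EX K. ALL k>=K. (1/2)^k < e" if "e > 0" for e :: real
 proof -
  have "(%k. (1/2::real)^k) ~~> 0" by (rule LIMSEQ_realpow_zero) auto
  then have "eventually (%k. (1/2)^k < e) sequentially" using that by (rule order_tendstoD)
  then show ?thesis by (simp add: eventually_sequentially)
 qed
 have xX: "EX N. ALL i>=N. ALL j>=N. EX K. ALL k>=K. n2 (x i \<ominus> X j k) < e" if e: "e > 0" for e
 proof -
  obtain N where N: "!!i j. i >= N ==> j >= N ==> EX K. ALL k>=K. n2 (X i k \<ominus> X j k) < e/2"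
  using C'[of "e/2"] e by auto
  obtain L where L: "!!k. k >= L ==> (1/2)^k < e/2" using half[of "e/2"] e by auto
  have "EX K. ALL k>=K. n2 (x i \<ominus> X j k) < e" if ij: "i >= max N L" "j >= max N L" for i j
  proof -
  obtain K where K: "!!k. k >= K ==> n2 (X i k \<ominus> X j k) < e/2" using N[of i j] ij by auto
  have "n2 (x i \<ominus> X j k) < e" if k: "k >= max K (m i)" for k
  using n2_triangle_minus[of "x i" "X i k" "X j k"] xc X K[of k] k m[of i "m i" k] L[of i] ij
  by (simp add: x_def)
  then show ?thesis by blast
  qed
  then show ?thesis by blast
 qed
 have x: "x : L2"
 proof (rule L2_I[OF xc])
  fix e :: real assume e: "e > 0"
  obtain N where N: "!!i j. i >= N ==> j >= N ==> EX K. ALL k>=K. n2 (x i \<ominus> X j k) < e/2"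
  using xX[of "e/2"] e by auto
  have "n2 (x i \<ominus> x j) < e" if ij: "i >= N" "j >= N" for i j
  proof -
  obtain K where K: "!!k. k >= K ==> n2 (x i \<ominus> X j k) < e/2" using N[of i j] ij by auto
  obtain K' where K': "!!k. k >= K' ==> n2 (x j \<ominus> X j k) < e/2" using N[of j j] ij by auto
  show ?thesis
  using K[of "max K K'"] K'[of "max K K'"] n2_triangle_minus[of "x i" "X j (max K K')" "x j"] xc X
  by (simp add: n2_minus_commute[of "X j _" "x j"])
  qed
  then show "EX N. ALL i>=N. ALL j>=N. n2 (x i \<ominus> x j) < e" by blast
 qed
 have "(%j. Re (linn (%k. X j k \<ominus> x k) (%k. X j k \<ominus> x k))) ~~> 0"
 proof (rule LIMSEQ_I)
  fix r :: real assume r: "0 < r"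
  define e where "e = sqrt (r / 2)"
  have e: "e > 0" "e\<^sup>2 = r / 2" using r by (auto simp: e_def)
  obtain N where N: "!!i j. i >= N ==> j >= N ==> EX K. ALL k>=K. n2 (x i \<ominus> X j k) < e / 2"
  using xX[of "e/2"] e by auto
  obtain N' where N': "!!i j. i >= N' ==> j >= N' ==> n2 (x i \<ominus> x j) < e / 2"
  using L2_D[OF x, of "e/2"] e by auto
  have "norm (Re (linn (%k. X j k \<ominus> x k) (%k. X j k \<ominus> x k)) - 0) < r" if j: "j >= N" for j
  proof -
  define i where "i = max N N'"
  obtain K where K: "!!k. k >= K ==> n2 (x i \<ominus> X j k) < e / 2" using N[of i j] j by (auto simp: i_def)
  have "(n2 (X j k \<ominus> x k))^2 <= r / 2" if k: "k >= max K N'" for k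
  proof -
  have "n2 (X j k \<ominus> x k) <= e"
  proof -
  have "n2 (X j k \<ominus> x i) < e / 2" using K[of k] k xc X n2_minus_commute[of "X j k" "x i"] by simp
  moreover have "n2 (x i \<ominus> x k) < e / 2" using N'[of i k] k by (simp add: i_def)
  ultimately show ?thesis using n2_triangle_minus[of "X j k" "x i" "x k"] xc X by simp
  qed
  then show ?thesis using e xc X by (metis minus_closed L2_carrier n2_nonneg power_mono)
  qed
  then have "Re (linn (%k. X j k \<ominus> x k) (%k. X j k \<ominus> x k)) <= r / 2"
  by (intro tendsto_upperbound[OF linn_self_tendsto[OF lminus_L2[OF X x]]])
  (auto simp: eventually_sequentially intro!: exI[of _ "max K N'"])
  moreover have "0 <= Re (linn (%k. X j k \<ominus> x k) (%k. X j k \<ominus> x k))"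
  by (rule tendsto_lowerbound[OF linn_self_tendsto[OF lminus_L2[OF X x]]]) auto
  ultimately show ?thesis using r by simp
  qed
  then show "EX no. ALL n>=no. norm (Re (linn (%k. X n k \<ominus> x k) (%k. X n k \<ominus> x k)) - 0) < r" by blast
 qed
 then show "EX x:L2. (%k. Re (linn (ladd (X k) (lsmul (-1) x)) (ladd (X k) (lsmul (-1) x)))) ~~> 0"
  using X x by (intro bexI[of _ x]) (auto simp: minus_as_ladd)
qed

end

lemma has_sum_minus:
 fixes f g :: "'b => complex"
 assumes "(f has_sum a) A" "(g has_sum b) A"
 shows "((%x. f x - g x) has_sum (a - b)) A"
 using has_sum_add[OF assms(1), of "%x. - g x" "- b"] assms(2) by (simp add: has_sum_uminus)

context semi_hilbert
begin

text \<open>The parallelogram law with one square dropped; a triangle inequality that avoids square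
  roots.\<close>

lemma sqnorm_diff_triangle:
 assumes "a : H" "b : H" "c : H"
 shows "sqnorm (diff a b) <= 2 * sqnorm (diff a c) + 2 * sqnorm (diff c b)"
proof -
 have "sqnorm (diff a b) + sqnorm (diff (diff a c) (diff c b)) = 2 * sqnorm (diff a c) + 2 * sqnorm (diff c b)"
  using assms inn_sym[of a b] inn_sym[of a c] inn_sym[of b c]
  by (simp add: sqnorm_def inn_diff inn_diff_left)
 then show ?thesis using sqnorm_nonneg[OF diff_closed[OF diff_closed[OF assms(1,3)] diff_closed[OF assms(3,2)]]] by linarith
qed

lemma sqnorm_eq_of_null: "[|x : H; y : H; sqnorm (diff x y) = 0|] ==> sqnorm x = sqnorm y"
 using inn_eq_of_null[of x x y] inn_eq_of_null[of y x y] arg_cong[OF inn_sym[of x y], of Re] by (simp add: sqnorm_def)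

end

section \<open>Coordinates of L^2(M), the left representation and its bicommutant\<close>

context tracial_W_algebra
begin

lemma L2_diff: "xi : L2 ==> et : L2 ==> L2.diff xi et = (%k. xi k \<ominus> et k)"
 by (simp add: L2.diff_def minus_as_ladd)

lemma sqnorm_tendsto: "xi : L2 ==> (%k. (n2 (xi k))^2) ~~> L2.sqnorm xi"
 unfolding L2.sqnorm_def by (rule linn_self_tendsto)

lemma sqnorm_const: "x : car M ==> L2.sqnorm (%_. x) = (n2 x)^2"
 using sqnorm_tendsto[of "%_. x"] LIMSEQ_unique tendsto_const const_L2 by blast

definition EB :: "(nat => 'a) set" where
 "EB = (SOME E. L2.orthonormal E & (ALL x:L2. (ALL e:E. linn e x = 0) --> L2.sqnorm x = 0))"

lemma EB: "L2.orthonormal EB" "!!x. x : L2 ==> (!!e. e : EB ==> linn e x = 0) ==> L2.sqnorm x = 0"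
 using someI_ex[OF L2.ex_maximal_orthonormal] unfolding EB_def by blast+

lemma EB_L2: "e : EB ==> e : L2"
 using EB(1) by (auto simp: L2.orthonormal_def)

text \<open>\<open>tracial_vNa\<close> asks for a Hilbert space indexed by elements of the algebra.
  Each basis vector is labelled by an element at square distance at most 1/4. Equal labels would put
  two basis vectors at square distance at most 2/4 + 2/4 = 1, while distinct ones are at square
  distance 2; hence the labelling is injective.\<close>

definition idx :: "(nat => 'a) => 'a" where
 "idx e = (SOME x. x : car M & L2.sqnorm (L2.diff (%_. x) e) <= 1/4)"

lemma idx: "e : L2 ==> idx e : car M & L2.sqnorm (L2.diff (%_. idx e) e) <= 1/4"
 unfolding idx_def
proof (rule someI_ex)
 assume e: "e : L2"
 obtain N where N: "!!i j. i >= N ==> j >= N ==> n2 (e i \<ominus> e j) < 1/2" using L2_D[OF e, of "1/2"] by auto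
 have "(n2 (e N \<ominus> e k))^2 <= (1/2)^2" if "k >= N" for k
  using N[of N k] that e by (intro power_mono) auto
 then have "L2.sqnorm (L2.diff (%_. e N) e) <= 1/4"
  using e sqnorm_tendsto[OF lminus_L2[OF const_L2 e], of "e N"]
  by (intro tendsto_upperbound[OF sqnorm_tendsto]) (auto simp: L2_diff eventually_sequentially power2_eq_square lminus_L2 intro!: exI[of _ N])
 then show "EX x. x : car M & L2.sqnorm (L2.diff (%_. x) e) <= 1/4" using e by (intro exI[of _ "e N"]) auto
qed

lemma inj_idx: "inj_on idx EB"
proof (rule inj_onI, rule ccontr)
 fix e f assume e: "e : EB" and f: "f : EB" and eq: "idx e = idx f" and ne: "e ~= f"
 have "L2.sqnorm (L2.diff e f) = 2"
  using e f ne L2.orthonormalD[OF EB(1)] EB_L2 by (simp add: L2.sqnorm_diff) (simp add: L2.sqnorm_def)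
 moreover have "L2.sqnorm (L2.diff e f) <= 2 * L2.sqnorm (L2.diff e (%_. idx e)) + 2 * L2.sqnorm (L2.diff (%_. idx e) f)"
  using e f idx EB_L2 by (intro L2.sqnorm_diff_triangle) auto
 moreover have "L2.sqnorm (L2.diff e (%_. idx e)) <= 1/4"
  using idx[OF EB_L2[OF e]] EB_L2[OF e] L2.sqnorm_diff_commute[of e "%_. idx e"] by auto
 moreover have "L2.sqnorm (L2.diff (%_. idx e) f) <= 1/4"
  using idx[OF EB_L2[OF f]] eq by auto
 ultimately show False by simp
qed

definition IS :: "'a set" where "IS = idx ` EB"

definition V :: "(nat => 'a) => 'a => complex" where
 "V xi = (%s. if s : IS then linn (the_inv_into EB idx s) xi else 0)"

lemma V_idx: "e : EB ==> V xi (idx e) = linn e xi"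
 by (simp add: V_def IS_def the_inv_into_f_f[OF inj_idx])

lemma V_eqI: "(!!e. e : EB ==> linn e xi = linn e et) ==> V xi = V et"
proof (rule ext)
 fix s assume "!!e. e : EB ==> linn e xi = linn e et"
 then show "V xi s = V et s"
  by (cases "s : IS") (auto simp: IS_def V_idx, simp add: V_def IS_def)
qed

lemma V_null: "xi : L2 ==> et : L2 ==> L2.sqnorm (L2.diff xi et) = 0 ==> V xi = V et"
 using L2.inn_eq_of_null EB_L2 by (intro V_eqI) blast

text \<open>Parseval's identity: Riesz-Fischer rebuilds a vector from the coefficients, and its
  difference from the given vector is orthogonal to the whole basis, hence null.\<close>

lemma V_has_sum: assumes xi: "xi : L2"
 shows "((%s. (cmod (V xi s))^2) has_sum L2.sqnorm xi) IS"
proof -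
 define s where "s = (\<Sum>\<^sub>\<infinity>e\<in>EB. (cmod (linn e xi))^2)"
 have s: "((%e. (cmod (linn e xi))^2) has_sum s) EB"
  unfolding s_def by (rule has_sum_infsum[OF L2.Bessel[OF EB(1) xi]])
 obtain x where x: "x : L2" "ALL e:EB. linn e x = linn e xi" "L2.sqnorm x = s"
  using L2.Riesz_Fischer[OF EB(1) s] by blast
 have "L2.sqnorm (L2.diff xi x) = 0"
  using x xi EB_L2 by (intro EB(2)) (auto simp: L2.inn_diff)
 then have eq: "L2.sqnorm xi = s" using L2.sqnorm_eq_of_null[OF xi x(1)] x by simp
 show ?thesis
  unfolding eq IS_def has_sum_reindex[OF inj_idx] using s
  by (simp add: o_def V_idx cong: has_sum_cong)
qed

lemma V_ell2: "xi : L2 ==> V xi : ell2 IS"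
 using V_has_sum[of xi] by (auto simp: ell2_def V_def summable_on_def)

lemma V_eq_iff: "xi : L2 ==> et : L2 ==> V xi = V et <-> L2.sqnorm (L2.diff xi et) = 0"
proof
 assume xi: "xi : L2" and et: "et : L2" and eq: "V xi = V et"
 have "linn e xi = linn e et" if "e : EB" for e using V_idx[OF that] eq by metis
 then show "L2.sqnorm (L2.diff xi et) = 0" using xi et EB_L2 by (intro EB(2)) (auto simp: L2.inn_diff)
qed (rule V_null)

lemma V_surj: assumes f: "f : ell2 IS" shows "EX xi:L2. V xi = f"
proof -
 have "(%i. (cmod (f i))^2) summable_on IS" using f by (simp add: ell2_def)
 then have "(%e. (cmod (f (idx e)))^2) summable_on EB"
  unfolding IS_def summable_on_reindex[OF inj_idx] by (simp add: o_def)
 from L2.Riesz_Fischer[OF EB(1) has_sum_infsum[OF this]]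
 obtain xi where xi: "xi : L2" "ALL e:EB. linn e xi = f (idx e)" by blast
 have "V xi s = f s" for s
  using f xi by (cases "s : IS") (auto simp: IS_def V_idx, auto simp: V_def IS_def ell2_def)
 then show ?thesis using xi by blast
qed

lemma V_add: "xi : L2 ==> et : L2 ==> V (ladd xi et) = (%i. V xi i + V et i)"
proof (rule ext)
 fix s assume "xi : L2" "et : L2"
 then show "V (ladd xi et) s = V xi s + V et s"
  by (cases "s : IS") (auto simp: IS_def V_idx EB_L2 L2.inn_add, auto simp: V_def IS_def)
qed

lemma V_smul: "xi : L2 ==> V (lsmul a xi) = (%i. a * V xi i)"
proof (rule ext)
 fix s assume "xi : L2"
 then show "V (lsmul a xi) s = a * V xi s"
  by (cases "s : IS") (auto simp: IS_def V_idx EB_L2 L2.inn_smul, auto simp: V_def IS_def)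
qed

lemma ell2_norm_V: "xi : L2 ==> ell2_norm IS (V xi) = sqrt (L2.sqnorm xi)"
 by (simp add: ell2_norm_def infsumI[OF V_has_sum])

text \<open>Polarisation expresses the inner product by four square norms, for which Parseval's
  identity is already available.\<close>

lemma ell2_inner_V: assumes xi: "xi : L2" and et: "et : L2"
 shows "ell2_inner IS (V xi) (V et) = linn xi et"
proof -
 let ?q = "%a s. cor ((cmod (V (ladd xi (lsmul a et)) s))^2)"
 let ?Q = "%a. cor (L2.sqnorm (ladd xi (lsmul a et)))"
 have hs: "(?q a has_sum ?Q a) IS" for a
  using V_has_sum[OF ladd_L2[OF xi lsmul_L2[OF et]]] by (simp only: has_sum_of_real_iff)
 have sum: "((%s. (1/4) * ((?q 1 s - ?q (-1) s) - \<i> * (?q \<i> s - ?q (-\<i>) s))) has_sum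
  ((1/4) * ((?Q 1 - ?Q (-1)) - \<i> * (?Q \<i> - ?Q (-\<i>))))) IS"
  by (intro has_sum_cmult_right has_sum_minus hs)
 have polar: "(1/4) * ((cor ((cmod (u + v))^2) - cor ((cmod (u - v))^2))
  - \<i> * (cor ((cmod (u + \<i> * v))^2) - cor ((cmod (u - \<i> * v))^2))) = cnj u * v" for u v
  by (simp add: complex_norm_square algebra_simps del: of_real_power)
 have 1: "(1/4) * ((?q 1 s - ?q (-1) s) - \<i> * (?q \<i> s - ?q (-\<i>) s)) = cnj (V xi s) * V et s" for s
  using polar[of "V xi s" "V et s"] xi et by (simp add: V_add V_smul lsmul_L2 del: of_real_power)
 have sq: "?Q a = linn xi xi + a * linn xi et + cnj a * cnj (linn xi et) + cnj a * a * linn et et" for a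
 proof -
  have "?Q a = linn (ladd xi (lsmul a et)) (ladd xi (lsmul a et))"
  using L2.inn_self[OF ladd_L2[OF xi lsmul_L2[OF et, of a]]] by (simp add: L2.sqnorm_def)
  also have "... = linn xi xi + a * linn xi et + cnj a * linn et xi + cnj a * a * linn et et"
  using xi et by (simp add: L2.inn_add L2.inn_add_left L2.inn_smul L2.inn_smul_left ladd_L2 lsmul_L2)
  finally show ?thesis using L2.inn_sym[OF xi et] by simp
 qed
 have 2: "(1/4) * ((?Q 1 - ?Q (-1)) - \<i> * (?Q \<i> - ?Q (-\<i>))) = linn xi et"
  unfolding sq by (simp add: algebra_simps)
 show ?thesis unfolding ell2_inner_def using infsumI[OF sum] unfolding 1 2 .
qed

definition pre :: "('a => complex) => nat => 'a" where
 "pre f = (SOME xi. xi : L2 & V xi = f)"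

lemma pre: "f : ell2 IS ==> pre f : L2 & V (pre f) = f"
 using someI_ex[of "%xi. xi : L2 & V xi = f"] V_surj[of f] unfolding pre_def by blast

definition op_of :: "((nat => 'a) => (nat => 'a)) => 'a oper" where
 "op_of h = (%f. if f : ell2 IS then V (h (pre f)) else (%_. 0))"

definition bounded_linear_map :: "((nat => 'a) => (nat => 'a)) => bool" where
 "bounded_linear_map h <-> (ALL xi:L2. h xi : L2) & (ALL xi:L2. ALL et:L2. h (ladd xi et) = ladd (h xi) (h et)) &
  (ALL a. ALL xi:L2. h (lsmul a xi) = lsmul a (h xi)) & (EX C>=0. ALL xi:L2. L2.sqnorm (h xi) <= C * L2.sqnorm xi)"

text \<open>\<open>op_of\<close> uses one chosen preimage. Boundedness sends null vectors to null
  vectors, so every preimage gives the same value.\<close>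

lemma op_of_V:
 assumes h: "bounded_linear_map h" and xi: "xi : L2"
 shows "op_of h (V xi) = V (h xi)"
proof -
 obtain C where C: "C >= 0" "!!xi. xi : L2 ==> L2.sqnorm (h xi) <= C * L2.sqnorm xi"
  using h by (auto simp: bounded_linear_map_def)
 let ?et = "pre (V xi)"
 have et: "?et : L2" "V ?et = V xi" using pre[OF V_ell2[OF xi]] by auto
 have hL: "h xi : L2" "h ?et : L2" using h xi et by (auto simp: bounded_linear_map_def)
 have "L2.sqnorm (L2.diff ?et xi) = 0" using V_eq_iff[OF et(1) xi] et by simp
 moreover have "h (L2.diff ?et xi) = L2.diff (h ?et) (h xi)"
  using h xi et lsmul_L2[OF xi] unfolding L2.diff_def bounded_linear_map_def by metis
 ultimately have "L2.sqnorm (L2.diff (h ?et) (h xi)) <= 0"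
  using C(2)[OF L2.diff_closed[OF et(1) xi]] by simp
 then have "L2.sqnorm (L2.diff (h ?et) (h xi)) = 0"
  using L2.sqnorm_nonneg[OF L2.diff_closed[OF hL(2,1)]] by linarith
 then show ?thesis using V_null[OF hL(2,1)] V_ell2[OF xi] by (simp add: op_of_def)
qed

lemma op_of_bounded:
 assumes h: "bounded_linear_map h"
 shows "op_of h : bounded_opers IS"
proof -
 obtain C where C: "C >= 0" "!!xi. xi : L2 ==> L2.sqnorm (h xi) <= C * L2.sqnorm xi"
  using h by (auto simp: bounded_linear_map_def)
 have hL: "h xi : L2" if "xi : L2" for xi using h that by (auto simp: bounded_linear_map_def)
 have 1: "op_of h f : ell2 IS" if "f : ell2 IS" for f
  using pre[OF that] hL V_ell2 op_of_V[OF h] by metis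
 have 2: "op_of h (%i. f i + g i) = (%i. op_of h f i + op_of h g i)" if "f : ell2 IS" "g : ell2 IS" for f g
 proof -
  obtain xi et where L: "xi : L2" "et : L2" "V xi = f" "V et = g" using V_surj \<open>f : ell2 IS\<close> \<open>g : ell2 IS\<close> by blast
  have "op_of h (V (ladd xi et)) = V (ladd (h xi) (h et))"
  using L h op_of_V[OF h ladd_L2[OF L(1,2)]] by (simp add: bounded_linear_map_def)
  then show ?thesis using L hL by (simp add: V_add op_of_V[OF h, symmetric])
 qed
 have 3: "op_of h (%i. a * f i) = (%i. a * op_of h f i)" if "f : ell2 IS" for f a
 proof -
  obtain xi where L: "xi : L2" "V xi = f" using V_surj \<open>f : ell2 IS\<close> by blast
  have "op_of h (V (lsmul a xi)) = V (lsmul a (h xi))"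
  using L h op_of_V[OF h lsmul_L2[OF L(1)]] by (simp add: bounded_linear_map_def)
  then show ?thesis using L hL by (simp add: V_smul op_of_V[OF h, symmetric])
 qed
 have 4: "ell2_norm IS (op_of h f) <= sqrt C * ell2_norm IS f" if "f : ell2 IS" for f
 proof -
  obtain xi where L: "xi : L2" "V xi = f" using V_surj \<open>f : ell2 IS\<close> by blast
  show ?thesis using C(2)[OF L(1)] L hL
  by (simp add: op_of_V[OF h] ell2_norm_V real_sqrt_mult[symmetric] flip: L(2))
 qed
 have "op_of h f = (%_. 0)" if "f \<notin> ell2 IS" for f using that by (simp add: op_of_def)
 then show ?thesis using 1 2 3 4 unfolding bounded_opers_def by blast
qed

abbreviation lmul :: "'a => (nat => 'a) => nat => 'a" where "lmul x xi \<equiv> %k. x \<otimes> xi k"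
abbreviation rmul :: "'a => (nat => 'a) => nat => 'a" where "rmul x xi \<equiv> %k. xi k \<otimes> x"

lemma sqnorm_le:
 assumes "xi : L2" "et : L2" "!!k. n2 (et k) <= C * n2 (xi k)"
 shows "L2.sqnorm et <= C\<^sup>2 * L2.sqnorm xi"
proof (rule tendsto_le[OF _ tendsto_mult[OF tendsto_const sqnorm_tendsto] sqnorm_tendsto])
 show "\<forall>\<^sub>F k in sequentially. (n2 (et k))^2 <= C\<^sup>2 * (n2 (xi k))^2"
  using assms power_mono[OF assms(3)] by (auto simp: power_mult_distrib)
qed (use assms in auto)

lemma lmul_bounded: "x : car M ==> bounded_linear_map (lmul x)"
 unfolding bounded_linear_map_def
 by (auto simp: lmul_L2 r_distr scal_mult_right opn_bound intro!: exI[of _ "(opn M x)^2"] sqnorm_le)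

lemma rmul_bounded: "x : car M ==> bounded_linear_map (rmul x)"
 unfolding bounded_linear_map_def
 by (auto simp: rmul_L2 l_distr scal_mult_left opn_bound_right mult.commute[of "opn M x"] intro!: exI[of _ "(opn M x)^2"] sqnorm_le)

definition \<pi> :: "'a => 'a oper" where "\<pi> x = op_of (lmul x)"
definition \<rho> :: "'a => 'a oper" where "\<rho> x = op_of (rmul x)"

lemma \<pi>_V: "x : car M ==> xi : L2 ==> \<pi> x (V xi) = V (lmul x xi)"
 by (simp add: \<pi>_def op_of_V lmul_bounded)

lemma \<rho>_V: "x : car M ==> xi : L2 ==> \<rho> x (V xi) = V (rmul x xi)"
 by (simp add: \<rho>_def op_of_V rmul_bounded)

lemma \<pi>_bounded: "x : car M ==> \<pi> x : bounded_opers IS"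
 by (simp add: \<pi>_def op_of_bounded lmul_bounded)

lemma \<rho>_bounded: "x : car M ==> \<rho> x : bounded_opers IS"
 by (simp add: \<rho>_def op_of_bounded rmul_bounded)

lemma bounded_oper_eqI:
 assumes "S : bounded_opers IS" "T : bounded_opers IS" "!!xi. xi : L2 ==> S (V xi) = T (V xi)"
 shows "S = T"
proof (rule ext)
 fix f show "S f = T f"
  using assms V_surj[of f] unfolding bounded_opers_def by (cases "f : ell2 IS") auto
qed

lemma ell2_zero: "(%_. 0) : ell2 IS"
 by (simp add: ell2_def)

lemma bounded_oper_zero: "T : bounded_opers IS ==> T (%_. 0) = (%_. 0)"
proof -
 assume "T : bounded_opers IS"
 then have "ALL a. ALL f:ell2 IS. T (%i. a * f i) = (%i. a * T f i)"
  unfolding bounded_opers_def by blast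
 from bspec[OF spec[OF this, of 0] ell2_zero] show ?thesis by simp
qed

lemma comp_bounded:
 assumes S: "S : bounded_opers IS" and T: "T : bounded_opers IS"
 shows "S \<circ> T : bounded_opers IS"
proof -
 obtain B where B: "ALL f:ell2 IS. ell2_norm IS (S f) <= B * ell2_norm IS f" using S by (auto simp: bounded_opers_def)
 obtain C where C: "ALL f:ell2 IS. ell2_norm IS (T f) <= C * ell2_norm IS f" using T by (auto simp: bounded_opers_def)
 have "ell2_norm IS (S (T f)) <= (max B 0 * C) * ell2_norm IS f" if f: "f : ell2 IS" for f
 proof -
  have Tf: "T f : ell2 IS" using T f by (auto simp: bounded_opers_def)
  have "0 <= ell2_norm IS (T f)" by (simp add: ell2_norm_def infsum_nonneg)
  have "ell2_norm IS (S (T f)) <= B * ell2_norm IS (T f)" using B Tf by blast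
  also have "... <= max B 0 * ell2_norm IS (T f)" using \<open>0 <= _\<close> by (intro mult_right_mono) auto
  also have "... <= max B 0 * (C * ell2_norm IS f)" using C f by (intro mult_left_mono) auto
  finally show ?thesis by (simp add: mult.assoc)
 qed
 moreover have "S (T f) = (%_. 0)" if "f \<notin> ell2 IS" for f
  using T that bounded_oper_zero[OF S] by (simp add: bounded_opers_def)
 ultimately show ?thesis using S T unfolding bounded_opers_def by (auto simp: o_def)
qed

lemma \<pi>_\<rho>_commute: "x : car M ==> y : car M ==> \<pi> x \<circ> \<rho> y = \<rho> y \<circ> \<pi> x"
 by (rule bounded_oper_eqI) (auto intro!: comp_bounded \<pi>_bounded \<rho>_bounded simp: \<pi>_V \<rho>_V lmul_L2 rmul_L2 m_assoc)

lemma \<pi>_adjoint: "x : car M ==> is_adjoint IS (\<pi> x) (\<pi> (adj M x))"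
 unfolding is_adjoint_def
proof (intro ballI)
 fix f g assume x: "x : car M" and f: "f : ell2 IS" and g: "g : ell2 IS"
 obtain xi et where L: "xi : L2" "et : L2" "V xi = f" "V et = g" using V_surj[OF f] V_surj[OF g] by blast
 have "linn (lmul x xi) et = linn xi (lmul (adj M x) et)"
  using x L linn_tendsto[OF L(1) lmul_L2[OF L(2), of "adj M x"]]
  by (intro linn_eqI lmul_L2) (auto simp: adj_mult m_assoc)
 then show "ell2_inner IS (\<pi> x f) g = ell2_inner IS f (\<pi> (adj M x) g)"
  using x L by (simp add: \<pi>_V ell2_inner_V lmul_L2 flip: L(3,4))
qed

lemma const_tendsto: "xi : L2 ==> (%k. L2.sqnorm (L2.diff xi (%_. xi k))) ~~> 0"
proof (rule LIMSEQ_I)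
 fix r :: real assume xi: "xi : L2" and r: "0 < r"
 obtain N where N: "!!i j. i >= N ==> j >= N ==> n2 (xi i \<ominus> xi j) < sqrt (r/2)"
  using L2_D[OF xi, of "sqrt (r/2)"] r by auto
 have "norm (L2.sqnorm (L2.diff xi (%_. xi k)) - 0) < r" if k: "k >= N" for k
 proof -
  have D: "L2.diff xi (%_. xi k) : L2" using xi by simp
  have "(n2 (xi j \<ominus> xi k))^2 <= r/2" if "j >= N" for j
  using N[OF that k] xi r power_mono[of "n2 (xi j \<ominus> xi k)" "sqrt (r/2)" 2] by simp
  then have "L2.sqnorm (L2.diff xi (%_. xi k)) <= r/2"
  using xi by (intro tendsto_upperbound[OF sqnorm_tendsto[OF D]]) (auto simp: L2_diff eventually_sequentially)
  then show ?thesis using r L2.sqnorm_nonneg[OF D] by simp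
 qed
 then show "EX no. ALL n>=no. norm (L2.sqnorm (L2.diff xi (%_. xi n)) - 0) < r" by blast
qed

text \<open>T commutes with right multiplications, so it is determined on constants by the vector xi
  = T(1). Boundedness of T says that xi is left bounded, so xi is an element a by
  \<open>bounded_complete\<close>. Then T and left multiplication by a agree on constants, and by
  density everywhere.\<close>

lemma bicommutant:
 assumes T: "T : commutant IS (commutant IS (\<pi> ` car M))"
 shows "T : \<pi> ` car M"
proof -
 have TB: "T : bounded_opers IS" using T by (simp add: commutant_def)
 obtain B where B: "!!f. f : ell2 IS ==> ell2_norm IS (T f) <= B * ell2_norm IS f"
  using TB unfolding bounded_opers_def by blast
 have T\<rho>: "T (\<rho> y f) = \<rho> y (T f)" if "y : car M" for y f
 proof -
  have "\<rho> y : commutant IS (\<pi> ` car M)"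
  using that \<pi>_\<rho>_commute by (auto simp: commutant_def \<rho>_bounded)
  then have "T \<circ> \<rho> y = \<rho> y \<circ> T" using T by (simp add: commutant_def)
  then show ?thesis by (metis comp_apply)
 qed
 have Tell: "T (V xi) : ell2 IS" if "xi : L2" for xi using TB V_ell2[OF that] by (auto simp: bounded_opers_def)
 obtain xi where xi: "xi : L2" "V xi = T (V (%_. \<one>))" using V_surj[OF Tell[OF const_L2]] by auto
 have Ty: "T (V (%_. y)) = V (rmul y xi)" if y: "y : car M" for y
 proof -
  have "T (V (%_. y)) = T (\<rho> y (V (%_. \<one>)))" using y by (simp add: \<rho>_V)
  also have "... = \<rho> y (V xi)" by (simp only: T\<rho>[OF y] xi(2))
  finally show ?thesis using y xi(1) by (simp add: \<rho>_V)
 qed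
 have "L2_Cauchy M xi & (ALL y:car M. ALL e>0. EX N. ALL k>=N. n2 (xi k \<otimes> y) <= B * n2 y + e)"
 proof (intro conjI ballI allI impI)
  show "L2_Cauchy M xi" using xi by (simp add: L2_def)
  fix y and e :: real assume y: "y : car M" and e: "0 < e"
  have "ell2_norm IS (T (V (%_. y))) <= B * ell2_norm IS (V (%_. y))"
  using y by (intro B V_ell2) auto
  then have le: "sqrt (L2.sqnorm (rmul y xi)) <= B * n2 y"
  using y xi by (simp add: Ty ell2_norm_V rmul_L2 sqnorm_const)
  have "(%k. sqrt ((n2 (xi k \<otimes> y))^2)) ~~> sqrt (L2.sqnorm (rmul y xi))"
  by (intro tendsto_real_sqrt sqnorm_tendsto rmul_L2 xi y)
  then have "(%k. n2 (xi k \<otimes> y)) ~~> sqrt (L2.sqnorm (rmul y xi))" using xi y by simp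
  then have "eventually (%k. n2 (xi k \<otimes> y) < B * n2 y + e) sequentially"
  using le e by (intro order_tendstoD(2)) auto
  then show "EX N. ALL k>=N. n2 (xi k \<otimes> y) <= B * n2 y + e"
  by (auto simp: eventually_sequentially intro: less_imp_le)
 qed
 then obtain a where a: "a : car M" "(%k. n2 (xi k \<ominus> a)) ~~> 0"
  using bounded_complete unfolding bounded_vectors_complete_def by blast
 have xia: "L2.sqnorm (L2.diff xi (%_. a)) = 0"
 proof -
  have "(%k. (n2 (xi k \<ominus> a))^2) ~~> 0" using tendsto_power[OF a(2), of 2] by simp
  moreover have "(%k. (n2 (xi k \<ominus> a))^2) ~~> L2.sqnorm (L2.diff xi (%_. a))"
  using sqnorm_tendsto[OF L2.diff_closed[OF xi(1) const_L2[OF a(1)]]] xi a by (simp add: L2_diff)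
  ultimately show ?thesis by (rule LIMSEQ_unique[symmetric])
 qed
 have T\<pi>: "T (V (%_. y)) = \<pi> a (V (%_. y))" if y: "y : car M" for y
 proof -
  have "V xi = V (%_. a)" using V_null[OF xi(1) const_L2[OF a(1)] xia] .
  then have "\<rho> y (V xi) = \<rho> y (V (%_. a))" by simp
  then show ?thesis using y a(1) xi(1) by (simp add: Ty \<rho>_V \<pi>_V)
 qed
 have "T (V et) = \<pi> a (V et)" if et: "et : L2" for et
 proof -
  obtain \<zeta> where \<zeta>: "\<zeta> : L2" "V \<zeta> = T (V et)" using V_surj[OF Tell[OF et]] by auto
  \<comment> \<open>Since the two operators agree on constants, their difference at
    \<open>et\<close> equals their difference at \<open>D k\<close>, which is small because both are
    bounded and \<open>D k\<close> tends to 0.\<close>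
  define D where "D k = L2.diff et (%_. et k)" for k
  have D: "D k : L2" for k using et by (simp add: D_def)
  have VD: "V (D k) = (%i. V et i + V (lsmul (-1) (%_. et k)) i)" for k
  using et V_add[OF et lsmul_L2[OF const_L2]] by (simp add: D_def L2.diff_def)
  have TD: "T (V (D k)) = (%i. T (V et) i + T (V (lsmul (-1) (%_. et k))) i)" for k
  proof -
  have "V et : ell2 IS" "V (lsmul (-1) (%_. et k)) : ell2 IS" using et by (auto intro!: V_ell2)
  then show ?thesis using TB unfolding VD bounded_opers_def by blast
  qed
  have \<pi>D: "\<pi> a (V (D k)) = (%i. \<pi> a (V et) i + \<pi> a (V (lsmul (-1) (%_. et k))) i)" for k
  proof -
  have "V et : ell2 IS" "V (lsmul (-1) (%_. et k)) : ell2 IS" using et by (auto intro!: V_ell2)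
  then show ?thesis using \<pi>_bounded[OF a(1)] unfolding VD bounded_opers_def by blast
  qed
  have eqk: "T (V (lsmul (-1) (%_. et k))) = \<pi> a (V (lsmul (-1) (%_. et k)))" for k
  using T\<pi>[of "scal M (-1) (et k)"] et by simp
  have "L2.sqnorm (L2.diff \<zeta> (lmul a et)) <= (2 * B\<^sup>2 + 2 * (opn M a)^2) * L2.sqnorm (D k)" for k
  proof -
  obtain \<tau> where \<tau>: "\<tau> : L2" "V \<tau> = T (V (D k))" using V_surj[OF Tell[OF D]] by auto
  have "V (L2.diff \<zeta> (lmul a et)) = (%i. T (V et) i - \<pi> a (V et) i)"
  using \<zeta> a et lsmul_L2[OF lmul_L2[OF et a(1)]] by (simp add: L2.diff_def V_add V_smul lmul_L2 \<pi>_V)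
  also have "... = (%i. T (V (D k)) i - \<pi> a (V (D k)) i)" unfolding TD \<pi>D eqk by simp
  also have "... = V (L2.diff \<tau> (lmul a (D k)))"
  using \<tau> a D lsmul_L2[OF lmul_L2[OF D a(1)]] by (simp add: L2.diff_def V_add V_smul lmul_L2 \<pi>_V)
  finally have "L2.sqnorm (L2.diff \<zeta> (lmul a et)) = L2.sqnorm (L2.diff \<tau> (lmul a (D k)))"
  using V_eq_iff L2.sqnorm_eq_of_null \<zeta> \<tau> D et a lmul_L2 L2.diff_closed by meson
  also have "... <= 2 * L2.sqnorm (L2.diff \<tau> (%_. \<zero>)) + 2 * L2.sqnorm (L2.diff (%_. \<zero>) (lmul a (D k)))"
  using \<tau> D a by (intro L2.sqnorm_diff_triangle lmul_L2) auto
  also have "L2.sqnorm (L2.diff \<tau> (%_. \<zero>)) = L2.sqnorm \<tau>"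
  using \<tau> sqnorm_const[of \<zero>] L2.inn_nil by (simp add: L2.sqnorm_diff)
  also have "L2.sqnorm (L2.diff (%_. \<zero>) (lmul a (D k))) = L2.sqnorm (lmul a (D k))"
  using D a sqnorm_const[of \<zero>] L2.inn_nil[of "lmul a (D k)"] L2.inn_sym[of "lmul a (D k)" "%_. \<zero>"]
  by (simp add: L2.sqnorm_diff lmul_L2)
  also have "L2.sqnorm (lmul a (D k)) <= (opn M a)^2 * L2.sqnorm (D k)"
  using D a by (intro sqnorm_le lmul_L2) (auto simp: opn_bound)
  also have "L2.sqnorm \<tau> <= B\<^sup>2 * L2.sqnorm (D k)"
  proof -
  have "sqrt (L2.sqnorm \<tau>) <= B * sqrt (L2.sqnorm (D k))"
  using B[OF V_ell2[OF D[of k]]] unfolding \<tau>(2)[symmetric] ell2_norm_V[OF \<tau>(1)] ell2_norm_V[OF D] .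
  then have "(sqrt (L2.sqnorm \<tau>))^2 <= (B * sqrt (L2.sqnorm (D k)))^2"
  using \<tau> by (intro power_mono) auto
  then show ?thesis using \<tau> D by (simp add: power_mult_distrib)
  qed
  finally show ?thesis by (simp add: algebra_simps)
  qed
  moreover have "(%k. (2 * B\<^sup>2 + 2 * (opn M a)^2) * L2.sqnorm (D k)) ~~> 0"
  unfolding D_def by (rule tendsto_mult_right_zero[OF const_tendsto[OF et]])
  ultimately have "L2.sqnorm (L2.diff \<zeta> (lmul a et)) <= 0"
  by (intro LIMSEQ_le_const) auto
  then have "L2.sqnorm (L2.diff \<zeta> (lmul a et)) = 0"
  using L2.sqnorm_nonneg[OF L2.diff_closed[OF \<zeta>(1) lmul_L2[OF et a(1)]]] by linarith
  then have "V \<zeta> = V (lmul a et)" using V_null[OF \<zeta>(1) lmul_L2[OF et a(1)]] by simp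
  then show ?thesis using \<zeta> a et by (simp add: \<pi>_V)
 qed
 then have "T = \<pi> a" by (intro bounded_oper_eqI TB \<pi>_bounded a)
 then show ?thesis using a by blast
qed

lemma von_neumann_algebra_\<pi>: "von_neumann_algebra IS (\<pi> ` car M)"
 unfolding von_neumann_algebra_def
proof (intro conjI ballI)
 show "\<pi> ` car M <= bounded_opers IS" using \<pi>_bounded by blast
 show "EX T':\<pi> ` car M. is_adjoint IS T T'" if "T : \<pi> ` car M" for T
  using that \<pi>_adjoint by (metis imageE imageI adj_closed)
 show "commutant IS (commutant IS (\<pi> ` car M)) = \<pi> ` car M"
 proof
  show "\<pi> ` car M <= commutant IS (commutant IS (\<pi> ` car M))"
  proof
  fix T assume T: "T : \<pi> ` car M"
  then have "T : bounded_opers IS" using \<pi>_bounded by blast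
  moreover have "T \<circ> A = A \<circ> T" if "A : commutant IS (\<pi> ` car M)" for A
  using that T unfolding commutant_def by fastforce
  ultimately show "T : commutant IS (commutant IS (\<pi> ` car M))" by (simp add: commutant_def)
  qed
 qed (use bicommutant in blast)
qed

lemma oper_norm_\<pi>: assumes x: "x : car M" shows "oper_norm IS (\<pi> x) = opn M x"
proof (rule antisym)
 let ?A = "{f : ell2 IS. ell2_norm IS f <= 1}"
 have le: "ell2_norm IS (\<pi> x f) <= opn M x * ell2_norm IS f" if "f : ell2 IS" for f
 proof -
  obtain xi where L: "xi : L2" "V xi = f" using V_surj \<open>f : ell2 IS\<close> by blast
  have "L2.sqnorm (lmul x xi) <= (opn M x)^2 * L2.sqnorm xi"
  using L x by (intro sqnorm_le lmul_L2) (auto simp: opn_bound)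
  then have "sqrt (L2.sqnorm (lmul x xi)) <= sqrt ((opn M x)^2 * L2.sqnorm xi)" by simp
  then show ?thesis using L x by (simp add: \<pi>_V ell2_norm_V lmul_L2 real_sqrt_mult opn_nonneg flip: L(2))
 qed
 have ub: "ell2_norm IS (\<pi> x f) <= opn M x" if "f : ?A" for f
  using le[of f] that mult_left_mono[of "ell2_norm IS f" 1 "opn M x"] x by (simp add: opn_nonneg)
 have zA: "(%_. 0) : ?A" by (simp add: ell2_zero ell2_norm_def)
 then show "oper_norm IS (\<pi> x) <= opn M x"
  unfolding oper_norm_def using ub by (intro cSUP_least) auto
 have bdd: "bdd_above ((%f. ell2_norm IS (\<pi> x f)) ` ?A)" using ub by (intro bdd_aboveI2) auto
 show "opn M x <= oper_norm IS (\<pi> x)"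
 proof (rule opn_least[OF x])
  show "0 <= oper_norm IS (\<pi> x)"
  unfolding oper_norm_def by (rule cSUP_upper2[OF bdd zA]) (simp add: ell2_norm_def infsum_nonneg)
  fix y assume y: "y : car M"
  show "n2 (x \<otimes> y) <= oper_norm IS (\<pi> x) * n2 y"
  proof (cases "n2 y = 0")
  case True
  then show ?thesis using x y opn_bound[OF x y] by simp
  next
  case False
  then have pos: "n2 y > 0" using y n2_nonneg[of y] by linarith
  let ?z = "scal M (cor (1 / n2 y)) y"
  have z: "?z : car M" "n2 ?z = 1" using y pos by (auto simp: n2_scal norm_divide)
  have "V (%_. ?z) : ?A" using z by (simp add: V_ell2 ell2_norm_V sqnorm_const)
  then have "ell2_norm IS (\<pi> x (V (%_. ?z))) <= oper_norm IS (\<pi> x)"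
  unfolding oper_norm_def by (rule cSUP_upper[OF _ bdd])
  then have "n2 (x \<otimes> ?z) <= oper_norm IS (\<pi> x)"
  using x z by (simp add: \<pi>_V ell2_norm_V sqnorm_const)
  then show ?thesis using x y pos by (simp add: scal_mult_right n2_scal norm_divide field_simps)
  qed
 qed
qed

lemma vN_representation_\<pi>: "vN_representation M IS (\<pi> ` car M) \<pi>"
 unfolding vN_representation_def
proof (intro conjI ballI allI)
 show "von_neumann_algebra IS (\<pi> ` car M)" by (rule von_neumann_algebra_\<pi>)
 have "inj_on \<pi> (car M)"
 proof (rule inj_onI)
  fix x y assume x: "x : car M" and y: "y : car M" and "\<pi> x = \<pi> y"
  then have "V (%_. x) = V (%_. y)" using \<pi>_V[OF x, of "%_. \<one>"] \<pi>_V[OF y, of "%_. \<one>"] by simp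
  then have "L2.sqnorm (%_. x \<ominus> y) = 0" using x y V_eq_iff[of "%_. x" "%_. y"] by (simp add: L2_diff)
  then have "n2 (x \<ominus> y) = 0" using x y by (simp add: sqnorm_const)
  then show "x = y" using x y by (intro eq_of_n2_minus)
 qed
 then show "bij_betw \<pi> (car M) (\<pi> ` car M)" by (rule inj_on_imp_bij_betw)
 show "\<pi> \<one> = id_oper IS"
 proof (rule ext)
  fix f show "\<pi> \<one> f = id_oper IS f"
  proof (cases "f : ell2 IS")
  case True
  then obtain xi where L: "xi : L2" "V xi = f" using V_surj by blast
  have "(%k. \<one> \<otimes> xi k) = xi" using L by simp
  then show ?thesis using True L \<pi>_V[of \<one> xi] by (simp add: id_oper_def)
  qed (simp add: \<pi>_def op_of_def id_oper_def)
 qed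
next
 fix x y assume x: "x : car M" and y: "y : car M"
 show "\<pi> (x \<otimes> y) = \<pi> x \<circ> \<pi> y"
  by (rule bounded_oper_eqI) (use x y in \<open>auto intro!: comp_bounded \<pi>_bounded simp: \<pi>_V lmul_L2 m_assoc\<close>)
 show "\<pi> (x \<oplus> y) = (%f i. \<pi> x f i + \<pi> y f i)"
 proof (rule ext)
  fix f show "\<pi> (x \<oplus> y) f = (%i. \<pi> x f i + \<pi> y f i)"
  proof (cases "f : ell2 IS")
  case True
  then obtain xi where L: "xi : L2" "V xi = f" using V_surj by blast
  have "lmul (x \<oplus> y) xi = ladd (lmul x xi) (lmul y xi)" using L x y by (simp add: l_distr)
  then show ?thesis using L x y V_add[OF lmul_L2[OF L(1) x] lmul_L2[OF L(1) y]]
  by (simp add: \<pi>_V flip: L(2))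
  qed (simp add: \<pi>_def op_of_def)
 qed
next
 fix x a assume x: "x : car M"
 show "\<pi> (scal M a x) = (%f i. a * \<pi> x f i)"
 proof (rule ext)
  fix f show "\<pi> (scal M a x) f = (%i. a * \<pi> x f i)"
  proof (cases "f : ell2 IS")
  case True
  then obtain xi where L: "xi : L2" "V xi = f" using V_surj by blast
  have "lmul (scal M a x) xi = lsmul a (lmul x xi)" using L x by (simp add: scal_mult_left)
  then show ?thesis using L x V_smul[OF lmul_L2[OF L(1) x]] by (simp add: \<pi>_V flip: L(2))
  qed (simp add: \<pi>_def op_of_def)
 qed
next
 fix x assume x: "x : car M"
 show "is_adjoint IS (\<pi> x) (\<pi> (adj M x))" using x by (rule \<pi>_adjoint)
 show "opn M x = oper_norm IS (\<pi> x)" using x by (simp add: oper_norm_\<pi>)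
qed

end

section \<open>Positivity and normality of the trace\<close>

context tracial_W_algebra
begin

text \<open>By traciality y moves to the other side, which makes the quadratic form at y continuous
  in b for the trace norm.\<close>

lemma ip_conj_le:
 assumes "b : car M" "y : car M"
 shows "cmod (trc M (adj M y \<otimes> (b \<otimes> y))) <= n2 b * n2 (y \<otimes> adj M y)"
proof -
 have "trc M (adj M y \<otimes> (b \<otimes> y)) = trc M ((b \<otimes> y) \<otimes> adj M y)"
  using assms by (intro trc_comm) auto
 also have "... = ip (adj M b) (y \<otimes> adj M y)" using assms by (simp add: m_assoc)
 finally show ?thesis using Cauchy_Schwarz_ip[of "adj M b" "y \<otimes> adj M y"] assms by (simp add: n2_adj)
qed

definition nonneg :: "'a => bool" where
 "nonneg a <-> a : car M & adj M a = a & (ALL y:car M. 0 <= Re (trc M (adj M y \<otimes> (a \<otimes> y))))"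

lemma nonneg_square: "z : car M ==> nonneg (adj M z \<otimes> z)"
proof -
 assume z: "z : car M"
 have "0 <= Re (trc M (adj M y \<otimes> ((adj M z \<otimes> z) \<otimes> y)))" if "y : car M" for y
  using z that trc_pos[of "z \<otimes> y"] by (simp add: adj_mult m_assoc)
 then show ?thesis using z by (simp add: nonneg_def adj_mult)
qed

lemma nonneg_iff: "nonneg a <-> (EX z:car M. a = adj M z \<otimes> z)"
 using pos_squares nonneg_square unfolding positive_squares_def nonneg_def by blast

lemma nonneg_carrier: "nonneg a ==> a : car M"
 by (simp add: nonneg_def)

lemma conj_add:
 "[|a : car M; b : car M; y : car M|] ==>
  trc M (adj M y \<otimes> ((a \<oplus> b) \<otimes> y)) = trc M (adj M y \<otimes> (a \<otimes> y)) + trc M (adj M y \<otimes> (b \<otimes> y))"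
 by (simp add: l_distr r_distr trc_add)

lemma conj_minus:
 "[|a : car M; b : car M; y : car M|] ==>
  trc M (adj M y \<otimes> ((a \<ominus> b) \<otimes> y)) = trc M (adj M y \<otimes> (a \<otimes> y)) - trc M (adj M y \<otimes> (b \<otimes> y))"
 by (simp add: minus_mult_left minus_mult_right trc_minus)

lemma nonneg_add: "nonneg a ==> nonneg b ==> nonneg (a \<oplus> b)"
 by (simp add: nonneg_def adj_add conj_add)

lemma pos_le_iff: "x : car M ==> y : car M ==> pos_le M x y <-> nonneg (y \<ominus> x)"
proof
 assume x: "x : car M" and y: "y : car M"
 show "nonneg (y \<ominus> x)" if "pos_le M x y"
 proof -
  obtain z where z: "z : car M" "y = x \<oplus> (adj M z \<otimes> z)" using \<open>pos_le M x y\<close> by (auto simp: pos_le_def)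
  then have "y \<ominus> x = adj M z \<otimes> z" using x add_minus_cancel_right[of "adj M z \<otimes> z" x] by (simp add: a_comm)
  then show ?thesis using nonneg_square z by simp
 qed
 show "pos_le M x y" if h: "nonneg (y \<ominus> x)"
 proof -
  obtain z where z: "z : car M" "y \<ominus> x = adj M z \<otimes> z" using h nonneg_iff by blast
  then have "y = x \<oplus> (adj M z \<otimes> z)" using add_minus_cancel[of y x] x y by simp
  then show ?thesis using z by (auto simp: pos_le_def)
 qed
qed

lemma pos_le_trans:
 assumes "x : car M" "y : car M" "z : car M" "pos_le M x y" "pos_le M y z"
 shows "pos_le M x z"
proof -
 have "z \<ominus> x = (z \<ominus> y) \<oplus> (y \<ominus> x)" using assms by (intro minus_split)
 then show ?thesis using assms nonneg_add[of "z \<ominus> y" "y \<ominus> x"] by (simp add: pos_le_iff)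
qed

lemma pos_le_trc: "x : car M ==> y : car M ==> pos_le M x y ==> Re (trc M x) <= Re (trc M y)"
 by (auto simp: pos_le_def trc_add intro: trc_pos)

text \<open>With p = z* z, the quadratic form of q bounds the operator norm of z by the square root
  of |q|. Hence |p|_2^2 is at most |z|^2 |z|_2^2, that is |q| tr p at most: convergence of traces
  yields convergence in trace norm.\<close>

lemma dominated:
 assumes p: "nonneg p" and q: "q : car M" and pq: "nonneg (q \<ominus> p)"
 shows "(n2 p)^2 <= opn M q * Re (trc M p)" "opn M p <= opn M q"
proof -
 obtain z where z: "z : car M" "p = adj M z \<otimes> z" using p nonneg_iff by blast
 have pc: "p : car M" using p by (rule nonneg_carrier)
 have oz: "opn M z <= sqrt (opn M q)"
 proof (rule opn_least[OF z(1)])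
  fix y assume y: "y : car M"
  have "(n2 (z \<otimes> y))^2 = Re (trc M (adj M y \<otimes> (p \<otimes> y)))"
  using z y by (simp add: n2_sq adj_mult m_assoc)
  also have "... <= Re (trc M (adj M y \<otimes> (q \<otimes> y)))"
  using pq q pc y by (auto simp: nonneg_def conj_minus)
  also have "... <= cmod (ip y (q \<otimes> y))" by (rule complex_Re_le_cmod)
  also have "... <= n2 y * n2 (q \<otimes> y)" using q y by (intro Cauchy_Schwarz_ip) auto
  also have "... <= n2 y * (opn M q * n2 y)" using q y by (intro mult_left_mono opn_bound) auto
  also have "... = (sqrt (opn M q) * n2 y)^2" using q by (simp add: power_mult_distrib opn_nonneg power2_eq_square)
  finally show "n2 (z \<otimes> y) <= sqrt (opn M q) * n2 y"
  by (rule power2_le_imp_le) (use q y in \<open>simp add: opn_nonneg\<close>)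
 qed (use q in \<open>simp add: opn_nonneg\<close>)
 have sq: "opn M z * opn M z <= opn M q"
  using mult_mono[OF oz oz] q z by (simp add: opn_nonneg)
 have "n2 p <= opn M z * n2 z" using z opn_bound[of "adj M z" z] by (simp add: opn_adj)
 then have "(n2 p)^2 <= (opn M z * n2 z)^2" using pc by (intro power_mono) auto
 also have "... = (opn M z * opn M z) * Re (trc M p)" using z by (simp add: power_mult_distrib n2_sq power2_eq_square[of "opn M z"])
 also have "... <= opn M q * Re (trc M p)" using sq z trc_pos by (intro mult_right_mono) auto
 finally show "(n2 p)^2 <= opn M q * Re (trc M p)" .
 show "opn M p <= opn M q" using z opn_mult[of "adj M z" z] sq by (simp add: opn_adj)
qed

text \<open>An increasing sequence in D whose traces approach their supremum T is Cauchy in trace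
  norm by \<open>dominated\<close> and has a limit a in the algebra, with trace at most T. Any e in
  D has a common upper bound with each member of the sequence, and that bound is again close to a;
  so a bounds D from above, the supremum s is below a, and tr s <= T.\<close>

lemma normal_trace: "normal_trace M"
 unfolding normal_trace_def
proof (intro allI impI, elim conjE)
 fix D s assume ne: "D ~= {}" and sa: "D <= self_adjoints M"
  and dir: "ALL d:D. ALL e:D. EX g:D. pos_le M d g & pos_le M e g" and s: "is_sup M D s"
 let ?t = "%x. Re (trc M x)"
 have Dc: "d : car M" "adj M d = d" if "d : D" for d using sa that by (auto simp: self_adjoints_def)
 have sc: "s : car M" and ub: "!!d. d : D ==> pos_le M d s" using s by (auto simp: is_sup_def self_adjoints_def)
 have tle: "?t d <= ?t s" if "d : D" for d using pos_le_trc Dc sc ub that by blast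
 have bdd: "bdd_above (?t ` D)" using tle by (intro bdd_aboveI2)
 define T where "T = (SUP d\<in>D. ?t d)"
 have tT: "?t d <= T" if "d : D" for d unfolding T_def using that bdd by (rule cSUP_upper)
 obtain d0 where d0: "d0 : D" using ne by blast
 \<comment> \<open>An element of nearly maximal trace is raised by directedness above the current
   one, so the sequence increases while its traces approach T.\<close>
 have step: "EX e. e : D & pos_le M d e & T - 1 / (real k + 1) < ?t e" if d: "d : D" for d k
 proof -
  have "T - 1 / (real k + 1) < T" by simp
  then obtain e where e: "e : D" "T - 1 / (real k + 1) < ?t e"
  unfolding T_def using less_cSUP_iff[OF ne bdd] by auto
  obtain g where g: "g : D" "pos_le M d g" "pos_le M e g" using dir d e by blast
  then have "?t e <= ?t g" using pos_le_trc Dc e by blast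
  then show ?thesis using g e by auto
 qed
 have "EX f. f 0 = d0 & (ALL k. f k : D & (pos_le M (f k) (f (Suc k)) & T - 1 / (real k + 1) < ?t (f (Suc k))))"
 proof -
  define f where "f = rec_nat d0 (%k d. SOME e. e : D & pos_le M d e & T - 1 / (real k + 1) < ?t e)"
  have fS: "f (Suc k) = (SOME e. e : D & pos_le M (f k) e & T - 1 / (real k + 1) < ?t e)" for k by (simp add: f_def)
  have fD: "f k : D" for k
  proof (induction k)
  case 0 then show ?case using d0 by (simp add: f_def)
  next
  case (Suc k) then show ?case using someI_ex[OF step[OF Suc, of k]] fS by simp
  qed
  have "pos_le M (f k) (f (Suc k)) & T - 1 / (real k + 1) < ?t (f (Suc k))" for k
  using someI_ex[OF step[OF fD[of k], of k]] fS[of k] by simp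
  then show ?thesis using fD by (intro exI[of _ f]) (auto simp: f_def)
 qed
 then obtain d where d: "d 0 = d0" "!!k. d k : D" "!!k. pos_le M (d k) (d (Suc k))"
  "!!k. T - 1 / (real k + 1) < ?t (d (Suc k))" by blast
 have dc: "d k : car M" for k using d Dc by blast
 have refl: "pos_le M x x" if "x : car M" for x using that by (auto simp: pos_le_def intro!: bexI[of _ \<zero>])
 have mono: "pos_le M (d k) (d l)" if "k <= l" for k l
  using that by (induction rule: dec_induct) (use refl dc d(3) pos_le_trans in blast)+
 \<comment> \<open>This fixed element dominates every increment of the sequence, since all members
   of D lie below s and the sequence starts at \<open>d0\<close>.\<close>
 define q where "q = s \<ominus> d0"
 have qc: "q : car M" using sc d0 Dc by (simp add: q_def)
 have dom: "(n2 (e \<ominus> d k))^2 <= opn M q * (?t e - ?t (d k))" "opn M (e \<ominus> d k) <= opn M q"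
  if e: "e : D" "pos_le M (d k) e" for e k
 proof -
  have ec: "e : car M" using e Dc by blast
  have p: "nonneg (e \<ominus> d k)" using e ec dc pos_le_iff by blast
  have "q \<ominus> (e \<ominus> d k) = (s \<ominus> e) \<oplus> (d k \<ominus> d0)"
  proof -
  have "s \<ominus> d0 = (s \<ominus> e) \<oplus> ((e \<ominus> d k) \<oplus> (d k \<ominus> d0))"
  using sc d0 Dc ec dc minus_split[of s e d0] minus_split[of e "d k" d0] by simp
  also have "... = ((s \<ominus> e) \<oplus> (d k \<ominus> d0)) \<oplus> (e \<ominus> d k)"
  using sc d0 Dc ec dc by (simp add: a_ac)
  finally show ?thesis using sc d0 Dc ec dc by (simp add: q_def add_minus_cancel_right)
  qed
  moreover have "nonneg (s \<ominus> e)" using ub[OF e(1)] ec sc pos_le_iff by blast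
  moreover have "nonneg (d k \<ominus> d0)" using mono[of 0 k] d dc d0 Dc pos_le_iff by auto
  ultimately have pq: "nonneg (q \<ominus> (e \<ominus> d k))" using nonneg_add by simp
  show "(n2 (e \<ominus> d k))^2 <= opn M q * (?t e - ?t (d k))" "opn M (e \<ominus> d k) <= opn M q"
  using dominated[OF p qc pq] ec dc by (auto simp: trc_minus)
 qed
 have tlim: "EX N. ALL k>=N. T - ?t (d k) < e" if e: "e > 0" for e
 proof -
  obtain N where N: "1 / (real N + 1) < e" using e reals_Archimedean by (metis Suc_eq_plus1 inverse_eq_divide of_nat_Suc add.commute)
  have "T - ?t (d k) < e" if k: "k >= Suc N" for k
  using d(4)[of N] pos_le_trc[OF dc dc mono[OF k]] N by linarith
  then show ?thesis by blast
 qed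
 \<comment> \<open>Not just the later members of the sequence but all elements of D above
   \<open>d k\<close> are close to it, since their traces are trapped below T.\<close>
 have close: "EX N. ALL k>=N. ALL e:D. pos_le M (d k) e --> n2 (e \<ominus> d k) < r" if r: "r > 0" for r
 proof -
  have op: "0 <= opn M q" using qc by (rule opn_nonneg)
  obtain N where N: "!!k. k >= N ==> T - ?t (d k) < r\<^sup>2 / (opn M q + 1)"
  using tlim[of "r\<^sup>2 / (opn M q + 1)"] r op by auto
  have "n2 (e \<ominus> d k) < r" if k: "k >= N" and e: "e : D" "pos_le M (d k) e" for e k
  proof -
  have "(n2 (e \<ominus> d k))^2 <= opn M q * (?t e - ?t (d k))" using dom e by blast
  also have "... <= opn M q * (r\<^sup>2 / (opn M q + 1))"
  using op N[OF k] tT[OF e(1)] by (intro mult_left_mono) auto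
  also have "... < r\<^sup>2" using op r by (simp add: divide_simps)
  finally show ?thesis using r by (meson less_imp_le power_less_imp_less_base)
  qed
  then show ?thesis by blast
 qed
 have C: "L2_Cauchy M d" unfolding L2_Cauchy_def
 proof (intro conjI allI impI)
  fix r :: real assume "r > 0"
  then obtain N where N: "!!k e. k >= N ==> e : D ==> pos_le M (d k) e ==> n2 (e \<ominus> d k) < r" using close by blast
  have "n2 (d i \<ominus> d j) < r" if ij: "i >= N" "j >= N" for i j
  proof (cases "i <= j")
  case True
  then show ?thesis using N[of i "d j"] ij d mono n2_minus_commute[OF dc dc, of i j] by auto
  next
  case False
  then show ?thesis using N[of j "d i"] ij d mono by auto
  qed
  then show "EX N. ALL i>=N. ALL j>=N. n2 (d i \<ominus> d j) < r" by blast
 qed (rule dc)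
 have "ALL y:car M. ALL e>0. EX N. ALL k>=N. n2 (d k \<otimes> y) <= (opn M d0 + opn M q) * n2 y + e"
 proof (intro ballI allI impI)
  fix y and e :: real assume y: "y : car M" and e: "0 < e"
  have "n2 (d k \<otimes> y) <= (opn M d0 + opn M q) * n2 y + e" for k
  proof -
  have "opn M (d k) <= opn M d0 + opn M (d k \<ominus> d0)"
  using opn_add[of d0 "d k \<ominus> d0"] d0 Dc dc add_minus_cancel[of "d k" d0] by simp
  also have "opn M (d k \<ominus> d0) <= opn M q" using dom(2)[of "d k" 0] d mono by auto
  finally have "opn M (d k) * n2 y <= (opn M d0 + opn M q) * n2 y" using y by (intro mult_right_mono) auto
  then show ?thesis using opn_bound[OF dc[of k] y] e by linarith
  qed
  then show "EX N. ALL k>=N. n2 (d k \<otimes> y) <= (opn M d0 + opn M q) * n2 y + e" by blast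
 qed
 then obtain a where a: "a : car M" and da: "(%k. n2 (d k \<ominus> a)) ~~> 0"
  using bounded_complete C unfolding bounded_vectors_complete_def by blast
 have asa: "adj M a = a"
 proof -
  have le: "n2 (adj M a \<ominus> a) <= n2 (d k \<ominus> a) + n2 (d k \<ominus> a)" for k
  proof -
  have "n2 (adj M a \<ominus> d k) = n2 (d k \<ominus> a)"
  using n2_adj[of "a \<ominus> d k"] a dc Dc(2)[OF d(2)] n2_minus_commute[of a "d k"] by (simp add: adj_minus)
  then show ?thesis using n2_triangle_minus[of "adj M a" "d k" a] a dc by simp
  qed
  have "n2 (adj M a \<ominus> a) <= 0" by (rule LIMSEQ_le_const[OF tendsto_add_zero[OF da da]]) (use le in blast)
  then show ?thesis using a by (intro eq_of_n2_minus) (auto intro: antisym)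
 qed
 have ta: "?t a <= T"
 proof (rule LIMSEQ_le_const2)
  have "(%k. trc M (d k) - trc M a) ~~> 0"
  by (rule Lim_null_comparison[OF _ da]) (use cmod_trc_diff dc a in auto)
  then have "(%k. trc M (d k)) ~~> trc M a" by (simp add: LIM_zero_iff)
  then show "(%k. ?t (d k)) ~~> ?t a" by (rule tendsto_Re)
  show "EX N. ALL n>=N. ?t (d n) <= T" using tT d by blast
 qed
 have aub: "pos_le M e a" if e: "e : D" for e
 proof -
  have ec: "e : car M" "adj M e = e" using Dc e by auto
  have "0 <= Re (trc M (adj M y \<otimes> ((a \<ominus> e) \<otimes> y)))" if y: "y : car M" for y
  proof (rule field_le_epsilon)
  fix r :: real assume r: "0 < r"
  define K where "K = n2 (y \<otimes> adj M y)"
  have K: "K >= 0" using y by (simp add: K_def)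
  define r' where "r' = r / (2 * (K + 1))"
  have r': "r' > 0" using r K by (simp add: r'_def)
  obtain N where N: "!!k e. k >= N ==> e : D ==> pos_le M (d k) e ==> n2 (e \<ominus> d k) < r'" using close[OF r'] by blast
  have "eventually (%k. n2 (d k \<ominus> a) < r') sequentially" using order_tendstoD(2)[OF da r'] .
  then obtain N' where N': "!!k. k >= N' ==> n2 (d k \<ominus> a) < r'" by (auto simp: eventually_sequentially)
  define k where "k = max N N'"
  obtain g where g: "g : D" "pos_le M e g" "pos_le M (d k) g" using dir e d by blast
  have gc: "g : car M" using Dc g by blast
  have "n2 (g \<ominus> a) < 2 * r'"
  using n2_triangle_minus[of g "d k" a] gc dc a N[of k g] N'[of k] g by (simp add: k_def)
  then have "cmod (trc M (adj M y \<otimes> ((g \<ominus> a) \<otimes> y))) <= 2 * r' * K"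
  using ip_conj_le[of "g \<ominus> a" y] gc a y K mult_right_mono[of "n2 (g \<ominus> a)" "2 * r'" K] by (simp add: K_def)
  also have "... <= r" using r K by (simp add: r'_def field_simps)
  finally have "Re (trc M (adj M y \<otimes> ((g \<ominus> a) \<otimes> y))) <= r" using complex_Re_le_cmod order_trans by blast
  moreover have "0 <= Re (trc M (adj M y \<otimes> ((g \<ominus> e) \<otimes> y)))"
  using g gc ec pos_le_iff y by (auto simp: nonneg_def)
  ultimately show "0 <= Re (trc M (adj M y \<otimes> ((a \<ominus> e) \<otimes> y))) + r"
  using gc a ec y by (simp add: conj_minus)
  qed
  then have "nonneg (a \<ominus> e)" using a ec asa by (simp add: nonneg_def adj_minus)
  then show ?thesis using a ec pos_le_iff by blast
 qed
 have "pos_le M s a" using s a asa aub by (auto simp: is_sup_def self_adjoints_def)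
 then have "?t s <= T" using pos_le_trc[OF sc a] ta by linarith
 moreover have "T <= ?t s" unfolding T_def using ne tle by (intro cSUP_least)
 ultimately show "?t s = (SUP d\<in>D. ?t d)" by (simp add: T_def)
qed

theorem tracial_vNa: "tracial_vNa M"
 unfolding tracial_vNa_def faithful_normal_tracial_state_def
proof (intro conjI ballI allI impI)
 show "ring M" ..
 show "EX (S :: 'a set) N \<pi>. vN_representation M S N \<pi>" using vN_representation_\<pi> by blast
 show "EX r>=0. ip x x = cor r" if "x : car M" for x
  using ip_self[OF that] by (intro exI[of _ "(n2 x)^2"]) auto
 show "x = \<zero>" if "x : car M" "ip x x = 0" for x using that trc_faithful[of x] by simp
qed (auto simp: trc_add trc_scal trc_one normal_trace intro: trc_comm)

end

lemma (in star_alg) positive_squares_of_positive_parts: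
 assumes "has_positive_parts M"
 shows "positive_squares M"
 unfolding positive_squares_def
proof (intro ballI impI, elim conjE)
 fix a assume a: "a : car M" "adj M a = a" and pos: "ALL y:car M. 0 <= Re (trc M (adj M y \<otimes> (a \<otimes> y)))"
 obtain p z where pz: "p : car M" "z : car M"
  "(n2 (a \<ominus> adj M z \<otimes> z))^2 <= opn M a * (- Re (trc M (adj M p \<otimes> (a \<otimes> p))))"
  using assms a unfolding has_positive_parts_def by blast
 have "opn M a * (- Re (trc M (adj M p \<otimes> (a \<otimes> p)))) <= 0"
  using pos pz a by (simp add: opn_nonneg mult_nonneg_nonpos)
 then have "(n2 (a \<ominus> adj M z \<otimes> z))^2 = 0" using pz(3) by (metis antisym order_trans zero_le_power2)
 then have "a = adj M z \<otimes> z" using a pz by (intro eq_of_n2_minus) auto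
 then show "EX z:car M. a = adj M z \<otimes> z" using pz by blast
qed

lemma mat_entry_le_norm2:
 assumes A: "A : sqm n" and ij: "i < n" "j < n"
 shows "cmod (A $$ (i, j)) <= sqrt (real n) * mat.n2 n A"
proof -
 have "(cmod (A $$ (i, j)))^2 <= (\<Sum>i<n. (cmod (A $$ (i, j)))^2)"
  using ij by (intro member_le_sum[where f="%i. (cmod (A $$ (i, j)))^2"]) auto
 also have "... <= (\<Sum>j<n. \<Sum>i<n. (cmod (A $$ (i, j)))^2)"
  using ij by (intro member_le_sum[where f="%j. (\<Sum>i<n. (cmod (A $$ (i, j)))^2)"]) (auto intro: sum_nonneg)
 finally have "cmod (A $$ (i, j)) <= sqrt (\<Sum>j<n. \<Sum>i<n. (cmod (A $$ (i, j)))^2)"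
  by (simp add: real_le_rsqrt)
 then show ?thesis using ij by (simp add: norm2_mat[OF A] real_sqrt_divide)
qed

text \<open>Entries are dominated by the trace norm, and conversely entrywise convergence of
  finitely many entries gives convergence in trace norm.\<close>

lemma mat_bounded_vectors_complete: "bounded_vectors_complete (Mat n)"
 unfolding bounded_vectors_complete_def
proof (intro allI impI, elim conjE)
 fix x :: "nat => complex mat" assume C: "L2_Cauchy (Mat n) x"
 have xc: "x k : sqm n" for k using C by (simp add: L2_Cauchy_def)
 have minus_entry: "(A -[Mat n] B) $$ (i, j) = A $$ (i, j) - B $$ (i, j)"
  if "A : sqm n" "B : sqm n" "i < n" "j < n" for A B i j
  using that mat.minus_eq_scal[of A n B] by simp
 have conv: "EX l. (%k. x k $$ (i, j)) ~~> l" if ij: "i < n" "j < n" for i j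
 proof -
  have "Cauchy (%k. x k $$ (i, j))"
  proof (rule CauchyI)
  fix e :: real assume e: "0 < e"
  have n: "n > 0" using ij by simp
  obtain N where N: "!!k l. k >= N ==> l >= N ==> mat.n2 n (x k -[Mat n] x l) < e / sqrt (real n)"
  using C e n unfolding L2_Cauchy_def by (meson divide_pos_pos of_nat_0_less_iff real_sqrt_gt_zero)
  have "norm (x k $$ (i, j) - x l $$ (i, j)) < e" if kl: "k >= N" "l >= N" for k l
  proof -
  have "x k -[Mat n] x l : sqm n" using mat.minus_closed[of "x k" n "x l"] xc by simp
  from mat_entry_le_norm2[OF this ij] show ?thesis
  using N[OF kl] n xc ij by (simp add: minus_entry pos_less_divide_eq mult.commute)
  qed
  then show "EX M. ALL k>=M. ALL l>=M. norm (x k $$ (i, j) - x l $$ (i, j)) < e" by blast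
  qed
  then show ?thesis using Cauchy_convergent_iff convergent_def by blast
 qed
 define a where "a = mat n n (%(i, j). lim (%k. x k $$ (i, j)))"
 have a: "a : sqm n" by (simp add: a_def)
 have lim: "(%k. x k $$ (i, j)) ~~> a $$ (i, j)" if ij: "i < n" "j < n" for i j
  using conv[OF ij] ij by (simp add: a_def convergent_def[symmetric] convergent_LIMSEQ_iff)
 have d: "x k -[Mat n] a : sqm n" for k using mat.minus_closed[of "x k" n a] xc a by simp
 have "(%k. \<Sum>j<n. \<Sum>i<n. (cmod (x k $$ (i, j) - a $$ (i, j)))^2) ~~> 0"
  by (intro tendsto_null_sum tendsto_null_power tendsto_norm_zero LIM_zero lim) auto
 from tendsto_real_sqrt[OF tendsto_divide_zero[OF this, of "real n"]]
 have "(%k. sqrt ((\<Sum>j<n. \<Sum>i<n. (cmod (x k $$ (i, j) - a $$ (i, j)))^2) / real n)) ~~> 0"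
  by simp
 then have "(%k. mat.n2 n (x k -[Mat n] a)) ~~> 0"
  using xc a by (simp add: norm2_mat[OF d] minus_entry)
 then show "EX a:car (Mat n). (%k. mat.n2 n (x k -[Mat n] a)) ~~> 0"
  using a by (intro bexI[of _ a]) auto
qed

lemma mat_tracial_W_algebra: "n > 0 ==> tracial_W_algebra (Mat n)"
 by unfold_locales (auto simp: mat_bounded_vectors_complete mat.positive_squares_of_positive_parts mat_has_positive_parts)

section \<open>Los' theorem\<close>

lemma Inf_eq_neg_Sup:
 fixes f :: "'c => real"
 shows "(INF y\<in>S. f y) = - (SUP y\<in>S. - f y)"
 by (simp add: Inf_real_def image_image)

lemma continuous_coordinate: "continuous_map (Euclidean_space k) euclideanreal (%v. v i)"
 unfolding Euclidean_space_def by (intro continuous_map_from_subtopology continuous_map_product_projection) auto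

text \<open>Negation as a connective lets infima be reduced to suprema.\<close>

lemma formula_in_neg: "formula_in k (Connective (%v. - v 0) [ps]) <-> formula_in k ps"
proof -
 have "continuous_map (Euclidean_space (Suc 0)) euclideanreal (%v. - v 0)"
  by (intro continuous_map_minus continuous_coordinate)
 then show ?thesis by simp
qed

context tracial_ultraproduct
begin

abbreviation coords :: "nat => (nat => 'a) list => 'a list" where
 "coords n xs \<equiv> map (%x. x n) xs"

lemma BS_list_bound:
 assumes "set xs <= BS"
 shows "EX R>0. ALL n. coords n xs : tuples (length xs) (op_ball (A n) R)"
proof -
 have "EX R>0. ALL x:set xs. ALL n. opn (A n) (x n) <= R"
  using assms
 proof (induction xs)
  case Nil
  then show ?case by (intro exI[of _ 1]) auto
 next
  case (Cons x xs)
  then obtain R where R: "R > 0" "ALL x:set xs. ALL n. opn (A n) (x n) <= R" by auto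
  obtain B where B: "B > 0" "ALL n. opn (A n) (x n) <= B" using BS_bound[of x] Cons.prems by auto
  show ?case using R B by (intro exI[of _ "max R B"]) (auto simp: le_max_iff_disj)
 qed
 then obtain R where R: "R > 0" "ALL x:set xs. ALL n. opn (A n) (x n) <= R" by blast
 have "coords n xs : tuples (length xs) (op_ball (A n) R)" for n
  using R assms by (auto simp: tuples_def op_ball_def)
 then show ?thesis using R by blast
qed

lemma poly_eval_cls:
 assumes "set xs <= BS" "poly_vars p <= {..<length xs}"
 shows "(%n. poly_eval (A n) (coords n xs) p) : BS &
  poly_eval Q (map cls xs) p = cls (%n. poly_eval (A n) (coords n xs) p)"
 using assms(2)
proof (induction p)
 case (PVar i)
 then have i: "i < length xs" by simp
 then have "xs ! i : BS" using assms(1) by (meson nth_mem subsetD)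
 then show ?case using i by simp
qed auto

lemma op_ball_Q_I:
 assumes "y : BS" "!!n. opn (A n) (y n) <= r"
 shows "cls y : op_ball Q r"
 using assms opn_cls_le[of y y r] by (auto simp: op_ball_def)

text \<open>The parameters are quantified inside, because the induction on the formula appends a
  parameter under each quantifier.\<close>

definition Los :: "formula => bool" where
 "Los ps <-> (ALL xs. set xs <= BS --> formula_in (length xs) ps -->
  ((%n. interp (A n) ps (coords n xs)) ~> interp Q ps (map cls xs)) U)"

lemma LosD: "Los ps ==> set xs <= BS ==> formula_in (length xs) ps ==>
  ((%n. interp (A n) ps (coords n xs)) ~> interp Q ps (map cls xs)) U"
 by (simp add: Los_def)

lemma Los_ReTr: "Los (ReTr p)"
 unfolding Los_def
proof (intro allI impI)
 fix xs assume xs: "set xs <= BS" and p: "formula_in (length xs) (ReTr p)"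
 have "(%n. poly_eval (A n) (coords n xs) p) : BS" "poly_eval Q (map cls xs) p = cls (%n. poly_eval (A n) (coords n xs) p)"
  using poly_eval_cls[OF xs] p by auto
 then show "((%n. interp (A n) (ReTr p) (coords n xs)) ~> interp Q (ReTr p) (map cls xs)) U"
  using trc_tendsto by (auto intro!: tendsto_intros)
qed

lemma Los_Connective:
 assumes IH: "!!ps. ps : set pss ==> Los ps"
 shows "Los (Connective f pss)"
 unfolding Los_def
proof (intro allI impI)
 fix xs assume xs: "set xs <= BS" and fi: "formula_in (length xs) (Connective f pss)"
 let ?k = "length xs" and ?l = "length pss"
 have f: "continuous_map (Euclidean_space ?l) euclideanreal f" and ps: "!!ps. ps : set pss ==> formula_in ?k ps"
  using fi by auto
 obtain R where R: "R > 0" "!!n. coords n xs : tuples ?k (op_ball (A n) R)" using BS_list_bound[OF xs] by blast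
 have "EX B. ALL ps:set pss. bounded_formula TYPE('a) ?k R ps B"
  using formula_uniformity[OF ps R(1)]
  by (intro ex_common_bound) (auto intro: bounded_formula_mono)
 then obtain B where B: "!!ps. ps : set pss ==> bounded_formula TYPE('a) ?k R ps B" by blast
 have bd: "\<bar>interp (A n) ps (coords n xs)\<bar> <= B" if "ps : set pss" for ps n
  using B[OF that] R(2) algebras unfolding bounded_formula_def by blast
 have lim: "((%n. interp (A n) ps (coords n xs)) ~> interp Q ps (map cls xs)) U" if "ps : set pss" for ps
  using LosD[OF IH[OF that] xs ps[OF that]] .
 have bdQ: "\<bar>interp Q ps (map cls xs)\<bar> <= B" if "ps : set pss" for ps
  using tendsto_upperbound[OF tendsto_rabs[OF lim[OF that]]] bd[OF that] by auto
 define v where "v n = map (%ps. interp (A n) ps (coords n xs)) pss" for n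
 define w where "w = map (%ps. interp Q ps (map cls xs)) pss"
 have vw: "v n : bounded_lists ?l B" "w : bounded_lists ?l B" for n
  using bd bdQ by (auto simp: v_def w_def bounded_lists_def)
 have "((%n. f (ext_list (v n))) ~> f (ext_list w)) U"
 proof (rule tendstoI)
  fix e :: real assume "e > 0"
  then obtain d where d: "d > 0" "!!v w. [|v : bounded_lists ?l B; w : bounded_lists ?l B;
  ALL i<?l. \<bar>v ! i - w ! i\<bar> <= d|] ==> \<bar>f (ext_list v) - f (ext_list w)\<bar> < e"
  using connective_uniformly_continuous[OF f, of e B] by blast
  have "eventually (%n. ALL ps:set pss. dist (interp (A n) ps (coords n xs)) (interp Q ps (map cls xs)) < d) U"
  using lim d by (intro eventually_ball_finite) (auto dest: tendstoD)
  then show "eventually (%n. dist (f (ext_list (v n))) (f (ext_list w)) < e) U"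
  proof (rule eventually_mono)
  fix n assume n: "ALL ps:set pss. dist (interp (A n) ps (coords n xs)) (interp Q ps (map cls xs)) < d"
  have "ALL i<?l. \<bar>v n ! i - w ! i\<bar> <= d"
  using n by (auto simp: v_def w_def dist_real_def less_imp_le)
  then show "dist (f (ext_list (v n))) (f (ext_list w)) < e"
  using d(2)[OF vw] by (simp add: dist_real_def)
  qed
 qed
 then show "((%n. interp (A n) (Connective f pss) (coords n xs)) ~> interp Q (Connective f pss) (map cls xs)) U"
  unfolding interp_Connective v_def w_def .
qed

text \<open>Near-maximisers chosen in each coordinate form an element of the ball of
  \<open>Q\<close>, which bounds the values from above. Conversely, an element of the ball of
  \<open>Q\<close> has representatives of norm at most r + d only; rescaling them into the ball of
  radius r moves them by at most d in trace norm, and the modulus absorbs this.\<close>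

lemma Los_SupBall:
 assumes IH: "Los ps"
 shows "Los (SupBall r ps)"
 unfolding Los_def
proof (intro allI impI)
 fix xs assume xs: "set xs <= BS" and fi: "formula_in (length xs) (SupBall r ps)"
 let ?k = "length xs"
 have r: "r > 0" and ps: "formula_in (Suc ?k) ps" using fi by auto
 obtain R0 where R0: "R0 > 0" "!!n. coords n xs : tuples ?k (op_ball (A n) R0)" using BS_list_bound[OF xs] by blast
 \<comment> \<open>Representatives exceed the radius r by at most 1, so all points used below lie in
   this ball.\<close>
 define R where "R = max R0 (r + 1)"
 have R: "R > 0" "R0 <= R" "r + 1 <= R" using R0 by (auto simp: R_def)
 have tup: "coords n xs @ [y] : tuples (Suc ?k) (op_ball (A n) R)" if "y : car (A n)" "opn (A n) y <= r + 1" for n y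
  using R0(2)[of n] that R by (auto simp: tuples_snoc op_ball_def tuples_def)
 obtain B where B: "bounded_formula TYPE('a) (Suc ?k) R ps B"
  using formula_uniformity[OF ps R(1)] by blast
 have bdA: "bdd_above ((%y. interp (A n) ps (coords n xs @ [y])) ` op_ball (A n) r)" for n
 proof (rule bdd_aboveI2)
  fix y assume "y : op_ball (A n) r"
  then have "coords n xs @ [y] : tuples (Suc ?k) (op_ball (A n) R)" using tup by (auto simp: op_ball_def)
  then show "interp (A n) ps (coords n xs @ [y]) <= B"
  using B algebras unfolding bounded_formula_def by (meson abs_le_D1)
 qed
 have IH': "((%n. interp (A n) ps (coords n xs @ [y n])) ~> interp Q ps (map cls xs @ [cls y])) U" if "y : BS" for y
  using LosD[OF IH, of "xs @ [y]"] xs that ps by simp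
 have bQ: "interp Q ps (map cls xs @ [Y]) <= B" if "Y : op_ball Q r" for Y
 proof -
  obtain y0 where y0: "y0 : BS" "Y = cls y0" using \<open>Y : op_ball Q r\<close> carrier_Q_cases by (auto simp: op_ball_def)
  obtain y where y: "y : BS" "cls y = Y" "!!n. opn (A n) (y n) <= opn Q Y + 1"
  using opn_cls_representative[OF y0(1), of 1] y0 by auto
  have "interp (A n) ps (coords n xs @ [y n]) <= B" for n
  proof -
  have "coords n xs @ [y n] : tuples (Suc ?k) (op_ball (A n) R)"
  using that y(3)[of n] y(1) by (intro tup) (auto simp: op_ball_def)
  then show ?thesis using B algebras unfolding bounded_formula_def by (meson abs_le_D1)
  qed
  then show ?thesis using tendsto_upperbound[OF IH'[OF y(1)]] y by auto
 qed
 have bdQ: "bdd_above ((%Y. interp Q ps (map cls xs @ [Y])) ` op_ball Q r)"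
  using bQ by (intro bdd_aboveI2)
 let ?F = "%n. interp (A n) (SupBall r ps) (coords n xs)" and ?S = "interp Q (SupBall r ps) (map cls xs)"
 have neA: "op_ball (A n) r ~= {}" for n using A.zero_in_op_ball[of r n] r by auto
 have neQ: "op_ball Q r ~= {}" using Q.zero_in_op_ball[of r] r by auto
 show "(?F ~> ?S) U"
 proof (rule tendstoI)
  fix e :: real assume e: "e > 0"
  have upper: "eventually (%n. ?F n < ?S + e) U"
  proof -
  have "ALL n. EX y:op_ball (A n) r. ?F n - e/2 < interp (A n) ps (coords n xs @ [y])"
  proof
  fix n
  have "?F n - e/2 < ?F n" using e by simp
  then show "EX y:op_ball (A n) r. ?F n - e/2 < interp (A n) ps (coords n xs @ [y])"
  unfolding interp.simps less_cSUP_iff[OF neA bdA] .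
  qed
  then obtain y where y: "!!n. y n : op_ball (A n) r" "!!n. ?F n - e/2 < interp (A n) ps (coords n xs @ [y n])" by metis
  have yB: "y : BS" using y(1) by (intro BS_I[of _ r]) (auto simp: op_ball_def)
  have "cls y : op_ball Q r" using y(1) by (intro op_ball_Q_I yB) (auto simp: op_ball_def)
  then have "interp Q ps (map cls xs @ [cls y]) <= ?S" using bdQ by (auto intro!: cSUP_upper)
  then have "interp Q ps (map cls xs @ [cls y]) < ?S + e/2" using e by simp
  from order_tendstoD(2)[OF IH'[OF yB] this] show ?thesis
  proof (rule eventually_mono)
  fix n assume "interp (A n) ps (coords n xs @ [y n]) < ?S + e/2"
  then show "?F n < ?S + e" using y(2)[of n] by linarith
  qed
  qed
  have lower: "eventually (%n. ?S - e < ?F n) U"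
  proof -
  obtain Y where Y: "Y : op_ball Q r" "?S - e/3 < interp Q ps (map cls xs @ [Y])"
  using less_cSUP_iff[OF neQ bdQ, of "?S - e/3"] e by auto
  obtain d0 where d0: "d0 > 0" "formula_modulus TYPE('a) (Suc ?k) R ps (e/3) d0"
  using formula_uniformity[OF ps R(1)] e by (meson divide_pos_pos zero_less_numeral)
  define d where "d = min d0 1"
  have d: "d > 0" "d <= 1" "d <= d0" using d0 by (auto simp: d_def)
  obtain y0 where y0: "y0 : BS" "Y = cls y0" using Y carrier_Q_cases by (auto simp: op_ball_def)
  obtain y where y: "y : BS" "cls y = Y" "!!n. opn (A n) (y n) <= opn Q Y + d"
  using opn_cls_representative[OF y0(1) d(1)] y0 by auto
  have yr: "opn (A n) (y n) <= r + d" for n using y(3)[of n] Y by (auto simp: op_ball_def)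
  \<comment> \<open>The difference from y is d/(r+d) times y, whose trace norm is at most r +
    d.\<close>
  define y' where "y' n = scal (A n) (cor (r / (r + d))) (y n)" for n
  have y'c: "y' n : car (A n)" for n using y by (simp add: y'_def)
  have y'r: "opn (A n) (y' n) <= r" for n
  proof -
  have "opn (A n) (y' n) <= (r / (r + d)) * opn (A n) (y n)"
  using A.opn_scal_le[of "y n" n "cor (r / (r + d))"] y r d unfolding y'_def norm_of_real by simp
  also have "... <= (r / (r + d)) * (r + d)" using yr r d by (intro mult_left_mono) auto
  finally show ?thesis using r d by simp
  qed
  have yy': "norm2 (A n) (y n -[A n] y' n) <= d0" for n
  proof -
  have "y n -[A n] y' n = scal (A n) (cor (d / (r + d))) (y n)"
  proof -
  have "y n -[A n] y' n = scal (A n) 1 (y n) +[A n] scal (A n) (- cor (r / (r + d))) (y n)"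
  using y y'c by (simp add: A.minus_eq_scal) (simp add: y'_def A.scal_scal)
  also have "... = scal (A n) (cor (1 - r / (r + d))) (y n)"
  using y A.add_scal[of "y n" n 1 "- cor (r / (r + d))"] by simp
  also have "1 - r / (r + d) = d / (r + d)" using r d by (simp add: field_simps)
  finally show ?thesis .
  qed
  moreover have "cmod (cor (d / (r + d))) = d / (r + d)"
  unfolding norm_of_real using r d by simp
  ultimately have "norm2 (A n) (y n -[A n] y' n) = (d / (r + d)) * norm2 (A n) (y n)"
  using A.n2_scal[of "y n" n "cor (d / (r + d))"] y(1) by (simp only: BS_carrier)
  also have "... <= (d / (r + d)) * (r + d)"
  using y yr[of n] A.n2_le_opn[of "y n" n] r d by (intro mult_left_mono) auto
  also have "... = d" using r d by simp
  finally show ?thesis using d by simp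
  qed
  have comp: "interp (A n) ps (coords n xs @ [y n]) - e/3 <= ?F n" for n
  proof -
  have "norm2 (A n) ((coords n xs @ [y n]) ! i -[A n] (coords n xs @ [y' n]) ! i) <= d0" if "i < Suc ?k" for i
  using that yy' xs d0 by (cases "i < ?k") (auto simp: nth_append less_Suc_eq subset_iff)
  moreover have "coords n xs @ [y n] : tuples (Suc ?k) (op_ball (A n) R)" "coords n xs @ [y' n] : tuples (Suc ?k) (op_ball (A n) R)"
  using yr[of n] y'r[of n] d y y'c by (auto intro!: tup)
  ultimately have "\<bar>interp (A n) ps (coords n xs @ [y n]) - interp (A n) ps (coords n xs @ [y' n])\<bar> <= e/3"
  using d0(2) algebras unfolding formula_modulus_def by blast
  moreover have "interp (A n) ps (coords n xs @ [y' n]) <= ?F n"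
  using bdA y'r y'c by (auto intro!: cSUP_upper simp: op_ball_def)
  ultimately show ?thesis by linarith
  qed
  have "?S - e/3 < interp Q ps (map cls xs @ [cls y])" using Y y by simp
  from order_tendstoD(1)[OF IH'[OF y(1)] this] show ?thesis
  proof (rule eventually_mono)
  fix n assume "?S - e/3 < interp (A n) ps (coords n xs @ [y n])"
  then show "?S - e < ?F n" using comp[of n] e by linarith
  qed
  qed
  show "eventually (%n. dist (?F n) ?S < e) U"
  using upper lower by eventually_elim (simp add: dist_real_def abs_less_iff)
 qed
qed

text \<open>An infimum is minus the supremum of the negated formula, and negation is a
  connective.\<close>

lemma Los_InfBall:
 assumes IH: "Los ps"
 shows "Los (InfBall r ps)"
 unfolding Los_def
proof (intro allI impI)
 fix xs assume xs: "set xs <= BS" and fi: "formula_in (length xs) (InfBall r ps)"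
 let ?neg = "Connective (%v. - v 0) [ps]"
 have "Los (SupBall r ?neg)" using IH by (intro Los_SupBall Los_Connective) auto
 moreover have "formula_in (length xs) (SupBall r ?neg)" using fi formula_in_neg[of _ ps] by (simp del: formula_in.simps(4))
 ultimately have "((%n. - interp (A n) (SupBall r ?neg) (coords n xs)) ~> - interp Q (SupBall r ?neg) (map cls xs)) U"
  using LosD xs by (intro tendsto_minus) blast
 then show "((%n. interp (A n) (InfBall r ps) (coords n xs)) ~> interp Q (InfBall r ps) (map cls xs)) U"
  by (simp add: Inf_eq_neg_Sup)
qed

theorem Los_all: "Los ps"
 by (induction ps) (auto intro: Los_ReTr Los_SupBall Los_InfBall Los_Connective)

lemma interp_tendsto:
 "set xs <= BS ==> formula_in (length xs) ps ==>
  ((%n. interp (A n) ps (coords n xs)) ~> interp Q ps (map cls xs)) U"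
 using LosD[OF Los_all] .

lemma tracial_W_algebra_Q: "tracial_W_algebra Q"
 by unfold_locales (auto simp: bounded_vectors_complete_Q positive_squares_Q trc_one_Q[simplified])

end

section \<open>Isomorphic copies\<close>

text \<open>Models must have their elements in the universe type, whereas matrices and their
  ultraproduct live on types of their own; the structure is transported along an injection.\<close>

definition copy_along :: "('a => 'b) => 'a alg => 'b alg" where
 "copy_along j M = (let i = the_inv_into (car M) j in
  \<lparr>carrier = j ` car M,
  mult = (%x y. j (i x *[M] i y)),
  one = j \<one>\<^bsub>M\<^esub>,
  zero = j \<zero>\<^bsub>M\<^esub>,
  add = (%x y. j (i x +[M] i y)),
  scal = (%a x. j (scal M a (i x))),
  adj = (%x. j (adj M (i x))),
  trc = (%x. trc M (i x)),
  opn = (%x. opn M (i x))\<rparr>)"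

locale algebra_copy = star_alg M for M :: "'a alg" +
 fixes j :: "'a => 'b"
 assumes inj: "inj_on j (car M)"
begin

abbreviation N :: "'b alg" where "N \<equiv> copy_along j M"

lemma inv_j [simp]: "x : car M ==> the_inv_into (car M) j (j x) = x"
 by (rule the_inv_into_f_f[OF inj])

lemma carrier_N: "car N = j ` car M"
 by (simp add: copy_along_def Let_def)

lemma j_carrier [simp]: "x : car M ==> j x : car N"
 by (simp add: carrier_N)

lemma copy_ops [simp]:
 "\<one>\<^bsub>N\<^esub> = j \<one>\<^bsub>M\<^esub>" "\<zero>\<^bsub>N\<^esub> = j \<zero>\<^bsub>M\<^esub>"
 "[|x : car M; y : car M|] ==> j x *[N] j y = j (x *[M] y)"
 "[|x : car M; y : car M|] ==> j x +[N] j y = j (x +[M] y)"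
 "x : car M ==> scal N a (j x) = j (scal M a x)"
 "x : car M ==> adj N (j x) = j (adj M x)"
 "x : car M ==> trc N (j x) = trc M x"
 "x : car M ==> opn N (j x) = opn M x"
 by (simp_all add: copy_along_def Let_def)

lemma norm2_copy [simp]: "x : car M ==> norm2 N (j x) = norm2 M x"
 by (simp add: norm2_def)

lemma N_cases: "X : car N ==> (!!x. x : car M ==> X = j x ==> P) ==> P"
 by (auto simp: carrier_N)

lemma ring_N: "ring N"
proof (rule ringI)
 show "abelian_group N"
 proof (rule abelian_groupI)
  fix X assume "X : car N"
  then obtain x where x: "x : car M" "X = j x" by (auto simp: carrier_N)
  show "\<zero>\<^bsub>N\<^esub> +[N] X = X" using x by simp
  have "j (\<ominus>\<^bsub>M\<^esub> x) +[N] X = \<zero>\<^bsub>N\<^esub>" using x by (simp add: l_neg)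
  then show "EX y:car N. y +[N] X = \<zero>\<^bsub>N\<^esub>" by (rule bexI) (use x in simp)
 qed (auto elim!: N_cases simp: a_ac)
 show "Group.monoid N"
  by (rule monoidI) (auto elim!: N_cases simp: m_assoc)
qed (auto elim!: N_cases simp: l_distr r_distr)

sublocale N: star_alg N
proof -
 interpret N: ring N by (rule ring_N)
 show "star_alg N"
 proof (unfold_locales)
  fix X assume X: "X : car N"
  show "opn N X <= B" if "0 <= B" "!!Y. Y : car N ==> norm2 N (X *[N] Y) <= B * norm2 N Y" for B
  proof -
  obtain x where x: "x : car M" "X = j x" using X by (auto simp: carrier_N)
  have "opn M x <= B"
  proof (rule opn_least[OF x(1) that(1)])
  fix y assume "y : car M"
  then show "norm2 M (x *[M] y) <= B * norm2 M y" using that(2)[of "j y"] x by simp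
  qed
  then show ?thesis using x by simp
  qed
  show "X = \<zero>\<^bsub>N\<^esub>" if "Re (trc N (adj N X *[N] X)) = 0"
  using X that by (auto elim!: N_cases dest: trc_faithful)
  fix Y assume "Y : car N"
  then show "trc N (X *[N] Y) = trc N (Y *[N] X)" using X by (auto elim!: N_cases intro: trc_comm)
 qed (auto elim!: N_cases simp: scal_add add_scal scal_scal scal_mult_left scal_mult_right adj_add adj_scal adj_mult
  trc_add trc_scal trc_adj trc_pos trc_one_le opn_nonneg opn_bound)
qed

lemma minus_copy [simp]: "x : car M ==> y : car M ==> j x -[N] j y = j (x -[M] y)"
 by (simp add: N.minus_eq_scal minus_eq_scal)

lemma op_ball_copy: "op_ball N R = j ` op_ball M R"
 by (auto simp: op_ball_def carrier_N)

lemma tuples_copy: "tuples k (j ` S) = map j ` tuples k S"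
proof
 show "tuples k (j ` S) <= map j ` tuples k S"
 proof
  fix ys assume ys: "ys : tuples k (j ` S)"
  then have "ys : lists (j ` S)" "length ys = k" by (auto simp: tuples_def)
  then obtain xs where "xs : lists S" "ys = map j xs" unfolding lists_image by auto
  then show "ys : map j ` tuples k S" using \<open>length ys = k\<close> by (auto simp: tuples_def)
 qed
qed (fastforce simp: tuples_def)

lemma poly_eval_copy:
 assumes "xs : tuples k (car M)" "poly_vars p <= {..<k}"
 shows "poly_eval N (map j xs) p = j (poly_eval M xs p)"
 using assms(2)
proof (induction p)
 case (PVar i)
 then show ?case using assms(1) by (simp add: tuples_def)
next
 case (PAdd p q)
 then show ?case using poly_eval_closed[OF _ assms(1)] by simp
next
 case (PMult p q)
 then show ?case using poly_eval_closed[OF _ assms(1)] by simp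
next
 case (PAdj p)
 then show ?case using poly_eval_closed[OF _ assms(1)] by simp
qed simp

lemma interp_copy:
 assumes "xs : tuples k (car M)" "formula_in k ps"
 shows "interp N ps (map j xs) = interp M ps xs"
 using assms(2,1)
proof (induction k ps arbitrary: xs rule: formula_in.induct)
 case (1 k p)
 then show ?case using poly_eval_copy poly_eval_closed by simp
next
 case (2 k r ps)
 have "interp N ps (map j xs @ [j y]) = interp M ps (xs @ [y])" if "y : op_ball M r" for y
  using 2(1)[of "xs @ [y]"] 2(2,3) that by (auto simp: tuples_snoc op_ball_def)
 then show ?case unfolding interp.simps op_ball_copy image_image by (intro SUP_cong) auto
next
 case (3 k r ps)
 have "interp N ps (map j xs @ [j y]) = interp M ps (xs @ [y])" if "y : op_ball M r" for y
  using 3(1)[of "xs @ [y]"] 3(2,3) that by (auto simp: tuples_snoc op_ball_def)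
 then show ?case unfolding interp.simps op_ball_copy image_image by (intro INF_cong) auto
next
 case (4 k f pss)
 then have "map (%ps. interp N ps (map j xs)) pss = map (%ps. interp M ps xs) pss" by auto
 then show ?case by (simp only: interp_Connective)
qed

lemma tp_copy: "xs : tuples m (car M) ==> tp m N (map j xs) = tp m M xs"
 unfolding tp_def by (rule restrict_ext) (simp add: interp_copy formulas_def)

lemma theory_of_copy: "ps : formulas 0 ==> interp N ps [] = interp M ps []"
 using interp_copy[of "[]" 0 ps] by (simp add: tuples_def formulas_def)

end

lemma tracial_W_algebra_copy:
 assumes M: "tracial_W_algebra M" and inj: "inj_on j (car M)"
 shows "tracial_W_algebra (copy_along j M)"
proof -
 interpret M: tracial_W_algebra M by fact
 interpret C: algebra_copy M j by unfold_locales (rule inj)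
 show ?thesis
 proof (unfold_locales)
  show "trc C.N \<one>\<^bsub>C.N\<^esub> = 1" by (simp add: M.trc_one)
  show "bounded_vectors_complete C.N" unfolding bounded_vectors_complete_def
  proof (intro allI impI, elim conjE)
  fix X B assume C: "L2_Cauchy C.N X" and bd: "ALL y:car C.N. ALL e>0. EX N. ALL k>=N. norm2 C.N (X k *[C.N] y) <= B * norm2 C.N y + e"
  have "ALL k. EX x. x : car M & X k = j x" using C by (auto simp: L2_Cauchy_def C.carrier_N)
  then obtain x where x: "!!k. x k : car M" "!!k. X k = j (x k)" by metis
  have "L2_Cauchy M x" using C x by (simp add: L2_Cauchy_def)
  moreover have "ALL y:car M. ALL e>0. EX N. ALL k>=N. norm2 M (x k *[M] y) <= B * norm2 M y + e"
  proof (intro ballI allI impI)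
  fix y and e :: real assume "y : car M" "e > 0"
  then show "EX N. ALL k>=N. norm2 M (x k *[M] y) <= B * norm2 M y + e"
  using bd[rule_format, of "j y" e] x by simp
  qed
  ultimately obtain a where a: "a : car M" "(%k. norm2 M (x k -[M] a)) ~~> 0"
  using M.bounded_complete unfolding bounded_vectors_complete_def by blast
  show "EX a:car C.N. (%k. norm2 C.N (X k -[C.N] a)) ~~> 0"
  using a x by (intro bexI[of _ "j a"]) auto
  qed
  show "positive_squares C.N" unfolding positive_squares_def
  proof (intro ballI impI, elim conjE)
  fix A assume A: "A : car C.N" "adj C.N A = A"
  and pos: "ALL y:car C.N. 0 <= Re (trc C.N (adj C.N y *[C.N] (A *[C.N] y)))"
  obtain a where a: "a : car M" "A = j a" using A by (auto simp: C.carrier_N)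
  have "adj M a = a" using A a inj by (simp add: inj_on_eq_iff)
  moreover have "ALL y:car M. 0 <= Re (trc M (adj M y *[M] (a *[M] y)))"
  proof
  fix y assume "y : car M"
  then show "0 <= Re (trc M (adj M y *[M] (a *[M] y)))" using pos[rule_format, of "j y"] a by simp
  qed
  ultimately obtain z where "z : car M" "a = adj M z *[M] z"
  using M.pos_squares a unfolding positive_squares_def by blast
  then show "EX z:car C.N. A = adj C.N z *[C.N] z" using a by (intro bexI[of _ "j z"]) auto
  qed
 qed
qed

section \<open>A countable dense set of formulas\<close>

text \<open>Syntax with rational data, hence countable; the original formulas involve arbitrary real
  constants and arbitrary continuous connectives.\<close>

datatype qpoly = QVar nat | QConst rat rat | QAdd qpoly qpoly | QMult qpoly qpoly | QAdj qpoly

instance qpoly :: countable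
 by countable_datatype

text \<open>\<open>QConn\<close> stores, in place of a continuous function, the floor value, the
  apexes with their heights, and the slope of a maximum of cones, followed by the arguments.\<close>

datatype qformula = QReTr qpoly | QSup rat qformula | QInf rat qformula
 | QConn rat "(rat list \<times> rat) list" nat "qformula list"

instance qformula :: countable
 by countable_datatype

primrec poly_of :: "qpoly => star_poly" where
 "poly_of (QVar i) = PVar i"
| "poly_of (QConst a b) = PConst (Complex (of_rat a) (of_rat b))"
| "poly_of (QAdd p q) = PAdd (poly_of p) (poly_of q)"
| "poly_of (QMult p q) = PMult (poly_of p) (poly_of q)"
| "poly_of (QAdj p) = PAdj (poly_of p)"

text \<open>A maximum of finitely many downward cones of slope \<open>L\<close>. Such functions approximate every
 continuous function uniformly on a box, with the apexes on the graph over a fine grid.\<close>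

primrec cones :: "rat => nat => nat => (rat list \<times> rat) list => (nat => real) => real" where
 "cones b L k [] v = of_rat b"
| "cones b L k (aq # D) v =
  max (of_rat (snd aq) - real L * (\<Sum>i<k. \<bar>v i - of_rat (fst aq ! i)\<bar>)) (cones b L k D v)"

lemma cones_ge: "aq : set D ==> of_rat (snd aq) - real L * (\<Sum>i<k. \<bar>v i - of_rat (fst aq ! i)\<bar>) <= cones b L k D v"
 by (induction D) auto

lemma cones_le:
 "[|of_rat b <= c; !!aq. aq : set D ==> of_rat (snd aq) - real L * (\<Sum>i<k. \<bar>v i - of_rat (fst aq ! i)\<bar>) <= c|]
  ==> cones b L k D v <= c"
 by (induction D) auto

lemma continuous_cones: "continuous_map (Euclidean_space n) euclideanreal (cones b L k D)"
proof (induction D)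
 case Nil
 have "cones b L k [] = (%_. of_rat b)" by auto
 then show ?case by simp
next
 case (Cons aq D)
 have "cones b L k (aq # D) = (%v. max (of_rat (snd aq) - real L * (\<Sum>i<k. \<bar>v i - of_rat (fst aq ! i)\<bar>)) (cones b L k D v))"
  by auto
 then show ?case
  using Cons by (simp only:) (intro continuous_map_real_max continuous_map_diff continuous_map_real_mult_left
  continuous_map_sum continuous_map_real_abs continuous_coordinate continuous_map_const[THEN iffD2] disjI2 Cons; simp)
qed

primrec fml :: "qformula => formula" where
 "fml (QReTr p) = ReTr (poly_of p)"
| "fml (QSup r ps) = SupBall (of_rat r) (fml ps)"
| "fml (QInf r ps) = InfBall (of_rat r) (fml ps)"
| "fml (QConn b D L pss) = Connective (cones b L (length pss) D) (map fml pss)"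

lemma ex_rational_complex: "e > 0 ==> EX p q. cmod (a - Complex (of_rat p) (of_rat q)) <= e"
proof -
 assume e: "e > 0"
 obtain p where p: "p : \<rat>" "Re a < p" "p < Re a + e/2" using Rats_dense_in_real[of "Re a" "Re a + e/2"] e by auto
 obtain q where q: "q : \<rat>" "Im a < q" "q < Im a + e/2" using Rats_dense_in_real[of "Im a" "Im a + e/2"] e by auto
 obtain p' q' where pq: "p = of_rat p'" "q = of_rat q'" using p(1) q(1) by (auto simp: Rats_def)
 have "cmod (a - Complex p q) <= \<bar>Re (a - Complex p q)\<bar> + \<bar>Im (a - Complex p q)\<bar>" by (rule cmod_le)
 also have "... <= e" using p q by simp
 finally show ?thesis using pq by blast
qed

lemma ex_rational_near: "e > 0 ==> EX q. \<bar>of_rat q - (x :: real)\<bar> <= e"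
proof -
 assume e: "e > 0"
 obtain p where p: "p : \<rat>" "x < p" "p < x + e" using Rats_dense_in_real[of x "x + e"] e by auto
 then obtain q where "p = of_rat q" by (auto simp: Rats_def)
 then show ?thesis using p by (intro exI[of _ q]) simp
qed

definition poly_close :: "'a itself => nat => real => star_poly => star_poly => real => bool" where
 "poly_close _ k R p q e <-> (ALL (M :: 'a alg) xs. star_alg M -->
  xs : tball M k R --> norm2 M (poly_eval M xs p -[M] poly_eval M xs q) <= e)"

lemma tuples_op_ball_carrier: "xs : tball M k R ==> xs : tuples k (car M)"
 by (auto simp: tuples_def op_ball_def)

lemma qpoly_dense:
 assumes "poly_vars p <= {..<k}" "e > 0"
 shows "EX q. poly_vars (poly_of q) <= {..<k} & poly_close TYPE('a) k R p (poly_of q) e"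
 using assms
proof (induction p arbitrary: e)
 case (PVar i)
 have "poly_close TYPE('a) k R (PVar i) (PVar i) e" unfolding poly_close_def
 proof (intro allI impI)
  fix M :: "'a alg" and xs assume M: "star_alg M" and xs: "xs : tball M k R"
  interpret star_alg M by fact
  show "norm2 M (poly_eval M xs (PVar i) -[M] poly_eval M xs (PVar i)) <= e"
  using poly_eval_closed[OF PVar(1) tuples_op_ball_carrier[OF xs]] PVar by simp
 qed
 then show ?case using PVar by (intro exI[of _ "QVar i"]) simp
next
 case (PConst a)
 obtain p q where pq: "cmod (a - Complex (of_rat p) (of_rat q)) <= e" using ex_rational_complex PConst by blast
 have "poly_close TYPE('a) k R (PConst a) (PConst (Complex (of_rat p) (of_rat q))) e" unfolding poly_close_def
 proof (intro allI impI)
  fix M :: "'a alg" and xs assume M: "star_alg M" and xs: "xs : tball M k R"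
  interpret star_alg M by fact
  let ?b = "Complex (of_rat p) (of_rat q)"
  have "scal M a \<one>\<^bsub>M\<^esub> -[M] scal M ?b \<one>\<^bsub>M\<^esub> = scal M (a - ?b) \<one>\<^bsub>M\<^esub>"
  using add_scal[of "\<one>\<^bsub>M\<^esub>" a "- ?b"] by (simp add: minus_eq_scal scal_scal)
  then have "norm2 M (scal M a \<one>\<^bsub>M\<^esub> -[M] scal M ?b \<one>\<^bsub>M\<^esub>) = cmod (a - ?b) * n2 \<one>\<^bsub>M\<^esub>" by (simp add: n2_scal)
  also have "... <= cmod (a - ?b) * 1" using n2_one_le by (intro mult_left_mono) auto
  finally show "norm2 M (poly_eval M xs (PConst a) -[M] poly_eval M xs (PConst ?b)) <= e" using pq by simp
 qed
 then show ?case by (intro exI[of _ "QConst p q"]) simp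
next
 case (PAdd p1 p2)
 obtain q1 q2 where q: "poly_vars (poly_of q1) <= {..<k}" "poly_vars (poly_of q2) <= {..<k}"
  "poly_close TYPE('a) k R p1 (poly_of q1) (e/2)" "poly_close TYPE('a) k R p2 (poly_of q2) (e/2)"
  using PAdd.IH(1)[of "e/2"] PAdd.IH(2)[of "e/2"] PAdd.prems by auto
 have "poly_close TYPE('a) k R (PAdd p1 p2) (PAdd (poly_of q1) (poly_of q2)) e" unfolding poly_close_def
 proof (intro allI impI)
  fix M :: "'a alg" and xs assume M: "star_alg M" and xs: "xs : tball M k R"
  interpret star_alg M by fact
  let ?E = "poly_eval M xs"
  have c: "?E p1 : car M" "?E p2 : car M" "?E (poly_of q1) : car M" "?E (poly_of q2) : car M"
  using PAdd.prems q tuples_op_ball_carrier[OF xs] by (auto intro!: poly_eval_closed)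
  have "n2 (?E p1 -[M] ?E (poly_of q1)) <= e/2" "n2 (?E p2 -[M] ?E (poly_of q2)) <= e/2"
  using q M xs unfolding poly_close_def by blast+
  then show "norm2 M (?E (PAdd p1 p2) -[M] ?E (PAdd (poly_of q1) (poly_of q2))) <= e"
  using c n2_triangle[of "?E p1 -[M] ?E (poly_of q1)" "?E p2 -[M] ?E (poly_of q2)"] by (simp add: minus_add_minus)
 qed
 then show ?case using q by (intro exI[of _ "QAdd q1 q2"]) simp
next
 case (PMult p1 p2)
 have p: "poly_vars p1 <= {..<k}" "poly_vars p2 <= {..<k}" using PMult.prems by auto
 obtain B where B: "B >= 0" "ALL (M :: 'a alg) xs. star_alg M --> xs : tball M k R -->
  poly_eval M xs p1 : car M & opn M (poly_eval M xs p1) <= B"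
  using poly_eval_opn_bounded[OF p(1)] by blast
 obtain q2 where q2: "poly_vars (poly_of q2) <= {..<k}" "poly_close TYPE('a) k R p2 (poly_of q2) (e / (2 * (B + 1)))"
  using PMult.IH(2)[of "e / (2 * (B + 1))"] PMult.prems B by auto
 obtain C where C: "C >= 0" "ALL (M :: 'a alg) xs. star_alg M --> xs : tball M k R -->
  poly_eval M xs (poly_of q2) : car M & opn M (poly_eval M xs (poly_of q2)) <= C"
  using poly_eval_opn_bounded[OF q2(1)] by blast
 obtain q1 where q1: "poly_vars (poly_of q1) <= {..<k}" "poly_close TYPE('a) k R p1 (poly_of q1) (e / (2 * (C + 1)))"
  using PMult.IH(1)[of "e / (2 * (C + 1))"] PMult.prems C by auto
 have "poly_close TYPE('a) k R (PMult p1 p2) (PMult (poly_of q1) (poly_of q2)) e" unfolding poly_close_def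
 proof (intro allI impI)
  fix M :: "'a alg" and xs assume M: "star_alg M" and xs: "xs : tball M k R"
  interpret star_alg M by fact
  let ?E = "poly_eval M xs"
  have c: "?E p1 : car M" "?E p2 : car M" "?E (poly_of q1) : car M" "?E (poly_of q2) : car M"
  using p q1 q2 tuples_op_ball_carrier[OF xs] by (auto intro!: poly_eval_closed)
  have 1: "n2 (?E p1 -[M] ?E (poly_of q1)) <= e / (2 * (C + 1))" and 2: "n2 (?E p2 -[M] ?E (poly_of q2)) <= e / (2 * (B + 1))"
  using q1 q2 M xs unfolding poly_close_def by blast+
  have "opn M (?E p1) * n2 (?E p2 -[M] ?E (poly_of q2)) <= B * (e / (2 * (B + 1)))"
  using B M xs 2 c by (intro mult_mono) auto
  also have "... <= e/2" using B PMult.prems by (simp add: field_simps)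
  finally have 3: "opn M (?E p1) * n2 (?E p2 -[M] ?E (poly_of q2)) <= e/2" .
  have "n2 (?E p1 -[M] ?E (poly_of q1)) * opn M (?E (poly_of q2)) <= (e / (2 * (C + 1))) * C"
  using C M xs 1 c PMult.prems by (intro mult_mono) (auto simp: opn_nonneg)
  also have "... <= e/2" using C PMult.prems by (simp add: field_simps)
  finally show "norm2 M (?E (PMult p1 p2) -[M] ?E (PMult (poly_of q1) (poly_of q2))) <= e"
  using 3 n2_mult_diff[OF c(1,2,3,4)] by simp
 qed
 then show ?case using q1 q2 by (intro exI[of _ "QMult q1 q2"]) simp
next
 case (PAdj p)
 obtain q where q: "poly_vars (poly_of q) <= {..<k}" "poly_close TYPE('a) k R p (poly_of q) e"
  using PAdj.IH[of e] PAdj.prems by auto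
 have "poly_close TYPE('a) k R (PAdj p) (PAdj (poly_of q)) e" unfolding poly_close_def
 proof (intro allI impI)
  fix M :: "'a alg" and xs assume M: "star_alg M" and xs: "xs : tball M k R"
  interpret star_alg M by fact
  let ?E = "poly_eval M xs"
  have c: "?E p : car M" "?E (poly_of q) : car M"
  using PAdj.prems q tuples_op_ball_carrier[OF xs] by (auto intro!: poly_eval_closed)
  show "norm2 M (?E (PAdj p) -[M] ?E (PAdj (poly_of q))) <= e"
  using q M xs c unfolding poly_close_def by (simp add: adj_minus[symmetric] n2_adj)
 qed
 then show ?case using q by (intro exI[of _ "QAdj q"]) simp
qed

definition formula_close :: "'a itself => nat => real => formula => formula => real => bool" where
 "formula_close _ k R \<phi> ps e <-> (ALL (M :: 'a alg). star_alg M -->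
  (ALL xs:tball M k R. \<bar>interp M \<phi> xs - interp M ps xs\<bar> <= e))"

lemma bdd_of_abs_le:
 fixes f :: "'b => real"
 assumes "!!y. y : A ==> \<bar>f y\<bar> <= c"
 shows "bdd_above (f ` A)" "bdd_below (f ` A)"
proof -
 show "bdd_above (f ` A)" by (rule bdd_aboveI2[of _ _ c]) (use assms in \<open>auto simp: abs_le_iff\<close>)
 show "bdd_below (f ` A)" by (rule bdd_belowI2[of _ "-c"]) (use assms minus_le_iff in \<open>auto simp: abs_le_iff\<close>)
qed

text \<open>Compares quantifiers over two nested balls; it allows a real radius to be replaced by a
  nearby rational one.\<close>

lemma SUP_radius_change:
 fixes f :: "'b => real"
 assumes "A ~= {}" "A <= B" "!!y. y : B ==> \<bar>f y\<bar> <= c" "!!y. y : B ==> EX z:A. \<bar>f y - f z\<bar> <= e"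
 shows "\<bar>(SUP y\<in>A. f y) - (SUP y\<in>B. f y)\<bar> <= e" "\<bar>(INF y\<in>A. f y) - (INF y\<in>B. f y)\<bar> <= e"
proof -
 note bB = bdd_of_abs_le[of B f c, OF assms(3)]
 have "\<bar>f y\<bar> <= c" if "y : A" for y using assms that by blast
 note bA = bdd_of_abs_le[of A f c, OF this]
 obtain y0 where "y0 : A" using assms(1) by blast
 then obtain z0 where "\<bar>f y0 - f z0\<bar> <= e" using assms(2,4) by blast
 then have e: "0 <= e" by linarith
 have "(SUP y\<in>A. f y) <= (SUP y\<in>B. f y)" using assms bB by (intro cSUP_subset_mono) auto
 moreover have "(SUP y\<in>B. f y) <= (SUP y\<in>A. f y) + e"
 proof (rule cSUP_least)
  fix y assume "y : B"
  then obtain z where z: "z : A" "\<bar>f y - f z\<bar> <= e" using assms by blast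
  then show "f y <= (SUP y\<in>A. f y) + e" using cSUP_upper[OF z(1) bA(1)] by linarith
 qed (use assms in auto)
 ultimately show "\<bar>(SUP y\<in>A. f y) - (SUP y\<in>B. f y)\<bar> <= e" using e by linarith
 have "(INF y\<in>B. f y) <= (INF y\<in>A. f y)" using assms bB by (intro cINF_superset_mono) auto
 moreover have "(INF y\<in>A. f y) - e <= (INF y\<in>B. f y)"
 proof (rule cINF_greatest)
  fix y assume "y : B"
  then obtain z where z: "z : A" "\<bar>f y - f z\<bar> <= e" using assms by blast
  then show "(INF y\<in>A. f y) - e <= f y" using cINF_lower[OF bA(2) z(1)] by linarith
 qed (use assms in auto)
 ultimately show "\<bar>(INF y\<in>A. f y) - (INF y\<in>B. f y)\<bar> <= e" using e by linarith
qed

lemma (in star_alg) shrink_radius: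
 assumes y: "y : op_ball M q" and r: "0 < r" "r <= q"
 shows "EX z:op_ball M r. n2 (y \<ominus> z) <= q - r"
proof (intro bexI[of _ "scal M (cor (r / q)) y"])
 have yc: "y : car M" "opn M y <= q" using y by (auto simp: op_ball_def)
 have rq: "0 <= r / q" "r / q <= 1" using r by auto
 have "opn M (scal M (cor (r / q)) y) <= cmod (cor (r / q)) * opn M y"
  using yc by (intro opn_scal_le)
 also have "... = (r / q) * opn M y" unfolding norm_of_real abs_of_nonneg[OF rq(1)] ..
 also have "... <= (r / q) * q" using yc rq by (intro mult_left_mono) auto
 finally show "scal M (cor (r / q)) y : op_ball M r" using yc r by (simp add: op_ball_def)
 have "y \<ominus> scal M (cor (r / q)) y = scal M 1 y \<oplus> scal M (- cor (r / q)) y"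
  using yc by (simp add: minus_eq_scal scal_scal)
 also have "... = scal M (cor (1 - r / q)) y"
  using yc add_scal[of y 1 "- cor (r / q)"] by simp
 finally have "n2 (y \<ominus> scal M (cor (r / q)) y) = cmod (cor (1 - r / q)) * n2 y"
  using yc by (simp only: n2_scal)
 also have "... = (1 - r / q) * n2 y" unfolding norm_of_real using abs_of_nonneg[of "1 - r / q"] rq(2) by simp
 also have "... <= (1 - r / q) * q" using yc n2_le_opn[of y] rq by (intro mult_left_mono) auto
 also have "(1 - r / q) * q = q - r" using r by (simp add: field_simps)
 finally show "n2 (y \<ominus> scal M (cor (r / q)) y) <= q - r" .
qed

text \<open>Coordinates are rounded down to multiples of 1/N. As B is a natural number, the faces of
  the box consist of such multiples, and rounding stays inside.\<close>

lemma bounded_grid: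
 fixes B N :: nat
 assumes N: "N > 0"
 shows "EX G :: rat list set. finite G & (ALL a:G. map of_rat a : bounded_lists l (real B)) &
  (ALL v:bounded_lists l (real B). EX a:G. ALL i<l. \<bar>v ! i - of_rat (a ! i)\<bar> <= 1 / real N)"
proof (intro exI conjI ballI)
 let ?P = "(%z. of_int z / of_nat N) ` {- (int B * int N) .. int B * int N} :: rat set"
 let ?G = "{a. set a <= ?P & length a = l}"
 show "finite ?G" by (rule finite_lists_length_eq) simp
 show "map of_rat a : bounded_lists l (real B)" if a: "a : ?G" for a
  unfolding bounded_lists_def
 proof (intro CollectI conjI allI impI)
  show "length (map of_rat a) = l" using a by simp
  fix i assume i: "i < l"
  then have "a ! i : ?P" using a by (metis (mono_tags, lifting) mem_Collect_eq nth_mem subsetD)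
  then obtain z where "a ! i = of_int z / of_nat N" "z : {- (int B * int N) .. int B * int N}" by (rule imageE)
  then have z: "a ! i = of_int z / of_nat N" "- (int B * int N) <= z" "z <= int B * int N" by auto
  have "\<bar>real_of_int z\<bar> <= real B * real N" 
  proof -
  have "\<bar>z\<bar> <= int B * int N" using z(2,3) by simp
  then have "real_of_int \<bar>z\<bar> <= real_of_int (int B * int N)" by (simp only: of_int_le_iff)
  then show ?thesis by simp
  qed
  then have "\<bar>real_of_int z / real N\<bar> <= real B" using N by (simp add: abs_divide field_simps)
  then show "\<bar>map of_rat a ! i\<bar> <= real B" using i a z by (simp add: of_rat_divide)
 qed
 fix v assume v: "v : bounded_lists l (real B)"
 let ?a = "map (%x. of_int \<lfloor>x * real N\<rfloor> / of_nat N) v :: rat list"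
 have "of_int \<lfloor>x * real N\<rfloor> / of_nat N : ?P" if "x : set v" for x
 proof (rule imageI)
  have x: "\<bar>x\<bar> <= real B" using that v by (auto simp: bounded_lists_def in_set_conv_nth)
  then have "\<bar>x * real N\<bar> <= real B * real N" by (simp add: abs_mult mult_right_mono)
  then have "x * real N <= real B * real N" "- (real B * real N) <= x * real N" by linarith+
  then show "\<lfloor>x * real N\<rfloor> : {- (int B * int N) .. int B * int N}"
  by (simp add: floor_le_iff le_floor_iff)
 qed
 then have "?a : ?G" using v by (auto simp: bounded_lists_def)
 moreover have "ALL i<l. \<bar>v ! i - of_rat (?a ! i)\<bar> <= 1 / real N"
 proof (intro allI impI)
  fix i assume i: "i < l"
  let ?x = "v ! i"
  have e: "of_rat (?a ! i) = real_of_int \<lfloor>?x * real N\<rfloor> / real N"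
  using i v by (simp add: bounded_lists_def of_rat_divide)
  have "0 <= ?x * real N - real_of_int \<lfloor>?x * real N\<rfloor>" "?x * real N - real_of_int \<lfloor>?x * real N\<rfloor> <= 1" by linarith+
  then have "\<bar>(?x * real N - real_of_int \<lfloor>?x * real N\<rfloor>) / real N\<bar> <= 1 / real N" using N by (simp add: divide_right_mono)
  moreover have "(?x * real N - real_of_int \<lfloor>?x * real N\<rfloor>) / real N = ?x - of_rat (?a ! i)"
  unfolding e using N by (simp add: diff_divide_distrib)
  ultimately show "\<bar>v ! i - of_rat (?a ! i)\<bar> <= 1 / real N" by simp
 qed
 ultimately show "EX a:?G. ALL i<l. \<bar>v ! i - of_rat (a ! i)\<bar> <= 1 / real N" by blast
qed

text \<open>Cones with apexes at height about f over a fine grid: near its apex a cone stays below f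
  + e by uniform continuity, far away the slope has already brought it down, and at every point some
  cone of a nearby grid point reaches f - e.\<close>

lemma cones_dense:
 assumes f: "continuous_map (Euclidean_space l) euclideanreal f" and e: "e > 0"
 shows "EX b L D. ALL v:bounded_lists l (real B). \<bar>cones b L l D (ext_list v) - f (ext_list v)\<bar> <= e"
proof -
 obtain C0 where C0: "ALL v:bounded_lists l (real B). \<bar>f (ext_list v)\<bar> <= C0" using connective_bounded[OF f] by blast
 define C where "C = max C0 0"
 have C: "C >= 0" "!!v. v : bounded_lists l (real B) ==> \<bar>f (ext_list v)\<bar> <= C" using C0 by (auto simp: C_def le_max_iff_disj)
 obtain d where d: "d > 0" "!!v w. [|v : bounded_lists l (real B); w : bounded_lists l (real B);
  ALL i<l. \<bar>v ! i - w ! i\<bar> <= d|] ==> \<bar>f (ext_list v) - f (ext_list w)\<bar> < e/4"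
  using connective_uniformly_continuous[OF f, of "e/4" "real B"] e by auto
 \<comment> \<open>The slope makes a cone drop by more than the oscillation 2 C + e over the
   distance d.\<close>
 obtain L :: nat where L: "(2 * C + e) / d < real L" using reals_Archimedean2 by blast
 then have Ld: "2 * C + e <= real L * d" using d by (simp add: field_simps)
 \<comment> \<open>The mesh is below d, and a cone drops by at most e/4 from an apex to a point in
   its grid cell.\<close>
 obtain N :: nat where N: "max (1 / d) (4 * (real L * real l) / e) < real N" using reals_Archimedean2 by blast
 have "0 < 1 / d" using d by simp
 then have "0 < real N" using N by linarith
 then have N0: "N > 0" by simp
 have Nd: "1 / real N <= d" using N d N0 by (simp add: field_simps)
 have NL: "real L * (real l * (1 / real N)) <= e / 4" using N e N0 by (simp add: field_simps)
 obtain G :: "rat list set" where G: "finite G" "!!a. a : G ==> map of_rat a : bounded_lists l (real B)"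
  "!!v. v : bounded_lists l (real B) ==> EX a:G. ALL i<l. \<bar>v ! i - of_rat (a ! i)\<bar> <= 1 / real N"
  using bounded_grid[OF N0, of l B] by blast
 have "ALL a. EX q. \<bar>of_rat q - f (ext_list (map of_rat a))\<bar> <= e/4" using ex_rational_near[of "e/4"] e by auto
 then obtain q where q: "!!a. \<bar>of_rat (q a) - f (ext_list (map of_rat a))\<bar> <= e/4" by metis
 obtain D0 where D0: "set D0 = G" using finite_list[OF G(1)] by blast
 define D where "D = map (%a. (a, q a)) D0"
 have D: "aq : set D <-> (EX a:G. aq = (a, q a))" for aq by (auto simp: D_def D0)
 \<comment> \<open>The floor lies between -C - 2 and -C, hence below f.\<close>
 obtain b where b: "\<bar>of_rat b - (- C - 1)\<bar> <= (1::real)" using ex_rational_near[of 1 "- C - 1"] by auto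
 have "\<bar>cones b L l D (ext_list v) - f (ext_list v)\<bar> <= e" if v: "v : bounded_lists l (real B)" for v
 proof -
  have vi: "ext_list v i = v ! i" if "i < l" for i using v that by (simp add: ext_list_def bounded_lists_def)
  have len: "length a = l" if "a : G" for a using G(2)[OF that] by (simp add: bounded_lists_def)
  obtain a where a: "a : G" "ALL i<l. \<bar>v ! i - of_rat (a ! i)\<bar> <= 1 / real N" using G(3)[OF v] by blast
  have "ALL i<l. \<bar>v ! i - map of_rat a ! i\<bar> <= d" using a(2) Nd len[OF a(1)] by (auto intro: order_trans)
  from d(2)[OF v G(2)[OF a(1)] this]
  have "\<bar>f (ext_list v) - f (ext_list (map of_rat a))\<bar> < e/4" .
  moreover have "(\<Sum>i<l. \<bar>ext_list v i - of_rat (a ! i)\<bar>) <= (\<Sum>i<l. 1 / real N)"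
  using a vi by (intro sum_mono) auto
  then have "real L * (\<Sum>i<l. \<bar>ext_list v i - of_rat (a ! i)\<bar>) <= real L * (real l * (1 / real N))"
  by (intro mult_left_mono) auto
  then have "real L * (\<Sum>i<l. \<bar>ext_list v i - of_rat (a ! i)\<bar>) <= e/4" using NL by linarith
  moreover have "of_rat (q a) - real L * (\<Sum>i<l. \<bar>ext_list v i - of_rat (a ! i)\<bar>) <= cones b L l D (ext_list v)"
  using cones_ge[where aq="(a, q a)" and D=D and L=L and k=l and v="ext_list v" and b=b] a D by auto
  ultimately have lower: "f (ext_list v) - e <= cones b L l D (ext_list v)" using q[of a] e by linarith
  have "cones b L l D (ext_list v) <= f (ext_list v) + e"
  proof (rule cones_le)
  show "of_rat b <= f (ext_list v) + e" using b C(2)[OF v] e by linarith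
  fix aq assume "aq : set D"
  then obtain a where a: "a : G" "aq = (a, q a)" using D by blast
  let ?s = "\<Sum>i<l. \<bar>ext_list v i - of_rat (a ! i)\<bar>"
  have s0: "0 <= real L * ?s" by (simp add: sum_nonneg)
  have "of_rat (q a) - real L * ?s <= f (ext_list v) + e"
  proof (cases "ALL i<l. \<bar>v ! i - of_rat (a ! i)\<bar> <= d")
  case True
  then have "ALL i<l. \<bar>v ! i - map of_rat a ! i\<bar> <= d" using len[OF a(1)] by simp
  from d(2)[OF v G(2)[OF a(1)] this]
  have "\<bar>f (ext_list v) - f (ext_list (map of_rat a))\<bar> < e/4" .
  then show ?thesis using q[of a] s0 e by linarith
  next
  case False
  then obtain i where i: "i < l" "d < \<bar>v ! i - of_rat (a ! i)\<bar>" by auto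
  have "\<bar>v ! i - of_rat (a ! i)\<bar> <= ?s"
  using i vi member_le_sum[of i "{..<l}" "%i. \<bar>ext_list v i - of_rat (a ! i)\<bar>"] by auto
  then have "real L * d <= real L * ?s" using i by (intro mult_left_mono) auto
  then show ?thesis using q[of a] C(2)[OF v] C(2)[OF G(2)[OF a(1)]] Ld e by linarith
  qed
  then show "of_rat (snd aq) - real L * (\<Sum>i<l. \<bar>ext_list v i - of_rat (fst aq ! i)\<bar>) <= f (ext_list v) + e"
  using a by simp
  qed
  then show ?thesis using lower by linarith
 qed
 then show ?thesis by blast
qed

text \<open>The real radius is enlarged to a rational one. Scaling the larger ball back moves its
  points by at most the difference of the radii, which is within the modulus for e/2; the other half
  of e pays for replacing the body.\<close>

lemma ball_radius_change:
 assumes IH: "!!R e. R > 0 ==> e > 0 ==> EX th. formula_in (Suc k) (fml th) & formula_close TYPE('a) (Suc k) R ps (fml th) e"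
  and ps: "formula_in (Suc k) ps" and r: "r > 0" and R: "R > 0" and e: "e > 0"
 shows "EX q th. of_rat q > (0::real) & formula_in (Suc k) (fml th) &
  formula_close TYPE('a) k R (SupBall r ps) (SupBall (of_rat q) (fml th)) e &
  formula_close TYPE('a) k R (InfBall r ps) (InfBall (of_rat q) (fml th)) e"
proof -
 define R' where "R' = max R (r + 1)"
 have R': "R' > 0" "R <= R'" "r + 1 <= R'" using R by (auto simp: R'_def)
 obtain th where th: "formula_in (Suc k) (fml th)" "formula_close TYPE('a) (Suc k) R' ps (fml th) (e/2)"
  using IH[OF R'(1), of "e/2"] e by auto
 obtain c where c: "bounded_formula TYPE('a) (Suc k) R' (fml th) c"
  using formula_uniformity[OF th(1) R'(1)] by blast
 obtain c' where c': "bounded_formula TYPE('a) (Suc k) R' ps c'"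
  using formula_uniformity[OF ps R'(1)] by blast
 obtain d where d: "d > 0" "formula_modulus TYPE('a) (Suc k) R' (fml th) (e/2) d"
  using formula_uniformity[OF th(1) R'(1)] e by (meson half_gt_zero)
 obtain q0 where q0: "q0 : \<rat>" "r < q0" "q0 < r + min d 1" using Rats_dense_in_real[of r "r + min d 1"] d by auto
 then obtain q where q: "q0 = of_rat q" by (auto simp: Rats_def)
 have q': "r < of_rat q" "of_rat q - r <= d" "of_rat q <= R'" using q0 q R' by auto
 have both: "\<bar>interp M (SupBall r ps) xs - interp M (SupBall (of_rat q) (fml th)) xs\<bar> <= e &
  \<bar>interp M (InfBall r ps) xs - interp M (InfBall (of_rat q) (fml th)) xs\<bar> <= e"
  if M: "star_alg M" and xs: "xs : tball M k R" for M :: "'a alg" and xs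
 proof -
  interpret star_alg M by fact
  let ?f = "%y. interp M (fml th) (xs @ [y])" and ?g = "%y. interp M ps (xs @ [y])"
  have in': "xs @ [y] : tuples (Suc k) (op_ball M R')" if "y : op_ball M (of_rat q)" for y
  using xs that R' q' by (auto simp: tuples_snoc op_ball_def tuples_def)
  have sub: "op_ball M r <= op_ball M (of_rat q)" using q' by (intro op_ball_mono) auto
  have ne: "op_ball M r ~= {}" using zero_in_op_ball[of r] r by auto
  have bf: "\<bar>?f y\<bar> <= c" if "y : op_ball M (of_rat q)" for y
  using c M in'[OF that] unfolding bounded_formula_def by blast
  have bg: "\<bar>?g y\<bar> <= c'" if "y : op_ball M (of_rat q)" for y
  using c' M in'[OF that] unfolding bounded_formula_def by blast
  have near: "EX z:op_ball M r. \<bar>?f y - ?f z\<bar> <= e/2" if y: "y : op_ball M (of_rat q)" for y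
  proof -
  obtain z where z: "z : op_ball M r" "n2 (y -[M] z) <= of_rat q - r" using shrink_radius[OF y r] q' by auto
  have "norm2 M ((xs @ [y]) ! i -[M] (xs @ [z]) ! i) <= d" if "i < Suc k" for i
  using that xs z q' d by (cases "i < k") (auto simp: nth_append tuples_def op_ball_def less_Suc_eq subset_iff)
  then have "\<bar>?f y - ?f z\<bar> <= e/2"
  using d(2) M in'[OF y] in'[of z] z sub unfolding formula_modulus_def by blast
  then show ?thesis using z by blast
  qed
  have gf: "\<bar>?g y - ?f y\<bar> <= e/2" if "y : op_ball M r" for y
  using th(2) M in'[of y] that sub unfolding formula_close_def by blast
  have "\<bar>?f y\<bar> <= c" "\<bar>?g y\<bar> <= c'" if "y : op_ball M r" for y using bf bg sub that by blast+
  note bd = bdd_of_abs_le[of "op_ball M r" ?f c, OF this(1)] bdd_of_abs_le[of "op_ball M r" ?g c', OF this(2)]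
  have "\<bar>(SUP y\<in>op_ball M r. ?g y) - (SUP y\<in>op_ball M r. ?f y)\<bar> <= e/2" using gf by (intro abs_SUP_diff_le ne bd)
  moreover have "\<bar>(INF y\<in>op_ball M r. ?g y) - (INF y\<in>op_ball M r. ?f y)\<bar> <= e/2" using gf by (intro abs_INF_diff_le ne bd)
  moreover note SUP_radius_change[OF ne sub bf near]
  ultimately show ?thesis unfolding interp.simps by (intro conjI) linarith+
 qed
 have q0: "0 < real_of_rat q" using q' r by linarith
 show ?thesis
  unfolding formula_close_def
  by (intro exI[of _ q] exI[of _ th] conjI allI impI ballI) (use th(1) q0 both in blast)+
qed

lemma formula_dense:
 assumes "formula_in k ps" "R > 0" "e > 0"
 shows "EX th. formula_in k (fml th) & formula_close TYPE('a) k R ps (fml th) e"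
 using assms
proof (induction k ps arbitrary: R e rule: formula_in.induct)
 case (1 k p)
 then obtain q where q: "poly_vars (poly_of q) <= {..<k}" "poly_close TYPE('a) k R p (poly_of q) e"
  using qpoly_dense[of p k e R] by auto
 have "formula_close TYPE('a) k R (ReTr p) (ReTr (poly_of q)) e" unfolding formula_close_def
 proof (intro allI impI ballI)
  fix M :: "'a alg" and xs assume M: "star_alg M" and xs: "xs : tball M k R"
  interpret star_alg M by fact
  let ?E = "poly_eval M xs"
  have c: "?E p : car M" "?E (poly_of q) : car M"
  using 1 q tuples_op_ball_carrier[OF xs] by (auto intro!: poly_eval_closed)
  have "\<bar>Re (trc M (?E p)) - Re (trc M (?E (poly_of q)))\<bar> <= cmod (trc M (?E p) - trc M (?E (poly_of q)))"
  using abs_Re_le_cmod[of "trc M (?E p) - trc M (?E (poly_of q))"] by simp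
  also have "... <= n2 (?E p -[M] ?E (poly_of q))" using c by (rule cmod_trc_diff)
  also have "... <= e" using q M xs unfolding poly_close_def by blast
  finally show "\<bar>interp M (ReTr p) xs - interp M (ReTr (poly_of q)) xs\<bar> <= e" by simp
 qed
 then show ?case using q by (intro exI[of _ "QReTr q"]) simp
next
 case (2 k r ps)
 obtain q th where "of_rat q > (0::real)" "formula_in (Suc k) (fml th)"
  "formula_close TYPE('a) k R (SupBall r ps) (SupBall (of_rat q) (fml th)) e"
  using ball_radius_change[of k ps r R e] 2 by auto
 then show ?case by (intro exI[of _ "QSup q th"]) simp
next
 case (3 k r ps)
 obtain q th where "of_rat q > (0::real)" "formula_in (Suc k) (fml th)"
  "formula_close TYPE('a) k R (InfBall r ps) (InfBall (of_rat q) (fml th)) e"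
  using ball_radius_change[of k ps r R e] 3 by auto
 then show ?case by (intro exI[of _ "QInf q th"]) simp
next
 case (4 k f pss)
 let ?l = "length pss"
 have f: "continuous_map (Euclidean_space ?l) euclideanreal f" and ps: "!!ps. ps : set pss ==> formula_in k ps"
  using 4(2) by auto
 have "EX B. ALL ps:set pss. bounded_formula TYPE('a) k R ps B"
  using formula_uniformity[OF ps 4(3)]
  by (intro ex_common_bound) (auto intro: bounded_formula_mono)
 then obtain B0 where B0: "!!ps. ps : set pss ==> bounded_formula TYPE('a) k R ps B0" by blast
 \<comment> \<open>The extra 1 leaves room for approximate argument values, which differ from the
   true ones by at most d' <= 1.\<close>
 obtain B :: nat where B: "B0 + 1 <= real B" using real_arch_simple by blast
 obtain d where d: "d > 0" "!!v w. [|v : bounded_lists ?l (real B); w : bounded_lists ?l (real B);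
  ALL i<?l. \<bar>v ! i - w ! i\<bar> <= d|] ==> \<bar>f (ext_list v) - f (ext_list w)\<bar> < e/2"
  using connective_uniformly_continuous[OF f, of "e/2" "real B"] 4(4) by auto
 define d' where "d' = min d 1"
 have d': "d' > 0" "d' <= d" "d' <= 1" using d by (auto simp: d'_def)
 obtain b L D where cone: "ALL v:bounded_lists ?l (real B). \<bar>cones b L ?l D (ext_list v) - f (ext_list v)\<bar> <= e/2"
  using cones_dense[OF f, of "e/2" B] 4(4) by auto
 have "ALL ps. EX th. ps : set pss --> formula_in k (fml th) & formula_close TYPE('a) k R ps (fml th) d'"
  using 4(1)[OF _ ps 4(3) d'(1)] by blast
 then obtain \<Theta> where \<Theta>: "!!ps. ps : set pss ==> formula_in k (fml (\<Theta> ps))"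
  "!!ps. ps : set pss ==> formula_close TYPE('a) k R ps (fml (\<Theta> ps)) d'" by metis
 let ?th = "QConn b D L (map \<Theta> pss)"
 have "formula_in k (fml ?th)" using \<Theta> continuous_cones by auto
 moreover have "formula_close TYPE('a) k R (Connective f pss) (fml ?th) e" unfolding formula_close_def
 proof (intro allI impI ballI)
  fix M :: "'a alg" and xs assume M: "star_alg M" and xs: "xs : tball M k R"
  let ?v = "map (%ps. interp M ps xs) pss" and ?w = "map (%ps. interp M (fml (\<Theta> ps)) xs) pss"
  have vB: "\<bar>interp M ps xs\<bar> <= B0" if "ps : set pss" for ps
  using B0[OF that] M xs unfolding bounded_formula_def by blast
  have vw: "\<bar>interp M ps xs - interp M (fml (\<Theta> ps)) xs\<bar> <= d'" if "ps : set pss" for ps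
  using \<Theta>(2)[OF that] M xs unfolding formula_close_def by blast
  have "\<bar>interp M ps xs\<bar> <= real B" if "ps : set pss" for ps
  using vB[OF that] B by linarith
  then have v: "?v : bounded_lists ?l (real B)" by (simp add: bounded_lists_def)
  have "\<bar>interp M (fml (\<Theta> ps)) xs\<bar> <= real B" if "ps : set pss" for ps
  using vB[OF that] vw[OF that] d' B by linarith
  then have w: "?w : bounded_lists ?l (real B)" by (simp add: bounded_lists_def)
  have "\<bar>f (ext_list ?v) - f (ext_list ?w)\<bar> < e/2"
  proof (intro d(2) v w allI impI)
  fix i assume "i < ?l"
  then show "\<bar>?v ! i - ?w ! i\<bar> <= d" using vw[of "pss ! i"] d' by simp
  qed
  moreover have "\<bar>cones b L ?l D (ext_list ?w) - f (ext_list ?w)\<bar> <= e/2" using cone w by blast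
  moreover have "interp M (fml ?th) xs = cones b L ?l D (ext_list ?w)"
  by (simp only: fml.simps interp_Connective length_map map_map o_def)
  ultimately show "\<bar>interp M (Connective f pss) xs - interp M (fml ?th) xs\<bar> <= e"
  unfolding interp_Connective by linarith
 qed
 ultimately show ?case by blast
qed

section \<open>The Prekopa-Leindler inequality\<close>

lemma weighted_AM_GM:
 fixes a b t :: real
 assumes "0 <= a" "0 <= b" "0 < t" "t < 1"
 shows "a powr (1 - t) * b powr t <= (1 - t) * a + t * b"
proof (cases "a = 0 \<or> b = 0")
 case True
 then show ?thesis using assms by auto
next
 case False
 then have ab: "a > 0" "b > 0" using assms by auto
 have "ln (a powr (1 - t) * b powr t) = (1 - t) * ln a + t * ln b"
  using ab by (simp add: ln_mult ln_powr)
 also have "... <= ln ((1 - t) * a + t * b)"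
 proof -
  have "concave_on {0<..} ln" by (rule ln_concave)
  from concave_onD[OF this, of t a b] show ?thesis using assms ab by simp
 qed
 finally show ?thesis using ab assms by (simp add: add_pos_pos)
qed

lemma emeasure_lborel_affine:
 fixes S :: "real set"
 assumes S: "S : sets borel" and c: "0 < c"
 shows "(%x. c * x + d) ` S : sets borel" "emeasure lborel ((%x. c * x + d) ` S) = ennreal c * emeasure lborel S"
proof -
 have im: "(%x. c * x + d) ` S = (%x. (x - d) / c) -` S"
 proof (intro equalityI subsetI)
  fix y assume "y : (%x. (x - d) / c) -` S"
  then show "y : (%x. c * x + d) ` S" using c by (intro image_eqI[of _ _ "(y - d) / c"]) auto
 qed (use c in auto)
 show 1: "(%x. c * x + d) ` S : sets borel"
  unfolding im using measurable_sets[OF _ S, of "%x. (x - d) / c" borel] by simp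
 have "lborel = density (distr lborel borel (%x. d + c * x)) (%_. ennreal \<bar>c\<bar>)"
  using c lborel_real_affine[of c d] by simp
 then have "emeasure lborel ((%x. c * x + d) ` S) =
  emeasure (density (distr lborel borel (%x. d + c * x)) (%_. ennreal \<bar>c\<bar>)) ((%x. c * x + d) ` S)" by simp
 also have "... = ennreal \<bar>c\<bar> * emeasure (distr lborel borel (%x. d + c * x)) ((%x. c * x + d) ` S)"
  using 1 by (simp add: emeasure_density_const)
 also have "emeasure (distr lborel borel (%x. d + c * x)) ((%x. c * x + d) ` S) =
  emeasure lborel ((%x. d + c * x) -` ((%x. c * x + d) ` S))"
  using 1 by (simp add: emeasure_distr)
 also have "(%x. d + c * x) -` ((%x. c * x + d) ` S) = S" using c by (auto simp: add.commute)
 finally show "emeasure lborel ((%x. c * x + d) ` S) = ennreal c * emeasure lborel S" using c by simp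
qed

text \<open>Take b near the infimum of B and a near the supremum of A. The sets (1-t) A + t b and t
  B + (1-t) a both lie in C and overlap in an interval of length at most e, so their measures add up
  to the measure of C plus e at most. Near-extremal points replace extremal ones since the sets need
  not be closed.\<close>

lemma Brunn_Minkowski_line:
 fixes A B C :: "real set"
 assumes meas: "A : sets borel" "B : sets borel" "C : sets borel"
  and ne: "A ~= {}" "B ~= {}" and bd: "A <= {-R..R}" "B <= {-R..R}"
  and t: "0 < t" "t < 1"
  and sum: "!!x y. x : A ==> y : B ==> (1 - t) * x + t * y : C"
 shows "ennreal (1 - t) * emeasure lborel A + ennreal t * emeasure lborel B <= emeasure lborel C"
proof (rule ennreal_le_epsilon)
 fix e :: real assume e: "0 < e"
 have bdd: "bdd_above A" "bdd_below B" using bd by (auto intro: bdd_above_mono bdd_below_mono)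
 obtain a where a: "a : A" "Sup A - e < a" using less_cSup_iff[OF ne(1) bdd(1), of "Sup A - e"] e by auto
 obtain b where b: "b : B" "b < Inf B + e" using cInf_less_iff[OF ne(2) bdd(2), of "Inf B + e"] e by auto
 let ?A = "(%x. (1 - t) * x + t * b) ` A" and ?B = "(%y. t * y + (1 - t) * a) ` B"
 have A: "?A : sets borel" "emeasure lborel ?A = ennreal (1 - t) * emeasure lborel A"
  using emeasure_lborel_affine[OF meas(1), of "1 - t"] t by auto
 have B: "?B : sets borel" "emeasure lborel ?B = ennreal t * emeasure lborel B"
  using emeasure_lborel_affine[OF meas(2), of t] t by auto
 have "?A \<inter> ?B <= {(1 - t) * a + t * Inf B .. (1 - t) * Sup A + t * b}"
 proof
  fix z assume z: "z : ?A \<inter> ?B"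
  from z obtain x where x: "x : A" "z = (1 - t) * x + t * b" by blast
  from z obtain y where y: "y : B" "z = t * y + (1 - t) * a" by blast
  have "x <= Sup A" "Inf B <= y" using x y bdd by (auto intro: cSup_upper cInf_lower)
  then have "(1 - t) * x <= (1 - t) * Sup A" "t * Inf B <= t * y" using t by auto
  then show "z : {(1 - t) * a + t * Inf B .. (1 - t) * Sup A + t * b}" using x(2) y(2) by auto
 qed
 then have "emeasure lborel (?A \<inter> ?B) <= emeasure lborel {(1 - t) * a + t * Inf B .. (1 - t) * Sup A + t * b}"
  by (intro emeasure_mono) auto
 also have "... <= ennreal e"
 proof -
  have "(1 - t) * Sup A + t * b - ((1 - t) * a + t * Inf B) = (1 - t) * (Sup A - a) + t * (b - Inf B)"
  by (simp add: algebra_simps)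
  also have "... <= (1 - t) * e + t * e" using a b t by (intro add_mono mult_left_mono) auto
  finally have le: "(1 - t) * Sup A + t * b - ((1 - t) * a + t * Inf B) <= e" by (simp add: algebra_simps)
  show ?thesis
  proof (cases "(1 - t) * a + t * Inf B <= (1 - t) * Sup A + t * b")
  case True
  then show ?thesis using le e by (simp add: ennreal_leI)
  qed (use e in auto)
 qed
 finally have I: "emeasure lborel (?A \<inter> ?B) <= ennreal e" .
 have "emeasure lborel ?A + emeasure lborel ?B = emeasure lborel (?A \<union> ?B) + emeasure lborel (?A \<inter> ?B)"
  using A B by (intro emeasure_Un_Int) auto
 also have "... <= emeasure lborel C + ennreal e"
  using I a b sum meas by (intro add_mono emeasure_mono) (auto simp: add.commute)
 finally show "ennreal (1 - t) * emeasure lborel A + ennreal t * emeasure lborel B <= emeasure lborel C + ennreal e"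
  using A B by simp
qed

text \<open>The truncation at c matches the integration range of levels; it is used for functions
  normalised to have supremum 1 and for a third function that may exceed 1.\<close>

lemma layer_cake:
 fixes f :: "real => real"
 assumes f: "f : borel_measurable borel"
 shows "(\<integral>\<^sup>+x. ennreal (min (max (f x) 0) c) \<partial>lborel) = (\<integral>\<^sup>+s. emeasure lborel {x. s <= f x} * indicator {0<..c} s \<partial>lborel)"
proof -
 have m: "(%(x, s). indicator {s. s <= f x} s * indicator {0<..c} s :: ennreal) : borel_measurable (lborel \<Otimes>\<^sub>M lborel)"
 proof -
  have "(%z. indicator {s. s <= f (fst z)} (snd z) * indicator {0<..c} (snd z) :: ennreal)
  = indicator {z. snd z <= f (fst z) & 0 < snd z & snd z <= c}"
  by (auto simp: indicator_def fun_eq_iff)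
  moreover have "{z : space (lborel \<Otimes>\<^sub>M lborel). snd z <= f (fst z) & 0 < snd z & snd z <= c} : sets (lborel \<Otimes>\<^sub>M lborel)"
  using f by measurable
  ultimately show ?thesis by (simp add: space_pair_measure split_beta')
 qed
 have 1: "ennreal (min (max (f x) 0) c) = (\<integral>\<^sup>+s. indicator {s. s <= f x} s * indicator {0<..c} s \<partial>lborel)" for x
 proof -
  have "(\<integral>\<^sup>+s. indicator {s. s <= f x} s * indicator {0<..c} s \<partial>lborel) = (\<integral>\<^sup>+s. indicator {0<..min (f x) c} s \<partial>lborel)"
  by (intro nn_integral_cong) (auto simp: indicator_def)
  also have "... = emeasure lborel {0<..min (f x) c}" by simp
  also have "... = ennreal (min (max (f x) 0) c)"
  by (cases "0 <= min (f x) c") (auto simp: min_def max_def ennreal_neg split: if_splits)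
  finally show ?thesis by simp
 qed
 have "(\<integral>\<^sup>+x. ennreal (min (max (f x) 0) c) \<partial>lborel) = (\<integral>\<^sup>+x. (\<integral>\<^sup>+s. indicator {s. s <= f x} s * indicator {0<..c} s \<partial>lborel) \<partial>lborel)"
  by (simp add: 1)
 also have "... = (\<integral>\<^sup>+s. (\<integral>\<^sup>+x. indicator {s. s <= f x} s * indicator {0<..c} s \<partial>lborel) \<partial>lborel)"
  using lborel_pair.Fubini'[OF m] by simp
 also have "... = (\<integral>\<^sup>+s. emeasure lborel {x. s <= f x} * indicator {0<..c} s \<partial>lborel)"
 proof (intro nn_integral_cong)
  fix s
  have ms: "{x. s <= f x} : sets borel" using f by measurable
  have "(\<integral>\<^sup>+x. indicator {s. s <= f x} s * indicator {0<..c} s \<partial>lborel) = (\<integral>\<^sup>+x. indicator {x. s <= f x} x * indicator {0<..c} s \<partial>lborel)"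
  by (intro nn_integral_cong) (auto simp: indicator_def)
  also have "... = emeasure lborel {x. s <= f x} * indicator {0<..c} s"
  using ms by (simp add: nn_integral_multc)
  finally show "(\<integral>\<^sup>+x. indicator {s. s <= f x} s * indicator {0<..c} s \<partial>lborel) = emeasure lborel {x. s <= f x} * indicator {0<..c} s" .
 qed
 finally show ?thesis .
qed

text \<open>Boundedness and support in a box are kept when one coordinate is integrated out, and
  they keep all integrals finite, so \<open>enn2real\<close> loses nothing.\<close>

definition box_function :: "'i set => real => real => (('i => real) => real) => bool" where
 "box_function I C R f <-> f : borel_measurable (LB I) &
  (ALL x:space (LB I). 0 <= f x & f x <= C & ((EX i:I. R < \<bar>x i\<bar>) --> f x = 0))"

text \<open>After normalising the suprema of f and g to 1, the level sets at heights below 1 are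
  nonempty and the one-dimensional Brunn-Minkowski inequality applies to them. Integrating over the
  heights gives an arithmetic mean of the integrals, which the weighted AM-GM inequality turns into
  the geometric mean.\<close>

lemma Prekopa_Leindler_line:
 fixes f g h :: "real => real"
 assumes meas: "f : borel_measurable borel" "g : borel_measurable borel" "h : borel_measurable borel"
  and f: "!!x. 0 <= f x & f x <= C & (R < \<bar>x\<bar> --> f x = 0)"
  and g: "!!x. 0 <= g x & g x <= C & (R < \<bar>x\<bar> --> g x = 0)"
  and h: "!!x. 0 <= h x"  and fin: "(\<integral>\<^sup>+x. ennreal (h x) \<partial>lborel) < \<infinity>"
  and t: "0 < t" "t < 1"
  and le: "!!x y. f x powr (1 - t) * g y powr t <= h ((1 - t) * x + t * y)"
 shows "enn2real (\<integral>\<^sup>+x. ennreal (f x) \<partial>lborel) powr (1 - t) * enn2real (\<integral>\<^sup>+x. ennreal (g x) \<partial>lborel) powr t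
  <= enn2real (\<integral>\<^sup>+x. ennreal (h x) \<partial>lborel)"
proof -
 define a where "a = (SUP x. f x)"
 define b where "b = (SUP x. g x)"
 have bdf: "bdd_above (range f)" "bdd_above (range g)" using f g by (auto intro!: bdd_aboveI2[of _ _ C])
 have fa: "f x <= a" for x unfolding a_def using bdf by (intro cSUP_upper) auto
 have gb: "g x <= b" for x unfolding b_def using bdf by (intro cSUP_upper) auto
 have a0: "0 <= a" using f[of 0] fa[of 0] by linarith
 have b0: "0 <= b" using g[of 0] gb[of 0] by linarith
 show ?thesis
 proof (cases "a = 0 \<or> b = 0")
  case True
  have "a = 0 ==> f x = 0" for x using f[of x] fa[of x] by simp
  moreover have "b = 0 ==> g x = 0" for x using g[of x] gb[of x] by simp
  ultimately show ?thesis using True by auto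
 next
  case False
  then have a: "a > 0" and b: "b > 0" using a0 b0 by auto
  \<comment> \<open>The matching normalisation of h, so that the pointwise inequality survives the
    division of f by a and of g by b.\<close>
  define k where "k = a powr (1 - t) * b powr t"
  have k: "k > 0" using a b by (simp add: k_def)
  define F where "F x = f x / a" for x
  define G where "G x = g x / b" for x
  define H where "H x = h x / k" for x
  have mF: "F : borel_measurable borel" "G : borel_measurable borel" "H : borel_measurable borel"
  unfolding F_def G_def H_def using meas by auto
  have F01: "0 <= F x" "F x <= 1" "0 <= G x" "G x <= 1" "0 <= H x" for x
  using f[of x] fa[of x] a g[of x] gb[of x] b h[of x] k by (auto simp: F_def G_def H_def)
  have FG: "F x powr (1 - t) * G y powr t <= H ((1 - t) * x + t * y)" for x y
  proof -
  have "F x powr (1 - t) * G y powr t = f x powr (1 - t) * g y powr t / k"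
  using a b f[of x] g[of y] by (simp add: F_def G_def k_def powr_divide)
  also have "... <= h ((1 - t) * x + t * y) / k" using le[of x y] k by (intro divide_right_mono) auto
  finally show ?thesis by (simp add: H_def)
  qed
  have level: "ennreal (1 - t) * emeasure lborel {x. s <= F x} + ennreal t * emeasure lborel {x. s <= G x} <= emeasure lborel {x. s <= H x}"
  if s: "0 < s" "s < 1" for s
  proof (rule Brunn_Minkowski_line[where R=R])
  show "{x. s <= F x} : sets borel" "{x. s <= G x} : sets borel" "{x. s <= H x} : sets borel"
  using mF by measurable
  show "{x. s <= F x} ~= {}"
  proof -
  have "s * a < a" using s a by simp
  then obtain x where "s * a < f x" unfolding a_def using less_cSUP_iff[of UNIV f "s * (SUP x. f x)"] bdf by auto
  then show ?thesis using a by (auto simp: F_def pos_le_divide_eq intro!: exI[of _ x] less_imp_le)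
  qed
  show "{x. s <= G x} ~= {}"
  proof -
  have "s * b < b" using s b by simp
  then obtain x where "s * b < g x" unfolding b_def using less_cSUP_iff[of UNIV g "s * (SUP x. g x)"] bdf by auto
  then show ?thesis using b by (auto simp: G_def pos_le_divide_eq intro!: exI[of _ x] less_imp_le)
  qed
  show "{x. s <= F x} <= {-R..R}"
  proof
  fix x assume "x : {x. s <= F x}"
  then have "f x ~= 0" using s by (auto simp: F_def)
  then have "\<not> R < \<bar>x\<bar>" using f[of x] by blast
  then show "x : {-R..R}" by auto
  qed
  show "{x. s <= G x} <= {-R..R}"
  proof
  fix x assume "x : {x. s <= G x}"
  then have "g x ~= 0" using s by (auto simp: G_def)
  then have "\<not> R < \<bar>x\<bar>" using g[of x] by blast
  then show "x : {-R..R}" by auto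
  qed
  fix x y assume "x : {x. s <= F x}" "y : {x. s <= G x}"
  then have "s powr (1 - t) * s powr t <= F x powr (1 - t) * G y powr t"
  using s t by (intro mult_mono powr_mono2) auto
  also have "s powr (1 - t) * s powr t = s" using s by (simp add: powr_add[symmetric])
  finally show "(1 - t) * x + t * y : {x. s <= H x}" using FG[of x y] by simp
  qed (rule t)+
  have lcF: "(\<integral>\<^sup>+x. ennreal (F x) \<partial>lborel) = (\<integral>\<^sup>+s. emeasure lborel {x. s <= F x} * indicator {0<..1} s \<partial>lborel)"
  using layer_cake[OF mF(1), of 1] F01 by simp
  have lcG: "(\<integral>\<^sup>+x. ennreal (G x) \<partial>lborel) = (\<integral>\<^sup>+s. emeasure lborel {x. s <= G x} * indicator {0<..1} s \<partial>lborel)"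
  using layer_cake[OF mF(2), of 1] F01 by simp
  have antimono_meas: "(%s. emeasure lborel {x. s <= p x} * indicator {0<..1} s) : borel_measurable borel"
  if p: "p : borel_measurable borel" for p :: "real => real"
  proof -
  have "(%s. emeasure lborel {x. s <= p x}) : borel_measurable borel"
  proof -
  have "{z : space (borel \<Otimes>\<^sub>M lborel). fst z <= p (snd z)} : sets (borel \<Otimes>\<^sub>M lborel)" using p by measurable
  then have "{z. fst z <= p (snd z)} : sets (borel \<Otimes>\<^sub>M lborel)" by (simp add: space_pair_measure)
  from lborel.measurable_emeasure_Pair[OF this] show ?thesis by (simp add: vimage_def)
  qed
  then show ?thesis by measurable
  qed
  have "ennreal (1 - t) * (\<integral>\<^sup>+x. ennreal (F x) \<partial>lborel) + ennreal t * (\<integral>\<^sup>+x. ennreal (G x) \<partial>lborel)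
  = (\<integral>\<^sup>+s. ennreal (1 - t) * (emeasure lborel {x. s <= F x} * indicator {0<..1} s) + ennreal t * (emeasure lborel {x. s <= G x} * indicator {0<..1} s) \<partial>lborel)"
  unfolding lcF lcG using antimono_meas mF by (simp add: nn_integral_add nn_integral_cmult)
  also have "... <= (\<integral>\<^sup>+s. emeasure lborel {x. s <= H x} * indicator {0<..1} s \<partial>lborel)"
  proof (rule nn_integral_mono_AE)
  \<comment> \<open>At height 1 the suprema need not be attained and the level sets may be empty;
    this height is a null set.\<close>
  have "AE s in lborel. s ~= (1::real)" by (rule AE_lborel_singleton)
  then show "AE s in lborel. ennreal (1 - t) * (emeasure lborel {x. s <= F x} * indicator {0<..1} s) + ennreal t * (emeasure lborel {x. s <= G x} * indicator {0<..1} s)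
  <= emeasure lborel {x. s <= H x} * indicator {0<..1} s"
  proof eventually_elim
  case (elim s)
  then show ?case using level[of s] by (auto simp: indicator_def)
  qed
  qed
  also have "... = (\<integral>\<^sup>+x. ennreal (min (max (H x) 0) 1) \<partial>lborel)" using layer_cake[OF mF(3), of 1] by simp
  also have "... <= (\<integral>\<^sup>+x. ennreal (H x) \<partial>lborel)" using F01 by (intro nn_integral_mono ennreal_leI) (auto simp: min_def max_def)
  finally have main: "ennreal (1 - t) * (\<integral>\<^sup>+x. ennreal (F x) \<partial>lborel) + ennreal t * (\<integral>\<^sup>+x. ennreal (G x) \<partial>lborel) <= (\<integral>\<^sup>+x. ennreal (H x) \<partial>lborel)" .
  have sc: "(\<integral>\<^sup>+x. ennreal (p x / c) \<partial>lborel) = ennreal (1 / c) * (\<integral>\<^sup>+x. ennreal (p x) \<partial>lborel)"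
  if "c > 0" "p : borel_measurable borel" "!!x. 0 <= p x" for p :: "real => real" and c
  proof -
  have "ennreal (p x / c) = ennreal (1 / c) * ennreal (p x)" for x using that by (simp add: ennreal_mult[symmetric])
  then show ?thesis using that by (simp add: nn_integral_cmult)
  qed
  have bounded_fin: "(\<integral>\<^sup>+x. ennreal (p x) \<partial>lborel) < \<infinity>" if p: "!!x. 0 <= p x & p x <= C & (R < \<bar>x\<bar> --> p x = 0)" for p :: "real => real"
  proof -
  have "(\<integral>\<^sup>+x. ennreal (p x) \<partial>lborel) <= (\<integral>\<^sup>+x. ennreal C * indicator {-R..R} x \<partial>lborel)"
  proof (rule nn_integral_mono)
  fix x show "ennreal (p x) <= ennreal C * indicator {-R..R} x"
  using p[of x] by (cases "R < \<bar>x\<bar>") (auto simp: indicator_def intro: ennreal_leI)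
  qed
  also have "... = ennreal C * emeasure lborel {-R..R}" by (simp add: nn_integral_cmult)
  also have "... < \<infinity>" by (auto simp: ennreal_mult_less_top emeasure_lborel_Icc_eq)
  finally show ?thesis .
  qed
  define If where "If = enn2real (\<integral>\<^sup>+x. ennreal (f x) \<partial>lborel)"
  define Ig where "Ig = enn2real (\<integral>\<^sup>+x. ennreal (g x) \<partial>lborel)"
  define Ih where "Ih = enn2real (\<integral>\<^sup>+x. ennreal (h x) \<partial>lborel)"
  have I0: "0 <= If" "0 <= Ig" "0 <= Ih" by (auto simp: If_def Ig_def Ih_def)
  have eI: "(\<integral>\<^sup>+x. ennreal (f x) \<partial>lborel) = ennreal If" "(\<integral>\<^sup>+x. ennreal (g x) \<partial>lborel) = ennreal Ig" "(\<integral>\<^sup>+x. ennreal (h x) \<partial>lborel) = ennreal Ih"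
  using bounded_fin[OF f] bounded_fin[OF g] fin by (auto simp: If_def Ig_def Ih_def)
  have eF: "(\<integral>\<^sup>+x. ennreal (F x) \<partial>lborel) = ennreal (If / a)" unfolding F_def
  using sc[OF a meas(1)] f a I0 by (simp add: eI ennreal_mult[symmetric])
  have eG: "(\<integral>\<^sup>+x. ennreal (G x) \<partial>lborel) = ennreal (Ig / b)" unfolding G_def
  using sc[OF b meas(2)] g b I0 by (simp add: eI ennreal_mult[symmetric])
  have eH: "(\<integral>\<^sup>+x. ennreal (H x) \<partial>lborel) = ennreal (Ih / k)" unfolding H_def
  using sc[OF k meas(3)] h k I0 by (simp add: eI ennreal_mult[symmetric])
  have main': "(1 - t) * (If / a) + t * (Ig / b) <= Ih / k"
  proof -
  have "ennreal ((1 - t) * (If / a) + t * (Ig / b)) <= ennreal (Ih / k)"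
  using main ennreal_plus[of "(1 - t) * (If / a)" "t * (Ig / b)"] ennreal_mult[of "1 - t" "If / a"] ennreal_mult[of t "Ig / b"] t a b I0
  unfolding eF eG eH by (simp del: times_divide_eq_right)
  then show ?thesis using I0 k by (simp add: ennreal_le_iff)
  qed
  have "(If / a) powr (1 - t) * (Ig / b) powr t <= Ih / k"
  using weighted_AM_GM[of "If / a" "Ig / b" t] main' t I0 a b by simp
  then have "If powr (1 - t) * Ig powr t / k <= Ih / k"
  using I0 a b by (simp add: powr_divide k_def)
  then have "If powr (1 - t) * Ig powr t <= Ih" using k by (simp add: divide_le_cancel)
  then show ?thesis by (simp add: If_def Ig_def Ih_def)
 qed
qed

interpretation lborel_product: product_sigma_finite "%_ :: 'i. lborel :: real measure"
 by unfold_locales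

definition box_integral :: "'i set => (('i => real) => real) => real" where
 "box_integral I f = enn2real (\<integral>\<^sup>+x. ennreal (f x) \<partial>(LB I))"

lemma box_function_section:
 assumes f: "box_function (insert i I) C R f" and i: "i \<notin> I" and x: "x : space (LB I)"
 shows "(%y. f (x(i := y))) : borel_measurable borel"
  "0 <= f (x(i := y)) & f (x(i := y)) <= C & (R < \<bar>y\<bar> --> f (x(i := y)) = 0)"
  "(EX j:I. R < \<bar>x j\<bar>) ==> f (x(i := y)) = 0"
proof -
 have m: "(%y. x(i := y)) : borel \<rightarrow>\<^sub>M (\<Pi>\<^sub>M i\<in>insert i I. (lborel :: real measure))"
  using measurable_compose[OF measurable_Pair[OF measurable_const[OF x] measurable_ident] measurable_add_dim] by simp
 show "(%y. f (x(i := y))) : borel_measurable borel"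
  using f measurable_compose[OF m] by (auto simp: box_function_def)
 have s: "x(i := y) : space (\<Pi>\<^sub>M i\<in>insert i I. (lborel :: real measure))" for y
  using measurable_space[OF m, of y] by simp
 show "0 <= f (x(i := y)) & f (x(i := y)) <= C & (R < \<bar>y\<bar> --> f (x(i := y)) = 0)"
  using f s[of y] by (auto simp: box_function_def)
 show "(EX j:I. R < \<bar>x j\<bar>) ==> f (x(i := y)) = 0"
  using f s[of y] i unfolding box_function_def by (metis fun_upd_other insert_iff)
qed

lemma line_integral_le:
 fixes p :: "real => real"
 assumes p: "!!x. 0 <= p x & p x <= C & (R < \<bar>x\<bar> --> p x = 0)" and R: "0 <= R"
 shows "(\<integral>\<^sup>+x. ennreal (p x) \<partial>lborel) <= ennreal (C * (2 * R))"
proof -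
 have C: "0 <= C" using p[of 0] by linarith
 have "(\<integral>\<^sup>+x. ennreal (p x) \<partial>lborel) <= (\<integral>\<^sup>+x. ennreal C * indicator {-R..R} x \<partial>lborel)"
 proof (rule nn_integral_mono)
  fix x show "ennreal (p x) <= ennreal C * indicator {-R..R} x"
  using p[of x] by (cases "R < \<bar>x\<bar>") (auto simp: indicator_def intro: ennreal_leI)
 qed
 also have "... = ennreal C * emeasure lborel {-R..R}" by (simp add: nn_integral_cmult)
 also have "... = ennreal (C * (2 * R))" using C R by (simp add: ennreal_mult[symmetric])
 finally show ?thesis .
qed

definition slice_integral :: "'i => (('i => real) => real) => ('i => real) => real" where
 "slice_integral i f x = enn2real (\<integral>\<^sup>+y. ennreal (f (x(i := y))) \<partial>lborel)"

lemma slice_integral_eq: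
 assumes f: "box_function (insert i I) C R f" and i: "i \<notin> I" and x: "x : space (LB I)" and R: "0 <= R"
 shows "(\<integral>\<^sup>+y. ennreal (f (x(i := y))) \<partial>lborel) = ennreal (slice_integral i f x)" "slice_integral i f x <= C * (2 * R)"
proof -
 have C: "0 <= C" using box_function_section(2)[OF f i x, of 0] by linarith
 have le: "(\<integral>\<^sup>+y. ennreal (f (x(i := y))) \<partial>lborel) <= ennreal (C * (2 * R))"
  using box_function_section(2)[OF f i x] R by (rule line_integral_le)
 have fin: "(\<integral>\<^sup>+y. ennreal (f (x(i := y))) \<partial>lborel) < \<infinity>" using order_le_less_trans[OF le] by simp
 from fin show eq: "(\<integral>\<^sup>+y. ennreal (f (x(i := y))) \<partial>lborel) = ennreal (slice_integral i f x)"
  by (simp add: slice_integral_def)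
 show "slice_integral i f x <= C * (2 * R)" using le C R unfolding eq by (simp add: ennreal_le_iff)
qed

lemma box_function_slice:
 assumes f: "box_function (insert i I) C R f" and i: "i \<notin> I" and R: "0 <= R"
 shows "box_function I (C * (2 * R)) R (slice_integral i f)"
 unfolding box_function_def
proof (intro conjI ballI)
 have "(%(x, y). ennreal (f (x(i := y)))) : borel_measurable ((LB I) \<Otimes>\<^sub>M lborel)"
  using f measurable_compose[OF measurable_add_dim[of i I "%_. lborel"], of f borel]
  by (auto simp: box_function_def split_beta' intro!: measurable_compose[OF _ measurable_ennreal])
 from lborel.borel_measurable_nn_integral[OF this]
 show "slice_integral i f : borel_measurable (LB I)"
  unfolding slice_integral_def[abs_def] by measurable
 fix x assume x: "x : space (LB I)"
 show "0 <= slice_integral i f x" by (simp add: slice_integral_def)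
 show "slice_integral i f x <= C * (2 * R)" by (rule slice_integral_eq[OF f i x R])
 show "(EX i:I. R < \<bar>x i\<bar>) --> slice_integral i f x = 0"
  using box_function_section(3)[OF f i x] by (simp add: slice_integral_def)
qed

lemma nn_integral_slice:
 assumes I: "finite I" and f: "box_function (insert i I) C R f" and i: "i \<notin> I" and R: "0 <= R"
 shows "(\<integral>\<^sup>+x. ennreal (f x) \<partial>(\<Pi>\<^sub>M i\<in>insert i I. lborel)) = (\<integral>\<^sup>+x. ennreal (slice_integral i f x) \<partial>(LB I))"
proof -
 have "(\<integral>\<^sup>+x. ennreal (f x) \<partial>(\<Pi>\<^sub>M i\<in>insert i I. lborel)) = (\<integral>\<^sup>+x. (\<integral>\<^sup>+y. ennreal (f (x(i := y))) \<partial>lborel) \<partial>(LB I))"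
  using f by (intro lborel_product.product_nn_integral_insert[OF I i]) (auto simp: box_function_def)
 also have "... = (\<integral>\<^sup>+x. ennreal (slice_integral i f x) \<partial>(LB I))"
  by (intro nn_integral_cong slice_integral_eq[OF f i _ R])
 finally show ?thesis .
qed

definition convex_comb :: "'i set => real => ('i => real) => ('i => real) => 'i => real" where
 "convex_comb I t x y = (\<lambda>i\<in>I. (1 - t) * x i + t * y i)"

text \<open>Induction on the coordinates: for fixed x and y, the line case applied to the slices is
  exactly the pointwise hypothesis for the functions with one coordinate integrated out.\<close>

theorem Prekopa_Leindler:
 assumes "finite I" and "0 < t" "t < 1" and "0 <= R"
  and "box_function I C R f" "box_function I C R g" "box_function I C R h"
  and "!!x y. [|x : space (LB I); y : space (LB I)|] ==>
  f x powr (1 - t) * g y powr t <= h (convex_comb I t x y)"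
 shows "box_integral I f powr (1 - t) * box_integral I g powr t <= box_integral I h"
 using assms
proof (induction I arbitrary: C f g h)
 case empty
 have u: "(%k. undefined) : space (\<Pi>\<^sub>M i\<in>{} :: 'a set. (lborel :: real measure))" by (simp add: space_PiM)
 have "convex_comb {} t (%k. undefined) (%k. undefined) = (%k :: 'a. undefined)" by (auto simp: convex_comb_def)
 then show ?case using empty.prems(4-6) empty.prems(7)[OF u u] u
  by (simp add: box_integral_def lborel_product.nn_integral_empty box_function_def)
next
 case (insert i I)
 note i = insert.hyps(2) and fin = insert.hyps(1) and R = insert.prems(3)
 have eq: "box_integral (insert i I) p = box_integral I (slice_integral i p)" if "box_function (insert i I) C R p" for p
  unfolding box_integral_def nn_integral_slice[OF fin that i R] ..
 have "box_integral I (slice_integral i f) powr (1 - t) * box_integral I (slice_integral i g) powr t <= box_integral I (slice_integral i h)"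
 proof (rule insert.IH[OF insert.prems(1-3) box_function_slice[OF insert.prems(4) i R] box_function_slice[OF insert.prems(5) i R] box_function_slice[OF insert.prems(6) i R]])
  fix x y assume x: "x : space (LB I)" and y: "y : space (LB I)"
  have z: "convex_comb I t x y : space (LB I)" by (simp add: convex_comb_def space_PiM)
  show "slice_integral i f x powr (1 - t) * slice_integral i g y powr t <= slice_integral i h (convex_comb I t x y)"
  unfolding slice_integral_def
  proof (rule Prekopa_Leindler_line)
  show "(%u. f (x(i := u))) : borel_measurable borel" by (rule box_function_section[OF insert.prems(4) i x])
  show "(%u. g (y(i := u))) : borel_measurable borel" by (rule box_function_section[OF insert.prems(5) i y])
  show "(%u. h ((convex_comb I t x y)(i := u))) : borel_measurable borel" by (rule box_function_section[OF insert.prems(6) i z])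
  show "0 <= f (x(i := u)) & f (x(i := u)) <= C & (R < \<bar>u\<bar> --> f (x(i := u)) = 0)" for u
  by (rule box_function_section[OF insert.prems(4) i x])
  show "0 <= g (y(i := u)) & g (y(i := u)) <= C & (R < \<bar>u\<bar> --> g (y(i := u)) = 0)" for u
  by (rule box_function_section[OF insert.prems(5) i y])
  show "0 <= h ((convex_comb I t x y)(i := u))" for u using box_function_section(2)[OF insert.prems(6) i z] by blast
  show "(\<integral>\<^sup>+u. ennreal (h ((convex_comb I t x y)(i := u))) \<partial>lborel) < \<infinity>"
  unfolding slice_integral_eq(1)[OF insert.prems(6) i z R] by simp
  show "0 < t" "t < 1" by fact+
  fix u v
  have xu: "x(i := u) : space (\<Pi>\<^sub>M i\<in>insert i I. (lborel :: real measure))" using x i by (auto simp: space_PiM PiE_iff extensional_def)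
  have yv: "y(i := v) : space (\<Pi>\<^sub>M i\<in>insert i I. (lborel :: real measure))" using y i by (auto simp: space_PiM PiE_iff extensional_def)
  have eqc: "convex_comb (insert i I) t (x(i := u)) (y(i := v)) = (convex_comb I t x y)(i := (1 - t) * u + t * v)"
  using i by (auto simp: convex_comb_def fun_eq_iff)
  show "f (x(i := u)) powr (1 - t) * g (y(i := v)) powr t <= h ((convex_comb I t x y)(i := (1 - t) * u + t * v))"
  unfolding eqc[symmetric] by (rule insert.prems(7)[OF xu yv])
  qed
 qed
 then show ?case using eq insert.prems by simp
qed

section \<open>Volumes of sets of matrix tuples\<close>

text \<open>A diagonal affine map acts on boxes coordinate by coordinate, and the product measure is
  determined by its values on boxes.\<close>

lemma emeasure_PiM_affine:
 fixes c d :: "'i => real"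
 assumes I: "finite I" and c: "!!i. i : I ==> 0 < c i" and A: "A : sets (LB I)"
 shows "{a : space (LB I). (\<lambda>i\<in>I. (a i - d i) / c i) : A} : sets (LB I)"
  and "emeasure (LB I) {a : space (LB I). (\<lambda>i\<in>I. (a i - d i) / c i) : A} =
  ennreal (\<Prod>i\<in>I. c i) * emeasure (LB I) A"
proof -
 let ?P = "LB I"
 define f where "f = (%a. \<lambda>i\<in>I. (a i - d i) / c i)"
 define C where "C = ennreal (\<Prod>i\<in>I. c i)"
 have C0: "0 < (\<Prod>i\<in>I. c i)" using c by (simp add: prod_pos)
 have f: "f : measurable ?P ?P" unfolding f_def by (rule measurable_restrict) measurable
 have eq: "{a : space ?P. (\<lambda>i\<in>I. (a i - d i) / c i) : A} = f -` A \<inter> space ?P" for A by (auto simp: f_def)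
 show "{a : space ?P. (\<lambda>i\<in>I. (a i - d i) / c i) : A} : sets ?P" unfolding eq by (rule measurable_sets[OF f A])
 \<comment> \<open>The push-forward, rescaled by the inverse of the determinant of the scaling, will
   agree with the product measure.\<close>
 define P' where "P' = scale_measure (ennreal (inverse (\<Prod>i\<in>I. c i))) (distr ?P ?P f)"
 have "P' = ?P"
 proof (rule lborel_product.PiM_eqI[OF I])
  show "sets P' = sets ?P" by (simp add: P'_def)
  fix B :: "'i => real set" assume B: "!!i. i : I ==> B i : sets lborel"
  have im: "(%x. c i * x + d i) ` B i = {x. (x - d i) / c i : B i}" if "i : I" for i
  proof (intro equalityI subsetI)
  fix x assume "x : {x. (x - d i) / c i : B i}"
  then show "x : (%x. c i * x + d i) ` B i" using c[OF that] by (intro image_eqI[of _ _ "(x - d i) / c i"]) auto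
  qed (use c[OF that] in auto)
  have "f -` Pi\<^sub>E I B \<inter> space ?P = Pi\<^sub>E I (%i. (%x. c i * x + d i) ` B i)"
  by (auto simp: f_def space_PiM im PiE_iff)
  moreover have "emeasure ?P (Pi\<^sub>E I (%i. (%x. c i * x + d i) ` B i)) = (\<Prod>i\<in>I. ennreal (c i) * emeasure lborel (B i))"
  using B c by (subst lborel_product.emeasure_PiM[OF I]) (auto simp: emeasure_lborel_affine intro!: prod.cong)
  moreover have "Pi\<^sub>E I B : sets ?P" using B by (intro sets_PiM_I_finite[OF I]) auto
  ultimately have "emeasure P' (Pi\<^sub>E I B) = ennreal (inverse (\<Prod>i\<in>I. c i)) * (\<Prod>i\<in>I. ennreal (c i) * emeasure lborel (B i))"
  by (simp add: P'_def emeasure_distr[OF f])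
  also have "... = (ennreal (inverse (\<Prod>i\<in>I. c i)) * C) * (\<Prod>i\<in>I. emeasure lborel (B i))"
  using c by (simp add: prod.distrib C_def prod_ennreal less_imp_le mult.assoc)
  also have "ennreal (inverse (\<Prod>i\<in>I. c i)) * C = 1"
  using C0 by (simp add: C_def ennreal_mult[symmetric] less_imp_le ennreal_1[symmetric] del: ennreal_1)
  finally show "emeasure P' (Pi\<^sub>E I B) = (\<Prod>i\<in>I. emeasure lborel (B i))" by simp
 qed
 then have "emeasure ?P A = emeasure P' A" by simp
 also have "... = ennreal (inverse (\<Prod>i\<in>I. c i)) * emeasure ?P (f -` A \<inter> space ?P)"
  using A by (simp add: P'_def emeasure_distr[OF f])
 finally have "C * emeasure ?P A = (C * ennreal (inverse (\<Prod>i\<in>I. c i))) * emeasure ?P (f -` A \<inter> space ?P)"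
  by (simp add: mult.assoc)
 also have "C * ennreal (inverse (\<Prod>i\<in>I. c i)) = 1"
  using C0 by (simp add: C_def ennreal_mult[symmetric] less_imp_le ennreal_1[symmetric] del: ennreal_1)
 finally show "emeasure ?P {a : space ?P. (\<lambda>i\<in>I. (a i - d i) / c i) : A} = ennreal (\<Prod>i\<in>I. c i) * emeasure ?P A"
  unfolding eq C_def by simp
qed

abbreviation coord_space :: "nat => nat => (nat \<times> nat \<times> nat \<times> bool => real) measure" where
 "coord_space n m \<equiv> \<Pi>\<^sub>M i\<in>coord_index n m. lborel"

abbreviation mat_ball :: "nat => nat => real => complex mat list set" where
 "mat_ball n m R \<equiv> tball (Mat n) m R"

text \<open>\<open>vol\<close> is an \<open>emeasure\<close>, which takes the default value 0 on
  sets that are not measurable, so measurability has to accompany every volume comparison.\<close>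

definition coord_measurable :: "nat => nat => complex mat list set => bool" where
 "coord_measurable n m G <-> {a : space (coord_space n m). mt n m a : G} : sets (coord_space n m)"

lemma finite_coord_index [simp]: "finite (coord_index n m)"
 by (simp add: coord_index_def)

lemma length_matrix_tuple [simp]: "length (mt n m a) = m"
 by (simp add: matrix_tuple_def)

lemma matrix_tuple_carrier [simp]: "j < m ==> mt n m a ! j : sqm n"
 by (simp add: matrix_tuple_def)

lemma matrix_tuple_entry:
 "j < m ==> p < n ==> q < n ==> mt n m a ! j $$ (p, q) =
  cor (sqrt (real n)) * Complex (a (j, p, q, False)) (a (j, p, q, True))"
 by (simp add: matrix_tuple_def)

lemma matrix_tuple_eqI:
 assumes "length X = m" and "!!j. j < m ==> X ! j : sqm n"
  and "!!j p q. j < m ==> p < n ==> q < n ==> X ! j $$ (p, q) = mt n m a ! j $$ (p, q)"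
 shows "mt n m a = X"
proof (rule nth_equalityI)
 fix j assume "j < length (mt n m a)"
 then show "mt n m a ! j = X ! j"
  using assms(2,3)[of j] matrix_tuple_carrier[of j m n a] by (intro eq_matI) (auto simp del: matrix_tuple_carrier)
qed (simp add: assms)

lemma matrix_tuple_cong:
 "(!!i. i : coord_index n m ==> a i = b i) ==> mt n m a = mt n m b"
 by (intro matrix_tuple_eqI) (auto simp: matrix_tuple_entry coord_index_def)

lemma mat_minus [simp]: "A : sqm n ==> B : sqm n ==> A -[Mat n] B = A - B"
 by (auto simp: mat.minus_eq_scal intro!: eq_matI)

text \<open>The factor sqrt n in \<open>matrix_tuple\<close> cancels the 1/n of the normalised
  trace, leaving the Euclidean distance of the coordinates.\<close>

lemma norm2_matrix_tuple_minus:
 assumes "j < m"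
 shows "mat.n2 n (mt n m a ! j - mt n m b ! j) =
  sqrt (\<Sum>q<n. \<Sum>p<n. (a (j, p, q, False) - b (j, p, q, False))^2 + (a (j, p, q, True) - b (j, p, q, True))^2)"
proof -
 have "mat.n2 n (mt n m a ! j - mt n m b ! j) =
  sqrt ((\<Sum>q<n. \<Sum>p<n. real n * ((a (j, p, q, False) - b (j, p, q, False))^2 + (a (j, p, q, True) - b (j, p, q, True))^2)) / real n)"
  using assms matrix_tuple_carrier[OF assms, of n a] matrix_tuple_carrier[OF assms, of n b]
  by (subst norm2_mat)
  (auto simp: matrix_tuple_entry norm_mult power_mult_distrib right_diff_distrib[symmetric] cmod_power2
  simp del: matrix_tuple_carrier intro!: sum.cong arg_cong[where f="%x. sqrt (x / real n)"])
 also have "... = sqrt (\<Sum>q<n. \<Sum>p<n. (a (j, p, q, False) - b (j, p, q, False))^2 + (a (j, p, q, True) - b (j, p, q, True))^2)"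
  by (cases "n = 0") (simp_all add: sum_distrib_left[symmetric])
 finally show ?thesis .
qed

lemma mat_ball_carrier: "X : mat_ball n m R ==> j < m ==> X ! j : sqm n"
 using tuplesD(2)[of X m "op_ball (Mat n) R" j] by (simp add: op_ball_def)

lemma coord_le_norm2:
 assumes "(j, p, q, b) : coord_index n m"
 shows "\<bar>a (j, p, q, b)\<bar> <= mat.n2 n (mt n m a ! j)"
proof -
 have jpq: "j < m" "p < n" "q < n" using assms by (auto simp: coord_index_def)
 have "cmod (mt n m a ! j $$ (p, q)) <= sqrt (real n) * mat.n2 n (mt n m a ! j)"
  using jpq by (intro mat_entry_le_norm2) auto
 then have "cmod (Complex (a (j, p, q, False)) (a (j, p, q, True))) <= mat.n2 n (mt n m a ! j)"
  using jpq by (simp add: matrix_tuple_entry norm_mult)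
 then show ?thesis
  using abs_Re_le_cmod[of "Complex (a (j, p, q, False)) (a (j, p, q, True))"]
  abs_Im_le_cmod[of "Complex (a (j, p, q, False)) (a (j, p, q, True))"] by (cases b) auto
qed

lemma coord_le_radius:
 assumes "mt n m a : mat_ball n m R" and "i : coord_index n m"
 shows "\<bar>a i\<bar> <= R"
proof -
 obtain j p q b where i: "i = (j, p, q, b)" by (cases i)
 have j: "j < m" using assms(2) i by (simp add: coord_index_def)
 have "mt n m a ! j : op_ball (Mat n) R" using tuplesD(2)[OF assms(1) j] .
 then show ?thesis using coord_le_norm2[of j p q b n m a] assms(2) i mat.n2_le_opn[of "mt n m a ! j" n] by (simp add: op_ball_def)
qed

text \<open>Coordinates outside the finite index set are set to 0, which leads to functions on the
  whole countable index type; there the product and Borel sigma-algebras agree, and topological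
  arguments apply.\<close>

lemma coord_measurable_borel:
 assumes "{a. mt n m a : G} : sets borel"
 shows "coord_measurable n m G"
proof -
 define f where "f = (%a i. if i : coord_index n m then a i else 0 :: real)"
 have "f : measurable (coord_space n m) (\<Pi>\<^sub>M i\<in>UNIV. borel)"
  unfolding f_def
 proof (rule measurable_PiM_single')
  fix i :: "nat \<times> nat \<times> nat \<times> bool"
  show "(%a. if i : coord_index n m then a i else 0) : measurable (coord_space n m) borel"
  using measurable_component_singleton[of i "coord_index n m" "%_. lborel :: real measure"]
  by (cases "i : coord_index n m") simp_all
 qed auto
 then have f: "f : measurable (coord_space n m) borel"
  by (simp add: measurable_cong_sets[OF refl sets_PiM_equal_borel])
 have "mt n m (f a) = mt n m a" for a by (rule matrix_tuple_cong) (simp add: f_def)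
 then have "{a : space (coord_space n m). mt n m a : G} = f -` {a. mt n m a : G} \<inter> space (coord_space n m)"
  by auto
 then show ?thesis unfolding coord_measurable_def using measurable_sets[OF f assms] by simp
qed

lemma coord_continuous:
 assumes "!!X e. X : S ==> e > 0 ==>
  EX d>0. ALL Y:S. (ALL j<m. mat.n2 n (Y ! j - X ! j) <= d) --> \<bar>g Y - g X\<bar> <= e"
 shows "continuous_on {a. mt n m a : S} (%a. g (mt n m a) :: real)"
 unfolding continuous_on_def
proof (intro ballI tendstoI)
 fix x e assume x: "x : {a. mt n m a : S}" and e: "0 < (e :: real)"
 obtain d where d: "d > 0" and dd: "!!Y. Y : S ==> ALL j<m. mat.n2 n (Y ! j - mt n m x ! j) <= d ==>
  \<bar>g Y - g (mt n m x)\<bar> <= e / 2"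
  using assms[of "mt n m x" "e / 2"] x e by auto
 let ?F = "at x within {a. mt n m a : S}"
 have "eventually (%y. mat.n2 n (mt n m y ! j - mt n m x ! j) < d) ?F" if j: "j < m" for j
 proof -
  let ?h = "%y. sqrt (\<Sum>q<n. \<Sum>p<n. (y (j, p, q, False) - x (j, p, q, False))^2 + (y (j, p, q, True) - x (j, p, q, True))^2)"
  have "continuous_on UNIV ?h" by (intro continuous_intros continuous_on_product_coordinates)
  then have "continuous_on {a. mt n m a : S} ?h" by (rule continuous_on_subset) simp
  then have "(?h ~> ?h x) ?F" using x by (auto simp: continuous_on_def)
  then have "eventually (%y. ?h y < d) ?F" using d by (intro order_tendstoD(2)) auto
  then show ?thesis by (simp only: norm2_matrix_tuple_minus[OF j])
 qed
 then have "eventually (%y. ALL j:{..<m}. mat.n2 n (mt n m y ! j - mt n m x ! j) < d) ?F"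
  by (intro eventually_ball_finite) auto
 moreover have "eventually (%y. mt n m y : S) ?F" by (simp add: eventually_at_filter)
 ultimately show "eventually (%y. dist (g (mt n m y)) (g (mt n m x)) < e) ?F"
 proof eventually_elim
  case (elim y)
  then have "\<bar>g (mt n m y) - g (mt n m x)\<bar> <= e / 2" by (intro dd) (auto intro: less_imp_le)
  then show ?case using e by (simp add: dist_real_def)
 qed
qed

text \<open>Writes the operator norm ball as an intersection of conditions that are continuous in
  the matrix, which makes it closed.\<close>

lemma op_ball_iff:
 assumes "A : sqm n" "0 <= R"
 shows "A : op_ball (Mat n) R <-> (ALL y:sqm n. mat.n2 n (A * y) - R * mat.n2 n y <= 0)"
proof
 assume A: "A : op_ball (Mat n) R"
 have "mat.n2 n (A * y) <= R * mat.n2 n y" if y: "y : sqm n" for y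
 proof -
  have "mat.n2 n (A * y) <= mat_opnorm n A * mat.n2 n y" using mat.opn_bound[of A n y] assms y by simp
  also have "... <= R * mat.n2 n y" using A mat.n2_nonneg[of y n] y by (intro mult_right_mono) (auto simp: op_ball_def)
  finally show ?thesis .
 qed
 then show "ALL y:sqm n. mat.n2 n (A * y) - R * mat.n2 n y <= 0" by simp
next
 assume "ALL y:sqm n. mat.n2 n (A * y) - R * mat.n2 n y <= 0"
 then show "A : op_ball (Mat n) R" using mat.opn_least[of A n R] assms by (simp add: op_ball_def)
qed

lemma closed_mat_ball:
 assumes "0 <= R"
 shows "closed {a. mt n m a : mat_ball n m R}"
proof -
 let ?g = "%j y X. mat.n2 n (X ! j * y) - R * mat.n2 n y"
 have "continuous_on UNIV (%a. ?g j y (mt n m a))" if j: "j < m" and y: "y : sqm n" for j y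
 proof -
  have "continuous_on {a. mt n m a : range (mt n m)} (%a. ?g j y (mt n m a))"
  proof (rule coord_continuous)
  fix X and e :: real assume X: "X : range (mt n m)" and e: "e > 0"
  have o: "0 <= mat_opnorm n y" using mat.opn_nonneg[of y n] y by simp
  have "\<bar>?g j y Y - ?g j y X\<bar> <= e" if Y: "Y : range (mt n m)" "ALL j<m. mat.n2 n (Y ! j - X ! j) <= e / (mat_opnorm n y + 1)" for Y
  proof -
  have c: "X ! j : sqm n" "Y ! j : sqm n" using X Y j by auto
  have "\<bar>?g j y Y - ?g j y X\<bar> <= mat.n2 n (Y ! j * y - X ! j * y)"
  using mat.n2_diff_abs[of "Y ! j * y" n "X ! j * y"] c y by simp
  also have "... = mat.n2 n ((Y ! j - X ! j) * y)"
  using c y by (simp add: minus_mult_distrib_mat)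
  also have "... <= mat.n2 n (Y ! j - X ! j) * mat_opnorm n y"
  using mat.opn_bound_right[of "Y ! j - X ! j" n y] c y by (simp add: minus_carrier_mat)
  also have "... <= e / (mat_opnorm n y + 1) * mat_opnorm n y" using Y j o by (intro mult_right_mono) auto
  also have "... <= e" using e o by (simp add: field_simps)
  finally show ?thesis .
  qed
  then show "EX d>0. ALL Y:range (mt n m). (ALL j<m. mat.n2 n (Y ! j - X ! j) <= d) --> \<bar>?g j y Y - ?g j y X\<bar> <= e"
  using e o by (intro exI[of _ "e / (mat_opnorm n y + 1)"]) auto
  qed
  then show ?thesis by simp
 qed
 then have "closed (\<Inter>j\<in>{..<m}. \<Inter>y\<in>sqm n. {a. ?g j y (mt n m a) <= 0})"
  by (intro closed_INT ballI closed_Collect_le) auto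
 moreover have "{a. mt n m a : mat_ball n m R} = (\<Inter>j\<in>{..<m}. \<Inter>y\<in>sqm n. {a. ?g j y (mt n m a) <= 0})"
  using op_ball_iff[OF matrix_tuple_carrier assms, of _ m n] by (auto simp: tuples_def set_conv_nth)
 ultimately show ?thesis by simp
qed

text \<open>By the uniform moduli of formulas the type depends continuously on the tuple in the
  ball, so the set is relatively open in a closed set.\<close>

lemma coord_measurable_open:
 assumes R: "R > 0" and W: "openin (product_topology (%_. euclideanreal) (formulas m)) W"
 shows "coord_measurable n m {X : mat_ball n m R. tp m (Mat n) X : W}"
proof (rule coord_measurable_borel)
 let ?B = "{a. mt n m a : mat_ball n m R}"
 have "continuous_on ?B (%a. itp n ps (mt n m a))" if ps: "ps : formulas m" for ps
 proof (rule coord_continuous)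
  fix X and e :: real assume X: "X : mat_ball n m R" and e: "e > 0"
  obtain d where d: "d > 0" "formula_modulus TYPE(complex mat) m R ps e d"
  using formula_uniformity[of m ps R] ps R e by (auto simp: formulas_def)
  have "\<bar>itp n ps Y - itp n ps X\<bar> <= e"
  if "Y : mat_ball n m R" "ALL j<m. mat.n2 n (Y ! j - X ! j) <= d" for Y
  proof -
  have "ALL j<m. mat.n2 n (Y ! j -[Mat n] X ! j) <= d"
  using that mat_ball_carrier[OF X] mat_ball_carrier[OF that(1)] by simp
  then show ?thesis using d(2) mat.star_alg_axioms[of n] X that(1) unfolding formula_modulus_def by blast
  qed
  with d(1) show "EX d>0. ALL Y:mat_ball n m R. (ALL j<m. mat.n2 n (Y ! j - X ! j) <= d) -->
  \<bar>itp n ps Y - itp n ps X\<bar> <= e" by blast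
 qed
 then have "continuous_map (top_of_set ?B) (product_topology (%_. euclideanreal) (formulas m)) (%a. tp m (Mat n) (mt n m a))"
  by (auto simp: continuous_map_componentwise tp_def)
 from openin_continuous_map_preimage[OF this W]
 have "openin (top_of_set ?B) {a : ?B. tp m (Mat n) (mt n m a) : W}" by simp
 then obtain T where "open T" "{a : ?B. tp m (Mat n) (mt n m a) : W} = ?B \<inter> T" by (auto simp: openin_open)
 then have "{a : ?B. tp m (Mat n) (mt n m a) : W} : sets borel"
  using closed_mat_ball[of R n m] R by auto
 then show "{a. mt n m a : {X : mat_ball n m R. tp m (Mat n) X : W}} : sets borel" by simp
qed

lemma openin_basic:
 assumes "finite F" "F <= formulas m" "!!ps. ps : F ==> open (G ps)"
 shows "openin (product_topology (%_. euclideanreal) (formulas m)) {l : extensional (formulas m). ALL ps:F. l ps : G ps}"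
 using assms
proof (induction F rule: finite_induct)
 case empty
 have "openin (product_topology (%_. euclideanreal) (formulas m)) (topspace (product_topology (%_. euclideanreal) (formulas m)))" by blast
 then show ?case by (simp add: PiE_UNIV_domain PiE_def)
next
 case (insert ps F)
 have "openin (product_topology (%_. euclideanreal) (formulas m)) {l : topspace (product_topology (%_. euclideanreal) (formulas m)). l ps : G ps}"
  using insert.prems by (intro openin_continuous_map_preimage[where Y=euclideanreal] continuous_map_product_projection) auto
 moreover have "openin (product_topology (%_. euclideanreal) (formulas m)) {l : extensional (formulas m). ALL ps:F. l ps : G ps}"
  using insert by auto
 ultimately have "openin (product_topology (%_. euclideanreal) (formulas m))
  ({l : topspace (product_topology (%_. euclideanreal) (formulas m)). l ps : G ps} \<inter> {l : extensional (formulas m). ALL ps:F. l ps : G ps})"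
  by (rule openin_Int)
 then show ?case by (rule arg_cong[where f="openin _", THEN iffD1, rotated]) (auto simp: PiE_def)
qed

lemma coord_measurable_basic:
 assumes "R > 0" "finite F" "F <= formulas m" "!!ps. ps : F ==> open (G ps)"
 shows "coord_measurable n m {X : mat_ball n m R. ALL ps:F. itp n ps X : G ps}"
proof -
 have "{X : mat_ball n m R. ALL ps:F. itp n ps X : G ps} =
  {X : mat_ball n m R. tp m (Mat n) X : {l : extensional (formulas m). ALL ps:F. l ps : G ps}}"
  using assms(3) by (auto simp: tp_def subset_iff)
 then show ?thesis using coord_measurable_open[OF assms(1) openin_basic[OF assms(2-4)]] by simp
qed

lemma vol_finite:
 assumes "G <= mat_ball n m R"
 shows "vol n m G < \<infinity>"
proof -
 have "{a : space (coord_space n m). mt n m a : G} <= Pi\<^sub>E (coord_index n m) (%_. {-R..R})"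
  using coord_le_radius[of n m _ R] assms by (force simp: space_PiM PiE_iff abs_le_iff)
 then have "vol n m G <= emeasure (coord_space n m) (Pi\<^sub>E (coord_index n m) (%_. {-R..R}))"
  unfolding vol_def Let_def by (intro emeasure_mono sets_PiM_I_finite) auto
 also have "... = (\<Prod>i\<in>coord_index n m. emeasure lborel {-R..R})"
  by (subst lborel_product.emeasure_PiM) auto
 also have "... < \<infinity>" by (simp add: emeasure_lborel_Icc_eq ennreal_power less_top[symmetric])
 finally show ?thesis .
qed

lemma vol_mono: "coord_measurable n m H ==> G <= H ==> vol n m G <= vol n m H"
 unfolding vol_def Let_def coord_measurable_def by (intro emeasure_mono) auto

text \<open>The functional inequality for indicators; \<open>matrix_tuple\<close> is linear, so
  matrix segments are convex combinations of coordinates.\<close>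

theorem vol_Prekopa_Leindler:
 assumes "0 < t" "t < 1" "0 <= R"
  and meas: "coord_measurable n m A" "coord_measurable n m B" "coord_measurable n m C"
  and sub: "A <= mat_ball n m R" "B <= mat_ball n m R" "C <= mat_ball n m R"
  and seg: "!!X Y. X : A ==> Y : B ==> tuple_segment (Mat n) t X Y : C"
 shows "enn2real (vol n m A) powr (1 - t) * enn2real (vol n m B) powr t <= enn2real (vol n m C)"
proof -
 let ?I = "coord_index n m"
 define f :: "complex mat list set => (nat \<times> nat \<times> nat \<times> bool => real) => real" where "f G = indicator {a : space (coord_space n m). mt n m a : G}" for G
 have bf: "box_function ?I 1 R (f G)" "box_integral ?I (f G) = enn2real (vol n m G)"
  if "coord_measurable n m G" "G <= mat_ball n m R" for G
 proof -
  have "\<not> R < \<bar>a i\<bar>" if "mt n m a : G" "i : ?I" for a i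
  using coord_le_radius[of n m a R i] that \<open>G <= _\<close> by auto
  then show "box_function ?I 1 R (f G)"
  using that(1) by (auto simp: box_function_def f_def coord_measurable_def indicator_def)
  show "box_integral ?I (f G) = enn2real (vol n m G)"
  using that(1) by (simp add: box_integral_def f_def vol_def Let_def coord_measurable_def ennreal_indicator)
 qed
 have seg': "mt n m (convex_comb ?I t x y) = tuple_segment (Mat n) t (mt n m x) (mt n m y)" for x y
  by (rule matrix_tuple_eqI)
  (auto simp: tuple_segment_def matrix_tuple_entry convex_comb_def coord_index_def complex_eq_iff algebra_simps matrix_tuple_def)
 have "box_integral ?I (f A) powr (1 - t) * box_integral ?I (f B) powr t <= box_integral ?I (f C)"
 proof (rule Prekopa_Leindler[OF finite_coord_index assms(1-3) bf(1)[OF meas(1) sub(1)] bf(1)[OF meas(2) sub(2)] bf(1)[OF meas(3) sub(3)]])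
  fix x y assume "x : space (coord_space n m)" "y : space (coord_space n m)"
  moreover have "convex_comb ?I t x y : space (coord_space n m)" by (simp add: convex_comb_def space_PiM)
  ultimately show "f A x powr (1 - t) * f B y powr t <= f C (convex_comb ?I t x y)"
  using seg[of "mt n m x" "mt n m y"] seg'[of x y] by (auto simp: f_def indicator_def)
 qed
 then show ?thesis using bf(2) meas sub by simp
qed

section \<open>Pushing matrices to the boundary of the operator norm ball\<close>

lemma rdiag_entries:
 assumes "x : sqm n" "p < n" "q < n"
 shows "(rdiag n d * x) $$ (p, q) = cor (d p) * x $$ (p, q)"
  and "(x * rdiag n d) $$ (p, q) = cor (d q) * x $$ (p, q)"
proof -
 have "(rdiag n d * x) $$ (p, q) = (\<Sum>k<n. rdiag n d $$ (p, k) * x $$ (k, q))"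
  using assms by (intro mat_mult_entry) auto
 also have "... = (\<Sum>k<n. if k = p then cor (d p) * x $$ (p, q) else 0)"
  using assms by (intro sum.cong) (auto simp: rdiag_def)
 finally show "(rdiag n d * x) $$ (p, q) = cor (d p) * x $$ (p, q)" using assms by simp
 have "(x * rdiag n d) $$ (p, q) = (\<Sum>k<n. x $$ (p, k) * rdiag n d $$ (k, q))"
  using assms by (intro mat_mult_entry) auto
 also have "... = (\<Sum>k<n. if k = q then cor (d q) * x $$ (p, q) else 0)"
  using assms by (intro sum.cong) (auto simp: rdiag_def)
 finally show "(x * rdiag n d) $$ (p, q) = cor (d q) * x $$ (p, q)" using assms by simp
qed

lemma norm2_diag_mult_sq:
 assumes "x : sqm n"
 shows "(mat.n2 n (rdiag n d * x))^2 = (\<Sum>j<n. \<Sum>i<n. (d i)^2 * (cmod (x $$ (i, j)))^2) / real n"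
 using assms by (simp add: norm2_mat sum_nonneg rdiag_entries norm_mult power_mult_distrib)

lemma norm2_mat_sum_sq: "x : sqm n ==> (mat.n2 n x)^2 = (\<Sum>j<n. \<Sum>i<n. (cmod (x $$ (i, j)))^2) / real n"
 by (simp add: norm2_mat sum_nonneg)

lemma norm2_diag_sq: "(mat.n2 n (rdiag n d))^2 = (\<Sum>i<n. (d i)^2) / real n"
proof -
 have "(mat.n2 n (rdiag n d))^2 = Re (trc (Mat n) (madj (rdiag n d) * rdiag n d))"
  using mat.n2_sq[of "rdiag n d" n] by simp
 then show ?thesis by (simp only: rdiag_adjoint rdiag_mult trc_diag_real Re_complex_of_real power2_eq_square)
qed

lemma opn_diag_le:
 assumes "0 <= B" "!!p. p < n ==> \<bar>d p\<bar> <= B"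
 shows "opn (Mat n) (rdiag n d) <= B"
proof (rule mat.opn_least)
 fix y assume "y : car (Mat n)"
 then have y: "y : sqm n" by simp
 have "(d i)^2 <= B\<^sup>2" if "i < n" for i using assms(1) assms(2)[OF that] abs_le_square_iff[of "d i" B] by simp
 then have "(mat.n2 n (rdiag n d * y))^2 <= (\<Sum>j<n. \<Sum>i<n. B\<^sup>2 * (cmod (y $$ (i, j)))^2) / real n"
  unfolding norm2_diag_mult_sq[OF y] by (intro divide_right_mono sum_mono mult_right_mono) auto
 also have "... = (B * mat.n2 n y)^2"
  by (simp only: norm2_mat_sum_sq[OF y] power_mult_distrib sum_distrib_left times_divide_eq_right)
 finally show "mat.n2 n (rdiag n d *[Mat n] y) <= B * mat.n2 n y"
  using power2_le_imp_le[of "mat.n2 n (rdiag n d * y)" "B * mat.n2 n y"] assms(1) mat.n2_nonneg[of y n] y by simp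
qed (use assms in auto)

text \<open>With T = sqrt (1 - S^2), this is S x S + R T^2, the compression of the block sum of x
  and R by the isometry with blocks S and T. Where s p is small, the diagonal entry is forced close
  to R.\<close>

definition push :: "nat => (nat => real) => real => complex mat => complex mat" where
 "push n s R x = rdiag n s * x * rdiag n s + rdiag n (%p. R * (1 - (s p)^2))"

lemma push_carrier [simp]: "x : sqm n ==> push n s R x : sqm n"
 by (simp add: push_def)

lemma push_entry:
 assumes "x : sqm n" "p < n" "q < n"
 shows "push n s R x $$ (p, q) = cor (s p * s q) * x $$ (p, q) + (if p = q then cor (R * (1 - (s p)^2)) else 0)"
proof -
 have "rdiag n s * x : sqm n" using assms by simp
 then have "push n s R x $$ (p, q) = (rdiag n s * x * rdiag n s) $$ (p, q) + rdiag n (%p. R * (1 - (s p)^2)) $$ (p, q)"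
  using assms by (simp add: push_def rdiag_def del: square_mult_closed)
 also have "(rdiag n s * x * rdiag n s) $$ (p, q) = cor (s q) * (cor (s p) * x $$ (p, q))"
  using assms by (simp add: rdiag_entries)
 finally show ?thesis using assms by (simp add: rdiag_def)
qed

lemma Cauchy_Schwarz_2:
 fixes a b c d u v :: real
 assumes "0 <= u" "0 <= v" "a\<^sup>2 + b\<^sup>2 = u\<^sup>2" "c\<^sup>2 + d\<^sup>2 = v\<^sup>2"
 shows "a * c + b * d <= u * v"
proof (rule power2_le_imp_le)
 have "(u * v)^2 - (a * c + b * d)^2 = (a * d - b * c)^2"
  unfolding power_mult_distrib assms(3,4)[symmetric] by (simp add: power2_eq_square algebra_simps)
 then show "(a * c + b * d)^2 <= (u * v)^2" by (metis diff_ge_0_iff_ge zero_le_power2)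
qed (use assms in simp)

text \<open>For z = \<open>push n s R x * y\<close> the inner product of z with itself splits into S
  z against x S y and R times T z against T y. Since |S z|^2 + |T z|^2 = |z|^2, and likewise for y,
  Cauchy-Schwarz gives |z|^2 <= R |z| |y|.\<close>

lemma opn_push_le:
 assumes x: "x : op_ball (Mat n) R" and s: "!!p. p < n ==> 0 <= s p & s p <= 1" and R: "0 <= R"
 shows "push n s R x : op_ball (Mat n) R"
proof -
 let ?M = "Mat n" and ?S = "rdiag n s" and ?T = "rdiag n (%p. sqrt (1 - (s p)^2))"
 have xc: "x : sqm n" and xn: "mat_opnorm n x <= R" using x by (auto simp: op_ball_def)
 have s1: "(s p)^2 <= 1" if "p < n" for p using s[OF that] by (simp add: power_le_one)
 have TT: "rdiag n (%p. R * (1 - (s p)^2)) = cor R \<cdot>\<^sub>m (?T * ?T)"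
  unfolding rdiag_mult using s1 by (auto simp: rdiag_def intro!: eq_matI)
 have split: "(norm2 ?M (?S * z))^2 + (norm2 ?M (?T * z))^2 = (norm2 ?M z)^2" if z: "z : sqm n" for z
  unfolding norm2_diag_mult_sq[OF z] norm2_mat_sum_sq[OF z] add_divide_distrib[symmetric] sum.distrib[symmetric]
  using s1 by (auto simp: algebra_simps intro!: sum.cong arg_cong[where f="%x. x / real n"])
 have "opn ?M (push n s R x) <= R"
 proof (rule mat.opn_least)
  show "push n s R x : car ?M" using xc by simp
  fix y assume "y : car ?M"
  then have y: "y : sqm n" by simp
  define z where "z = push n s R x * y"
  have z: "z : sqm n" using xc y by (simp add: z_def)
  have "z = ?S * (x * (?S * y)) + cor R \<cdot>\<^sub>m (?T * (?T * y))"
  using xc y unfolding z_def push_def TT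
  by (subst add_mult_distrib_mat[of _ n n]) (auto simp: assoc_mult_mat[of _ n n _ n _ n] mult_smult_assoc_mat[of _ n n _ n])
  then have "trc ?M (madj z * z) =
  trc ?M (madj z * (?S * (x * (?S * y)))) + cor R * trc ?M (madj z * (?T * (?T * y)))"
  using mat.ip_add_right[of z n "?S * (x * (?S * y))" "cor R \<cdot>\<^sub>m (?T * (?T * y))"]
  mat.ip_scal_right[of z n "?T * (?T * y)" "cor R"] xc y z
  by (simp del: mat_algebra_simps(8))
  moreover have "madj z * (rdiag n e * w) = madj (rdiag n e * z) * w" if "w : sqm n" for e w
  using that z mat_adjoint_mult[of "rdiag n e" n z] by (simp add: rdiag_adjoint assoc_mult_mat[of _ n n _ n _ n])
  ultimately have "trc ?M (madj z * z) =
  trc ?M (madj (?S * z) * (x * (?S * y))) + cor R * trc ?M (madj (?T * z) * (?T * y))"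
  using xc y by (simp del: mat_algebra_simps(8))
  then have "(norm2 ?M z)^2 = Re (trc ?M (madj (?S * z) * (x * (?S * y)))) + R * Re (trc ?M (madj (?T * z) * (?T * y)))"
  using mat.n2_sq[of z n] z by (simp del: mat_algebra_simps(8))
  also have "... <= norm2 ?M (?S * z) * norm2 ?M (x * (?S * y)) + R * (norm2 ?M (?T * z) * norm2 ?M (?T * y))"
  using mat.Cauchy_Schwarz_ip[of "?S * z" n "x * (?S * y)"] mat.Cauchy_Schwarz_ip[of "?T * z" n "?T * y"] xc y z R
  by (intro add_mono mult_left_mono order_trans[OF complex_Re_le_cmod]) (auto simp del: mat_algebra_simps(8))
  also have "... <= norm2 ?M (?S * z) * (R * norm2 ?M (?S * y)) + R * (norm2 ?M (?T * z) * norm2 ?M (?T * y))"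
  using mat.opn_bound[of x n "?S * y"] mult_right_mono[OF xn mat.n2_nonneg[of "?S * y" n]] mat.n2_nonneg[of "?S * z" n] xc y z
  by (intro add_right_mono mult_left_mono) auto
  also have "... = R * (norm2 ?M (?S * z) * norm2 ?M (?S * y) + norm2 ?M (?T * z) * norm2 ?M (?T * y))"
  by (simp add: algebra_simps)
  also have "... <= R * (norm2 ?M z * norm2 ?M y)"
  using R mat.n2_nonneg[of z n] mat.n2_nonneg[of y n] z y by (intro mult_left_mono Cauchy_Schwarz_2 split) auto
  finally have "norm2 ?M z * norm2 ?M z <= (R * norm2 ?M y) * norm2 ?M z" by (simp add: power2_eq_square ac_simps)
  then show "norm2 ?M (push n s R x *[?M] y) <= R * norm2 ?M y"
  using mult_nonneg_nonneg[OF R mat.n2_nonneg[of y n]] mat.n2_nonneg[of z n] z y mult_right_le_imp_le[of "norm2 ?M z" "norm2 ?M z" "R * norm2 ?M y"]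
  by (cases "norm2 ?M z > 0") (auto simp: z_def[symmetric])
 qed (rule R)
 then show ?thesis using xc by (simp add: op_ball_def)
qed

text \<open>The difference is (S - 1) x S + x (S - 1) + R (1 - S^2). The first two terms cost R each
  and the last costs 2 R because 1 + s <= 2, which makes 4 R in total.\<close>

lemma norm2_push_minus_le:
 assumes x: "x : op_ball (Mat n) R" and s: "!!p. p < n ==> 0 <= s p & s p <= 1" and R: "0 <= R"
 shows "mat.n2 n (push n s R x - x) <= 4 * R * mat.n2 n (rdiag n (%p. s p - 1))"
proof -
 let ?M = "Mat n" and ?S = "rdiag n s" and ?D = "rdiag n (%p. s p - 1)" and ?E = "rdiag n (%p. R * (1 - (s p)^2))"
 have xc: "x : sqm n" and xn: "mat_opnorm n x <= R" using x by (auto simp: op_ball_def)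
 have eq: "push n s R x - x = (?D * x * ?S + x * ?D) + ?E"
 proof (rule eq_matI)
  fix p q assume "p < dim_row ((?D * x * ?S + x * ?D) + ?E)" "q < dim_col ((?D * x * ?S + x * ?D) + ?E)"
  then have pq: "p < n" "q < n" by (simp_all add: rdiag_def)
  have "(?D * x * ?S) $$ (p, q) = cor (s q) * (cor (s p - 1) * x $$ (p, q))"
  using xc pq by (simp add: rdiag_entries)
  moreover have "dim_row (?D * x * ?S) = n" "dim_col (?D * x * ?S) = n" "dim_row (x * ?D) = n" "dim_col (x * ?D) = n"
  using xc by (auto simp: rdiag_def)
  ultimately have "((?D * x * ?S + x * ?D) + ?E) $$ (p, q) = cor (s q) * (cor (s p - 1) * x $$ (p, q))
  + cor (s q - 1) * x $$ (p, q) + (if p = q then cor (R * (1 - (s p)^2)) else 0)"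
  using pq rdiag_entries(2)[OF xc pq, of "%p. s p - 1"] by (simp add: rdiag_def del: index_mult_mat(1))
  then show "(push n s R x - x) $$ (p, q) = ((?D * x * ?S + x * ?D) + ?E) $$ (p, q)"
  using push_entry[OF xc pq, of s R] xc pq by (simp add: algebra_simps)
 qed (use xc in \<open>auto simp: rdiag_def push_def\<close>)
 have "norm2 ?M (?D * x * ?S) <= norm2 ?M (?D * x) * mat_opnorm n ?S"
  using mat.opn_bound_right[of "?D * x" n ?S] xc by simp
 also have "... <= (norm2 ?M ?D * mat_opnorm n x) * 1"
  using mat.opn_bound_right[of ?D n x] opn_diag_le[of 1 n s] s xc mat.n2_nonneg[of "?D" n] mat.opn_nonneg[of x n] mat.opn_nonneg[of ?S n]
  by (intro mult_mono) auto
 also have "... <= norm2 ?M ?D * R" using xn mat.n2_nonneg[of "?D" n] by (simp add: mult_left_mono)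
 finally have 1: "norm2 ?M (?D * x * ?S) <= norm2 ?M ?D * R" .
 have 2: "norm2 ?M (x * ?D) <= R * norm2 ?M ?D"
  using mat.opn_bound[of x n ?D] mult_right_mono[OF xn mat.n2_nonneg[of ?D n]] xc by simp
 have "(norm2 ?M ?E)^2 <= (\<Sum>i<n. (2 * R)^2 * (s i - 1)^2) / real n"
  unfolding norm2_diag_sq
 proof (intro divide_right_mono sum_mono)
  fix i assume "i : {..<n}"
  then have "\<bar>1 + s i\<bar> <= 2" using s[of i] by auto
  then have "(1 + s i)^2 <= 2\<^sup>2" by (metis abs_le_square_iff abs_numeral)
  then have "(R * (1 - s i))^2 * (1 + s i)^2 <= (R * (1 - s i))^2 * 2\<^sup>2" by (intro mult_left_mono) auto
  then show "(R * (1 - (s i)^2))^2 <= (2 * R)^2 * (s i - 1)^2" by (simp add: power2_eq_square algebra_simps)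
 qed simp
 also have "... = (2 * R * norm2 ?M ?D)^2" by (simp add: power_mult_distrib norm2_diag_sq sum_distrib_left)
 finally have 3: "norm2 ?M ?E <= 2 * R * norm2 ?M ?D" using R mat.n2_nonneg[of ?D n] power2_le_imp_le[of "norm2 ?M ?E" "2 * R * norm2 ?M ?D"] by simp
 have "norm2 ?M (push n s R x - x) <= norm2 ?M (?D * x * ?S) + norm2 ?M (x * ?D) + norm2 ?M ?E"
  unfolding eq using mat.n2_triangle[of "?D * x * ?S + x * ?D" n ?E] mat.n2_triangle[of "?D * x * ?S" n "x * ?D"] xc by simp
 then show ?thesis using 1 2 3 by (simp add: mult.commute mult.left_commute)
qed

text \<open>The crude Stirling bound n! >= (n/e)^n in logarithmic form.\<close>

lemma sum_ln_ge: "- real n <= (\<Sum>p<n. ln (real (Suc p) / real n))"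
proof -
 have "real k * ln (real k) - real k <= (\<Sum>p<k. ln (real (Suc p)))" for k
 proof (induction k)
  case (Suc k)
  have "real k * (ln (real (Suc k)) - ln (real k)) <= 1"
  proof (cases "k = 0")
  case False
  then have "ln (real (Suc k)) - ln (real k) = ln (real (Suc k) / real k)" using False ln_div[of "real (Suc k)" "real k"] by simp
  also have "real (Suc k) / real k = 1 + 1 / real k" using False by (simp add: field_simps)
  also have "ln (1 + 1 / real k) <= 1 / real k" by (rule ln_add_one_self_le_self) simp
  finally show ?thesis using False by (simp add: field_simps)
  qed simp
  then show ?case using Suc by (simp add: algebra_simps)
 qed simp
 moreover have "(\<Sum>p<n. ln (real (Suc p) / real n)) = (\<Sum>p<n. ln (real (Suc p)) - ln (real n))"
  by (intro sum.cong) (auto simp: ln_div)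
 ultimately show ?thesis by (simp add: sum_subtractf) (smt (verit))
qed

text \<open>The values of u^a at equally spaced u in (0, 1]. For small a they are close to 1 on
  average and the mean of their logarithms is at least -a, so distance and volume loss are small
  uniformly in n. Still, a fixed positive proportion of them lies below any given positive bound
  when n is large.\<close>

definition ramp :: "real => nat => nat => real" where
 "ramp a n p = (real (Suc p) / real n) powr a"

lemma ramp_bounds: "0 <= a ==> p < n ==> 0 < ramp a n p & ramp a n p <= 1"
 by (auto simp: ramp_def intro!: powr_le1)

text \<open>Uses (1 - s)^2 <= 1 - s <= - ln s for 0 < s <= 1 and then
  \<open>sum_ln_ge\<close>.\<close>

lemma norm2_ramp_le:
 assumes a: "0 < a"
 shows "mat.n2 n (rdiag n (%p. ramp a n p - 1)) <= sqrt a"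
proof (cases "n = 0")
 case False
 have "(mat.n2 n (rdiag n (%p. ramp a n p - 1)))^2 = (\<Sum>p<n. (ramp a n p - 1)^2) / real n"
  by (rule norm2_diag_sq)
 also have "... <= (\<Sum>p<n. - a * ln (real (Suc p) / real n)) / real n"
 proof (intro divide_right_mono sum_mono)
  fix p assume p: "p : {..<n}"
  have "(ramp a n p - 1)^2 = (1 - ramp a n p) * (1 - ramp a n p)" by (simp add: power2_eq_square algebra_simps)
  also have "... <= (1 - ramp a n p) * 1" using ramp_bounds[of a p n] a p by (intro mult_left_mono) auto
  finally have "(ramp a n p - 1)^2 <= 1 - ramp a n p" by simp
  moreover have "ramp a n p = exp (a * ln (real (Suc p) / real n))" using False by (simp add: ramp_def powr_def)
  ultimately show "(ramp a n p - 1)^2 <= - a * ln (real (Suc p) / real n)"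
  using exp_ge_add_one_self[of "a * ln (real (Suc p) / real n)"] by linarith
 qed simp
 also have "... = - a * (\<Sum>p<n. ln (real (Suc p) / real n)) / real n" by (simp add: sum_distrib_left)
 also have "... <= a * real n / real n"
  using mult_left_mono[OF sum_ln_ge[of n], of a] a by (intro divide_right_mono) auto
 finally show ?thesis using False by (intro real_le_rsqrt) simp
qed (use a in \<open>simp add: norm2_mat\<close>)

lemma vol_push:
 assumes n: "n > 0" and s: "!!p. p < n ==> 0 < s p" and G: "coord_measurable n m G" "G <= tuples m (sqm n)"
 shows "coord_measurable n m (map (push n s R) ` G)"
  and "vol n m (map (push n s R) ` G) = ennreal (\<Prod>(j, p, q, b)\<in>coord_index n m. s p * s q) * vol n m G"
proof -
 let ?I = "coord_index n m"
 define c where "c = (%(j :: nat, p, q, b :: bool). s p * s q)"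
 \<comment> \<open>The shift concerns only the real parts of diagonal entries; the division by sqrt
   n converts an entry into a coordinate.\<close>
 define d where "d = (%(j :: nat, p, q, b). if p = q & \<not> b then R * (1 - (s p)^2) / sqrt (real n) else 0)"
 have c: "0 < c i" if "i : ?I" for i using that s by (auto simp: c_def coord_index_def)
 let ?f = "%a. \<lambda>i\<in>?I. (a i - d i) / c i"
 have push: "map (push n s R) (mt n m (?f a)) = mt n m a" for a
 proof (rule matrix_tuple_eqI[symmetric])
  fix j p q assume jpq: "j < m" "p < n" "q < n"
  have I: "(j, p, q, b) : ?I" for b using jpq by (simp add: coord_index_def)
  have sne: "s p ~= 0" "s q ~= 0" using s[OF jpq(2)] s[OF jpq(3)] by auto
  have "sqrt (real n) * sqrt (real n) = real n" by simp
  then show "map (push n s R) (mt n m (?f a)) ! j $$ (p, q) = mt n m a ! j $$ (p, q)"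
  using jpq n sne by (simp add: push_entry matrix_tuple_entry I complex_eq_iff c_def d_def field_simps)
 qed auto
 have inj: "X = Y" if X: "X : tuples m (sqm n)" and Y: "Y : tuples m (sqm n)" and e: "map (push n s R) X = map (push n s R) Y" for X Y
 proof (rule nth_equalityI)
  show l: "length X = length Y" using X Y by (simp add: tuples_def)
  fix j assume j: "j < length X"
  have XY: "X ! j : sqm n" "Y ! j : sqm n" using tuplesD[OF X] tuplesD[OF Y] j by auto
  have e: "push n s R (X ! j) = push n s R (Y ! j)" using e j l by (metis nth_map)
  show "X ! j = Y ! j"
  proof (rule eq_matI)
  fix p q assume "p < dim_row (Y ! j)" "q < dim_col (Y ! j)"
  then have pq: "p < n" "q < n" using XY by auto
  then show "X ! j $$ (p, q) = Y ! j $$ (p, q)"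
  using push_entry[OF XY(1) pq, of s R] push_entry[OF XY(2) pq, of s R] e s[OF pq(1)] s[OF pq(2)] by auto
  qed (use XY in auto)
 qed
 have fsp: "?f a : space (coord_space n m)" for a by (simp add: space_PiM)
 have mt: "mt n m a : tuples m (sqm n)" for a by (auto simp: tuples_def set_conv_nth)
 have "mt n m a : map (push n s R) ` G <-> mt n m (?f a) : G" for a
 proof
  assume "mt n m a : map (push n s R) ` G"
  then obtain X where X: "X : G" "map (push n s R) X = map (push n s R) (mt n m (?f a))" unfolding push[of a] by auto
  then have "X = mt n m (?f a)" using inj[OF _ mt] G(2) by blast
  then show "mt n m (?f a) : G" using X(1) by simp
 next
  assume "mt n m (?f a) : G"
  then show "mt n m a : map (push n s R) ` G" unfolding push[of a, symmetric] by (rule imageI)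
 qed
 then have eq: "{a : space (coord_space n m). mt n m a : map (push n s R) ` G} =
  {a : space (coord_space n m). ?f a : {a : space (coord_space n m). mt n m a : G}}"
  using fsp by blast
 show "coord_measurable n m (map (push n s R) ` G)"
  unfolding coord_measurable_def eq using c G(1) by (intro emeasure_PiM_affine(1)) (auto simp: coord_measurable_def)
 show "vol n m (map (push n s R) ` G) = ennreal (\<Prod>(j, p, q, b)\<in>?I. s p * s q) * vol n m G"
  unfolding vol_def Let_def eq c_def[symmetric] using c G(1) by (intro emeasure_PiM_affine(2)) (auto simp: coord_measurable_def)
qed

text \<open>Each of the m matrices has two real coordinates per entry, and each coordinate is scaled
  by a row and a column factor; this gives the 4 m, and \<open>sum_ln_ge\<close> bounds each sum of
  logarithms.\<close>

lemma prod_ramp_ge: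
 assumes a: "0 < a"
 shows "exp (- (4 * real m * a * (real n)^2)) <= (\<Prod>(j, p, q, b)\<in>coord_index n m. ramp a n p * ramp a n q)"
proof -
 let ?L = "\<Sum>p<n. ln (real (Suc p) / real n)"
 have "(\<Prod>(j, p, q, b)\<in>coord_index n m. ramp a n p * ramp a n q) =
  (\<Prod>(j, p, q, b)\<in>coord_index n m. exp (a * (ln (real (Suc p) / real n) + ln (real (Suc q) / real n))))"
  by (intro prod.cong) (auto simp: coord_index_def ramp_def powr_def exp_add[symmetric] algebra_simps)
 also have "... = exp (\<Sum>(j, p, q, b)\<in>coord_index n m. a * (ln (real (Suc p) / real n) + ln (real (Suc q) / real n)))"
  by (subst exp_sum) (auto simp: case_prod_unfold)
 also have "(\<Sum>(j, p, q, b)\<in>coord_index n m. a * (ln (real (Suc p) / real n) + ln (real (Suc q) / real n))) = 4 * real m * a * (real n * ?L)"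
  unfolding coord_index_def sum.cartesian_product[symmetric]
  by (simp add: sum.distrib sum_distrib_left[symmetric] UNIV_bool algebra_simps)
 finally have eq: "(\<Prod>(j, p, q, b)\<in>coord_index n m. ramp a n p * ramp a n q) = exp (4 * real m * a * (real n * ?L))" .
 have "real n * - real n <= real n * ?L" using sum_ln_ge[of n] by (rule mult_left_mono) simp
 then have "4 * real m * a * (real n * - real n) <= 4 * real m * a * (real n * ?L)" by (rule mult_left_mono) (use a in simp)
 moreover have "4 * real m * a * (real n * - real n) = - (4 * real m * a * (real n)^2)" by (simp add: power2_eq_square)
 ultimately show ?thesis unfolding eq exp_le_cancel_iff by linarith
qed

lemma mat_entry_le_opn:
 assumes A: "A : sqm n" and p: "p < n"
 shows "cmod (A $$ (p, p)) <= mat_opnorm n A"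
proof -
 let ?e = "rdiag n (%i. if i = p then 1 else 0)"
 have n: "n > 0" using p by simp
 have "(mat.n2 n ?e)^2 = 1 / real n"
 proof -
  have "(\<Sum>i<n. (if i = p then 1 else 0 :: real)^2) = (\<Sum>i<n. if i = p then 1 else 0)" by (intro sum.cong) auto
  then show ?thesis using p by (simp add: norm2_diag_sq)
 qed
 then have e: "mat.n2 n ?e = sqrt (1 / real n)" using mat.n2_nonneg[of ?e n] by (metis rdiag_carrier mat_algebra_simps(1) real_sqrt_abs abs_of_nonneg)
 have "cmod ((A * ?e) $$ (p, p)) <= sqrt (real n) * mat.n2 n (A * ?e)" using A p by (intro mat_entry_le_norm2) auto
 also have "... <= sqrt (real n) * (mat_opnorm n A * sqrt (1 / real n))"
  using mat.opn_bound[of A n ?e] A e by (intro mult_left_mono) auto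
 also have "... = mat_opnorm n A" using n by (simp add: real_sqrt_divide)
 finally show ?thesis using rdiag_entries(2)[OF A p p, of "%i. if i = p then 1 else 0"] by (simp del: index_mult_mat)
qed

text \<open>On the first indices s^2 is at most (R - r)/(4 R). There the diagonal entry of the
  pushed matrix has real part at least R - 2 R s^2 >= R - (R - r)/2, while that of y is at most r. A
  gap of (R - r)/2 on a fixed proportion of the diagonal keeps the trace norm away from 0.\<close>

lemma push_far_from_smaller_ball:
 assumes a: "0 < a" and r: "0 <= r" "r < R"
 shows "\<exists>\<kappa>>0. EX N. ALL n>=N. ALL x:op_ball (Mat n) R. ALL y:op_ball (Mat n) r.
  \<kappa> <= (mat.n2 n (push n (ramp a n) R x - y))^2"
proof -
 \<comment> \<open>The proportion of indices with small ramp, chosen so that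
   \<open>th powr (2 * a)\<close> equals (R - r)/(4 R).\<close>
 define th where "th = ((R - r) / (4 * R)) powr (1 / (2 * a))"
 define et where "et = (R - r) / 2"
 have R: "R > 0" using r by simp
 have q: "0 < (R - r) / (4 * R)" "(R - r) / (4 * R) < 1" using r by (auto simp: field_simps)
 have "\<bar>(R - r) / (4 * R)\<bar> <= 1" "0 <= 1 / (2 * a)" using q a by (linarith, simp)
 then have "th <= 1" unfolding th_def by (intro powr_le1)
 moreover have "th > 0" unfolding th_def powr_gt_zero using q(1) by linarith
 ultimately have th: "th > 0" "th <= 1" by simp_all
 have "1 / (2 * a) * (2 * a) = 1" using a by simp
 then have th2: "th powr (2 * a) = (R - r) / (4 * R)" unfolding th_def powr_powr using powr_one[OF less_imp_le[OF q(1)]] by metis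
 have et: "et > 0" using r by (simp add: et_def)
 show ?thesis
 proof (intro exI conjI allI impI ballI)
  \<comment> \<open>Rounding th n down to a natural number still leaves at least th n / 2 indices
    once n >= 2 / th.\<close>
  show "th / 2 * et\<^sup>2 > 0" using th et by simp
  fix n x y assume n: "nat \<lceil>2 / th\<rceil> <= n" and x: "x : op_ball (Mat n) R" and y: "y : op_ball (Mat n) r"
  have n2: "2 / th <= real n" using n by linarith
  then have n0: "n > 0" "2 <= th * real n" using th by (auto simp: field_simps intro: Nat.gr0I)
  have xc: "x : sqm n" "mat_opnorm n x <= R" and yc: "y : sqm n" "mat_opnorm n y <= r"
  using x y by (auto simp: op_ball_def)
  define k where "k = nat \<lfloor>th * real n\<rfloor>"
  have k: "real k <= th * real n" "th * real n - 1 <= real k" using n0 by (auto simp: k_def)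
  have kn: "k <= n" using k(1) th(2) n0 mult_right_mono[of th 1 "real n"] by linarith
  let ?d = "push n (ramp a n) R x - y"
  have big: "et <= cmod (?d $$ (p, p))" if p: "p < k" for p
  proof -
  have pn: "p < n" using p kn by simp
  have "ramp a n p <= th powr a"
  unfolding ramp_def using p k(1) n0 a by (intro powr_mono2) (auto simp: field_simps)
  then have "(ramp a n p)^2 <= (th powr a)^2" using ramp_bounds[of a p n] a pn by (intro power_mono) auto
  also have "(th powr a)^2 = th powr (2 * a)" by (simp add: power2_eq_square powr_add[symmetric])
  finally have "(ramp a n p)^2 * (2 * R) <= (R - r) / (4 * R) * (2 * R)" unfolding th2 by (rule mult_right_mono) (use R in simp)
  then have s: "(ramp a n p)^2 * (2 * R) <= et" using R by (simp add: et_def)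
  have "Re (x $$ (p, p)) >= - R" "Re (y $$ (p, p)) <= r"
  using mat_entry_le_opn[OF xc(1) pn] mat_entry_le_opn[OF yc(1) pn] xc yc
  abs_Re_le_cmod[of "x $$ (p, p)"] abs_Re_le_cmod[of "y $$ (p, p)"] by linarith+
  moreover from this(1) have "(ramp a n p)^2 * Re (x $$ (p, p)) >= (ramp a n p)^2 * - R" by (intro mult_left_mono) auto
  moreover have "Re (?d $$ (p, p)) = (ramp a n p)^2 * Re (x $$ (p, p)) + R * (1 - (ramp a n p)^2) - Re (y $$ (p, p))"
  using push_entry[OF xc(1) pn pn, of "ramp a n" R] xc yc pn by (simp add: power2_eq_square)
  ultimately have "et <= Re (?d $$ (p, p))" using s by (simp add: et_def algebra_simps)
  then show ?thesis using complex_Re_le_cmod[of "?d $$ (p, p)"] by linarith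
  qed
  have dc: "?d : sqm n" using xc yc by (simp add: minus_carrier_mat)
  have "th / 2 * et\<^sup>2 <= (\<Sum>p<k. et\<^sup>2) / real n" using k(2) n0 th et by (simp add: field_simps)
  also have "... <= (\<Sum>p<k. (cmod (?d $$ (p, p)))^2) / real n"
  using big et by (intro divide_right_mono sum_mono power_mono) auto
  also have "... <= (\<Sum>p<n. (cmod (?d $$ (p, p)))^2) / real n" using kn by (intro divide_right_mono sum_mono2) auto
  also have "... <= (\<Sum>p<n. \<Sum>i<n. (cmod (?d $$ (i, p)))^2) / real n"
  by (intro divide_right_mono sum_mono member_le_sum[where f="%i. (cmod (?d $$ (i, _)))^2"]) auto
  also have "... = (mat.n2 n ?d)^2" using norm2_mat_sum_sq[OF dc] by simp
  finally show "th / 2 * et\<^sup>2 <= (mat.n2 n ?d)^2" .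
 qed
qed

section \<open>Realising sequences of matrix tuples in the universe\<close>

lemma (in star_alg) L2_norm_tuple_diff:
 assumes "xs : tuples k (car M)" "ys : tuples k (car M)"
 shows "L2_norm M (tuple_diff M xs ys) = sqrt (\<Sum>j<k. (n2 (xs ! j \<ominus> ys ! j))^2)"
proof -
 have l: "length xs = k" "length ys = k" and c: "!!j. j < k ==> xs ! j : car M & ys ! j : car M"
  using tuplesD[OF assms(1)] tuplesD[OF assms(2)] by auto
 have "Re (L2_inner M (tuple_diff M xs ys) (tuple_diff M xs ys)) = (\<Sum>j<k. (n2 (xs ! j \<ominus> ys ! j))^2)"
  unfolding L2_inner_def Re_sum using l c by (intro sum.cong) (auto simp: tuple_diff_def n2_sq)
 then show ?thesis by (simp add: L2_norm_def)
qed

text \<open>Commuting with the diagonal units kills the off-diagonal entries, and commuting with the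
  all-ones matrix equates the diagonal ones.\<close>

lemma mat_center:
 fixes z :: "complex mat"
 assumes z: "z : sqm n" and comm: "!!x. x : sqm n ==> z * x = x * z"
 shows "EX a. z = a \<cdot>\<^sub>m 1\<^sub>m n"
proof (intro exI eq_matI)
 fix p q assume "p < dim_row (z $$ (0, 0) \<cdot>\<^sub>m 1\<^sub>m n :: complex mat)" "q < dim_col (z $$ (0, 0) \<cdot>\<^sub>m 1\<^sub>m n :: complex mat)"
 then have pq: "p < n" "q < n" "0 < n" by auto
 let ?e = "mat n n (%_. 1)" and ?d = "rdiag n (%i. if i = p then 1 else 0)"
 have "(z * ?d) $$ (p, q) = (?d * z) $$ (p, q)" using comm by simp
 then have off: "p ~= q ==> z $$ (p, q) = 0" using z pq by (simp add: rdiag_entries del: index_mult_mat(1))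
 have offd: "z $$ (i, k) = 0" if "i ~= k" "i < n" "k < n" for i k
 proof -
  let ?d = "rdiag n (%l. if l = i then 1 else 0)"
  have "(z * ?d) $$ (i, k) = (?d * z) $$ (i, k)" using comm by simp
  then show ?thesis using z that by (simp add: rdiag_entries del: index_mult_mat(1))
 qed
 have e: "?e : sqm n" by simp
 have "(z * ?e) $$ (p, 0) = (\<Sum>k<n. z $$ (p, k) * ?e $$ (k, 0))" using z pq by (intro mat_mult_entry) auto
 also have "... = (\<Sum>k<n. if k = p then z $$ (p, p) else 0)" using offd pq by (intro sum.cong) auto
 finally have 1: "(z * ?e) $$ (p, 0) = z $$ (p, p)" using pq by simp
 have "(?e * z) $$ (p, 0) = (\<Sum>k<n. ?e $$ (p, k) * z $$ (k, 0))" using z pq by (intro mat_mult_entry) auto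
 also have "... = (\<Sum>k<n. if k = 0 then z $$ (0, 0) else 0)" using offd pq by (intro sum.cong) auto
 finally have 2: "(?e * z) $$ (p, 0) = z $$ (0, 0)" using pq by simp
 show "z $$ (p, q) = (z $$ (0, 0) \<cdot>\<^sub>m 1\<^sub>m n) $$ (p, q)" using 1 2 comm[OF e] off pq by auto
qed (use z in auto)

lemma tracial_factor_copy:
 assumes n: "n > 0" and inj: "inj_on j (sqm n)"
 shows "tracial_factor (copy_along j (Mat n))"
proof -
 interpret C: algebra_copy "Mat n" j by unfold_locales (simp add: inj)
 have "tracial_vNa C.N"
  by (rule tracial_W_algebra.tracial_vNa[OF tracial_W_algebra_copy[OF mat_tracial_W_algebra[OF n]]]) (simp add: inj)
 moreover have "{z : car C.N. ALL x:car C.N. z *[C.N] x = x *[C.N] z} = range (%a. scal C.N a \<one>\<^bsub>C.N\<^esub>)"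
 proof (intro equalityI subsetI)
  fix Z assume "Z : {z : car C.N. ALL x:car C.N. z *[C.N] x = x *[C.N] z}"
  then obtain z where z: "z : sqm n" "Z = j z" and "ALL x:sqm n. j z *[C.N] j x = j x *[C.N] j z"
  by (auto simp: C.carrier_N)
  then have "ALL x:sqm n. j (z * x) = j (x * z)" by simp
  then have "z * x = x * z" if "x : sqm n" for x using z that inj by (metis inj_onD square_mult_closed)
  then obtain a where "z = a \<cdot>\<^sub>m 1\<^sub>m n" using mat_center[OF z(1)] by blast
  then show "Z : range (%a. scal C.N a \<one>\<^bsub>C.N\<^esub>)" using z(2) by auto
 next
  fix Z assume "Z : range (%a. scal C.N a \<one>\<^bsub>C.N\<^esub>)"
  then show "Z : {z : car C.N. ALL x:car C.N. z *[C.N] x = x *[C.N] z}"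
  using mult_smult_distrib[of _ n n "1\<^sub>m n :: complex mat" n] mult_smult_assoc_mat[of "1\<^sub>m n :: complex mat" n n _ n]
  by (auto simp: C.carrier_N C.copy_ops[simplified])
 qed
 ultimately show ?thesis by (simp add: tracial_factor_def)
qed

text \<open>Each real and imaginary part is recorded by its Dedekind cut, so a sequence of matrices
  becomes a set of natural numbers; entries inside the n-by-n block suffice for sequences of
  matrices of size n.\<close>

definition matrix_code :: "(nat => complex mat) => nat set" where
 "matrix_code x = {to_nat (n, i, j, b, q :: rat) | n i j b q. i < n & j < n & of_rat q < (if b then Re (x n $$ (i, j)) else Im (x n $$ (i, j)))}"

lemma inj_on_matrix_code: "inj_on matrix_code {x. ALL n. x n : sqm n}"
proof (rule inj_onI)
 fix x y assume x: "x : {x. ALL n. x n : sqm n}" and y: "y : {x. ALL n. x n : sqm n}" and e: "matrix_code x = matrix_code y"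
 have iff: "of_rat q < (if b then Re (x n $$ (i, j)) else Im (x n $$ (i, j))) <-> of_rat q < (if b then Re (y n $$ (i, j)) else Im (y n $$ (i, j)))"
  if ij: "i < n" "j < n" for n i j b q
 proof -
  have "to_nat (n, i, j, b, q) : matrix_code x <-> to_nat (n, i, j, b, q) : matrix_code y" using e by simp
  then show ?thesis using ij by (auto simp: matrix_code_def)
 qed
 have le: "u <= v" if "!!q. of_rat q < u ==> of_rat q < v" for u v :: real
 proof (rule ccontr)
  assume "\<not> u <= v"
  then obtain q where "v < of_rat q" "of_rat q < u" using of_rat_dense[of v u] by auto
  then show False using that[of q] by simp
 qed
 have "x n $$ (i, j) = y n $$ (i, j)" if "i < n" "j < n" for n i j
  using iff[OF that, where b=True] iff[OF that, where b=False] by (intro complex_eqI antisym le) auto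
 moreover have "dim_row (x n) = n" "dim_col (x n) = n" "dim_row (y n) = n" "dim_col (y n) = n" for n using x y by (auto intro: carrier_matD)
 ultimately have "x n = y n" for n by (intro eq_matI) auto
 then show "x = y" by (rule ext)
qed

lemma tracial_ultraproduct_mat:
 assumes "free_ultrafilter U"
 shows "tracial_ultraproduct U Mat"
proof
 show "eventually (%n. trc (Mat n) \<one>\<^bsub>Mat n\<^esub> = 1) U"
  using free_ultrafilter_ge[OF assms, of 1] by (rule eventually_mono) simp
qed (use assms mat.star_alg_axioms mat_truncatable mat_has_positive_parts in auto)

text \<open>The injection of the reals into \<open>'u\<close> leaves room for one label for each
  sequence of matrices, hence for the matrix algebras and their ultraproduct.\<close>

locale universe =
 fixes U :: "nat filter" and h :: "real => 'u"
 assumes ultra: "free_ultrafilter U" and inj_h: "inj h"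
begin

sublocale P: tracial_ultraproduct U Mat
 by (rule tracial_ultraproduct_mat[OF ultra])

definition encode :: "(nat => complex mat) => 'u" where
 "encode x = h ((SOME f. bij_betw f (UNIV :: nat set set) (UNIV :: real set)) (matrix_code x))"

lemma inj_encode: "inj_on encode {x. ALL n. x n : sqm n}"
proof -
 have "EX f. bij_betw f (UNIV :: nat set set) (UNIV :: real set)" using nat_sets_eqpoll_reals by (simp add: eqpoll_def)
 then have "inj (SOME f. bij_betw f (UNIV :: nat set set) (UNIV :: real set))" by (rule someI2_ex) (simp add: bij_betw_def)
 then show ?thesis
  using inj_h inj_on_matrix_code by (auto simp: encode_def inj_on_def)
qed

text \<open>A single matrix is regarded as a sequence that is zero at all other indices, so the same
  injection \<open>encode\<close> serves for matrices and for sequences.\<close>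

definition matrix_copy :: "nat => 'u alg" where
 "matrix_copy n = copy_along (%A. encode (%k. if k = n then A else 0\<^sub>m k k)) (Mat n)"

lemma inj_matrix_copy: "inj_on (%A. encode (%k. if k = n then A else 0\<^sub>m k k)) (sqm n)"
proof (rule inj_onI)
 fix A B assume "A : sqm n" "B : sqm n"
  and "encode (%k. if k = n then A else 0\<^sub>m k k) = encode (%k. if k = n then B else 0\<^sub>m k k)"
 then have "(%k. if k = n then A else 0\<^sub>m k k) = (%k. if k = n then B else 0\<^sub>m k k)"
  by (intro inj_onD[OF inj_encode]) auto
 then show "A = B" by (metis (full_types))
qed

lemma matrix_copy_factor: "n > 0 ==> matrix_copy n : models_fact" "n > 0 ==> matrix_copy n : models_tr"
 using tracial_factor_copy[OF _ inj_matrix_copy] by (auto simp: matrix_copy_def models_fact_def models_tr_def tracial_factor_def)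

lemma copies: "algebra_copy (Mat n) (%A. encode (%k. if k = n then A else 0\<^sub>m k k))"
 by unfold_locales (simp add: inj_matrix_copy)

text \<open>Through the copies, every matrix tuple in the ball has a type of the space on which
  \<open>chi_full_R\<close> takes its neighbourhoods; on microstates, membership in that space
  imposes no further condition.\<close>

lemma tp_mat_ball:
 assumes "n > 0" "X : mat_ball n m R"
 shows "tp m (Mat n) X : types_ball (models_fact :: 'u alg set) m R"
proof -
 interpret C: algebra_copy "Mat n" "%A. encode (%k. if k = n then A else 0\<^sub>m k k)" by (rule copies)
 have "tp m (Mat n) X = tp m C.N (map (%A. encode (%k. if k = n then A else 0\<^sub>m k k)) X)"
  using assms(2) by (intro C.tp_copy[symmetric] tuples_op_ball_carrier)
 moreover have "map (%A. encode (%k. if k = n then A else 0\<^sub>m k k)) X : tball C.N m R"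
  using assms(2) by (auto simp: C.op_ball_copy C.tuples_copy)
 moreover have "C.N : models_fact" using matrix_copy_factor[OF assms(1)] by (simp add: matrix_copy_def)
 ultimately show ?thesis unfolding types_ball_def by blast
qed

abbreviation choose_rep :: "(nat => complex mat) set => 'u" where
 "choose_rep X \<equiv> encode (SOME x. x : X)"

lemma inj_choose_rep: "inj_on choose_rep (car P.Q)"
proof (rule inj_onI)
 fix X Y assume X: "X : car P.Q" and Y: "Y : car P.Q" and e: "encode (SOME x. x : X) = encode (SOME x. x : Y)"
 obtain x y where x: "x : P.BS" "X = P.cls x" and y: "y : P.BS" "Y = P.cls y" using P.carrier_Q_cases[OF X] P.carrier_Q_cases[OF Y] by blast
 have "(SOME x. x : X) : X" unfolding x(2) by (rule someI[of _ x]) (simp add: P.in_cls_iff x)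
 moreover have "(SOME x. x : Y) : Y" unfolding y(2) by (rule someI[of _ y]) (simp add: P.in_cls_iff y)
 ultimately have *: "(SOME x. x : X) : P.BS" "P.cls (SOME x. x : X) = X" "(SOME x. x : Y) : P.BS" "P.cls (SOME x. x : Y) = Y"
  using x y P.in_cls_iff by auto
 have c: "f : {x. ALL n. x n : sqm n}" if "f : P.BS" for f using P.BS_carrier[OF that] by simp
 have "(SOME x. x : X) = (SOME x. x : Y)" by (rule inj_onD[OF inj_encode, OF e c[OF *(1)] c[OF *(3)]])
 then show "X = Y" using *(2,4) by metis
qed

definition Qu :: "'u alg" where "Qu = copy_along choose_rep P.Q"

sublocale Q: algebra_copy P.Q choose_rep
 by unfold_locales (rule inj_choose_rep)

lemma Qu_models: "Qu : models_U U" "Qu : models_tr"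
proof -
 have "tracial_vNa Qu" unfolding Qu_def
  by (rule tracial_W_algebra.tracial_vNa[OF tracial_W_algebra_copy[OF P.tracial_W_algebra_Q inj_choose_rep]])
 then show "Qu : models_U U" "Qu : models_tr"
  using Q.theory_of_copy by (auto simp: models_U_def models_def models_tr_def theory_of_def matrix_ultraproduct_def Qu_def)
qed

definition ulim :: "nat => (nat => complex mat list) => 'u list" where
 "ulim m X = map (%j. choose_rep (P.cls (%n. X n ! j))) [0..<m]"

lemma ulim_seq:
 assumes X: "!!n. X n : mat_ball n m R"
 shows "set (map (%j n. X n ! j) [0..<m]) <= P.BS" "P.coords n (map (%j n. X n ! j) [0..<m]) = X n"
  "ulim m X = map choose_rep (map P.cls (map (%j n. X n ! j) [0..<m]))" "j < m ==> (%n. X n ! j) : P.BS"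
proof -
 show b: "(%n. X n ! j) : P.BS" if "j < m" for j
  using tuplesD(2)[OF X that] by (intro P.BS_I[where B=R]) (auto simp: op_ball_def)
 then show "set (map (%j n. X n ! j) [0..<m]) <= P.BS" by auto
 show "P.coords n (map (%j n. X n ! j) [0..<m]) = X n"
  using tuplesD(1)[OF X[of n]] by (intro nth_equalityI) auto
qed (simp add: ulim_def)

lemma ulim_carrier:
 assumes X: "!!n. X n : mat_ball n m R"
 shows "map P.cls (map (%j n. X n ! j) [0..<m]) : tball P.Q m R"
proof -
 have "P.cls (%n. X n ! j) : op_ball P.Q R" if "j < m" for j
  using tuplesD(2)[OF X that] ulim_seq(4)[OF X that] by (intro P.op_ball_Q_I) (auto simp: op_ball_def)
 then show ?thesis by (auto simp: tuples_def)
qed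

lemma ulim_ball: "(!!n. X n : mat_ball n m R) ==> ulim m X : tball Qu m R"
 using ulim_carrier[of X m R] ulim_seq(3)[of X m R] by (auto simp del: map_map simp: Qu_def Q.op_ball_copy Q.tuples_copy)

lemma ulim_interp:
 assumes X: "!!n. X n : mat_ball n m R" and ps: "ps : formulas m"
 shows "((%n. itp n ps (X n)) ~> interp Qu ps (ulim m X)) U"
proof -
 have "((%n. itp n ps (P.coords n (map (%j n. X n ! j) [0..<m]))) ~> interp P.Q ps (map P.cls (map (%j n. X n ! j) [0..<m]))) U"
  using ps by (intro P.interp_tendsto ulim_seq(1)[OF X]) (simp add: formulas_def)
 moreover have "interp Qu ps (ulim m X) = interp P.Q ps (map P.cls (map (%j n. X n ! j) [0..<m]))"
  unfolding Qu_def ulim_seq(3)[OF X] using ps tuples_op_ball_carrier[OF ulim_carrier[OF X]] by (intro Q.interp_copy) (auto simp: formulas_def)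
 ultimately show ?thesis unfolding ulim_seq(2)[OF X] by simp
qed

lemma ulim_dist:
 assumes X: "!!n. X n : mat_ball n m R" and Y: "!!n. Y n : mat_ball n m R'"
 shows "((%n. L2_norm (Mat n) (tuple_diff (Mat n) (X n) (Y n))) ~> L2_norm Qu (tuple_diff Qu (ulim m X) (ulim m Y))) U"
proof -
 have c: "j < m ==> P.cls (%n. X n ! j) : car P.Q" "j < m ==> P.cls (%n. Y n ! j) : car P.Q" for j
  using ulim_seq(4)[OF X] ulim_seq(4)[OF Y] by auto
 have "L2_norm Q.N (tuple_diff Q.N (ulim m X) (ulim m Y)) = sqrt (\<Sum>j<m. (norm2 Q.N (ulim m X ! j -[Q.N] ulim m Y ! j))^2)"
  using ulim_ball[of X m R] ulim_ball[of Y m R'] X Y by (intro Q.N.L2_norm_tuple_diff tuples_op_ball_carrier) (auto simp: Qu_def)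
 also have "... = sqrt (\<Sum>j<m. (norm2 P.Q (P.cls (%n. X n ! j) -[P.Q] P.cls (%n. Y n ! j)))^2)"
  using c by (intro arg_cong[where f=sqrt] sum.cong) (auto simp: ulim_def)
 finally have 1: "L2_norm Q.N (tuple_diff Q.N (ulim m X) (ulim m Y)) =
  sqrt (\<Sum>j<m. (norm2 P.Q (P.cls (%n. X n ! j) -[P.Q] P.cls (%n. Y n ! j)))^2)" .
 have 2: "L2_norm (Mat n) (tuple_diff (Mat n) (X n) (Y n)) =
  sqrt (\<Sum>j<m. (mat.n2 n (X n ! j -[Mat n] Y n ! j))^2)" for n
  using X Y by (intro mat.L2_norm_tuple_diff tuples_op_ball_carrier)
 show ?thesis unfolding Qu_def 1 2 using P.norm2_minus_tendsto ulim_seq(4)[OF X] ulim_seq(4)[OF Y]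
  by (intro tendsto_real_sqrt tendsto_sum tendsto_power) auto
qed

lemma interp_clamp:
 "interp N (Connective (%v. min 1 (max 0 (\<bar>v 0 - v 1\<bar> - e))) [ps, th]) ys = min 1 (max 0 (\<bar>interp N ps ys - interp N th ys\<bar> - e))"
 by (simp add: Let_def)

text \<open>Closeness on the ball is the sentence that the supremum over all variables of the excess
  of the difference over e is 0. It holds in every matrix algebra, hence in the ultraproduct by Los'
  theorem, hence in every model of its theory.\<close>

lemma formula_close_models_U:
 assumes fin: "ps : formulas m" "th : formulas m" and close: "formula_close TYPE(complex mat) m R ps th e"
  and M: "M : models_U U" and xs: "xs : tball M m R" and R: "R > 0"
 shows "\<bar>interp M ps xs - interp M th xs\<bar> <= e"
proof -
 \<comment> \<open>Clamping to [0, 1] bounds every supremum in an arbitrary model, without using its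
   star algebra structure.\<close>
 define xi where "xi = Connective (%v. min 1 (max 0 (\<bar>v 0 - v 1\<bar> - e))) [ps, th]"
 define S where "S k = ((SupBall R) ^^ k) xi" for k
 have S0: "S 0 = xi" and SS: "S (Suc k) = SupBall R (S k)" for k by (simp_all add: S_def)
 note xi = interp_clamp[of _ e ps th, folded xi_def]
 have form: "formula_in (m - k) (S k)" if "k <= m" for k
  using that
 proof (induction k)
  case 0
  have "continuous_map (Euclidean_space 2) euclideanreal (%v. min 1 (max 0 (\<bar>v 0 - v 1\<bar> - e)))"
  by (intro continuous_map_real_min continuous_map_real_max continuous_map_diff continuous_map_real_abs continuous_coordinate) auto
  then show ?case using fin by (simp add: S0 xi_def formulas_def numeral_2_eq_2)
 next
  case (Suc k)
  then show ?case using R by (simp add: SS Suc_diff_Suc)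
 qed
 have zero: "itp n (S k) ys = 0" if "k <= m" "ys : mat_ball n (m - k) R" for n k ys
  using that
 proof (induction k arbitrary: ys)
  case 0
  then have "\<bar>itp n ps ys - itp n th ys\<bar> <= e"
  using close mat.star_alg_axioms[of n] by (simp add: formula_close_def)
  then show ?case by (simp add: S0 xi)
 next
  case (Suc k)
  have "ys @ [y] : mat_ball n (m - k) R" if "y : op_ball (Mat n) R" for y
  using Suc.prems that tuples_snoc[of ys y "m - Suc k"] by (simp add: Suc_diff_Suc)
  then have "itp n (S k) (ys @ [y]) = 0" if "y : op_ball (Mat n) R" for y using Suc that by simp
  then have "itp n (S (Suc k)) ys = (SUP y\<in>op_ball (Mat n) R. 0)" unfolding SS interp.simps by (intro SUP_cong) auto
  also have "... = 0" using mat.zero_in_op_ball[of R n] R by (intro cSUP_const) auto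
  finally show ?case .
 qed
 have "((%n. itp n (S m) (P.coords n [])) ~> interp P.Q (S m) (map P.cls [])) U"
  using form[of m] by (intro P.interp_tendsto) auto
 moreover have "itp n (S m) [] = 0" for n using zero[of m "[]" n] by (simp add: tuples_def)
 ultimately have "interp P.Q (S m) [] = 0" by (simp add: tendsto_const_iff)
 then have "S m : theory_of (matrix_ultraproduct U)" using form[of m] by (simp add: theory_of_def formulas_def matrix_ultraproduct_def)
 then have SM: "interp M (S m) [] = 0" using M by (simp add: models_U_def models_def)
 \<comment> \<open>After k quantifiers the last k variables are bound and the first m - k are still
   filled by \<open>xs\<close>.\<close>
 have val: "0 <= interp M (S k) (take (m - k) xs) & interp M (S k) ys <= 1" if "k <= m" for k ys
  using that
 proof (induction k arbitrary: ys)
  case 0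
  then show ?case by (simp add: S0 xi)
 next
  case (Suc k)
  have k: "m - Suc k < m" using Suc.prems by simp
  have x: "xs ! (m - Suc k) : op_ball M R" using tuplesD(2)[OF xs k] .
  have bd: "bdd_above ((%y. interp M (S k) (zs @ [y])) ` op_ball M R)" for zs
  using Suc by (intro bdd_aboveI2[of _ _ 1]) simp
  have "take (m - Suc k) xs @ [xs ! (m - Suc k)] = take (m - k) xs"
  using k tuplesD(1)[OF xs] Suc.prems by (simp add: take_Suc_conv_app_nth[symmetric] Suc_diff_Suc)
  then have "0 <= interp M (S k) (take (m - Suc k) xs @ [xs ! (m - Suc k)])" using Suc by simp
  also have "... <= interp M (S (Suc k)) (take (m - Suc k) xs)" unfolding SS interp.simps by (rule cSUP_upper[OF x bd])
  finally show ?case unfolding SS interp.simps using Suc x by (auto intro!: cSUP_least)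
 qed
 \<comment> \<open>From the closed sentence inward: a supremum that is at most 0 bounds its body at
   the next entry of \<open>xs\<close>.\<close>
 have "interp M (S k) (take (m - k) xs) <= 0" if "k <= m" for k
  using that
 proof (induction k rule: inc_induct)
  case base
  then show ?case using SM by simp
 next
  case (step k)
  have k: "m - Suc k < m" using step by simp
  have x: "xs ! (m - Suc k) : op_ball M R" using tuplesD(2)[OF xs k] .
  have bd: "bdd_above ((%y. interp M (S k) (zs @ [y])) ` op_ball M R)" for zs
  using step val[of k] by (intro bdd_aboveI2[of _ _ 1]) simp
  have "take (m - Suc k) xs @ [xs ! (m - Suc k)] = take (m - k) xs"
  using k tuplesD(1)[OF xs] step by (simp add: take_Suc_conv_app_nth[symmetric] Suc_diff_Suc)
  then have "interp M (S k) (take (m - k) xs) <= interp M (S (Suc k)) (take (m - Suc k) xs)" unfolding SS interp.simps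
  using cSUP_upper[OF x bd[of "take (m - Suc k) xs"]] by simp
  then show ?case using step by simp
 qed
 from this[of 0] have "interp M xi xs <= 0" using tuplesD(1)[OF xs] by (simp add: S0)
 then show ?thesis unfolding xi by linarith
qed

end

section \<open>Entropy, coupling and covering\<close>

lemma ultrafilter_not: "free_ultrafilter U ==> \<not> eventually P U ==> eventually (%n. \<not> P n) U"
 by (auto simp: free_ultrafilter_def)

lemma tendsto_Lim_ultrafilter:
 fixes f :: "nat => ereal"
 assumes U: "free_ultrafilter U"
 shows "(f ~> Lim U f) U"
proof -
 obtain l where "(f ~> l) U"
  using ultrafilter_tendsto_compact[OF U, of UNIV f] by (auto simp: compact_UNIV)
 then show ?thesis using U by (metis tendsto_Lim free_ultrafilter_def)
qed

text \<open>The volume for which the expression inside \<open>chi_full_R\<close>, the normalised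
  logarithm plus 2 m log n, equals h; entropy bounds thus become inequalities between real
  volumes.\<close>

definition volume_at :: "nat => nat => real => real" where
 "volume_at n m h = exp ((real n)^2 * (h - 2 * real m * ln (real n)))"

lemma volume_at_pos [simp]: "0 < volume_at n m h"
 by (simp add: volume_at_def)

lemma rate_iff:
 assumes n: "n > 0" and v: "v < \<infinity>"
 shows "ereal (1 / (real n)^2) * log_ennreal v + ereal (2 * real m * ln (real n)) < ereal h <-> enn2real v < volume_at n m h"
  and "ereal h < ereal (1 / (real n)^2) * log_ennreal v + ereal (2 * real m * ln (real n)) <-> volume_at n m h < enn2real v"
proof -
 consider "v = 0" | r where "r > 0" "v = ennreal r"
  using v by (cases v) (auto simp: less_eq_real_def)
 then have "(ereal (1 / (real n)^2) * log_ennreal v + ereal (2 * real m * ln (real n)) < ereal h <-> enn2real v < volume_at n m h) &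
  (ereal h < ereal (1 / (real n)^2) * log_ennreal v + ereal (2 * real m * ln (real n)) <-> volume_at n m h < enn2real v)"
 proof cases
  case 1
  then show ?thesis using n less_asym'[of 0 "volume_at n m h"] by (auto simp: log_ennreal_def dest: less_trans)
 next
  case 2
  have e: "enn2real v = exp (ln r)" using 2 by simp
  have "1 / (real n)^2 * ln r + 2 * real m * ln (real n) < h <-> ln r < (real n)^2 * (h - 2 * real m * ln (real n))"
  "h < 1 / (real n)^2 * ln r + 2 * real m * ln (real n) <-> (real n)^2 * (h - 2 * real m * ln (real n)) < ln r"
  using n by (simp_all add: field_simps)
  then show ?thesis unfolding e volume_at_def exp_less_cancel_iff using 2 by (simp add: log_ennreal_def)
 qed
 then show "ereal (1 / (real n)^2) * log_ennreal v + ereal (2 * real m * ln (real n)) < ereal h <-> enn2real v < volume_at n m h"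
  "ereal h < ereal (1 / (real n)^2) * log_ennreal v + ereal (2 * real m * ln (real n)) <-> volume_at n m h < enn2real v" by auto
qed

text \<open>Microstates of a basic neighbourhood, given by finitely many formulas with a set of
  allowed values for each.\<close>

definition basic :: "nat => nat => real => formula set => (formula => real set) => complex mat list set" where
 "basic n m R F G = {X : mat_ball n m R. ALL ps:F. itp n ps X : G ps}"

definition nbhd_data :: "nat => (formula => real) => formula set => (formula => real set) => bool" where
 "nbhd_data m l F G <-> finite F & F <= formulas m & (ALL ps:F. open (G ps) & l ps : G ps)"

lemma coord_measurable_basic': "R > 0 ==> nbhd_data m l F G ==> coord_measurable n m (basic n m R F G)"
 unfolding basic_def nbhd_data_def by (intro coord_measurable_basic) auto

lemma basic_subset: "basic n m R F G <= mat_ball n m R"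
 by (auto simp: basic_def)

lemma enn2real_vol_mono:
 "coord_measurable n m H ==> G <= H ==> H <= mat_ball n m R ==> enn2real (vol n m G) <= enn2real (vol n m H)"
 using vol_finite[where G=H and n=n and m=m and R=R] by (intro enn2real_mono vol_mono) auto

lemma tp_extensional: "tp m M xs : extensional (formulas m)"
 by (simp add: tp_def)

lemma tp_apply: "ps : formulas m ==> tp m M xs ps = interp M ps xs"
 by (simp add: tp_def)

text \<open>Two tuples of the same type lie in a common ball, where one formula approximates the
  predicate in both models; so the value depends only on the type, and the definite description in
  \<open>pairing\<close> is justified.\<close>

lemma pairing_eq:
 assumes def: "definable_predicate K m \<phi>" and M: "M : K" "xs : tuples m (car M)"
 shows "pairing K m (tp m M xs) \<phi> = \<phi> M xs"
proof -
 have ball: "EX R>0. ys : tball N m R" if "ys : tuples m (car N)" for N :: "'a alg" and ys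
 proof (intro exI conjI)
  show "0 < Max (insert 1 (opn N ` set ys))" by (simp add: Max_gr_iff)
  show "ys : tuples m (op_ball N (Max (insert 1 (opn N ` set ys))))" using that by (auto simp: tuples_def op_ball_def)
 qed
 have "\<phi> N ys = \<phi> M xs" if N: "N : K" "ys : tuples m (car N)" "tp m N ys = tp m M xs" for N ys
 proof -
  obtain R where R: "R > 0" "xs : tball M m R" using ball M by blast
  obtain R' where R': "R' > 0" "ys : tball N m R'" using ball N by blast
  have b: "xs : tuples m (op_ball M (max R R'))" "ys : tuples m (op_ball N (max R R'))"
  using R(2) R'(2) tuples_mono[OF op_ball_mono] by (meson max.cobounded1 max.cobounded2 subsetD)+
  have "\<bar>\<phi> N ys - \<phi> M xs\<bar> < e" if e: "e > 0" for e
  proof -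
  obtain ps where ps: "ps : formulas m" and cl: "!!M xs. M : K ==> xs : tuples m (op_ball M (max R R')) ==> \<bar>\<phi> M xs - interp M ps xs\<bar> < e / 2"
  using def[unfolded definable_predicate_def, rule_format, OF half_gt_zero[OF e] less_le_trans[OF R(1) max.cobounded1]] by blast
  have "interp N ps ys = interp M ps xs" using fun_cong[OF N(3), of ps] by (simp add: tp_apply[OF ps])
  then show ?thesis using cl[OF N(1) b(2)] cl[OF M(1) b(1)] by linarith
  qed
  from this[of "\<bar>\<phi> N ys - \<phi> M xs\<bar>"] show ?thesis by auto
 qed
 then show ?thesis unfolding pairing_def using M by (intro the_equality) blast+
qed

context universe
begin

lemma eventually_pos: "eventually (%n. 0 < n) U"
 using free_ultrafilter_ge[OF ultra, of 1] by (rule eventually_mono) simp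

text \<open>\<open>chi_full_R\<close> is an infimum over neighbourhoods, so each neighbourhood has
  at least that rate, and a rate above h' along the ultrafilter is a lower bound for the
  volume.\<close>

lemma volume_eventually_gt:
 assumes R: "R > 0" and l: "l : types_ball (models_fact :: 'u alg set) m R"
  and chi: "ereal h' < chi_full_R TYPE('u) U m R l" and FG: "nbhd_data m l F G"
 shows "eventually (%n. volume_at n m h' < enn2real (vol n m (basic n m R F G))) U"
proof -
 define V where "V = types_ball (models_fact :: 'u alg set) m R \<inter> {l : extensional (formulas m). ALL ps:F. l ps : G ps}"
 let ?f = "%n. ereal (1 / (real n)^2) * log_ennreal (vol n m (microstates n m R V)) + ereal (2 * real m * ln (real n))"
 have "l : extensional (formulas m)" using l by (auto simp: types_ball_def tp_extensional)
 moreover have "openin (types_topology (models_fact :: 'u alg set) m R) V"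
  unfolding types_topology_def V_def using FG openin_basic[of F m G]
  by (subst Int_commute) (auto simp: openin_subtopology nbhd_data_def)
 ultimately have "V : {V. openin (types_topology (models_fact :: 'u alg set) m R) V & l : V}"
  using l FG by (simp add: V_def nbhd_data_def)
 then have "chi_full_R TYPE('u) U m R l <= Lim U ?f" unfolding chi_full_R_def by (rule INF_lower)
 then have "ereal h' < Lim U ?f" using chi by simp
 then have "eventually (%n. ereal h' < ?f n) U" using tendsto_Lim_ultrafilter[OF ultra] order_tendstoD(1) by blast
 then show ?thesis using eventually_pos
 proof eventually_elim
  case (elim n)
  have "microstates n m R V = basic n m R F G"
  using tp_mat_ball[OF elim(2), of _ m R] FG
  by (auto simp: microstates_def V_def basic_def tp_extensional tp_apply nbhd_data_def subset_iff)
  then show ?case using elim rate_iff(2)[of n "vol n m (basic n m R F G)" h' m] vol_finite[OF basic_subset] by simp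
 qed
qed

lemma volume_eventually_lt:
 assumes R: "R > 0" and chi: "chi_full_R TYPE('u) U m R l < ereal h'"
 shows "EX F G. nbhd_data m l F G & eventually (%n. enn2real (vol n m (basic n m R F G)) < volume_at n m h') U"
proof -
 let ?T = "types_ball (models_fact :: 'u alg set) m R"
 obtain V where V: "openin (types_topology (models_fact :: 'u alg set) m R) V" "l : V"
  and lt: "Lim U (%n. ereal (1 / (real n)^2) * log_ennreal (vol n m (microstates n m R V)) + ereal (2 * real m * ln (real n))) < ereal h'"
  using chi unfolding chi_full_R_def INF_less_iff by blast
 obtain W where W: "openin (product_topology (%_. euclideanreal) (formulas m)) W" "V = W \<inter> ?T"
  using V(1) by (auto simp: types_topology_def openin_subtopology)
 obtain G where G: "finite {ps : formulas m. G ps ~= UNIV}" "!!ps. ps : formulas m ==> open (G ps)" "l : Pi\<^sub>E (formulas m) G" "Pi\<^sub>E (formulas m) G <= W"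
  using W V(2) unfolding openin_product_topology_alt by auto
 let ?F = "{ps : formulas m. G ps ~= UNIV}"
 have FG: "nbhd_data m l ?F G" using G by (auto simp: nbhd_data_def)
 have "eventually (%n. ereal (1 / (real n)^2) * log_ennreal (vol n m (microstates n m R V)) + ereal (2 * real m * ln (real n)) < ereal h') U"
  using tendsto_Lim_ultrafilter[OF ultra] lt order_tendstoD(2) by blast
 then have "eventually (%n. enn2real (vol n m (basic n m R ?F G)) < volume_at n m h') U" using eventually_pos
 proof eventually_elim
  case (elim n)
  have ms: "microstates n m R V = {X : mat_ball n m R. tp m (Mat n) X : W}"
  using tp_mat_ball[OF elim(2), of _ m R] by (auto simp: microstates_def W(2))
  have "basic n m R ?F G <= microstates n m R V"
  proof
  fix X assume X: "X : basic n m R ?F G"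
  have "tp m (Mat n) X ps : G ps" if "ps : formulas m" for ps
  using X that by (cases "G ps = UNIV") (auto simp: basic_def tp_apply)
  then have "tp m (Mat n) X : Pi\<^sub>E (formulas m) G" using tp_extensional by (simp add: PiE_iff)
  then have "tp m (Mat n) X : W" using G(4) by blast
  then show "X : microstates n m R V" using X by (simp add: ms basic_def)
  qed
  then have "enn2real (vol n m (basic n m R ?F G)) <= enn2real (vol n m (microstates n m R V))"
  using coord_measurable_open[OF R W(1), of n] by (intro enn2real_vol_mono[where R=R]) (auto simp: ms)
  also have "... < volume_at n m h'" using elim rate_iff(1)[of n "vol n m (microstates n m R V)" m h']
  vol_finite[where G="microstates n m R V" and n=n and m=m and R=R] by (auto simp: ms)
  finally show ?case .
 qed
 then show ?thesis using FG by blast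
qed

text \<open>Outside a set of the ultrafilter the sequences may leave the ball; they are replaced
  there by zero tuples, and Los' theorem applies to the result.\<close>

lemma realize:
 assumes R: "R > 0" and X: "eventually (%n. X n : mat_ball n m R) U" and Y: "eventually (%n. Y n : mat_ball n m R) U"
 shows "EX xs:tball Qu m R. EX ys:tball Qu m R.
  (ALL ps:formulas m. ((%n. itp n ps (X n)) ~> interp Qu ps xs) U & ((%n. itp n ps (Y n)) ~> interp Qu ps ys) U) &
  ((%n. L2_norm (Mat n) (tuple_diff (Mat n) (X n) (Y n))) ~> L2_norm Qu (tuple_diff Qu xs ys)) U"
proof -
 define p where "p Z = (%n. if Z n : mat_ball n m R then Z n else replicate m (0\<^sub>m n n))" for Z :: "nat => complex mat list"
 have z: "replicate m (0\<^sub>m n n) : mat_ball n m R" for n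
  using mat.zero_in_op_ball[of R n] R by (auto simp: tuples_def)
 have p: "p Z n : mat_ball n m R" for Z n using z by (simp add: p_def)
 have eX: "eventually (%n. p X n = X n) U" "eventually (%n. p Y n = Y n) U" using X Y by (auto simp: p_def elim: eventually_mono)
 have "((%n. itp n ps (X n)) ~> interp Qu ps (ulim m (p X))) U" "((%n. itp n ps (Y n)) ~> interp Qu ps (ulim m (p Y))) U"
  if "ps : formulas m" for ps
  by (rule Lim_transform_eventually[OF ulim_interp[OF p that]], use eX in \<open>auto elim: eventually_mono\<close>)+
 moreover have "((%n. L2_norm (Mat n) (tuple_diff (Mat n) (X n) (Y n))) ~> L2_norm Qu (tuple_diff Qu (ulim m (p X)) (ulim m (p Y)))) U"
  by (rule Lim_transform_eventually[OF ulim_dist[OF p p]]) (use eventually_conj[OF eX] in \<open>auto elim: eventually_mono\<close>)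
 ultimately show ?thesis using ulim_ball[of "p X" m R] ulim_ball[of "p Y" m R] p by blast
qed

text \<open>Countably many formulas decide the type, since the uniform approximation of any formula
  by them holds in all models of the theory.\<close>

lemma type_determined:
 assumes M: "M : models_U U" "xs : tball M m R" and N: "N : models_U U" "ys : tball N m R" and R: "R > 0"
  and agree: "!!th. formula_in m (fml th) ==> interp M (fml th) xs = interp N (fml th) ys"
 shows "tp m M xs = tp m N ys"
 unfolding tp_def
proof (rule restrict_ext)
 fix ps assume ps: "ps : formulas m"
 have "\<bar>interp M ps xs - interp N ps ys\<bar> <= e" if e: "e > 0" for e
 proof -
  obtain th where th: "formula_in m (fml th)" "formula_close TYPE(complex mat) m R ps (fml th) (e / 2)"
  using formula_dense[of m ps R "e / 2"] ps R e by (auto simp: formulas_def)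
  have "fml th : formulas m" using th(1) by (simp add: formulas_def)
  then have "\<bar>interp M ps xs - interp M (fml th) xs\<bar> <= e / 2" "\<bar>interp N ps ys - interp N (fml th) ys\<bar> <= e / 2"
  using formula_close_models_U[OF ps _ th(2) M R] formula_close_models_U[OF ps _ th(2) N R] by blast+
  then show ?thesis using agree[OF th(1)] by linarith
 qed
 then have "\<bar>interp M ps xs - interp N ps ys\<bar> <= 0" by (rule dense_ge)
 then show "interp M ps xs = interp N ps ys" by simp
qed

text \<open>Close pairs of microstates in all pairs of neighbourhoods can be selected diagonally for
  countably many formulas and tolerances at once. The limits in the ultraproduct then realise both
  types at distance at most d.\<close>

lemma d_W_full_le:
 assumes R: "R > 0" and M: "M : models_U U" "xs : tball M m R" and N: "N : models_U U" "ys : tball N m R"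
  and close: "!!F G H. nbhd_data m (tp m M xs) F G ==> nbhd_data m (tp m N ys) F H ==>
  eventually (%n. EX X:basic n m R F G. EX Y:basic n m R F H. L2_norm (Mat n) (tuple_diff (Mat n) X Y) < d) U"
 shows "d_W_full TYPE('u) U m (tp m M xs) (tp m N ys) <= ereal d"
proof -
 \<comment> \<open>An index k codes a formula together with a tolerance, so that every formula of
   the countable family occurs with each tolerance 1/(i+1).\<close>
 define fm where "fm k = fml (fst (from_nat k :: qformula \<times> nat))" for k
 define r where "r k = inverse (real (Suc (snd (from_nat k :: qformula \<times> nat))))" for k
 define good where "good k j n XY <-> formula_in m (fm k) --> \<bar>itp n (fm k) (fst XY) - interp M (fm k) xs\<bar> < r k
  & \<bar>itp n (fm k) (snd XY) - interp N (fm k) ys\<bar> < r k" for k j :: nat and n XY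
 define P where "P k n XY <-> fst XY : mat_ball n m R & snd XY : mat_ball n m R &
  L2_norm (Mat n) (tuple_diff (Mat n) (fst XY) (snd XY)) < d & good k 0 n XY" for k n XY
 have r: "r k > 0" for k by (simp add: r_def)
 have "eventually (%n. EX XY. ALL j<=k. P j n XY) U" for k
 proof -
  define S where "S = {j. j <= k & formula_in m (fm j)}"
  let ?F = "fm ` S" and ?r = "Min (insert 1 (r ` {..k}))"
  have "nbhd_data m (tp m M xs) ?F (%ps. ball (interp M ps xs) ?r)" "nbhd_data m (tp m N ys) ?F (%ps. ball (interp N ps ys) ?r)"
  using r by (auto simp: nbhd_data_def S_def formulas_def tp_apply)
  from close[OF this] show ?thesis
  proof (rule eventually_mono, elim bexE)
  fix n X Y assume X: "X : basic n m R ?F (%ps. ball (interp M ps xs) ?r)" and Y: "Y : basic n m R ?F (%ps. ball (interp N ps ys) ?r)"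
  and d: "L2_norm (Mat n) (tuple_diff (Mat n) X Y) < d"
  have "P j n (X, Y)" if j: "j <= k" for j
  proof -
  have "?r <= r j" using j by (intro Min_le) auto
  moreover have "\<bar>itp n (fm j) X - interp M (fm j) xs\<bar> < ?r & \<bar>itp n (fm j) Y - interp N (fm j) ys\<bar> < ?r"
  if "formula_in m (fm j)"
  proof -
  have "fm j : ?F" using j that by (auto simp: S_def)
  then have "itp n (fm j) X : ball (interp M (fm j) xs) ?r" "itp n (fm j) Y : ball (interp N (fm j) ys) ?r"
  using X Y unfolding basic_def by blast+
  then show ?thesis by (simp only: mem_ball dist_real_def abs_minus_commute)
  qed
  ultimately have "good j 0 n (X, Y)" unfolding good_def by (simp only: fst_conv snd_conv) (meson less_le_trans)
  then show ?thesis using X Y d by (simp add: P_def basic_def)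
  qed
  then show "EX XY. ALL j<=k. P j n XY" by blast
  qed
 qed
 from ultrafilter_diagonal[OF ultra this] obtain XY where XY: "!!k. eventually (%n. P k n (XY n)) U" by blast
 have "eventually (%n. fst (XY n) : mat_ball n m R) U" "eventually (%n. snd (XY n) : mat_ball n m R) U"
  by (rule eventually_mono[OF XY[of 0]], simp add: P_def)+
 from realize[OF R this] obtain us vs where us: "us : tball Qu m R" and vs: "vs : tball Qu m R"
  and lim: "!!ps. ps : formulas m ==> ((%n. itp n ps (fst (XY n))) ~> interp Qu ps us) U"
  "!!ps. ps : formulas m ==> ((%n. itp n ps (snd (XY n))) ~> interp Qu ps vs) U"
  and dist: "((%n. L2_norm (Mat n) (tuple_diff (Mat n) (fst (XY n)) (snd (XY n)))) ~> L2_norm Qu (tuple_diff Qu us vs)) U"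
  by blast
 have "interp Qu (fml th) us = interp M (fml th) xs & interp Qu (fml th) vs = interp N (fml th) ys"
  if th: "formula_in m (fml th)" for th
 proof -
  have "\<bar>interp Qu (fml th) us - interp M (fml th) xs\<bar> <= inverse (real (Suc i)) &
  \<bar>interp Qu (fml th) vs - interp N (fml th) ys\<bar> <= inverse (real (Suc i))" for i
  proof -
  define k where "k = to_nat (th, i)"
  have k: "fm k = fml th" "r k = inverse (real (Suc i))" by (simp_all add: k_def fm_def r_def)
  have ev: "eventually (%n. \<bar>itp n (fml th) (fst (XY n)) - interp M (fml th) xs\<bar> <= inverse (real (Suc i))) U"
  "eventually (%n. \<bar>itp n (fml th) (snd (XY n)) - interp N (fml th) ys\<bar> <= inverse (real (Suc i))) U"
  by (rule eventually_mono[OF XY[of k]], use th in \<open>simp add: P_def good_def k\<close>)+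
  have f: "fml th : formulas m" using th by (simp add: formulas_def)
  show ?thesis
  using tendsto_upperbound[OF tendsto_rabs[OF tendsto_diff[OF lim(1)[OF f] tendsto_const]] ev(1)]
  tendsto_upperbound[OF tendsto_rabs[OF tendsto_diff[OF lim(2)[OF f] tendsto_const]] ev(2)] by simp
  qed
  then have "\<bar>interp Qu (fml th) us - interp M (fml th) xs\<bar> <= 0" "\<bar>interp Qu (fml th) vs - interp N (fml th) ys\<bar> <= 0"
  by (intro LIMSEQ_le_const[OF LIMSEQ_inverse_real_of_nat]; blast)+
  then show ?thesis by simp
 qed
 then have "tp m Qu us = tp m M xs" "tp m Qu vs = tp m N ys"
  using type_determined[OF Qu_models(1) us M R] type_determined[OF Qu_models(1) vs N R] by auto
 moreover have "L2_norm Qu (tuple_diff Qu us vs) <= d"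
  using XY[of 0] by (intro tendsto_upperbound[OF dist]) (auto simp: P_def elim: eventually_mono)
 ultimately show ?thesis unfolding d_W_full_def
  using us vs Qu_models(1) by (intro order_trans[OF Inf_lower, of "ereal (L2_norm Qu (tuple_diff Qu us vs))"]) (force intro: tuples_op_ball_carrier)+
qed

text \<open>The Lindelof argument. If no finite number of small rational neighbourhoods covered
  \<open>C n\<close> along the ultrafilter, a diagonal choice would give X n in \<open>C n\<close>
  outside all of them. The limit type of X has a small neighbourhood by hypothesis, this contains a
  rational one around the limit, and X n would eventually lie in it.\<close>

lemma volume_cover:
 assumes R: "R > 0"
  and local: "!!X xs. eventually (%n. X n : C n) U ==> xs : tball Qu m R ==>
  (!!ps. ps : formulas m ==> ((%n. itp n ps (X n)) ~> interp Qu ps xs) U) ==>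
  EX F G. nbhd_data m (tp m Qu xs) F G & eventually (%n. enn2real (vol n m (basic n m R F G)) < volume_at n m h') U"
  and C: "!!n. C n <= mat_ball n m R"
 shows "EX K. eventually (%n. enn2real (vol n m (C n)) <= real K * volume_at n m h') U"
proof -
 \<comment> \<open>A countable list of basic sets: finitely many formulas of the dense family, each
   confined to an interval with rational ends.\<close>
 define B where "B k n = {X : mat_ball n m R. ALL (th, p, q):set (from_nat k :: (qformula \<times> rat \<times> rat) list).
  itp n (fml th) X : {of_rat p<..<of_rat q}}" for k n
 define good where "good k <-> (ALL (th, p, q):set (from_nat k :: (qformula \<times> rat \<times> rat) list). formula_in m (fml th)) &
  eventually (%n. enn2real (vol n m (B k n)) < volume_at n m h') U" for k
 have meas: "coord_measurable n m (B k n)" if "good k" for k n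
 proof -
  let ?b = "set (from_nat k :: (qformula \<times> rat \<times> rat) list)"
  define G where "G ps = (\<Inter>(th, p, q)\<in>{x : ?b. fml (fst x) = ps}. {real_of_rat p<..<of_rat q})" for ps
  have "B k n = {X : mat_ball n m R. ALL ps:fml ` fst ` ?b. itp n ps X : G ps}"
  unfolding B_def G_def by (fastforce simp: case_prod_unfold)
  moreover have "coord_measurable n m {X : mat_ball n m R. ALL ps:fml ` fst ` ?b. itp n ps X : G ps}"
  using that R by (intro coord_measurable_basic) (auto simp: good_def formulas_def G_def case_prod_unfold intro!: open_INT)
  ultimately show ?thesis by simp
 qed
 have "EX K. eventually (%n. C n <= (\<Union>k\<in>{k. k <= K & good k}. B k n)) U"
 proof (rule ccontr)
  assume "\<nexists>K. eventually (%n. C n <= (\<Union>k\<in>{k. k <= K & good k}. B k n)) U"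
  then have "eventually (%n. \<not> C n <= (\<Union>k\<in>{k. k <= K & good k}. B k n)) U" for K
  using ultrafilter_not[OF ultra] by blast
  then have "eventually (%n. EX x. ALL j<=K. x : C n & (good j --> x \<notin> B j n)) U" for K
  by (rule eventually_mono) blast
  from ultrafilter_diagonal[OF ultra this] obtain X where X: "!!k. eventually (%n. X n : C n & (good k --> X n \<notin> B k n)) U" by blast
  have XC: "eventually (%n. X n : C n) U" using X[of 0] by (rule eventually_mono) simp
  then have XR: "eventually (%n. X n : mat_ball n m R) U" by (rule eventually_mono) (use C in auto)
  from realize[OF R XR XR] obtain xs where xs: "xs : tball Qu m R"
  and lim: "!!ps. ps : formulas m ==> ((%n. itp n ps (X n)) ~> interp Qu ps xs) U" by blast
  obtain F G where FG: "nbhd_data m (tp m Qu xs) F G" and small: "eventually (%n. enn2real (vol n m (basic n m R F G)) < volume_at n m h') U"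
  using local[OF XC xs lim] by blast
  have "EX th p q. formula_in m (fml th) & interp Qu (fml th) xs : {of_rat p<..<of_rat q} &
  (ALL n. ALL Z:mat_ball n m R. itp n (fml th) Z : {of_rat p<..<of_rat q} --> itp n ps Z : G ps)"
  if ps: "ps : F" for ps
  proof -
  have psm: "ps : formulas m" "open (G ps)" "interp Qu ps xs : G ps" using FG ps by (auto simp: nbhd_data_def tp_apply subset_iff)
  obtain e where e: "e > 0" "ball (interp Qu ps xs) e <= G ps" using psm(2,3) openE by blast
  \<comment> \<open>Three errors of at most e/4 occur: replacing the formula at the limit, the width
    of the rational window, and replacing it back at the microstate; together they stay below
    e.\<close>
  obtain th where th: "formula_in m (fml th)" "formula_close TYPE(complex mat) m R ps (fml th) (e / 4)"
  using formula_dense[of m ps R "e / 4"] psm(1) R e by (auto simp: formulas_def)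
  have 1: "\<bar>interp Qu ps xs - interp Qu (fml th) xs\<bar> <= e / 4"
  using th psm(1) xs R Qu_models(1) by (intro formula_close_models_U) (auto simp: formulas_def)
  obtain p q where pq: "interp Qu (fml th) xs - e / 4 < of_rat p" "of_rat p < interp Qu (fml th) xs"
  "interp Qu (fml th) xs < of_rat q" "of_rat q < interp Qu (fml th) xs + e / 4"
  using of_rat_dense[of "interp Qu (fml th) xs - e / 4" "interp Qu (fml th) xs"]
  of_rat_dense[of "interp Qu (fml th) xs" "interp Qu (fml th) xs + e / 4"] e(1) by auto
  have "itp n ps Z : G ps" if Z: "Z : mat_ball n m R" "itp n (fml th) Z : {of_rat p<..<of_rat q}" for n Z
  proof -
  have "\<bar>itp n ps Z - itp n (fml th) Z\<bar> <= e / 4"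
  using th(2) Z(1) mat.star_alg_axioms[of n] by (simp add: formula_close_def)
  then have "dist (interp Qu ps xs) (itp n ps Z) < e" using 1 pq Z(2) unfolding dist_real_def greaterThanLessThan_iff by (elim conjE) linarith
  then show ?thesis using e(2) by auto
  qed
  then show ?thesis using th(1) pq by (intro exI[of _ th] exI[of _ p] exI[of _ q]) auto
  qed
  then obtain th p q where tpq: "!!ps. ps : F ==> formula_in m (fml (th ps)) & interp Qu (fml (th ps)) xs : {of_rat (p ps)<..<of_rat (q ps)} &
  (ALL n. ALL Z:mat_ball n m R. itp n (fml (th ps)) Z : {of_rat (p ps)<..<of_rat (q ps)} --> itp n ps Z : G ps)"
  by metis
  obtain fs where fs: "set fs = F" using FG finite_list unfolding nbhd_data_def by blast
  \<comment> \<open>The finitely many windows are collected in a single list and coded by one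
    index.\<close>
  define k where "k = to_nat (map (%ps. (th ps, p ps, q ps)) fs)"
  have k: "set (from_nat k :: (qformula \<times> rat \<times> rat) list) = (%ps. (th ps, p ps, q ps)) ` F" by (simp add: k_def fs)
  have "B k n <= basic n m R F G" for n using tpq by (auto simp: B_def k basic_def)
  then have "enn2real (vol n m (B k n)) <= enn2real (vol n m (basic n m R F G))" for n
  using coord_measurable_basic'[OF R FG, of n] basic_subset by (intro enn2real_vol_mono)
  then have "eventually (%n. enn2real (vol n m (B k n)) < volume_at n m h') U"
  using small by (auto elim!: eventually_mono intro: le_less_trans)
  then have good: "good k" using tpq by (auto simp: good_def k)
  have "eventually (%n. ALL ps:F. itp n (fml (th ps)) (X n) : {of_rat (p ps)<..<of_rat (q ps)}) U"
  proof (intro eventually_ball_finite ballI)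
  fix ps assume "ps : F"
  then show "eventually (%n. itp n (fml (th ps)) (X n) : {of_rat (p ps)<..<of_rat (q ps)}) U"
  using tpq[of ps] by (intro topological_tendstoD[OF lim]) (auto simp: formulas_def)
  qed (use FG in \<open>simp add: nbhd_data_def\<close>)
  then have "eventually (%n. False) U"
  by (rule eventually_mono[OF eventually_conj[OF eventually_conj[OF X[of k] XR]]]) (use good in \<open>auto simp: B_def k\<close>)
  then show False using P.U_not_bot by (simp add: eventually_False)
 qed
 then obtain K where K: "eventually (%n. C n <= (\<Union>k\<in>{k. k <= K & good k}. B k n)) U" by blast
 let ?S = "{k. k <= K & good k}"
 have "eventually (%n. ALL k:?S. enn2real (vol n m (B k n)) < volume_at n m h') U"
  by (intro eventually_ball_finite) (auto simp: good_def)
 with K have "eventually (%n. enn2real (vol n m (C n)) <= real (Suc K) * volume_at n m h') U"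
 proof eventually_elim
  case (elim n)
  have fin: "vol n m (B k n) < \<infinity>" for k by (rule vol_finite[where R=R]) (auto simp: B_def)
  have sets: "(%k. {a : space (coord_space n m). mt n m a : B k n}) ` ?S <= sets (coord_space n m)"
  using meas by (auto simp: coord_measurable_def)
  have "vol n m (C n) <= emeasure (coord_space n m) (\<Union>k\<in>?S. {a : space (coord_space n m). mt n m a : B k n})"
  unfolding vol_def Let_def using elim(1) sets by (intro emeasure_mono sets.finite_UN) auto
  also have "... <= (\<Sum>k\<in>?S. vol n m (B k n))"
  unfolding vol_def Let_def by (rule emeasure_subadditive_finite) (use sets in auto)
  finally have "enn2real (vol n m (C n)) <= enn2real (\<Sum>k\<in>?S. vol n m (B k n))"
  using fin by (intro enn2real_mono) (auto simp: less_top[symmetric])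
  also have "... = (\<Sum>k\<in>?S. enn2real (vol n m (B k n)))" using enn2real_sum[of ?S "%k. vol n m (B k n)"] fin by (simp add: o_def)
  also have "... <= (\<Sum>k\<in>?S. volume_at n m h')" using elim(2) by (intro sum_mono less_imp_le) auto
  also have "... = real (card ?S) * volume_at n m h'" by simp
  also have "... <= real (Suc K) * volume_at n m h'"
  using card_mono[of "{..K}" ?S] by (intro mult_right_mono less_imp_le[OF volume_at_pos] of_nat_mono) (simp add: subset_eq)
  finally show ?case .
 qed
 then show ?thesis by blast
qed

end

section \<open>The Talagrand inequality\<close>

text \<open>The square trace-norm distance of variable 0 to the ball of radius r, expanded into
  traces, with variable m as the quantified point. It detects whether variable 0 has operator norm
  at most r. The maximum with 0 bounds the infimum from below in any algebra.\<close>

definition dist_formula :: "nat => real => formula" where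
 "dist_formula m r = InfBall r (Connective (%v. max 0 (v 0 + v 1 - 2 * v 2))
  [ReTr (PMult (PAdj (PVar 0)) (PVar 0)), ReTr (PMult (PAdj (PVar m)) (PVar m)), ReTr (PMult (PAdj (PVar 0)) (PVar m))])"

lemma dist_formula_in: "m > 0 ==> r > 0 ==> dist_formula m r : formulas m"
proof -
 assume "m > 0" "r > 0"
 moreover have "continuous_map (Euclidean_space (Suc (Suc (Suc 0)))) euclideanreal (%v. max 0 (v 0 + v 1 - 2 * v 2))"
  by (intro continuous_map_real_max continuous_map_diff continuous_map_add continuous_map_real_mult continuous_coordinate) auto
 ultimately show ?thesis by (simp add: dist_formula_def formulas_def)
qed

lemma interp_dist_formula:
 assumes "m > 0" "length xs = m"
 shows "interp M (dist_formula m r) xs = (INF y\<in>op_ball M r. max 0 (Re (trc M (adj M (xs ! 0) *[M] (xs ! 0)))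
  + Re (trc M (adj M y *[M] y)) - 2 * Re (trc M (adj M (xs ! 0) *[M] y))))"
 using assms by (simp add: dist_formula_def Let_def nth_append)

lemma dist_formula_nonpos:
 assumes m: "m > 0" and xs: "xs : tball M m r"
 shows "interp M (dist_formula m r) xs <= 0"
proof -
 let ?f = "%y. max 0 (Re (trc M (adj M (xs ! 0) *[M] (xs ! 0))) + Re (trc M (adj M y *[M] y)) - 2 * Re (trc M (adj M (xs ! 0) *[M] y)))"
 have "(INF y\<in>op_ball M r. ?f y) <= ?f (xs ! 0)"
  by (rule cINF_lower) (use tuplesD(2)[OF xs m] in \<open>auto intro: bdd_belowI2[of _ 0]\<close>)
 then show ?thesis using interp_dist_formula[OF m tuplesD(1)[OF xs], of M r] by simp
qed

context star_alg
begin

lemma dist_formula_ge: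
 assumes m: "m > 0" and xs: "xs : tuples m (car M)" and r: "r >= 0"
  and far: "!!y. y : op_ball M r ==> \<kappa> <= (n2 (xs ! 0 \<ominus> y))^2"
 shows "\<kappa> <= interp M (dist_formula m r) xs"
 unfolding interp_dist_formula[OF m tuplesD(1)[OF xs]]
proof (rule cINF_greatest)
 show "op_ball M r ~= {}" using zero_in_op_ball[OF r] by auto
 fix y assume y: "y : op_ball M r"
 have c: "xs ! 0 : car M" "y : car M" using tuplesD(2)[OF xs m] y by (auto simp: op_ball_def)
 have "(n2 (xs ! 0 \<ominus> y))^2 = Re (ip (xs ! 0) (xs ! 0)) + Re (ip y y) - 2 * Re (ip (xs ! 0) y)"
  using c ip_sym[of "xs ! 0" y] by (simp add: n2_sq ip_simps)
 then show "\<kappa> <= max 0 (Re (ip (xs ! 0) (xs ! 0)) + Re (ip y y) - 2 * Re (ip (xs ! 0) y))" using far[OF y] by simp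
qed

lemma L2_norm_sq: "xs : tuples k (car M) ==> (L2_norm M xs)^2 = (\<Sum>j<k. (n2 (xs ! j))^2)"
proof -
 assume xs: "xs : tuples k (car M)"
 have "Re (L2_inner M xs xs) = (\<Sum>j<k. (n2 (xs ! j))^2)"
  unfolding L2_inner_def Re_sum using tuplesD[OF xs] by (intro sum.cong) (auto simp: n2_sq)
 then show ?thesis by (simp add: L2_norm_def sum_nonneg)
qed

lemma tuple_segment_nth:
 "xs : tuples k (car M) ==> ys : tuples k (car M) ==> j < k ==>
  tuple_segment M t xs ys ! j = scal M (cor (1 - t)) (xs ! j) \<oplus> scal M (cor t) (ys ! j)"
 using tuplesD(1)[of xs k "car M"] tuplesD(1)[of ys k "car M"] by (simp add: tuple_segment_def)

lemma tuple_segment_carrier: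
 "xs : tuples k (car M) ==> ys : tuples k (car M) ==> tuple_segment M t xs ys : tuples k (car M)"
proof -
 assume xs: "xs : tuples k (car M)" and ys: "ys : tuples k (car M)"
 have "tuple_segment M t xs ys ! j : car M" if "j < k" for j
  unfolding tuple_segment_nth[OF xs ys that] using tuplesD(2)[OF xs that] tuplesD(2)[OF ys that] by simp
 moreover have "length (tuple_segment M t xs ys) = k" using tuplesD(1)[OF xs] tuplesD(1)[OF ys] by (simp add: tuple_segment_def)
 ultimately show ?thesis by (auto simp: tuples_def in_set_conv_nth)
qed

lemma tuple_segment_ball:
 assumes xs: "xs : tball M k R" and ys: "ys : tball M k R" and t: "0 <= t" "t <= 1"
 shows "tuple_segment M t xs ys : tball M k R"
proof -
 have seg: "scal M (cor (1 - t)) x \<oplus> scal M (cor t) y : op_ball M R" if "x : op_ball M R" "y : op_ball M R" for x y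
 proof -
  have c: "x : car M" "y : car M" "opn M x <= R" "opn M y <= R" using that by (auto simp: op_ball_def)
  have "opn M (scal M (cor (1 - t)) x \<oplus> scal M (cor t) y) <= cmod (cor (1 - t)) * opn M x + cmod (cor t) * opn M y"
  using opn_add[of "scal M (cor (1 - t)) x" "scal M (cor t) y"]
  opn_scal_le[OF c(1), of "cor (1 - t)"] opn_scal_le[OF c(2), of "cor t"] c(1,2) by simp
  also have "... = (1 - t) * opn M x + t * opn M y" unfolding norm_of_real using t by simp
  also have "... <= (1 - t) * R + t * R" using c t by (intro add_mono mult_left_mono) auto
  finally show ?thesis using c by (simp add: op_ball_def algebra_simps)
 qed
 have c: "xs : tuples k (car M)" "ys : tuples k (car M)" using xs ys by (auto intro: tuples_op_ball_carrier)
 have "tuple_segment M t xs ys ! j : op_ball M R" if "j < k" for j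
  unfolding tuple_segment_nth[OF c that] using tuplesD(2)[OF xs that] tuplesD(2)[OF ys that] by (rule seg)
 then show ?thesis using tuplesD(1)[OF tuple_segment_carrier[OF c]] by (auto simp: tuples_def set_conv_nth)
qed

text \<open>The last term of this identity is the source of the gain that strong convexity has over
  mere convexity.\<close>

lemma L2_norm_segment:
 assumes xs: "xs : tuples k (car M)" and ys: "ys : tuples k (car M)"
 shows "(L2_norm M (tuple_segment M t xs ys))^2 =
  (1 - t) * (L2_norm M xs)^2 + t * (L2_norm M ys)^2 - t * (1 - t) * (L2_norm M (tuple_diff M xs ys))^2"
proof -
 have "(n2 (tuple_segment M t xs ys ! j))^2 = (1 - t) * (n2 (xs ! j))^2 + t * (n2 (ys ! j))^2 - t * (1 - t) * (n2 (xs ! j \<ominus> ys ! j))^2"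
  if j: "j < k" for j
 proof -
  have c: "xs ! j : car M" "ys ! j : car M" using tuplesD(2)[OF xs j] tuplesD(2)[OF ys j] by auto
  have "Re (ip (ys ! j) (xs ! j)) = Re (ip (xs ! j) (ys ! j))" using ip_sym[OF c] by simp
  then show ?thesis unfolding tuple_segment_nth[OF xs ys j]
  using c by (simp add: n2_sq ip_simps) (simp add: algebra_simps power2_eq_square)
 qed
 moreover have "(L2_norm M (tuple_diff M xs ys))^2 = (\<Sum>j<k. (n2 (xs ! j \<ominus> ys ! j))^2)"
  by (simp add: L2_norm_tuple_diff[OF xs ys] sum_nonneg)
 ultimately show ?thesis
  using L2_norm_sq[OF xs] L2_norm_sq[OF ys] L2_norm_sq[OF tuple_segment_carrier[OF xs ys]]
  by (simp add: sum.distrib sum_subtractf sum_distrib_left)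
qed

end

context algebra_copy
begin

lemma L2_norm_copy: "xs : tuples k (car M) ==> L2_norm N (map j xs) = L2_norm M xs"
 using tuplesD[of xs k] by (simp add: L2_norm_def L2_inner_def)

lemma tuple_segment_copy:
 "xs : tuples k (car M) ==> ys : tuples k (car M) ==> tuple_segment N t (map j xs) (map j ys) = map j (tuple_segment M t xs ys)"
 using tuplesD[of xs k] tuplesD[of ys k] by (intro nth_equalityI) (auto simp: tuple_segment_def)

lemma strongly_convex_segment:
 assumes conv: "strongly_convex K m c \<phi>" and K: "N : K" and xs: "xs : tuples m (car M)" and ys: "ys : tuples m (car M)" and t: "0 <= t" "t <= 1"
 shows "\<phi> N (map j (tuple_segment M t xs ys)) <=
  (1 - t) * \<phi> N (map j xs) + t * \<phi> N (map j ys) - c / 2 * (t * (1 - t) * (L2_norm M (tuple_diff M xs ys))^2)"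
proof -
 have "map j xs : tuples m (car N)" "map j ys : tuples m (car N)"
  using xs ys by (auto simp: carrier_N tuples_copy)
 then have "\<phi> N (tuple_segment N t (map j xs) (map j ys)) - c / 2 * (L2_norm N (tuple_segment N t (map j xs) (map j ys)))^2
  <= (1 - t) * (\<phi> N (map j xs) - c / 2 * (L2_norm N (map j xs))^2) + t * (\<phi> N (map j ys) - c / 2 * (L2_norm N (map j ys))^2)"
  using conv K t unfolding strongly_convex_def Let_def by auto
 moreover have "P <= (1 - t) * X + t * Y - k * (t * (1 - t) * D)"
  if "P - k * ((1 - t) * A + t * B - t * (1 - t) * D) <= (1 - t) * (X - k * A) + t * (Y - k * B)" for P k A B D X Y :: real
  using that by (simp add: algebra_simps)
 ultimately show ?thesis
  unfolding tuple_segment_copy[OF xs ys] L2_norm_copy[OF tuple_segment_carrier[OF xs ys]] L2_norm_copy[OF xs] L2_norm_copy[OF ys]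
  L2_norm_segment[OF xs ys] by blast
qed

end

lemma types_ball_mono: "R <= R' ==> types_ball K m R <= types_ball K m R'"
 unfolding types_ball_def using tuples_mono[OF op_ball_mono] by blast

text \<open>\<open>chi_full\<close> uses a chosen radius. If the type did not belong to the ball of
  that radius, there would be no neighbourhoods, and the infimum over the empty set would be
  \<infinity>.\<close>

lemma chi_full_radius:
 fixes l :: "formula => real"
 assumes "chi_full TYPE('u) U m l ~= \<infinity>"
 shows "EX R>0. l : types_ball (models_fact :: 'u alg set) m R & chi_full TYPE('u) U m l = chi_full_R TYPE('u) U m R l"
proof -
 define P where "P R <-> R > 0 & l : types_ball (models_fact :: 'u alg set) m R" for R
 have chi: "chi_full TYPE('u) U m l = chi_full_R TYPE('u) U m (SOME R. P R) l" by (simp add: chi_full_def P_def)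
 have "l : types_ball (models_fact :: 'u alg set) m (SOME R. P R)"
 proof (rule ccontr)
  assume "l \<notin> types_ball (models_fact :: 'u alg set) m (SOME R. P R)"
  then have e: "{V. openin (types_topology (models_fact :: 'u alg set) m (SOME R. P R)) V & l : V} = {}"
  by (auto simp: types_topology_def openin_subtopology)
  then have "chi_full_R TYPE('u) U m (SOME R. P R) l = \<infinity>" by (simp only: chi_full_R_def e image_empty Inf_empty top_ereal_def)
  then show False using assms chi by simp
 qed
 \<comment> \<open>Membership at the chosen radius yields a positive admissible radius, so the
   choice was made from a nonempty set.\<close>
 then have "P (max 1 (SOME R. P R))" using types_ball_mono[of "SOME R. P R" "max 1 (SOME R. P R)"] unfolding P_def[of "max 1 (SOME R. P R)"] by auto
 then have "P (SOME R. P R)" by (rule someI)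
 then show ?thesis using chi by (auto simp: P_def)
qed

text \<open>The case m = 0 is separate because the empty tuple lies in balls of every radius, so
  there radii cannot be compared through norms.\<close>

lemma basic_mono:
 assumes "m = 0 \<or> R <= R'" and "!!ps. ps : F ==> ps : F' & G' ps <= G ps"
 shows "basic n m R F' G' <= basic n m R' F G"
proof -
 have "mat_ball n m R <= mat_ball n m R'"
 proof (cases "m = 0")
  case False
  then show ?thesis using assms(1) by (intro tuples_mono op_ball_mono) simp
 qed (auto simp: tuples_def)
 then show ?thesis using assms(2) unfolding basic_def by blast
qed

context universe
begin

text \<open>Along pushed matrices the distance formula at a radius r < R stays above a fixed
  positive number, hence so does its value at the limit type; on a tuple in the ball of radius r its
  value is at most 0. Thus any radius at which the limit type is realised is at least R.\<close>

lemma boundary_radius: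
 assumes m: "m > 0" and a: "a > 0" and R: "R > 0"
  and X: "eventually (%n. X n : map (push n (ramp a n) R) ` mat_ball n m R) U"
  and lim: "!!ps. ps : formulas m ==> ((%n. itp n ps (X n)) ~> l ps) U"
  and r: "r > 0" "xs : tball M m r" "!!ps. ps : formulas m ==> interp M ps xs = l ps"
 shows "R <= r"
proof (rule ccontr)
 assume "\<not> R <= r"
 then obtain \<kappa> N where \<kappa>: "\<kappa> > 0" and far: "!!n x y. n >= N ==> x : op_ball (Mat n) R ==> y : op_ball (Mat n) r ==>
  \<kappa> <= (mat.n2 n (push n (ramp a n) R x - y))^2"
  using push_far_from_smaller_ball[OF a less_imp_le[OF r(1)], of R] by (meson not_le)
 have "eventually (%n. \<kappa> <= itp n (dist_formula m r) (X n)) U"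
  using X free_ultrafilter_ge[OF ultra, of N]
 proof eventually_elim
  case (elim n)
  then obtain Y where Y: "Y : mat_ball n m R" "X n = map (push n (ramp a n) R) Y" by blast
  have c: "Y ! j : sqm n" if "j < m" for j using mat_ball_carrier[OF Y(1) that] .
  have X0: "X n ! 0 = push n (ramp a n) R (Y ! 0)" using Y m tuplesD(1)[OF Y(1)] by simp
  show ?case
  proof (rule mat.dist_formula_ge[OF m])
  show "X n : tuples m (car (Mat n))" using c tuplesD(1)[OF Y(1)] by (auto simp: Y(2) tuples_def set_conv_nth)
  fix y assume y: "y : op_ball (Mat n) r"
  then show "\<kappa> <= (mat.n2 n (X n ! 0 -[Mat n] y))^2"
  using far[OF elim(2) tuplesD(2)[OF Y(1) m] y] c[OF m] by (simp add: X0 op_ball_def)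
  qed (use r in simp)
 qed
 then have "\<kappa> <= l (dist_formula m r)"
  using dist_formula_in[OF m r(1)] P.U_not_bot by (intro tendsto_lowerbound[OF lim]) auto
 also have "... <= 0" using dist_formula_nonpos[OF m r(2)] r(3) dist_formula_in[OF m r(1)] by metis
 finally show False using \<kappa> by simp
qed

lemma models_U_tr: "M : models_U U ==> M : models_tr"
 by (simp add: models_U_def models_def models_tr_def)

lemma type_radius:
 assumes "l : types (models_U U :: 'u alg set) m"
 shows "EX M xs R. M : (models_U U :: 'u alg set) & R > 0 & xs : tball M m R & l = tp m M xs"
 using assms by (auto simp: types_def types_ball_def)

text \<open>By contradiction: a failing distance bound separates microstates of the two types, the
  segments between them acquire low energy, and the pushed segments carry more volume than the Gibbs
  property allows to limit types of that energy.\<close>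

lemma d_W_full_bound:
 fixes \<phi> :: "'u predicate"
 assumes c: "c > 0" and def: "definable_predicate models_tr m \<phi>" and conv: "strongly_convex models_tr m c \<phi>"
  and gibbs: "gibbs_type U m \<phi> \<mu>" and \<nu>: "\<nu> : types (models_U U :: 'u alg set) m"
  and chi\<mu>: "chi_full TYPE('u) U m \<mu> = ereal em" and chi\<nu>: "chi_full TYPE('u) U m \<nu> = ereal en"
  and d: "d > 0" "pairing models_tr m \<nu> \<phi> - en - pairing models_tr m \<mu> \<phi> + em < c / 2 * d\<^sup>2"
 shows "d_W_full TYPE('u) U m \<mu> \<nu> <= ereal d"
proof (rule ccontr)
 assume not_le: "\<not> d_W_full TYPE('u) U m \<mu> \<nu> <= ereal d"
 define pm where "pm = pairing models_tr m \<mu> \<phi>"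
 define pn where "pn = pairing models_tr m \<nu> \<phi>"
 have \<mu>: "\<mu> : types (models_U U :: 'u alg set) m" using gibbs by (simp add: gibbs_type_def)
 obtain M xs R1 where M: "M : (models_U U :: 'u alg set)" "R1 > 0" "xs : tball M m R1" "\<mu> = tp m M xs"
  using type_radius[OF \<mu>] by blast
 obtain N ys R2 where N: "N : (models_U U :: 'u alg set)" "R2 > 0" "ys : tball N m R2" "\<nu> = tp m N ys"
  using type_radius[OF \<nu>] by blast
 obtain R\<mu> where R\<mu>: "R\<mu> > 0" "\<mu> : types_ball (models_fact :: 'u alg set) m R\<mu>" "chi_full_R TYPE('u) U m R\<mu> \<mu> = ereal em"
  using chi_full_radius[of U m \<mu>, where ?'u='u] chi\<mu> by auto
 obtain R\<nu> where R\<nu>: "R\<nu> > 0" "\<nu> : types_ball (models_fact :: 'u alg set) m R\<nu>" "chi_full_R TYPE('u) U m R\<nu> \<nu> = ereal en"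
  using chi_full_radius[of U m \<nu>, where ?'u='u] chi\<nu> by auto
 define R where "R = Max {R1, R2, R\<mu>, R\<nu>}"
 have Rle: "R1 <= R" "R2 <= R" "R\<mu> <= R" "R\<nu> <= R" by (auto simp: R_def)
 then have R: "R > 0" using M by linarith
 have xsR: "xs : tball M m R" "ys : tball N m R"
  using M(3) N(3) Rle tuples_mono[OF op_ball_mono] by blast+
 \<comment> \<open>The excess of (c/2) d^2 over the entropy-energy deficit; it is positive by
   assumption.\<close>
 define \<Delta> where "\<Delta> = c / 2 * d\<^sup>2 - (pn - en - pm + em)"
 have \<Delta>: "\<Delta> > 0" using d by (simp add: \<Delta>_def pm_def pn_def)
 \<comment> \<open>Small enough that the second-order term t^2 c d^2 / 2 is at most t \<Delta> /
   2.\<close>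
 define t where "t = min (1 / 2) (\<Delta> / (c * d\<^sup>2))"
 have t: "0 < t" "t < 1" using \<Delta> c d by (auto simp: t_def)
 have "t * (c * d\<^sup>2) <= \<Delta> / (c * d\<^sup>2) * (c * d\<^sup>2)" using c by (intro mult_right_mono) (auto simp: t_def)
 then have td: "t * (c * d\<^sup>2) <= \<Delta>" using c d by simp
 \<comment> \<open>Ten copies of \<epsilon> are lost in total, one in h0, five in K, three in h' and
   one in g; they amount to t \<Delta> / 4, half of the remaining gain t \<Delta> / 2.\<close>
 define \<epsilon> where "\<epsilon> = t * \<Delta> / 40"
 have \<epsilon>: "\<epsilon> > 0" using t \<Delta> by (simp add: \<epsilon>_def)
 \<comment> \<open>An energy bound on the segments. Passing between \<phi> and \<open>ps\<close> at
   the types and at the microstates costs 3 \<epsilon>, and 2 \<epsilon> are kept in reserve for the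
   return from \<phi> to \<open>ps\<close>.\<close>
 define K where "K = (1 - t) * pm + t * pn - c / 2 * (t * (1 - t) * d\<^sup>2) + 5 * \<epsilon>"
 \<comment> \<open>The entropy that Prekopa-Leindler guarantees for the segments.\<close>
 define h0 where "h0 = (1 - t) * (em - \<epsilon>) + t * (en - \<epsilon>)"
 \<comment> \<open>By the Gibbs property, a type of energy below K + 2 \<epsilon> has entropy below
   this number.\<close>
 define h' where "h' = em - pm + K + 3 * \<epsilon>"
 define g where "g = h0 - \<epsilon> - h'"
 have "g = t * (\<Delta> - t * (c * d\<^sup>2) / 2) - 10 * \<epsilon>"
  by (simp add: g_def h0_def h'_def K_def \<Delta>_def field_simps)
 also have "... >= t * (\<Delta> / 2) - 10 * \<epsilon>" using td t by (intro diff_right_mono mult_left_mono) auto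
 finally have "t * (\<Delta> / 2) - 10 * \<epsilon> <= g" .
 moreover have "t * (\<Delta> / 2) - 10 * \<epsilon> = t * \<Delta> / 4" by (simp add: \<epsilon>_def)
 ultimately have g: "g > 0" using mult_pos_pos[OF t(1) \<Delta>] by linarith
 obtain ps where ps: "ps : formulas m" and near: "!!M xs. M : models_tr ==> xs : tball M m R ==> \<bar>\<phi> M xs - interp M ps xs\<bar> < \<epsilon>"
  using def[unfolded definable_predicate_def, rule_format, OF \<epsilon> R] by blast
 have p\<mu>: "pm = \<phi> M xs" and p\<nu>: "pn = \<phi> N ys"
  unfolding pm_def pn_def M(4) N(4) using xsR M(1) N(1) by (auto intro!: pairing_eq[OF def] models_U_tr tuples_op_ball_carrier)
 \<comment> \<open>If every pair of neighbourhoods contained close microstates along the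
   ultrafilter, saturation would give a coupling at distance at most d.\<close>
 obtain F G H where FG: "nbhd_data m \<mu> F G" "nbhd_data m \<nu> F H" and nev: "\<not> eventually (%n. EX X:basic n m R F G. EX Y:basic n m R F H.
  L2_norm (Mat n) (tuple_diff (Mat n) X Y) < d) U"
  using d_W_full_le[OF R M(1) xsR(1) N(1) xsR(2), folded M(4) N(4)] not_le by blast
 have apart: "eventually (%n. ALL X:basic n m R F G. ALL Y:basic n m R F H. d <= L2_norm (Mat n) (tuple_diff (Mat n) X Y)) U"
  using ultrafilter_not[OF ultra nev] by (rule eventually_mono) (auto simp: not_less)
 \<comment> \<open>Adds to a neighbourhood the requirement that \<open>ps\<close> be within
   \<epsilon> of its value; \<open>UNIV\<close> stands for no requirement.\<close>
 define near_set where "near_set l B = (%th. (if th : F then B th else UNIV) \<inter> (if th = ps then ball (l ps) \<epsilon> else UNIV))" for l :: "formula => real" and B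
 have nd: "nbhd_data m l (insert ps F) (near_set l B)" if "nbhd_data m l F B" for l B
  using that ps \<epsilon> by (auto simp: nbhd_data_def near_set_def)
 \<comment> \<open>The microstates are taken at the radii at which the two entropies are evaluated;
   both balls lie in the common ball of radius R.\<close>
 define A where "A n = basic n m R\<mu> (insert ps F) (near_set \<mu> G)" for n
 define B where "B n = basic n m R\<nu> (insert ps F) (near_set \<nu> H)" for n
 define C where "C n = {Z : mat_ball n m R. itp n ps Z < K}" for n
 have AB: "A n <= basic n m R F G" "B n <= basic n m R F H" for n
  unfolding A_def B_def using Rle by (intro basic_mono; auto simp: near_set_def)+
 have Cmeas: "coord_measurable n m (C n)" for n
  using coord_measurable_basic[of R "{ps}" m "%_. {..<K}" n] R ps by (simp add: C_def)
 have volC: "eventually (%n. volume_at n m h0 <= enn2real (vol n m (C n))) U"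
  using volume_eventually_gt[OF R\<mu>(1,2) _ nd[OF FG(1)], of "em - \<epsilon>", unfolded R\<mu>(3), folded A_def]
  volume_eventually_gt[OF R\<nu>(1,2) _ nd[OF FG(2)], of "en - \<epsilon>", unfolded R\<nu>(3), folded B_def] apart eventually_pos
 proof (rule eventually_elim2[OF eventually_conj[OF _ _] eventually_conj])
  show "ereal (em - \<epsilon>) < ereal em" "ereal (en - \<epsilon>) < ereal en" using \<epsilon> by auto
  fix n assume vol: "volume_at n m (em - \<epsilon>) < enn2real (vol n m (A n)) & volume_at n m (en - \<epsilon>) < enn2real (vol n m (B n))"
  and ap: "(ALL X:basic n m R F G. ALL Y:basic n m R F H. d <= L2_norm (Mat n) (tuple_diff (Mat n) X Y)) & 0 < n"
  let ?j = "%A. encode (%k. if k = n then A else 0\<^sub>m k k)"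
  interpret CN: algebra_copy "Mat n" ?j by (rule copies)
  have tr: "CN.N : models_tr" using matrix_copy_factor(2)[of n] ap by (simp add: matrix_copy_def)
  have \<phi>ps: "\<bar>\<phi> CN.N (map ?j Z) - itp n ps Z\<bar> < \<epsilon>" if Z: "Z : mat_ball n m R" for Z
  proof -
  have "interp CN.N ps (map ?j Z) = itp n ps Z"
  using Z ps by (intro CN.interp_copy[of _ m] tuples_op_ball_carrier) (auto simp: formulas_def)
  then show ?thesis using near[OF tr, of "map ?j Z"] Z by (auto simp: CN.op_ball_copy CN.tuples_copy)
  qed
  have "enn2real (vol n m (A n)) powr (1 - t) * enn2real (vol n m (B n)) powr t <= enn2real (vol n m (C n))"
  proof (rule vol_Prekopa_Leindler[OF t])
  show "coord_measurable n m (A n)" "coord_measurable n m (B n)"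
  unfolding A_def B_def using R\<mu> R\<nu> nd FG by (auto intro: coord_measurable_basic')
  show sub: "A n <= mat_ball n m R" "B n <= mat_ball n m R" using AB[of n] basic_subset[of n m R] by blast+
  fix X Y assume X: "X : A n" and Y: "Y : B n"
  have XY: "X : mat_ball n m R" "Y : mat_ball n m R" using X Y sub by auto
  have "itp n ps X : ball (\<mu> ps) \<epsilon>" "itp n ps Y : ball (\<nu> ps) \<epsilon>"
  using X Y by (auto simp: A_def B_def basic_def near_set_def)
  then have "\<phi> CN.N (map ?j X) <= pm + 3 * \<epsilon>" "\<phi> CN.N (map ?j Y) <= pn + 3 * \<epsilon>"
  using \<phi>ps[OF XY(1)] \<phi>ps[OF XY(2)] near[OF models_U_tr[OF M(1)] xsR(1)] near[OF models_U_tr[OF N(1)] xsR(2)]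
  unfolding p\<mu> p\<nu> M(4) N(4) tp_apply[OF ps] mem_ball dist_real_def by linarith+
  then have "(1 - t) * \<phi> CN.N (map ?j X) + t * \<phi> CN.N (map ?j Y) <= (1 - t) * (pm + 3 * \<epsilon>) + t * (pn + 3 * \<epsilon>)"
  using t by (intro add_mono mult_left_mono) auto
  moreover have "d <= L2_norm (Mat n) (tuple_diff (Mat n) X Y)" using ap X Y AB[of n] by blast
  then have "d\<^sup>2 <= (L2_norm (Mat n) (tuple_diff (Mat n) X Y))^2" using d by (intro power_mono) auto
  then have "c / 2 * (t * (1 - t) * d\<^sup>2) <= c / 2 * (t * (1 - t) * (L2_norm (Mat n) (tuple_diff (Mat n) X Y))^2)"
  using c t by (intro mult_left_mono) auto
  moreover have Z: "tuple_segment (Mat n) t X Y : mat_ball n m R" using XY t by (intro mat.tuple_segment_ball) auto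
  ultimately have "\<phi> CN.N (map ?j (tuple_segment (Mat n) t X Y)) <= K - 2 * \<epsilon>"
  using CN.strongly_convex_segment[OF conv tr tuples_op_ball_carrier[OF XY(1)] tuples_op_ball_carrier[OF XY(2)], of t] t
  unfolding K_def by (simp add: algebra_simps)
  then have "itp n ps (tuple_segment (Mat n) t X Y) < K" using \<phi>ps[OF Z] \<epsilon> by linarith
  then show "tuple_segment (Mat n) t X Y : C n" using Z by (simp add: C_def)
  qed (use R Cmeas in \<open>auto simp: C_def\<close>)
  moreover have "volume_at n m h0 = volume_at n m (em - \<epsilon>) powr (1 - t) * volume_at n m (en - \<epsilon>) powr t"
  by (simp add: volume_at_def h0_def powr_def exp_add[symmetric] algebra_simps)
  moreover have "... <= enn2real (vol n m (A n)) powr (1 - t) * enn2real (vol n m (B n)) powr t"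
  using vol t by (intro mult_mono powr_mono2) (auto intro: less_imp_le)
  ultimately show "volume_at n m h0 <= enn2real (vol n m (C n))" by linarith
 qed
 obtain \<delta> where \<delta>: "\<delta> > 0" and md: "formula_modulus TYPE(complex mat) m R ps \<epsilon> \<delta>"
  using formula_uniformity[of m ps R] ps R \<epsilon> by (auto simp: formulas_def)
 \<comment> \<open>The first bound keeps the entropy loss 4 m a of the push below \<epsilon>; the
   second keeps its displacement 4 R sqrt a within the modulus of \<open>ps\<close>.\<close>
 define a where "a = min (\<epsilon> / (4 * real m + 1)) ((\<delta> / (4 * R))^2)"
 have a: "a > 0" using \<epsilon> \<delta> R by (simp add: a_def add_pos_nonneg)
 have "a <= (\<delta> / (4 * R))^2" unfolding a_def by (rule min.cobounded2)
 then have "sqrt a <= \<delta> / (4 * R)" using \<delta> R by (intro real_le_lsqrt) auto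
 then have a\<delta>: "4 * R * sqrt a <= \<delta>" using R by (simp add: pos_le_divide_eq mult.commute)
 have "a * (4 * real m + 1) <= \<epsilon>" using min.cobounded1[of "\<epsilon> / (4 * real m + 1)" "(\<delta> / (4 * R))^2"] unfolding a_def[symmetric] by (simp add: pos_le_divide_eq)
 then have a\<epsilon>: "4 * real m * a <= \<epsilon>" using a by (simp add: algebra_simps)
 \<comment> \<open>The segments are pushed only now, after the energy bound: this costs \<epsilon>
   in energy and \<epsilon> in entropy.\<close>
 define D where "D n = map (push n (ramp a n) R) ` C n" for n
 have ramp: "p < n ==> 0 < ramp a n p & ramp a n p <= 1" for n p using ramp_bounds[of a p n] a by simp
 have DR: "D n <= {Z : mat_ball n m R. itp n ps Z < K + \<epsilon>}" for n
 proof
  fix W assume "W : D n"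
  then obtain Z where Z: "Z : mat_ball n m R" "itp n ps Z < K" and W: "W = map (push n (ramp a n) R) Z" by (auto simp: D_def C_def)
  have b: "push n (ramp a n) R z : op_ball (Mat n) R" if "z : op_ball (Mat n) R" for z
  using that ramp R by (intro opn_push_le) (auto intro: less_imp_le)
  then have WR: "W : mat_ball n m R" using Z(1) by (auto simp: W tuples_def)
  have "mat.n2 n (W ! i -[Mat n] Z ! i) <= \<delta>" if i: "i < m" for i
  proof -
  have "mat.n2 n (push n (ramp a n) R (Z ! i) - Z ! i) <= 4 * R * mat.n2 n (rdiag n (%p. ramp a n p - 1))"
  using tuplesD(2)[OF Z(1) i] ramp R by (intro norm2_push_minus_le) (auto intro: less_imp_le)
  also have "... <= 4 * R * sqrt a" using norm2_ramp_le[OF a, of n] R by (intro mult_left_mono) auto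
  finally show ?thesis using a\<delta> mat_ball_carrier[OF Z(1) i] tuplesD(1)[OF Z(1)] i by (simp add: W)
  qed
  then have "\<bar>itp n ps W - itp n ps Z\<bar> <= \<epsilon>"
  using md mat.star_alg_axioms[of n] WR Z(1) unfolding formula_modulus_def by blast
  then show "W : {Z : mat_ball n m R. itp n ps Z < K + \<epsilon>}" using WR Z(2) by auto
 qed
 have volD: "eventually (%n. volume_at n m (h0 - \<epsilon>) <= enn2real (vol n m (D n))) U"
  using volC eventually_pos
 proof eventually_elim
  case (elim n)
  let ?c = "\<Prod>(j, p, q, b)\<in>coord_index n m. ramp a n p * ramp a n q"
  have "volume_at n m (h0 - \<epsilon>) = exp (- (\<epsilon> * (real n)^2)) * volume_at n m h0" by (simp add: volume_at_def exp_add[symmetric] algebra_simps)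
  also have "... <= exp (- (4 * real m * a * (real n)^2)) * volume_at n m h0"
  using a\<epsilon> by (intro mult_right_mono less_imp_le[OF volume_at_pos]) (simp add: mult_right_mono)
  also have "... <= ?c * enn2real (vol n m (C n))"
  using prod_ramp_ge[OF a, of m n] elim(1) by (intro mult_mono less_imp_le[OF volume_at_pos]) (auto intro: order_trans[OF exp_ge_zero])
  also have "... = enn2real (vol n m (D n))"
  proof -
  have "C n <= tuples m (sqm n)" using tuples_op_ball_carrier[of _ m "Mat n" R] by (auto simp: C_def)
  from vol_push(2)[OF elim(2) _ Cmeas this, of "ramp a n" R] have "vol n m (D n) = ennreal ?c * vol n m (C n)" using ramp by (simp add: D_def)
  moreover have "0 <= ?c" using prod_ramp_ge[OF a, of m n] by (rule order_trans[OF exp_ge_zero])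
  ultimately show ?thesis by (simp add: enn2real_mult)
  qed
  finally show ?case .
 qed
 have "EX k. eventually (%n. enn2real (vol n m (D n)) <= real k * volume_at n m h') U"
 proof (rule volume_cover[OF R])
  show "D n <= mat_ball n m R" for n using DR[of n] by blast
  fix X zs assume X: "eventually (%n. X n : D n) U" and zs: "zs : tball Qu m R"
  and lim: "!!ps. ps : formulas m ==> ((%n. itp n ps (X n)) ~> interp Qu ps zs) U"
  let ?l = "tp m Qu zs"
  have "?l : types_ball (models_U U :: 'u alg set) m R" unfolding types_ball_def using zs Qu_models(1) by blast
  then have "?l : types (models_U U :: 'u alg set) m" unfolding types_def using R by (intro UN_I) simp_all
  then have "chi_full TYPE('u) U m ?l - ereal (pairing models_tr m ?l \<phi>) <= ereal em - ereal pm"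
  using gibbs chi\<mu> by (auto simp: gibbs_type_def pm_def)
  moreover have "pairing models_tr m ?l \<phi> = \<phi> Qu zs" using zs Qu_models(2) by (intro pairing_eq[OF def] tuples_op_ball_carrier)
  moreover have "\<phi> Qu zs < K + 2 * \<epsilon>"
  proof -
  have "eventually (%n. itp n ps (X n) <= K + \<epsilon>) U" using X by (rule eventually_mono) (use DR in \<open>auto intro: less_imp_le\<close>)
  then have "interp Qu ps zs <= K + \<epsilon>" using P.U_not_bot by (intro tendsto_upperbound[OF lim[OF ps]]) auto
  then show ?thesis using near[OF Qu_models(2) zs] by linarith
  qed
  ultimately have lt: "chi_full TYPE('u) U m ?l < ereal h'" using \<epsilon>
  by (cases "chi_full TYPE('u) U m ?l") (auto simp: h'_def)
  then have "chi_full TYPE('u) U m ?l ~= \<infinity>" by auto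
  from chi_full_radius[OF this] obtain r where r: "r > 0" "?l : types_ball (models_fact :: 'u alg set) m r" "chi_full TYPE('u) U m ?l = chi_full_R TYPE('u) U m r ?l"
  by blast
  obtain M' ys' where M': "ys' : tball (M' :: 'u alg) m r" "tp m M' ys' = ?l" using r(2) by (auto simp: types_ball_def)
  \<comment> \<open>The radius chosen by \<open>chi_full\<close> for the limit type is at least R,
    so small volume at that radius implies small volume at radius R, where \<open>D\<close>
    lives.\<close>
  have Rr: "m = 0 \<or> R <= r"
  proof (cases "m = 0")
  case False
  have "eventually (%n. X n : map (push n (ramp a n) R) ` mat_ball n m R) U" using X by (rule eventually_mono) (auto simp: D_def C_def)
  moreover have "interp M' th ys' = interp Qu th zs" if "th : formulas m" for th using fun_cong[OF M'(2), of th] by (simp add: tp_apply[OF that])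
  ultimately have "R <= r" using False by (intro boundary_radius[OF _ a R _ lim r(1) M'(1)]) auto
  then show ?thesis ..
  qed simp
  obtain F' G' where F': "nbhd_data m ?l F' G'" "eventually (%n. enn2real (vol n m (basic n m r F' G')) < volume_at n m h') U"
  using volume_eventually_lt[OF r(1) lt[unfolded r(3)]] by blast
  have "enn2real (vol n m (basic n m R F' G')) <= enn2real (vol n m (basic n m r F' G'))" for n
  by (rule enn2real_vol_mono[OF coord_measurable_basic'[OF r(1) F'(1)] basic_mono[OF Rr] basic_subset]) simp
  then show "EX F G. nbhd_data m ?l F G & eventually (%n. enn2real (vol n m (basic n m R F G)) < volume_at n m h') U"
  using F' by (intro exI[of _ F'] exI[of _ G']) (auto elim!: eventually_mono intro: le_less_trans)
 qed
 then obtain k where k: "eventually (%n. enn2real (vol n m (D n)) <= real k * volume_at n m h') U" by blast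
 \<comment> \<open>The lower bound on the volume of \<open>D\<close> exceeds
   \<open>volume_at n m h'\<close> by the factor exp (n^2 g), which outgrows the fixed number k of
   covering sets.\<close>
 have "eventually (%n. False) U"
  using k volD free_ultrafilter_ge[OF ultra, of "nat \<lceil>real k / g\<rceil> + 1"]
 proof eventually_elim
  case (elim n)
  have "exp ((real n)^2 * g) * volume_at n m h' = volume_at n m (h0 - \<epsilon>)"
  by (simp add: volume_at_def exp_add[symmetric] g_def algebra_simps)
  also have "... <= real k * volume_at n m h'" using elim by linarith
  finally have "exp ((real n)^2 * g) <= real k" by (simp add: mult_le_cancel_right)
  moreover have "(real n)^2 * g < exp ((real n)^2 * g)" using exp_ge_add_one_self[of "(real n)^2 * g"] by linarith
  moreover have "real k / g <= real n" "1 <= real n" using elim(3) by linarith+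
  then have "real k <= real n * g" using g by (simp add: field_simps)
  moreover have "real n * g <= (real n)^2 * g" using \<open>1 <= real n\<close> g by (intro mult_right_mono) (auto simp: power2_eq_square)
  ultimately show False by linarith
 qed
 then show False using P.U_not_bot by (simp add: eventually_False)
qed

text \<open>Arbitrary models are treated here directly through positivity of the trace. The sign is
  what allows bounds on the distance to be squared.\<close>

lemma d_W_full_nonneg: "0 <= d_W_full TYPE('u) U m \<mu> \<nu>"
 unfolding d_W_full_def
proof (rule Inf_greatest, clarsimp)
 fix M :: "'u alg" and xs ys assume M: "M : models_U U" and xs: "xs : tuples m (car M)" and ys: "ys : tuples m (car M)"
 have ring: "ring M" and st: "faithful_normal_tracial_state M" using M by (auto simp: models_U_def models_def tracial_vNa_def)
 have "EX r>=0. trc M (adj M z *[M] z) = cor r" if "z : car M" for z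
  using st that unfolding faithful_normal_tracial_state_def by blast
 then have pos: "0 <= Re (trc M (adj M z *[M] z))" if "z : car M" for z using that by fastforce
 have "tuple_diff M xs ys ! j : car M" if "j < length (tuple_diff M xs ys)" for j
  using that tuplesD[OF xs] tuplesD[OF ys] ring.ring_simprules(4)[OF ring] by (auto simp: tuple_diff_def)
 then show "0 <= L2_norm M (tuple_diff M xs ys)" using pos by (auto simp: L2_norm_def L2_inner_def intro!: sum_nonneg)
qed

end

theorem proposition5p10:
 fixes U :: "nat filter" and m :: nat and c :: real
  and \<phi> :: "'u predicate" and \<mu> :: "formula \<Rightarrow> real"
 assumes universe: "\<exists>h :: real \<Rightarrow> 'u. inj h"
  and "free_ultrafilter U"
  and "c > 0"
  and "definable_predicate models_tr m \<phi>"
  and "strongly_convex models_tr m c \<phi>"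
  and "gibbs_type U m \<phi> \<mu>"
 shows "\<forall>\<nu>\<in>types (models_U U :: 'u tracial_algebra set) m.
  (d_W_full TYPE('u) U m \<mu> \<nu>)\<^sup>2 \<le>
   ereal (2 / c) *
    (ereal (pairing models_tr m \<nu> \<phi>) - chi_full TYPE('u) U m \<nu>
     - ereal (pairing models_tr m \<mu> \<phi>) + chi_full TYPE('u) U m \<mu>)"
proof
 fix \<nu> assume \<nu>: "\<nu> : types (models_U U :: 'u alg set) m"
 obtain h :: "real => 'u" where "inj h" using universe by blast
 then interpret universe U h using assms(2) by unfold_locales
 let ?p\<nu> = "pairing models_tr m \<nu> \<phi>" and ?p\<mu> = "pairing models_tr m \<mu> \<phi>"
 let ?\<chi>\<nu> = "chi_full TYPE('u) U m \<nu>" and ?\<chi>\<mu> = "chi_full TYPE('u) U m \<mu>" and ?d = "d_W_full TYPE('u) U m \<mu> \<nu>"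
 have gibbs: "?\<chi>\<nu> - ereal ?p\<nu> <= ?\<chi>\<mu> - ereal ?p\<mu>" using assms(6) \<nu> by (simp add: gibbs_type_def)
 show "?d\<^sup>2 <= ereal (2 / c) * (ereal ?p\<nu> - ?\<chi>\<nu> - ereal ?p\<mu> + ?\<chi>\<mu>)"
 proof (cases "?\<chi>\<mu> = \<infinity> \<or> ?\<chi>\<nu> = -\<infinity>")
  case True
  \<comment> \<open>In \<open>ereal\<close> the sum of \<infinity> and -\<infinity> is \<infinity>,
    so the right-hand side is infinite whatever the other entropy is.\<close>
  then have inf: "ereal ?p\<nu> - ?\<chi>\<nu> - ereal ?p\<mu> + ?\<chi>\<mu> = \<infinity>" by auto
  show ?thesis unfolding inf using assms(3) by simp
 next
  case False
  \<comment> \<open>The Gibbs inequality excludes the remaining infinite values: an infinite entropy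
    of \<nu> would force one of \<mu>, and -\<infinity> for \<mu> would force it for \<nu>.\<close>
  then obtain em en where e: "?\<chi>\<mu> = ereal em" "?\<chi>\<nu> = ereal en"
  using gibbs by (cases ?\<chi>\<mu>; cases ?\<chi>\<nu>) auto
  define S where "S = ?p\<nu> - en - ?p\<mu> + em"
  have S: "0 <= S" using gibbs by (simp add: e S_def)
  have bound: "?d <= ereal d" if "d > 0" "2 / c * S < d\<^sup>2" for d
  using that assms(3) by (intro d_W_full_bound[OF assms(3-6) \<nu> e]) (auto simp: S_def field_simps)
  \<comment> \<open>Any admissible d shows that the distance is finite; the extra 1 makes the
    inequality strict. The sharp bound then follows by taking s between 2 S / c and the square of
    the distance.\<close>
  have "2 / c * S < (sqrt (2 / c * S + 1))^2" "0 < sqrt (2 / c * S + 1)" using S assms(3) by (auto simp: add_nonneg_pos)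
  then have "?d <= ereal (sqrt (2 / c * S + 1))" using bound by blast
  then obtain w where w: "?d = ereal w" "0 <= w" using d_W_full_nonneg[of m \<mu> \<nu>] by (cases ?d) auto
  have "w\<^sup>2 <= 2 / c * S"
  proof (rule ccontr)
  assume "\<not> w\<^sup>2 <= 2 / c * S"
  then obtain s where s: "2 / c * S < s" "s < w\<^sup>2" using dense not_le by blast
  have "0 <= 2 / c * S" using S assms(3) by simp
  then have "s > 0" using s by linarith
  then have "w <= sqrt s" using bound[of "sqrt s"] s w by simp
  then have "w\<^sup>2 <= s" using w(2) \<open>s > 0\<close> power_mono[of w "sqrt s" 2] by simp
  then show False using s by simp
  qed
  then show ?thesis by (simp add: e w S_def power2_eq_square)
 qed
qed

end
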